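(* Let $k$ be an algebraically closed field of characteristic zero. Suppose that $X,Y\subset\mathbf{P}^r_k$ are smooth subvarieties with ideal sheaves $\mathcal I_X,\mathcal I_Y$, and set $Z=X\cap Y$. Let $F\subset N_{Y/\mathbf{P}^r}=\mathrm{Hom}(\mathcal I_Y,\mathcal O_Y)$ be the subsheaf consisting of those local sections that map $\mathcal I_X\cap\mathcal I_Y$ into $\mathcal I_{Z/Y}\subset\mathcal O_Y$. (1) If $\eta\in H^0(N_{Y/\mathbf{P}^r})$ is a flat first-order deformation of $Y$, then $\eta$ induces a flat first-order deformation of $X\cap Y$ if and only if $\eta\in H^0(F)$. (2) There is a natural short exact sequence $$0\to F\to N_{Y/\mathbf{P}^r}\to Q(X,Y)\to0 .$$ (3) $Q(X,Y)= Q(Y,X)$ (i.e. they are naturally isomorphic).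
   Context: Intersections are scheme-theoretic; $\mathrm{Hom}$ denotes sheaf Hom. A section $\eta\in H^0(N_{Y/\mathbf{P}^r})$ corresponds to a closed subscheme $Y_\epsilon\subset\mathbf{P}^r\times\operatorname{Spec}k[\epsilon]/(\epsilon^2)$, flat over $k[\epsilon]/(\epsilon^2)$, restricting to $Y$; "$\eta$ induces a flat first-order deformation of $X\cap Y$" means that $Y_\epsilon\cap (X\times\operatorname{Spec}k[\epsilon]/(\epsilon^2))$ is flat over $k[\epsilon]/(\epsilon^2)$; equivalently, there is a homomorphism $\psi:\mathcal I_Z\to\mathcal O_Z$ that vanishes on $\mathcal I_X$ and whose restriction to $\mathcal I_Y$ is the composite of $\eta:\mathcal I_Y\to\mathcal O_Y$ with $\mathcal O_Y\to\mathcal O_Z$. For closed subschemes $X,Y$ of a scheme $P$ with $Z=X\cap Y$, restriction of functions gives a map $\mathcal I_{Y/P}/\mathcal I_{Y/P}^2\to \mathcal I_{Z/X}/\mathcal I_{Z/X}^2$, and $$Q(X,Y):=\operatorname{coker}\bigl(\mathrm{Hom}(\mathcal I_{Z/X}/\mathcal I_{Z/X}^2,\mathcal O_Z)\to \mathrm{Hom}(\mathcal I_{Y/P}/\mathcal I_{Y/P}^2,\mathcal O_Z)\bigr).$$ Here $P=\mathbf{P}^r$. *)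

theory Defs
  imports
    "HOL-Analysis.Abstract_Topology"
    "HOL-Algebra.Ideal_Product"
    "HOL-Algebra.Module"
    "HOL-Algebra.RingHom"
    "HOL-Library.Poly_Mapping"
    "HOL-Computational_Algebra.Fraction_Field"
    "Jordan_Normal_Form.Determinant"
begin

section \<open>Flat modules\<close>

definition linear_maps ::
  "('a, 'c) ring_scheme \<Rightarrow> ('a, 'm, 'd) module_scheme \<Rightarrow> ('a, 'n, 'e) module_scheme
     \<Rightarrow> ('m \<Rightarrow> 'n) set" where
  "linear_maps A M N =
     {f \<in> hom (add_monoid M) (add_monoid N).
        \<forall>a\<in>carrier A. \<forall>x\<in>carrier M. f (a \<odot>\<^bsub>M\<^esub> x) = a \<odot>\<^bsub>N\<^esub> f x}"

text \<open>
  \<open>N \<otimes>\<^sub>A M\<close> is the free abelian group on \<open>carrier N \<times> carrier M\<close> (finitely supported integer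
  functions) modulo the following subgroup.
\<close>

inductive_set tensor_null ::
  "('a, 'c) ring_scheme \<Rightarrow> ('a, 'n, 'd) module_scheme \<Rightarrow> ('a, 'm, 'e) module_scheme
     \<Rightarrow> ('n \<times> 'm \<Rightarrow>\<^sub>0 int) set"
  for A and N and M where
  zero: "0 \<in> tensor_null A N M"
| diff: "s \<in> tensor_null A N M \<Longrightarrow> t \<in> tensor_null A N M \<Longrightarrow> s - t \<in> tensor_null A N M"
| add_left: "x \<in> carrier N \<Longrightarrow> x' \<in> carrier N \<Longrightarrow> y \<in> carrier M \<Longrightarrow>
    Poly_Mapping.single (x \<oplus>\<^bsub>N\<^esub> x', y) 1 - Poly_Mapping.single (x, y) 1
      - Poly_Mapping.single (x', y) 1 \<in> tensor_null A N M"
| add_right: "x \<in> carrier N \<Longrightarrow> y \<in> carrier M \<Longrightarrow> y' \<in> carrier M \<Longrightarrow>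
    Poly_Mapping.single (x, y \<oplus>\<^bsub>M\<^esub> y') 1 - Poly_Mapping.single (x, y) 1
      - Poly_Mapping.single (x, y') 1 \<in> tensor_null A N M"
| smult: "a \<in> carrier A \<Longrightarrow> x \<in> carrier N \<Longrightarrow> y \<in> carrier M \<Longrightarrow>
    Poly_Mapping.single (a \<odot>\<^bsub>N\<^esub> x, y) 1 - Poly_Mapping.single (x, a \<odot>\<^bsub>M\<^esub> y) 1
      \<in> tensor_null A N M"

definition tensor_map :: "('n \<Rightarrow> 'n') \<Rightarrow> ('n \<times> 'm \<Rightarrow>\<^sub>0 int) \<Rightarrow> ('n' \<times> 'm \<Rightarrow>\<^sub>0 int)" where
  "tensor_map f t =
     (\<Sum>z\<in>Poly_Mapping.keys t.
        Poly_Mapping.single (f (fst z), snd z) (Poly_Mapping.lookup t z))"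

text \<open>
  \<open>M\<close> is flat if \<open>_ \<otimes>\<^sub>A M\<close> preserves injectivity of linear maps.  The carrier type of the test
  modules has to be fixed; \<open>(nat \<Rightarrow> 'a) set\<close> contains every quotient of every \<open>A\<^sup>n\<close> (as a set of
  cosets), hence a copy of each finitely generated module and its submodules.  These suffice
  to test flatness.
\<close>

definition flat_module ::
  "('a, 'c) ring_scheme \<Rightarrow> ('a, 'm, 'e) module_scheme \<Rightarrow> bool" where
  "flat_module A M \<longleftrightarrow> module A M \<and>
     (\<forall>(N :: ('a, (nat \<Rightarrow> 'a) set) module) (N' :: ('a, (nat \<Rightarrow> 'a) set) module) f.
        module A N \<and> module A N' \<and> f \<in> linear_maps A N N' \<and> inj_on f (carrier N) \<longrightarrow>
        (\<forall>t. Poly_Mapping.keys t \<subseteq> carrier N \<times> carrier M \<and>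
             tensor_map f t \<in> tensor_null A N' M \<longrightarrow> t \<in> tensor_null A N M))"

section \<open>Presheaves and sheaves of modules\<close>

text \<open>
  \<open>Res F U V\<close> is the restriction from \<open>U\<close> to \<open>V \<subseteq> U\<close>.  The multiplication and unit in
  \<open>Sec F U\<close> are meaningful only when \<open>F\<close> is a presheaf of rings; a structure sheaf is stored as a
  module over itself.  Values at sets that are not open play no role.
\<close>

record ('p, 'a, 'm) presheaf =
  Sec :: "'p set \<Rightarrow> ('a, 'm) module"
  Res :: "'p set \<Rightarrow> 'p set \<Rightarrow> 'm \<Rightarrow> 'm"

record ('p, 'a) ringed_space =
  Top :: "'p topology"
  Str :: "('p, 'a, 'a) presheaf"

abbreviation global :: "('p, 'a) ringed_space \<Rightarrow> ('p, 'a, 'm) presheaf \<Rightarrow> 'm set" where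
  "global S F \<equiv> carrier (Sec F (topspace (Top S)))"

definition subpresheaf ::
  "('p, 'a, 'm) presheaf \<Rightarrow> ('p set \<Rightarrow> 'm set) \<Rightarrow> ('p, 'a, 'm) presheaf" where
  "subpresheaf F G = F\<lparr>Sec := \<lambda>U. (Sec F U)\<lparr>carrier := G U\<rparr>\<rparr>"

definition morphism_on ::
  "('p, 'a) ringed_space \<Rightarrow> 'p set \<Rightarrow> ('p, 'a, 'm) presheaf \<Rightarrow> ('p, 'a, 'n) presheaf
     \<Rightarrow> ('p set \<Rightarrow> 'm \<Rightarrow> 'n) \<Rightarrow> bool" where
  "morphism_on S U F G \<phi> \<longleftrightarrow>
     (\<forall>V. openin (Top S) V \<and> V \<subseteq> U \<longrightarrow> \<phi> V \<in> linear_maps (Sec (Str S) V) (Sec F V) (Sec G V)) \<and>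
     (\<forall>V W. openin (Top S) V \<and> openin (Top S) W \<and> W \<subseteq> V \<and> V \<subseteq> U \<longrightarrow>
        (\<forall>x\<in>carrier (Sec F V). \<phi> W (Res F V W x) = Res G V W (\<phi> V x)))"

abbreviation sheaf_morphism ::
  "('p, 'a) ringed_space \<Rightarrow> ('p, 'a, 'm) presheaf \<Rightarrow> ('p, 'a, 'n) presheaf
     \<Rightarrow> ('p set \<Rightarrow> 'm \<Rightarrow> 'n) \<Rightarrow> bool" where
  "sheaf_morphism S F G \<equiv> morphism_on S (topspace (Top S)) F G"

definition sheaf_isomorphism ::
  "('p, 'a) ringed_space \<Rightarrow> ('p, 'a, 'm) presheaf \<Rightarrow> ('p, 'a, 'n) presheaf
     \<Rightarrow> ('p set \<Rightarrow> 'm \<Rightarrow> 'n) \<Rightarrow> bool" where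
  "sheaf_isomorphism S F G \<phi> \<longleftrightarrow> sheaf_morphism S F G \<phi> \<and>
     (\<forall>U. openin (Top S) U \<longrightarrow> bij_betw (\<phi> U) (carrier (Sec F U)) (carrier (Sec G U)))"

text \<open>\<open>0 \<rightarrow> F' \<rightarrow> F \<rightarrow> F'' \<rightarrow> 0\<close>: the kernel of a sheaf morphism is computed on sections, surjectivity
  is local.\<close>

definition short_exact ::
  "('p, 'a) ringed_space \<Rightarrow> ('p, 'a, 'l) presheaf \<Rightarrow> ('p, 'a, 'm) presheaf
     \<Rightarrow> ('p, 'a, 'n) presheaf \<Rightarrow> ('p set \<Rightarrow> 'l \<Rightarrow> 'm) \<Rightarrow> ('p set \<Rightarrow> 'm \<Rightarrow> 'n) \<Rightarrow> bool" where
  "short_exact S F' F F'' \<alpha> \<beta> \<longleftrightarrow>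
     sheaf_morphism S F' F \<alpha> \<and> sheaf_morphism S F F'' \<beta> \<and>
     (\<forall>U. openin (Top S) U \<longrightarrow>
        inj_on (\<alpha> U) (carrier (Sec F' U)) \<and>
        \<alpha> U ` carrier (Sec F' U) = {x \<in> carrier (Sec F U). \<beta> U x = \<zero>\<^bsub>Sec F'' U\<^esub>} \<and>
        (\<forall>z\<in>carrier (Sec F'' U). \<forall>p\<in>U. \<exists>V. openin (Top S) V \<and> p \<in> V \<and> V \<subseteq> U \<and>
           (\<exists>x\<in>carrier (Sec F V). \<beta> V x = Res F'' U V z)))"

text \<open>A section over \<open>U\<close> of the sheaf Hom assigns maps to all open \<open>V \<subseteq> U\<close>; \<open>hom_restrict\<close> cuts off
  the irrelevant values, so that equal sections are equal as functions.\<close>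

definition hom_restrict ::
  "('p, 'a) ringed_space \<Rightarrow> ('p, 'a, 'm) presheaf \<Rightarrow> 'p set \<Rightarrow> ('p set \<Rightarrow> 'm \<Rightarrow> 'n)
     \<Rightarrow> 'p set \<Rightarrow> 'm \<Rightarrow> 'n" where
  "hom_restrict S F U \<phi> =
     (\<lambda>V. if openin (Top S) V \<and> V \<subseteq> U then restrict (\<phi> V) (carrier (Sec F V)) else undefined)"

definition sheaf_hom ::
  "('p, 'a) ringed_space \<Rightarrow> ('p, 'a, 'm) presheaf \<Rightarrow> ('p, 'a, 'n) presheaf
     \<Rightarrow> ('p, 'a, 'p set \<Rightarrow> 'm \<Rightarrow> 'n) presheaf" where
  "sheaf_hom S F G =
     \<lparr>Sec = (\<lambda>U. \<lparr>
        carrier = {\<phi>. morphism_on S U F G \<phi> \<and> hom_restrict S F U \<phi> = \<phi>},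
        monoid.mult = undefined, monoid.one = undefined,
        ring.zero = hom_restrict S F U (\<lambda>V x. \<zero>\<^bsub>Sec G V\<^esub>),
        ring.add = (\<lambda>\<phi> \<psi>. hom_restrict S F U (\<lambda>V x. \<phi> V x \<oplus>\<^bsub>Sec G V\<^esub> \<psi> V x)),
        module.smult = (\<lambda>a \<phi>. hom_restrict S F U (\<lambda>V x. Res (Str S) U V a \<odot>\<^bsub>Sec G V\<^esub> \<phi> V x))\<rparr>),
      Res = (\<lambda>U V \<phi>. hom_restrict S F V \<phi>)\<rparr>"

subsection \<open>Quotient sheaves\<close>

text \<open>
  For a subpresheaf \<open>G\<close> of \<open>F\<close>, the element of \<open>F\<^sub>p / G\<^sub>p\<close> represented by a section \<open>s\<close> over \<open>U\<close>
  is the set of all \<open>(V, t)\<close> such that \<open>s - t\<close> lies in \<open>G\<close> near \<open>p\<close>.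
\<close>

definition quot_germ ::
  "('p, 'a) ringed_space \<Rightarrow> ('p, 'a, 'm) presheaf \<Rightarrow> ('p set \<Rightarrow> 'm set) \<Rightarrow> 'p
     \<Rightarrow> 'p set \<Rightarrow> 'm \<Rightarrow> ('p set \<times> 'm) set" where
  "quot_germ S F G p U s =
     {(V, t). openin (Top S) V \<and> p \<in> V \<and> t \<in> carrier (Sec F V) \<and>
        (\<exists>W. openin (Top S) W \<and> p \<in> W \<and> W \<subseteq> U \<inter> V \<and>
             Res F U W s \<ominus>\<^bsub>Sec F W\<^esub> Res F V W t \<in> G W)}"

text \<open>
  The stalk \<open>F\<^sub>p / G\<^sub>p\<close>.  Operations are computed on representatives; each union below is taken
  over a family whose members all coincide.  Scalars are pairs \<open>(U, a)\<close> representing a germ of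
  the structure sheaf at \<open>p\<close>.
\<close>

definition germ_op ::
  "('p, 'a) ringed_space \<Rightarrow> ('p, 'a, 'm) presheaf \<Rightarrow> ('p set \<Rightarrow> 'm set) \<Rightarrow> 'p
     \<Rightarrow> ('p set \<Rightarrow> 'm \<Rightarrow> 'm \<Rightarrow> 'm)
     \<Rightarrow> ('p set \<times> 'm) set \<Rightarrow> ('p set \<times> 'm) set \<Rightarrow> ('p set \<times> 'm) set" where
  "germ_op S F G p f g h =
     (\<Union>(U, s)\<in>g. \<Union>(V, t)\<in>h.
        quot_germ S F G p (U \<inter> V) (f (U \<inter> V) (Res F U (U \<inter> V) s) (Res F V (U \<inter> V) t)))"

definition quot_stalk ::
  "('p, 'a) ringed_space \<Rightarrow> ('p, 'a, 'm) presheaf \<Rightarrow> ('p set \<Rightarrow> 'm set) \<Rightarrow> 'p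
     \<Rightarrow> ('p set \<times> 'a, ('p set \<times> 'm) set) module" where
  "quot_stalk S F G p = \<lparr>
     carrier = {quot_germ S F G p U s | U s. openin (Top S) U \<and> p \<in> U \<and> s \<in> carrier (Sec F U)},
     monoid.mult = germ_op S F G p (\<lambda>U. monoid.mult (Sec F U)),
     monoid.one = quot_germ S F G p (topspace (Top S)) \<one>\<^bsub>Sec F (topspace (Top S))\<^esub>,
     ring.zero = quot_germ S F G p (topspace (Top S)) \<zero>\<^bsub>Sec F (topspace (Top S))\<^esub>,
     ring.add = germ_op S F G p (\<lambda>U. ring.add (Sec F U)),
     module.smult = (\<lambda>(U, a) g. \<Union>(V, t)\<in>g.
        quot_germ S F G p (U \<inter> V)
          (Res (Str S) U (U \<inter> V) a \<odot>\<^bsub>Sec F (U \<inter> V)\<^esub> Res F V (U \<inter> V) t))\<rparr>"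

text \<open>The sheaf associated to \<open>U \<mapsto> F U / G U\<close>: functions into the stalks that are locally
  given by a section of \<open>F\<close>.\<close>

definition quot_sheaf ::
  "('p, 'a) ringed_space \<Rightarrow> ('p, 'a, 'm) presheaf \<Rightarrow> ('p set \<Rightarrow> 'm set)
     \<Rightarrow> ('p, 'a, 'p \<Rightarrow> ('p set \<times> 'm) set) presheaf" where
  "quot_sheaf S F G =
     \<lparr>Sec = (\<lambda>U. \<lparr>
        carrier = {\<sigma> \<in> extensional U. \<forall>p\<in>U. \<exists>V s. openin (Top S) V \<and> p \<in> V \<and> V \<subseteq> U \<and>
                     s \<in> carrier (Sec F V) \<and> (\<forall>q\<in>V. \<sigma> q = quot_germ S F G q V s)},
        monoid.mult = (\<lambda>\<sigma> \<tau>. \<lambda>p\<in>U. \<sigma> p \<otimes>\<^bsub>quot_stalk S F G p\<^esub> \<tau> p),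
        monoid.one = (\<lambda>p\<in>U. \<one>\<^bsub>quot_stalk S F G p\<^esub>),
        ring.zero = (\<lambda>p\<in>U. \<zero>\<^bsub>quot_stalk S F G p\<^esub>),
        ring.add = (\<lambda>\<sigma> \<tau>. \<lambda>p\<in>U. \<sigma> p \<oplus>\<^bsub>quot_stalk S F G p\<^esub> \<tau> p),
        module.smult = (\<lambda>a \<sigma>. \<lambda>p\<in>U. (U, a) \<odot>\<^bsub>quot_stalk S F G p\<^esub> \<sigma> p)\<rparr>),
      Res = (\<lambda>U V \<sigma>. restrict \<sigma> V)\<rparr>"

definition quot_proj ::
  "('p, 'a) ringed_space \<Rightarrow> ('p, 'a, 'm) presheaf \<Rightarrow> ('p set \<Rightarrow> 'm set)
     \<Rightarrow> 'p set \<Rightarrow> 'm \<Rightarrow> 'p \<Rightarrow> ('p set \<times> 'm) set" where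
  "quot_proj S F G U s = (\<lambda>p\<in>U. quot_germ S F G p U s)"

text \<open>
  The map \<open>F / G \<rightarrow> F' / G'\<close> induced by a morphism \<open>\<phi>\<close> with \<open>\<phi> (G) \<subseteq> G'\<close>, and the map
  \<open>F / G \<rightarrow> H\<close> induced by a morphism \<open>\<phi> : F \<rightarrow> H\<close> vanishing on \<open>G\<close>, where the sections of \<open>H\<close>
  are functions of points (as they are for any \<open>quot_sheaf\<close>).  Again the unions are over
  families of equal sets.  As \<open>\<phi>\<close> may be defined only on open subsets of \<open>U\<close>, the second construction
  first restricts representatives to \<open>U\<close>.
\<close>

definition quot_map ::
  "('p, 'a) ringed_space \<Rightarrow> ('p, 'a, 'n) presheaf \<Rightarrow> ('p set \<Rightarrow> 'n set) \<Rightarrow> ('p set \<Rightarrow> 'm \<Rightarrow> 'n)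
     \<Rightarrow> 'p set \<Rightarrow> ('p \<Rightarrow> ('p set \<times> 'm) set) \<Rightarrow> 'p \<Rightarrow> ('p set \<times> 'n) set" where
  "quot_map S F' G' \<phi> U \<sigma> = (\<lambda>p\<in>U. \<Union>(V, s)\<in>\<sigma> p. quot_germ S F' G' p V (\<phi> V s))"

definition quot_descend ::
  "('p, 'a, 'm) presheaf \<Rightarrow> ('p set \<Rightarrow> 'm \<Rightarrow> 'p \<Rightarrow> 'h set)
     \<Rightarrow> 'p set \<Rightarrow> ('p \<Rightarrow> ('p set \<times> 'm) set) \<Rightarrow> 'p \<Rightarrow> 'h set" where
  "quot_descend F \<phi> U \<sigma> = (\<lambda>p\<in>U. \<Union>(V, s)\<in>\<sigma> p. \<phi> (U \<inter> V) (Res F V (U \<inter> V) s) p)"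

section \<open>Ideal sheaves and closed subschemes\<close>

definition ideal_sheaf :: "('p, 'a) ringed_space \<Rightarrow> ('p set \<Rightarrow> 'a set) \<Rightarrow> bool" where
  "ideal_sheaf S I \<longleftrightarrow>
     (\<forall>U. openin (Top S) U \<longrightarrow> ideal (I U) (Sec (Str S) U)) \<and>
     (\<forall>U V. openin (Top S) U \<and> openin (Top S) V \<and> V \<subseteq> U \<longrightarrow> Res (Str S) U V ` I U \<subseteq> I V) \<and>
     (\<forall>U s. openin (Top S) U \<and> s \<in> carrier (Sec (Str S) U) \<and>
        (\<forall>p\<in>U. \<exists>V. openin (Top S) V \<and> p \<in> V \<and> V \<subseteq> U \<and> Res (Str S) U V s \<in> I V) \<longrightarrow> s \<in> I U)"

definition locally_generated :: "('p, 'a) ringed_space \<Rightarrow> ('p set \<Rightarrow> 'a set) \<Rightarrow> bool" where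
  "locally_generated S I \<longleftrightarrow>
     (\<forall>p\<in>topspace (Top S). \<exists>U. openin (Top S) U \<and> p \<in> U \<and>
        (\<forall>V. openin (Top S) V \<and> V \<subseteq> U \<longrightarrow>
           (\<forall>s\<in>I V. \<forall>q\<in>V. \<exists>W. openin (Top S) W \<and> q \<in> W \<and> W \<subseteq> V \<and>
              Res (Str S) V W s \<in> Idl\<^bsub>Sec (Str S) W\<^esub> (Res (Str S) U W ` I U))))"

text \<open>
  On a scheme, closed subschemes correspond to ideal sheaves that are locally generated by
  sections, equivalently quasi-coherent.  All sheaves living on a closed subscheme are
  represented by their push-forwards to the ambient space.
\<close>

definition closed_subscheme :: "('p, 'a) ringed_space \<Rightarrow> ('p set \<Rightarrow> 'a set) \<Rightarrow> bool" where
  "closed_subscheme S I \<longleftrightarrow> ideal_sheaf S I \<and> locally_generated S I"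

abbreviation struct_sheaf ::
  "('p, 'a) ringed_space \<Rightarrow> ('p set \<Rightarrow> 'a set)
     \<Rightarrow> ('p, 'a, 'p \<Rightarrow> ('p set \<times> 'a) set) presheaf" where
  "struct_sheaf S I \<equiv> quot_sheaf S (Str S) I"

definition support :: "('p, 'a) ringed_space \<Rightarrow> ('p set \<Rightarrow> 'a set) \<Rightarrow> 'p set" where
  "support S I = {p \<in> topspace (Top S).
     \<not> (\<exists>U. openin (Top S) U \<and> p \<in> U \<and> \<one>\<^bsub>Sec (Str S) U\<^esub> \<in> I U)}"

definition integral_subscheme :: "('p, 'a) ringed_space \<Rightarrow> ('p set \<Rightarrow> 'a set) \<Rightarrow> bool" where
  "integral_subscheme S I \<longleftrightarrow> support S I \<noteq> {} \<and>
     (\<forall>U. openin (Top S) U \<and> U \<inter> support S I \<noteq> {} \<longrightarrow> domain (Sec (struct_sheaf S I) U))"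

text \<open>The ideal sheaf of a scheme-theoretic intersection.\<close>

definition ideal_sum ::
  "('p, 'a) ringed_space \<Rightarrow> ('p set \<Rightarrow> 'a set) \<Rightarrow> ('p set \<Rightarrow> 'a set) \<Rightarrow> 'p set \<Rightarrow> 'a set" where
  "ideal_sum S I J U =
     {s \<in> carrier (Sec (Str S) U). \<forall>p\<in>U. \<exists>V. openin (Top S) V \<and> p \<in> V \<and> V \<subseteq> U \<and>
        (\<exists>a\<in>I V. \<exists>b\<in>J V. Res (Str S) U V s = a \<oplus>\<^bsub>Sec (Str S) V\<^esub> b)}"

text \<open>For \<open>I \<subseteq> K\<close> defining \<open>Z \<subseteq> X\<close>, the ideal sheaf \<open>K / I\<close> of \<open>Z\<close> in \<open>O\<^sub>X\<close>.\<close>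

definition rel_ideal ::
  "('p, 'a) ringed_space \<Rightarrow> ('p set \<Rightarrow> 'a set) \<Rightarrow> ('p set \<Rightarrow> 'a set)
     \<Rightarrow> 'p set \<Rightarrow> ('p \<Rightarrow> ('p set \<times> 'a) set) set" where
  "rel_ideal S I K U =
     {\<sigma> \<in> carrier (Sec (struct_sheaf S I) U). \<forall>p\<in>U. \<exists>(V, s)\<in>\<sigma> p. s \<in> K V}"

text \<open>\<open>I / I\<^sup>2\<close> for an ideal sheaf \<open>I\<close> in a sheaf of rings \<open>R\<close>.  The presheaf square suffices, since
  \<open>quot_sheaf\<close> sheafifies.\<close>

definition square :: "('p, 'a, 'm) presheaf \<Rightarrow> ('p set \<Rightarrow> 'm set) \<Rightarrow> 'p set \<Rightarrow> 'm set" where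
  "square R I U = ideal_prod (Sec R U) (I U) (I U)"

definition conormal ::
  "('p, 'a) ringed_space \<Rightarrow> ('p, 'a, 'm) presheaf \<Rightarrow> ('p set \<Rightarrow> 'm set)
     \<Rightarrow> ('p, 'a, 'p \<Rightarrow> ('p set \<times> 'm) set) presheaf" where
  "conormal S R I = quot_sheaf S (subpresheaf R I) (square R I)"

section \<open>The sheaves \<open>N\<close>, \<open>F\<close> and \<open>Q(X, Y)\<close>\<close>

text \<open>From here on \<open>I\<close> and \<open>J\<close> are the ideal sheaves of \<open>X\<close> and \<open>Y\<close>.\<close>

definition normal_sheaf ::
  "('p, 'a) ringed_space \<Rightarrow> ('p set \<Rightarrow> 'a set)
     \<Rightarrow> ('p, 'a, 'p set \<Rightarrow> 'a \<Rightarrow> 'p \<Rightarrow> ('p set \<times> 'a) set) presheaf" where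
  "normal_sheaf S J = sheaf_hom S (subpresheaf (Str S) J) (struct_sheaf S J)"

definition F_sections ::
  "('p, 'a) ringed_space \<Rightarrow> ('p set \<Rightarrow> 'a set) \<Rightarrow> ('p set \<Rightarrow> 'a set)
     \<Rightarrow> 'p set \<Rightarrow> ('p set \<Rightarrow> 'a \<Rightarrow> 'p \<Rightarrow> ('p set \<times> 'a) set) set" where
  "F_sections S I J U =
     {\<eta> \<in> carrier (Sec (normal_sheaf S J) U).
        \<forall>V. openin (Top S) V \<and> V \<subseteq> U \<longrightarrow> \<eta> V ` (I V \<inter> J V) \<subseteq> rel_ideal S J (ideal_sum S I J) V}"

definition F_sheaf ::
  "('p, 'a) ringed_space \<Rightarrow> ('p set \<Rightarrow> 'a set) \<Rightarrow> ('p set \<Rightarrow> 'a set)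
     \<Rightarrow> ('p, 'a, 'p set \<Rightarrow> 'a \<Rightarrow> 'p \<Rightarrow> ('p set \<times> 'a) set) presheaf" where
  "F_sheaf S I J = subpresheaf (normal_sheaf S J) (F_sections S I J)"

text \<open>\<open>Hom (I\<^sub>Y / I\<^sub>Y\<^sup>2, O\<^sub>Z)\<close> and \<open>Hom (I\<^bsub>Z/X\<^esub> / I\<^bsub>Z/X\<^esub>\<^sup>2, O\<^sub>Z)\<close>\<close>

definition hom_conormal ::
  "('p, 'a) ringed_space \<Rightarrow> ('p set \<Rightarrow> 'a set) \<Rightarrow> ('p set \<Rightarrow> 'a set) \<Rightarrow>
    ('p, 'a, 'p set \<Rightarrow> ('p \<Rightarrow> ('p set \<times> 'a) set) \<Rightarrow> 'p \<Rightarrow> ('p set \<times> 'a) set) presheaf" where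
  "hom_conormal S I J =
     sheaf_hom S (conormal S (Str S) J) (struct_sheaf S (ideal_sum S I J))"

definition rel_conormal ::
  "('p, 'a) ringed_space \<Rightarrow> ('p set \<Rightarrow> 'a set) \<Rightarrow> ('p set \<Rightarrow> 'a set) \<Rightarrow>
    ('p, 'a, 'p \<Rightarrow> ('p set \<times> ('p \<Rightarrow> ('p set \<times> 'a) set)) set) presheaf" where
  "rel_conormal S I J = conormal S (struct_sheaf S I) (rel_ideal S I (ideal_sum S I J))"

definition hom_rel_conormal ::
  "('p, 'a) ringed_space \<Rightarrow> ('p set \<Rightarrow> 'a set) \<Rightarrow> ('p set \<Rightarrow> 'a set) \<Rightarrow>
    ('p, 'a, 'p set \<Rightarrow> ('p \<Rightarrow> ('p set \<times> ('p \<Rightarrow> ('p set \<times> 'a) set)) set)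
       \<Rightarrow> 'p \<Rightarrow> ('p set \<times> 'a) set) presheaf" where
  "hom_rel_conormal S I J =
     sheaf_hom S (rel_conormal S I J) (struct_sheaf S (ideal_sum S I J))"

text \<open>Restriction of functions \<open>I\<^sub>Y / I\<^sub>Y\<^sup>2 \<rightarrow> I\<^bsub>Z/X\<^esub> / I\<^bsub>Z/X\<^esub>\<^sup>2\<close>, and the map it induces on Hom into
  \<open>O\<^sub>Z\<close>.\<close>

definition conormal_restriction ::
  "('p, 'a) ringed_space \<Rightarrow> ('p set \<Rightarrow> 'a set) \<Rightarrow> ('p set \<Rightarrow> 'a set) \<Rightarrow> 'p set
     \<Rightarrow> ('p \<Rightarrow> ('p set \<times> 'a) set) \<Rightarrow> 'p \<Rightarrow> ('p set \<times> ('p \<Rightarrow> ('p set \<times> 'a) set)) set" where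
  "conormal_restriction S I J =
     (let R = struct_sheaf S I; K = rel_ideal S I (ideal_sum S I J)
      in quot_map S (subpresheaf R K) (square R K) (quot_proj S (Str S) I))"

definition hom_pullback ::
  "('p, 'a) ringed_space \<Rightarrow> ('p set \<Rightarrow> 'a set) \<Rightarrow> ('p set \<Rightarrow> 'a set) \<Rightarrow> 'p set
     \<Rightarrow> ('p set \<Rightarrow> ('p \<Rightarrow> ('p set \<times> ('p \<Rightarrow> ('p set \<times> 'a) set)) set) \<Rightarrow> 'p \<Rightarrow> ('p set \<times> 'a) set)
     \<Rightarrow> 'p set \<Rightarrow> ('p \<Rightarrow> ('p set \<times> 'a) set) \<Rightarrow> 'p \<Rightarrow> ('p set \<times> 'a) set" where
  "hom_pullback S I J U \<phi> =
     hom_restrict S (conormal S (Str S) J) U (\<lambda>V \<sigma>. \<phi> V (conormal_restriction S I J V \<sigma>))"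

definition pullback_image ::
  "('p, 'a) ringed_space \<Rightarrow> ('p set \<Rightarrow> 'a set) \<Rightarrow> ('p set \<Rightarrow> 'a set) \<Rightarrow> 'p set
     \<Rightarrow> ('p set \<Rightarrow> ('p \<Rightarrow> ('p set \<times> 'a) set) \<Rightarrow> 'p \<Rightarrow> ('p set \<times> 'a) set) set" where
  "pullback_image S I J U = hom_pullback S I J U ` carrier (Sec (hom_rel_conormal S I J) U)"

definition Q_sheaf where
  "Q_sheaf S I J = quot_sheaf S (hom_conormal S I J) (pullback_image S I J)"

definition Q_class where
  "Q_class S I J = quot_proj S (hom_conormal S I J) (pullback_image S I J)"

text \<open>
  The canonical map \<open>N = Hom (I\<^sub>Y, O\<^sub>Y) \<rightarrow> Hom (I\<^sub>Y, O\<^sub>Z) = Hom (I\<^sub>Y / I\<^sub>Y\<^sup>2, O\<^sub>Z) \<rightarrow> Q(X, Y)\<close>.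
\<close>

definition struct_restriction ::
  "('p, 'a) ringed_space \<Rightarrow> ('p set \<Rightarrow> 'a set) \<Rightarrow> 'p set
     \<Rightarrow> ('p \<Rightarrow> ('p set \<times> 'a) set) \<Rightarrow> 'p \<Rightarrow> ('p set \<times> 'a) set" where
  "struct_restriction S K = quot_map S (Str S) K (\<lambda>V s. s)"

definition normal_to_hom ::
  "('p, 'a) ringed_space \<Rightarrow> ('p set \<Rightarrow> 'a set) \<Rightarrow> ('p set \<Rightarrow> 'a set) \<Rightarrow> 'p set
     \<Rightarrow> ('p set \<Rightarrow> 'a \<Rightarrow> 'p \<Rightarrow> ('p set \<times> 'a) set)
     \<Rightarrow> 'p set \<Rightarrow> ('p \<Rightarrow> ('p set \<times> 'a) set) \<Rightarrow> 'p \<Rightarrow> ('p set \<times> 'a) set" where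
  "normal_to_hom S I J U \<eta> =
     hom_restrict S (conormal S (Str S) J) U
       (quot_descend (subpresheaf (Str S) J)
          (\<lambda>V s. struct_restriction S (ideal_sum S I J) V (\<eta> V s)))"

definition normal_to_Q where
  "normal_to_Q S I J U \<eta> = Q_class S I J U (normal_to_hom S I J U \<eta>)"

text \<open>
  Sections of \<open>Hom (I\<^sub>Y / I\<^sub>Y\<^sup>2, O\<^sub>Z)\<close> and \<open>Hom (I\<^sub>X / I\<^sub>X\<^sup>2, O\<^sub>Z)\<close> over \<open>U\<close> that have the same image in
  \<open>Hom (I\<^sub>X \<inter> I\<^sub>Y, O\<^sub>Z)\<close>.
\<close>

definition agree_on_inter ::
  "('p, 'a) ringed_space \<Rightarrow> ('p set \<Rightarrow> 'a set) \<Rightarrow> ('p set \<Rightarrow> 'a set) \<Rightarrow> 'p set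
     \<Rightarrow> ('p set \<Rightarrow> ('p \<Rightarrow> ('p set \<times> 'a) set) \<Rightarrow> 'p \<Rightarrow> ('p set \<times> 'a) set)
     \<Rightarrow> ('p set \<Rightarrow> ('p \<Rightarrow> ('p set \<times> 'a) set) \<Rightarrow> 'p \<Rightarrow> ('p set \<times> 'a) set) \<Rightarrow> bool" where
  "agree_on_inter S I J U \<theta> \<theta>' \<longleftrightarrow>
     (\<forall>V. openin (Top S) V \<and> V \<subseteq> U \<longrightarrow> (\<forall>s \<in> I V \<inter> J V.
        \<theta> V (quot_proj S (subpresheaf (Str S) J) (square (Str S) J) V s) =
        \<theta>' V (quot_proj S (subpresheaf (Str S) I) (square (Str S) I) V s)))"

text \<open>
  Naturality of \<open>\<beta> : Q(X, Y) \<rightarrow> Q(Y, X)\<close>: both sheaves embed into \<open>Hom (I\<^sub>X \<inter> I\<^sub>Y, O\<^sub>Z)\<close> by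
  restricting homomorphisms to \<open>I\<^sub>X \<inter> I\<^sub>Y\<close>, and \<open>\<beta>\<close> is compatible with these embeddings.
  At most one \<open>\<beta>\<close> has this property.
\<close>

definition natural_iso where
  "natural_iso S I J \<beta> \<longleftrightarrow> sheaf_isomorphism S (Q_sheaf S I J) (Q_sheaf S J I) \<beta> \<and>
     (\<forall>U. openin (Top S) U \<longrightarrow>
        (\<forall>\<theta>\<in>carrier (Sec (hom_conormal S I J) U). \<forall>\<theta>'\<in>carrier (Sec (hom_conormal S J I) U).
           \<beta> U (Q_class S I J U \<theta>) = Q_class S J I U \<theta>' \<longleftrightarrow> agree_on_inter S I J U \<theta> \<theta>'))"

section \<open>First-order deformations\<close>

definition dual_ring :: "('a, 'c) ring_scheme \<Rightarrow> ('a \<times> 'a, 'a \<times> 'a) module" where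
  "dual_ring A = (let m = (\<lambda>(a, b) (c, d). (a \<otimes>\<^bsub>A\<^esub> c, a \<otimes>\<^bsub>A\<^esub> d \<oplus>\<^bsub>A\<^esub> b \<otimes>\<^bsub>A\<^esub> c)) in \<lparr>
     carrier = carrier A \<times> carrier A,
     monoid.mult = m,
     monoid.one = (\<one>\<^bsub>A\<^esub>, \<zero>\<^bsub>A\<^esub>),
     ring.zero = (\<zero>\<^bsub>A\<^esub>, \<zero>\<^bsub>A\<^esub>),
     ring.add = (\<lambda>(a, b) (c, d). (a \<oplus>\<^bsub>A\<^esub> c, b \<oplus>\<^bsub>A\<^esub> d)),
     module.smult = m\<rparr>)"

text \<open>\<open>P \<times> Spec k[\<epsilon>]\<close> has the same underlying space as \<open>P\<close> and structure sheaf \<open>O\<^sub>P \<oplus> \<epsilon> O\<^sub>P\<close>.\<close>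

definition dual_space :: "('p, 'a) ringed_space \<Rightarrow> ('p, 'a \<times> 'a) ringed_space" where
  "dual_space S = \<lparr>Top = Top S, Str = \<lparr>Sec = (\<lambda>U. dual_ring (Sec (Str S) U)),
     Res = (\<lambda>U V. map_prod (Res (Str S) U V) (Res (Str S) U V))\<rparr>\<rparr>"

text \<open>The ideal sheaf of \<open>X \<times> Spec k[\<epsilon>]\<close>.\<close>

definition trivial_deformation :: "('p set \<Rightarrow> 'a set) \<Rightarrow> 'p set \<Rightarrow> ('a \<times> 'a) set" where
  "trivial_deformation I U = I U \<times> I U"

text \<open>The ideal sheaf of \<open>Y\<^sub>\<epsilon>\<close>: all \<open>f + \<epsilon> g\<close> with \<open>f\<close> in \<open>I\<^sub>Y\<close> such that \<open>g\<close> represents \<open>\<eta> f\<close> in \<open>O\<^sub>Y\<close>.\<close>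

definition deformation_ideal ::
  "('p, 'a) ringed_space \<Rightarrow> ('p set \<Rightarrow> 'a set) \<Rightarrow> ('p set \<Rightarrow> 'a \<Rightarrow> 'p \<Rightarrow> ('p set \<times> 'a) set)
     \<Rightarrow> 'p set \<Rightarrow> ('a \<times> 'a) set" where
  "deformation_ideal S J \<eta> U =
     {(f, g). f \<in> J U \<and> g \<in> carrier (Sec (Str S) U) \<and> quot_proj S (Str S) J U g = \<eta> U f}"

section \<open>Projective space\<close>

type_synonym 'k mpoly = "(nat \<Rightarrow>\<^sub>0 nat) \<Rightarrow>\<^sub>0 'k"

definition const_poly :: "'k::field \<Rightarrow> 'k mpoly" where
  "const_poly c = Poly_Mapping.single 0 c"

definition poly_ring :: "nat \<Rightarrow> 'k::field mpoly ring" where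
  "poly_ring n = \<lparr>
     carrier = {f. \<forall>m\<in>Poly_Mapping.keys f. Poly_Mapping.keys m \<subseteq> {..<n}},
     monoid.mult = (*), monoid.one = 1, ring.zero = 0, ring.add = (+)\<rparr>"

definition partial_deriv :: "nat \<Rightarrow> 'k::field mpoly \<Rightarrow> 'k mpoly" where
  "partial_deriv i f =
     (\<Sum>m\<in>Poly_Mapping.keys f.
        Poly_Mapping.single (m - Poly_Mapping.single i 1)
          (of_nat (Poly_Mapping.lookup m i) * Poly_Mapping.lookup f m))"

definition monomial_degree :: "(nat \<Rightarrow>\<^sub>0 nat) \<Rightarrow> nat" where
  "monomial_degree m = (\<Sum>i\<in>Poly_Mapping.keys m. Poly_Mapping.lookup m i)"

definition forms :: "nat \<Rightarrow> nat \<Rightarrow> 'k::field mpoly set" where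
  "forms r d = {f \<in> carrier (poly_ring (Suc r)).
     \<forall>m\<in>Poly_Mapping.keys f. monomial_degree m = d}"

text \<open>\<open>P\<^sup>r = Proj k[x\<^sub>0, \<dots>, x\<^sub>r]\<close>: the homogeneous prime ideals that do not contain all
  polynomials without constant term.\<close>

definition proj_points :: "nat \<Rightarrow> 'k::field mpoly set set" where
  "proj_points r = {\<pp>. primeideal \<pp> (poly_ring (Suc r)) \<and>
     \<pp> = Idl\<^bsub>poly_ring (Suc r)\<^esub> (\<pp> \<inter> (\<Union>d. forms r d)) \<and>
     \<not> {f \<in> carrier (poly_ring (Suc r)). Poly_Mapping.lookup f 0 = 0} \<subseteq> \<pp>}"

definition proj_top :: "nat \<Rightarrow> 'k::field mpoly set topology" where
  "proj_top r = topology (\<lambda>U. \<exists>A\<subseteq>(\<Union>d. forms r d). U = {\<pp> \<in> proj_points r. \<not> A \<subseteq> \<pp>})"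

lemma forms_mult:
  assumes "a \<in> forms r d" "b \<in> forms r e"
  shows "a * b \<in> forms r (d + e)"
proof -
  have "monomial_degree m = d + e \<and> Poly_Mapping.keys m \<subseteq> {..<Suc r}"
    if "m \<in> Poly_Mapping.keys (a * b)" for m
  proof -
    obtain k l where kl: "m = k + l" "k \<in> Poly_Mapping.keys a" "l \<in> Poly_Mapping.keys b"
      using \<open>m \<in> Poly_Mapping.keys (a * b)\<close> keys_mult[of a b] by blast
    have sub: "Poly_Mapping.keys k \<subseteq> {..<Suc r}" "Poly_Mapping.keys l \<subseteq> {..<Suc r}"
      and deg: "monomial_degree k = d" "monomial_degree l = e"
      using kl assms unfolding forms_def poly_ring_def by auto
    have "monomial_degree n = (\<Sum>i<Suc r. Poly_Mapping.lookup n i)"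
      if "Poly_Mapping.keys n \<subseteq> {..<Suc r}" for n
      unfolding monomial_degree_def
      by (rule sum.mono_neutral_left) (use that in \<open>auto simp: in_keys_iff\<close>)
    moreover have "Poly_Mapping.keys m \<subseteq> {..<Suc r}"
      using sub keys_add[of k l] kl(1) by blast
    ultimately show ?thesis
      using sub deg kl(1) by (simp add: lookup_add sum.distrib)
  qed
  then show ?thesis
    by (auto simp: forms_def poly_ring_def)
qed

lemma istopology_zariski:
  fixes H :: "'a::times set"
  assumes mult: "\<And>a b. a \<in> H \<Longrightarrow> b \<in> H \<Longrightarrow> a * b \<in> H"
    and prime: "\<And>a b \<pp>. \<pp> \<in> P \<Longrightarrow> a \<in> H \<Longrightarrow> b \<in> H \<Longrightarrow> a * b \<in> \<pp> \<longleftrightarrow> a \<in> \<pp> \<or> b \<in> \<pp>"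
  shows "istopology (\<lambda>U. \<exists>A\<subseteq>H. U = {\<pp> \<in> P. \<not> A \<subseteq> \<pp>})"
  unfolding istopology_def
proof (intro conjI allI impI)
  fix U V
  assume "\<exists>A\<subseteq>H. U = {\<pp> \<in> P. \<not> A \<subseteq> \<pp>}" and "\<exists>B\<subseteq>H. V = {\<pp> \<in> P. \<not> B \<subseteq> \<pp>}"
  then obtain A B where A: "A \<subseteq> H" "U = {\<pp> \<in> P. \<not> A \<subseteq> \<pp>}"
    and B: "B \<subseteq> H" "V = {\<pp> \<in> P. \<not> B \<subseteq> \<pp>}"
    by (elim exE conjE)
  define C where "C = (\<lambda>(a, b). a * b) ` (A \<times> B)"
  have *: "C \<subseteq> \<pp> \<longleftrightarrow> A \<subseteq> \<pp> \<or> B \<subseteq> \<pp>" if "\<pp> \<in> P" for \<pp>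
  proof -
    have "C \<subseteq> \<pp> \<longleftrightarrow> (\<forall>a\<in>A. \<forall>b\<in>B. a * b \<in> \<pp>)"
      by (auto simp: C_def)
    also have "\<dots> \<longleftrightarrow> (\<forall>a\<in>A. \<forall>b\<in>B. a \<in> \<pp> \<or> b \<in> \<pp>)"
      using prime[OF that] A(1) B(1) by (intro ball_cong refl) (simp add: subset_eq)
    also have "\<dots> \<longleftrightarrow> A \<subseteq> \<pp> \<or> B \<subseteq> \<pp>"
      by blast
    finally show ?thesis .
  qed
  have "U \<inter> V = {\<pp> \<in> P. \<not> C \<subseteq> \<pp>}"
    unfolding A(2) B(2) by (rule Set.set_eqI) (use * in blast)
  moreover have "C \<subseteq> H"
    using A(1) B(1) mult by (auto simp: C_def)
  ultimately show "\<exists>C\<subseteq>H. U \<inter> V = {\<pp> \<in> P. \<not> C \<subseteq> \<pp>}"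
    by (intro exI[of _ C] conjI)
next
  fix \<U>
  assume "\<forall>U\<in>\<U>. \<exists>A\<subseteq>H. U = {\<pp> \<in> P. \<not> A \<subseteq> \<pp>}"
  then obtain A where "\<forall>U\<in>\<U>. A U \<subseteq> H \<and> U = {\<pp> \<in> P. \<not> A U \<subseteq> \<pp>}"
    by (rule bchoice[THEN exE])
  then have A: "A U \<subseteq> H" "\<pp> \<in> U \<longleftrightarrow> \<pp> \<in> P \<and> \<not> A U \<subseteq> \<pp>" if "U \<in> \<U>" for U \<pp>
    using that by (simp, metis (mono_tags, lifting) mem_Collect_eq)
  have "\<Union>\<U> = {\<pp> \<in> P. \<not> \<Union> (A ` \<U>) \<subseteq> \<pp>}"
    by (rule Set.set_eqI) (simp add: A(2) UN_subset_iff cong: bex_cong)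
  moreover have "\<Union> (A ` \<U>) \<subseteq> H"
    using A(1) by (intro UN_least)
  ultimately show "\<exists>C\<subseteq>H. \<Union>\<U> = {\<pp> \<in> P. \<not> C \<subseteq> \<pp>}"
    by (intro exI[of _ "\<Union> (A ` \<U>)"] conjI)
qed

lemma istopology_proj:
  "istopology (\<lambda>U. \<exists>A\<subseteq>(\<Union>d. forms r d). U = {\<pp> \<in> proj_points r. \<not> A \<subseteq> \<pp>})"
proof (rule istopology_zariski)
  show "a * b \<in> (\<Union>d. forms r d)"
    if "a \<in> (\<Union>d. forms r d)" "b \<in> (\<Union>d. forms r d)" for a b :: "'a mpoly"
    using that by (auto intro: forms_mult)
next
  fix a b :: "'a mpoly" and \<pp> :: "'a mpoly set"
  assume "\<pp> \<in> proj_points r" "a \<in> (\<Union>d. forms r d)" "b \<in> (\<Union>d. forms r d)"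
  then have prime: "primeideal \<pp> (poly_ring (Suc r))"
    and a: "a \<in> carrier (poly_ring (Suc r))" and b: "b \<in> carrier (poly_ring (Suc r))"
    by (auto simp: proj_points_def forms_def)
  have "monoid.mult (poly_ring (Suc r)) a b = a * b"
    by (simp add: poly_ring_def)
  then show "a * b \<in> \<pp> \<longleftrightarrow> a \<in> \<pp> \<or> b \<in> \<pp>"
    using primeideal.I_prime[OF prime a b] a b
      ideal.I_l_closed[OF primeideal.axioms(1)[OF prime], of b a]
      ideal.I_r_closed[OF primeideal.axioms(1)[OF prime], of a b]
    by auto
qed

definition basic_open :: "nat \<Rightarrow> 'k::field mpoly \<Rightarrow> 'k mpoly set set" where
  "basic_open r g = {\<pp> \<in> proj_points r. g \<notin> \<pp>}"

text \<open>
  Since \<open>k[x\<^sub>0, \<dots>, x\<^sub>r]\<close> is a domain, the homogeneous localizations at all points are subrings of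
  its field of fractions.  A regular function assigns to each point an element of the
  localization there and is locally a quotient of two forms of the same degree.
\<close>

definition proj_sheaf ::
  "nat \<Rightarrow> ('k::field mpoly set, 'k mpoly set \<Rightarrow> 'k mpoly fract, 'k mpoly set \<Rightarrow> 'k mpoly fract)
     presheaf" where
  "proj_sheaf r =
     \<lparr>Sec = (\<lambda>U. \<lparr>
        carrier = {s \<in> extensional U. \<forall>\<pp>\<in>U. \<exists>V d a b. openin (proj_top r) V \<and> \<pp> \<in> V \<and> V \<subseteq> U \<and>
           a \<in> forms r d \<and> b \<in> forms r d \<and> (\<forall>\<qq>\<in>V. b \<notin> \<qq> \<and> s \<qq> = Fract a b)},
        monoid.mult = (\<lambda>s t. \<lambda>\<pp>\<in>U. s \<pp> * t \<pp>),
        monoid.one = (\<lambda>\<pp>\<in>U. 1), ring.zero = (\<lambda>\<pp>\<in>U. 0),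
        ring.add = (\<lambda>s t. \<lambda>\<pp>\<in>U. s \<pp> + t \<pp>),
        module.smult = (\<lambda>s t. \<lambda>\<pp>\<in>U. s \<pp> * t \<pp>)\<rparr>),
      Res = (\<lambda>U V s. restrict s V)\<rparr>"

definition proj_space ::
  "nat \<Rightarrow> ('k::field mpoly set, 'k mpoly set \<Rightarrow> 'k mpoly fract) ringed_space" where
  "proj_space r = \<lparr>Top = proj_top r, Str = proj_sheaf r\<rparr>"

definition const_section ::
  "'k::field mpoly set set \<Rightarrow> 'k \<Rightarrow> 'k mpoly set \<Rightarrow> 'k mpoly fract" where
  "const_section U c = (\<lambda>\<pp>\<in>U. Fract (const_poly c) 1)"

type_synonym 'k subscheme = "'k mpoly set set \<Rightarrow> ('k mpoly set \<Rightarrow> 'k mpoly fract) set"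

text \<open>
  A \<open>k\<close>-algebra \<open>A\<close> with structure map \<open>\<iota>\<close> is standard smooth if it has a presentation
  \<open>k[x\<^sub>1, \<dots>, x\<^sub>n] / (f\<^sub>1, \<dots>, f\<^sub>c)\<close> in which the Jacobian minor with respect to the first \<open>c\<close>
  variables is invertible.
\<close>

definition standard_smooth :: "('k::field \<Rightarrow> 'a) \<Rightarrow> ('a, 'e) ring_scheme \<Rightarrow> bool" where
  "standard_smooth \<iota> A \<longleftrightarrow> (\<exists>n c f \<phi>. c \<le> n \<and> f ` {..<c} \<subseteq> carrier (poly_ring n) \<and>
     \<phi> \<in> Ring.ring_hom (poly_ring n) A \<and> (\<forall>a. \<phi> (const_poly a) = \<iota> a) \<and>
     \<phi> ` carrier (poly_ring n) = carrier A \<and>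
     a_kernel (poly_ring n) A \<phi> = Idl\<^bsub>poly_ring n\<^esub> (f ` {..<c}) \<and>
     \<phi> (det (mat c c (\<lambda>(i, j). partial_deriv i (f j)))) \<in> Units A)"

text \<open>\<open>Y\<close> is smooth over \<open>k\<close>: every point has an affine open neighbourhood with standard smooth
  coordinate ring.  The sets \<open>Y \<inter> D\<^sub>+(g)\<close>, with \<open>g\<close> of positive degree, form a basis of affine
  opens, and standard smoothness passes to principal localizations.\<close>

definition smooth_subscheme :: "nat \<Rightarrow> 'k::field subscheme \<Rightarrow> bool" where
  "smooth_subscheme r J \<longleftrightarrow>
     (\<forall>\<pp>\<in>support (proj_space r) J. \<exists>d>0. \<exists>g\<in>forms r d. g \<notin> \<pp> \<and>
        standard_smooth
          (\<lambda>c. quot_proj (proj_space r) (proj_sheaf r) J (basic_open r g)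
                 (const_section (basic_open r g) c))
          (Sec (struct_sheaf (proj_space r) J) (basic_open r g)))"

definition smooth_subvariety :: "nat \<Rightarrow> 'k::field subscheme \<Rightarrow> bool" where
  "smooth_subvariety r J \<longleftrightarrow> closed_subscheme (proj_space r) J \<and>
     integral_subscheme (proj_space r) J \<and> smooth_subscheme r J"

definition field_ring :: "'k::field ring" where
  "field_ring = \<lparr>carrier = UNIV, monoid.mult = (*), monoid.one = 1, ring.zero = 0, ring.add = (+)\<rparr>"

text \<open>
  The closed subscheme of \<open>P\<^sup>r \<times> Spec k[\<epsilon>]\<close> with ideal sheaf \<open>K\<close> is flat over \<open>k[\<epsilon>]\<close>: all stalks of
  its structure sheaf are flat, where \<open>k[\<epsilon>]\<close> acts on them through global constant sections.
\<close>

definition flat_over_dual ::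
  "nat \<Rightarrow> ('k::field mpoly set set
     \<Rightarrow> (('k mpoly set \<Rightarrow> 'k mpoly fract) \<times> ('k mpoly set \<Rightarrow> 'k mpoly fract)) set) \<Rightarrow> bool" where
  "flat_over_dual r K \<longleftrightarrow>
     (\<forall>\<pp>\<in>proj_points r.
        let M = quot_stalk (dual_space (proj_space r)) (Str (dual_space (proj_space r))) K \<pp>;
            const = map_prod (const_section (proj_points r)) (const_section (proj_points r))
        in flat_module (dual_ring (field_ring :: 'k ring))
             \<lparr>carrier = carrier M, monoid.mult = monoid.mult M, monoid.one = one M,
              ring.zero = zero M, ring.add = add M,
              module.smult = (\<lambda>c x. (proj_points r, const c) \<odot>\<^bsub>M\<^esub> x)\<rparr>)"

text \<open>\<open>Y\<^sub>\<epsilon> \<inter> (X \<times> Spec k[\<epsilon>])\<close> is flat over \<open>k[\<epsilon>]\<close>, where \<open>I\<close>, \<open>J\<close> define \<open>X\<close>, \<open>Y\<close>.\<close>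

definition induces_flat_deformation where
  "induces_flat_deformation r I J \<eta> \<longleftrightarrow>
     flat_over_dual r (ideal_sum (dual_space (proj_space r))
        (deformation_ideal (proj_space r) J \<eta>) (trivial_deformation I))"

end

theory Submission
  imports
    Defs
    "HOL-Algebra.Free_Abelian_Groups"
    "HOL-Computational_Algebra.Polynomial_Factorial"
begin

text \<open>
  A homomorphism \<open>I\<^sub>Y / I\<^sub>Y\<^sup>2 \<rightarrow> O\<^sub>Z\<close> comes from \<open>I\<^bsub>Z/X\<^esub> / I\<^bsub>Z/X\<^esub>\<^sup>2\<close> iff it vanishes on \<open>I\<^sub>X \<inter> I\<^sub>Y\<close>, so \<open>Q(X, Y)\<close>
  is the sheaf of homomorphisms \<open>I\<^sub>X \<inter> I\<^sub>Y \<rightarrow> O\<^sub>Z\<close> that extend to \<open>I\<^sub>Y\<close>. Since \<open>Y\<close> is smooth, \<open>I\<^sub>Y / I\<^sub>Y\<^sup>2\<close> is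
  locally a direct summand of \<open>\<Omega>\<^sub>P|\<^sub>Y\<close>: every homomorphism \<open>I\<^sub>Y \<rightarrow> O\<^sub>Z\<close> is locally the restriction of a
  derivation \<open>O\<^sub>P \<rightarrow> O\<^sub>P\<close>. Reducing this derivation modulo \<open>I\<^sub>Y\<close> gives the surjectivity of \<open>N \<rightarrow> Q(X, Y)\<close>;
  restricting it to \<open>I\<^sub>X\<close> gives the symmetry. A module over \<open>k[\<epsilon>]\<close> is flat iff the kernel of \<open>\<epsilon>\<close> is its
  image, which for the stalks of \<open>Y\<^sub>\<epsilon> \<inter> (X \<times> Spec k[\<epsilon>])\<close> means \<open>\<eta> (I\<^sub>X \<inter> I\<^sub>Y) \<subseteq> I\<^bsub>Z/Y\<^esub>\<close>.
\<close>

section \<open>Presheaves of modules and quotient sheaves\<close>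

text \<open>The criterion for factoring rests on the local fact that the kernel of I_Y -> I_{Z/X} /
  I_{Z/X}^2 is (I_X \<inter> I_Y) + I_Y^2, where I_Y^2 is killed by every homomorphism into O_Z. A
  derivation becomes O-linear once it is restricted to an ideal and reduced modulo a larger one;
  this is why one derivation of O_P serves I_Y -> O_Y, I_Y -> O_Z and I_X -> O_Z at once. The
  difficulty is to produce it: smoothness is given as a presentation of the coordinate ring of Y
  \<inter> D_+(g) alone, unrelated to the coordinates of P. Newton's method lifts the presentation
  to functions on P satisfying its relations modulo I_Y^2. The coordinates of P then become
  polynomials in the lifted ones plus errors E_j in I_Y, and these E_j generate I_Y modulo I_Y^2.
  The presentation sees only relations valid on all of Y \<inter> D_+(g), whereas an element of I_Y
  is known near one point; integrality of Y, used through its generic point, bridges this gap. The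
  computations take place in the fraction field of k[x_0, ..., x_r], where a regular function on P
  is a single fraction.\<close>

abbreviation keys :: "('a \<Rightarrow>\<^sub>0 'b::zero) \<Rightarrow> 'a set" where "keys \<equiv> Poly_Mapping.keys"
abbreviation lookup :: "('a \<Rightarrow>\<^sub>0 'b::zero) \<Rightarrow> 'a \<Rightarrow> 'b" where "lookup \<equiv> Poly_Mapping.lookup"
abbreviation single :: "'a \<Rightarrow> 'b::zero \<Rightarrow> 'a \<Rightarrow>\<^sub>0 'b" where "single \<equiv> Poly_Mapping.single"

declare openin_Int [simp]

text \<open>Additive inverses are (-1) x, so the law 0 x = 0 is asked for in place of inverses. The
  module structures below (stalks, quotient sheaves, sheaf Hom) are verified through this
  criterion.\<close>

lemma module_from_smult:
  fixes R (structure) and M (structure)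
  assumes R: "cring R"
    and closed: "\<And>x y. x \<in> carrier M \<Longrightarrow> y \<in> carrier M \<Longrightarrow> x \<oplus>\<^bsub>M\<^esub> y \<in> carrier M"
    and assoc: "\<And>x y z. x \<in> carrier M \<Longrightarrow> y \<in> carrier M \<Longrightarrow> z \<in> carrier M \<Longrightarrow>
      (x \<oplus>\<^bsub>M\<^esub> y) \<oplus>\<^bsub>M\<^esub> z = x \<oplus>\<^bsub>M\<^esub> (y \<oplus>\<^bsub>M\<^esub> z)"
    and comm: "\<And>x y. x \<in> carrier M \<Longrightarrow> y \<in> carrier M \<Longrightarrow> x \<oplus>\<^bsub>M\<^esub> y = y \<oplus>\<^bsub>M\<^esub> x"
    and zero: "\<zero>\<^bsub>M\<^esub> \<in> carrier M" "\<And>x. x \<in> carrier M \<Longrightarrow> \<zero>\<^bsub>M\<^esub> \<oplus>\<^bsub>M\<^esub> x = x"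
    and smult_closed: "\<And>a x. a \<in> carrier R \<Longrightarrow> x \<in> carrier M \<Longrightarrow> a \<odot>\<^bsub>M\<^esub> x \<in> carrier M"
    and smult_l_distr: "\<And>a b x. a \<in> carrier R \<Longrightarrow> b \<in> carrier R \<Longrightarrow> x \<in> carrier M \<Longrightarrow>
      (a \<oplus> b) \<odot>\<^bsub>M\<^esub> x = (a \<odot>\<^bsub>M\<^esub> x) \<oplus>\<^bsub>M\<^esub> (b \<odot>\<^bsub>M\<^esub> x)"
    and smult_r_distr: "\<And>a x y. a \<in> carrier R \<Longrightarrow> x \<in> carrier M \<Longrightarrow> y \<in> carrier M \<Longrightarrow>
      a \<odot>\<^bsub>M\<^esub> (x \<oplus>\<^bsub>M\<^esub> y) = (a \<odot>\<^bsub>M\<^esub> x) \<oplus>\<^bsub>M\<^esub> (a \<odot>\<^bsub>M\<^esub> y)"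
    and assoc1: "\<And>a b x. a \<in> carrier R \<Longrightarrow> b \<in> carrier R \<Longrightarrow> x \<in> carrier M \<Longrightarrow>
      (a \<otimes> b) \<odot>\<^bsub>M\<^esub> x = a \<odot>\<^bsub>M\<^esub> (b \<odot>\<^bsub>M\<^esub> x)"
    and one: "\<And>x. x \<in> carrier M \<Longrightarrow> \<one> \<odot>\<^bsub>M\<^esub> x = x"
    and zero_smult: "\<And>x. x \<in> carrier M \<Longrightarrow> \<zero> \<odot>\<^bsub>M\<^esub> x = \<zero>\<^bsub>M\<^esub>"
  shows "module R M"
proof (rule moduleI)
  interpret cring R by fact
  show "abelian_group M"
  proof (rule abelian_groupI)
    fix x assume x: "x \<in> carrier M"
    have "(\<ominus> \<one>) \<odot>\<^bsub>M\<^esub> x \<oplus>\<^bsub>M\<^esub> x = (\<ominus> \<one>) \<odot>\<^bsub>M\<^esub> x \<oplus>\<^bsub>M\<^esub> \<one> \<odot>\<^bsub>M\<^esub> x"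
      using x one by simp
    also have "\<dots> = (\<ominus> \<one> \<oplus> \<one>) \<odot>\<^bsub>M\<^esub> x"
      by (rule smult_l_distr[symmetric]) (use x in auto)
    also have "\<dots> = \<zero>\<^bsub>M\<^esub>"
      using x zero_smult by (simp add: l_neg)
    finally show "\<exists>y\<in>carrier M. y \<oplus>\<^bsub>M\<^esub> x = \<zero>\<^bsub>M\<^esub>"
      using x smult_closed by (intro bexI[of _ "(\<ominus> \<one>) \<odot>\<^bsub>M\<^esub> x"]) auto
  qed (use assms in auto)
qed (use assms in auto)

lemma (in abelian_group) add_minus_add:
  assumes "x \<in> carrier G" "y \<in> carrier G" "z \<in> carrier G" "w \<in> carrier G"
  shows "(x \<oplus> y) \<ominus> (z \<oplus> w) = (x \<ominus> z) \<oplus> (y \<ominus> w)"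
  using assms by (simp add: a_minus_def minus_add a_ac)

lemma (in abelian_group) minus_eq_zero_iff:
  assumes "x \<in> carrier G" "y \<in> carrier G"
  shows "x \<ominus> y = \<zero> \<longleftrightarrow> x = y"
  using assms by (metis a_minus_def a_inv_closed minus_equality minus_minus r_neg)

section \<open>Presheaves of rings and of modules over them\<close>

locale ring_presheaf =
  fixes S :: "('p, 'a) ringed_space"
  assumes cring: "openin (Top S) U \<Longrightarrow> cring (Sec (Str S) U)"
    and smult_mult: "openin (Top S) U \<Longrightarrow> a \<in> carrier (Sec (Str S) U) \<Longrightarrow>
      b \<in> carrier (Sec (Str S) U) \<Longrightarrow> a \<odot>\<^bsub>Sec (Str S) U\<^esub> b = a \<otimes>\<^bsub>Sec (Str S) U\<^esub> b"
    and str_res_hom: "openin (Top S) U \<Longrightarrow> openin (Top S) V \<Longrightarrow> V \<subseteq> U \<Longrightarrow>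
      Res (Str S) U V \<in> Ring.ring_hom (Sec (Str S) U) (Sec (Str S) V)"
    and str_res_id: "openin (Top S) U \<Longrightarrow> a \<in> carrier (Sec (Str S) U) \<Longrightarrow> Res (Str S) U U a = a"
    and str_res_res: "openin (Top S) U \<Longrightarrow> openin (Top S) V \<Longrightarrow> openin (Top S) W \<Longrightarrow>
      W \<subseteq> V \<Longrightarrow> V \<subseteq> U \<Longrightarrow> a \<in> carrier (Sec (Str S) U) \<Longrightarrow>
      Res (Str S) V W (Res (Str S) U V a) = Res (Str S) U W a"
begin

abbreviation "opn \<equiv> openin (Top S)"
abbreviation "X \<equiv> topspace (Top S)"
abbreviation R where "R U \<equiv> Sec (Str S) U"
abbreviation rho where "rho \<equiv> Res (Str S)"

abbreviation \<O> where "\<O> U \<equiv> carrier (R U)"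

lemma str_res_closed [simp]:
  "opn U \<Longrightarrow> opn V \<Longrightarrow> V \<subseteq> U \<Longrightarrow> a \<in> \<O> U \<Longrightarrow> rho U V a \<in> \<O> V"
  using str_res_hom[of U V] by (auto simp: Ring.ring_hom_def)

lemma str_res_mult:
  "opn U \<Longrightarrow> opn V \<Longrightarrow> V \<subseteq> U \<Longrightarrow> a \<in> \<O> U \<Longrightarrow> b \<in> \<O> U \<Longrightarrow>
   rho U V (a \<otimes>\<^bsub>R U\<^esub> b) = rho U V a \<otimes>\<^bsub>R V\<^esub> rho U V b"
  using str_res_hom[of U V] by (auto simp: Ring.ring_hom_def)

lemma str_res_add:
  "opn U \<Longrightarrow> opn V \<Longrightarrow> V \<subseteq> U \<Longrightarrow> a \<in> \<O> U \<Longrightarrow> b \<in> \<O> U \<Longrightarrow>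
   rho U V (a \<oplus>\<^bsub>R U\<^esub> b) = rho U V a \<oplus>\<^bsub>R V\<^esub> rho U V b"
  using str_res_hom[of U V] by (auto simp: Ring.ring_hom_def)

lemma str_res_one:
  "opn U \<Longrightarrow> opn V \<Longrightarrow> V \<subseteq> U \<Longrightarrow> rho U V \<one>\<^bsub>R U\<^esub> = \<one>\<^bsub>R V\<^esub>"
  using str_res_hom[of U V] by (auto simp: Ring.ring_hom_def)

lemma str_module: "opn U \<Longrightarrow> module (R U) (R U)"
proof (rule module_from_smult)
  assume U: "opn U"
  interpret cring "R U" by (rule cring[OF U])
  show "cring (R U)" by unfold_locales
  show "\<one>\<^bsub>R U\<^esub> \<odot>\<^bsub>R U\<^esub> x = x" if "x \<in> \<O> U" for x
    using that U by (simp add: smult_mult)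
qed (use smult_mult[of U] in \<open>auto simp: cring.cring_simprules[OF cring]\<close>)

end

locale module_presheaf = ring_presheaf S for S :: "('p, 'a) ringed_space" +
  fixes F :: "('p, 'a, 'm) presheaf"
  assumes module: "openin (Top S) U \<Longrightarrow> module (Sec (Str S) U) (Sec F U)"
    and res_closed [simp]: "openin (Top S) U \<Longrightarrow> openin (Top S) V \<Longrightarrow> V \<subseteq> U \<Longrightarrow>
      x \<in> carrier (Sec F U) \<Longrightarrow> Res F U V x \<in> carrier (Sec F V)"
    and res_add: "openin (Top S) U \<Longrightarrow> openin (Top S) V \<Longrightarrow> V \<subseteq> U \<Longrightarrow>
      x \<in> carrier (Sec F U) \<Longrightarrow> y \<in> carrier (Sec F U) \<Longrightarrow>
      Res F U V (x \<oplus>\<^bsub>Sec F U\<^esub> y) = Res F U V x \<oplus>\<^bsub>Sec F V\<^esub> Res F U V y"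
    and res_smult: "openin (Top S) U \<Longrightarrow> openin (Top S) V \<Longrightarrow> V \<subseteq> U \<Longrightarrow>
      a \<in> carrier (Sec (Str S) U) \<Longrightarrow> x \<in> carrier (Sec F U) \<Longrightarrow>
      Res F U V (a \<odot>\<^bsub>Sec F U\<^esub> x) = Res (Str S) U V a \<odot>\<^bsub>Sec F V\<^esub> Res F U V x"
    and res_id: "openin (Top S) U \<Longrightarrow> x \<in> carrier (Sec F U) \<Longrightarrow> Res F U U x = x"
    and res_res: "openin (Top S) U \<Longrightarrow> openin (Top S) V \<Longrightarrow> openin (Top S) W \<Longrightarrow>
      W \<subseteq> V \<Longrightarrow> V \<subseteq> U \<Longrightarrow> x \<in> carrier (Sec F U) \<Longrightarrow>
      Res F V W (Res F U V x) = Res F U W x"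
begin

abbreviation M where "M U \<equiv> Sec F U"

lemma abelian: "opn U \<Longrightarrow> abelian_group (M U)"
  using module by (rule module.axioms(2))

lemmas M_add_closed [simp] = abelian_monoid.a_closed[OF abelian_group.axioms(1)[OF abelian]]
lemmas M_zero_closed [simp] = abelian_monoid.zero_closed[OF abelian_group.axioms(1)[OF abelian]]
lemmas M_smult_closed [simp] = module.smult_closed[OF module]
lemmas M_minus_closed [simp] = abelian_group.minus_closed[OF abelian]
lemmas M_inv_closed [simp] = abelian_group.a_inv_closed[OF abelian]

text \<open>Writes inverses as scalar multiples, so that closure under scalars and linearity of maps
  carry over to inverses and differences.\<close>

lemma smult_minus_one:
  assumes U: "opn U" and x: "x \<in> carrier (M U)"
  shows "(\<ominus>\<^bsub>R U\<^esub> \<one>\<^bsub>R U\<^esub>) \<odot>\<^bsub>M U\<^esub> x = \<ominus>\<^bsub>M U\<^esub> x"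
proof -
  interpret module "R U" "M U" by (rule module[OF U])
  show ?thesis using x by (simp add: smult_l_minus)
qed

lemma res_zero:
  assumes "opn U" "opn V" "V \<subseteq> U"
  shows "Res F U V \<zero>\<^bsub>M U\<^esub> = \<zero>\<^bsub>M V\<^esub>"
proof -
  interpret V: abelian_group "M V" by (rule abelian) fact
  interpret U: abelian_group "M U" by (rule abelian) fact
  have "Res F U V \<zero>\<^bsub>M U\<^esub> \<oplus>\<^bsub>M V\<^esub> Res F U V \<zero>\<^bsub>M U\<^esub> = Res F U V \<zero>\<^bsub>M U\<^esub>"
    using assms by (subst res_add[symmetric]) auto
  then show ?thesis
    using assms by (metis M_zero_closed V.add.r_cancel_one' res_closed)
qed

lemma res_inv:
  assumes "opn U" "opn V" "V \<subseteq> U" "x \<in> carrier (M U)"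
  shows "Res F U V (\<ominus>\<^bsub>M U\<^esub> x) = \<ominus>\<^bsub>M V\<^esub> Res F U V x"
proof -
  interpret V: abelian_group "M V" by (rule abelian) fact
  interpret U: abelian_group "M U" by (rule abelian) fact
  have "Res F U V (\<ominus>\<^bsub>M U\<^esub> x) \<oplus>\<^bsub>M V\<^esub> Res F U V x = \<zero>\<^bsub>M V\<^esub>"
    using assms by (subst res_add[symmetric]) (auto simp: U.l_neg res_zero)
  then show ?thesis
    using assms by (intro V.minus_equality[symmetric]) auto
qed

lemma res_minus:
  assumes "opn U" "opn V" "V \<subseteq> U" "x \<in> carrier (M U)" "y \<in> carrier (M U)"
  shows "Res F U V (x \<ominus>\<^bsub>M U\<^esub> y) = Res F U V x \<ominus>\<^bsub>M V\<^esub> Res F U V y"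
  using assms by (simp add: a_minus_def res_add res_inv)

end

section \<open>Stalks of the quotient by a subpresheaf of modules\<close>

locale submodule_presheaf = module_presheaf S F
  for S :: "('p, 'a) ringed_space" and F :: "('p, 'a, 'm) presheaf" +
  fixes G :: "'p set \<Rightarrow> 'm set"
  assumes sub_carrier: "openin (Top S) U \<Longrightarrow> x \<in> G U \<Longrightarrow> x \<in> carrier (Sec F U)"
    and sub_zero: "openin (Top S) U \<Longrightarrow> \<zero>\<^bsub>Sec F U\<^esub> \<in> G U"
    and sub_add: "openin (Top S) U \<Longrightarrow> x \<in> G U \<Longrightarrow> y \<in> G U \<Longrightarrow> x \<oplus>\<^bsub>Sec F U\<^esub> y \<in> G U"
    and sub_smult: "openin (Top S) U \<Longrightarrow> a \<in> carrier (Sec (Str S) U) \<Longrightarrow> x \<in> G U \<Longrightarrow>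
      a \<odot>\<^bsub>Sec F U\<^esub> x \<in> G U"
    and sub_res: "openin (Top S) U \<Longrightarrow> openin (Top S) V \<Longrightarrow> V \<subseteq> U \<Longrightarrow> x \<in> G U \<Longrightarrow>
      Res F U V x \<in> G V"
begin

lemma sub_inv:
  assumes "opn U" "x \<in> G U"
  shows "\<ominus>\<^bsub>M U\<^esub> x \<in> G U"
proof -
  interpret module "R U" "M U" by (rule module) fact
  show ?thesis
    using assms sub_smult[of U "\<ominus>\<^bsub>R U\<^esub> \<one>\<^bsub>R U\<^esub>" x] by (simp add: smult_minus_one sub_carrier)
qed

lemma sub_minus: "opn U \<Longrightarrow> x \<in> G U \<Longrightarrow> y \<in> G U \<Longrightarrow> x \<ominus>\<^bsub>M U\<^esub> y \<in> G U"
  by (simp add: a_minus_def sub_add sub_inv)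

lemma subpresheaf_module: "module_presheaf S (subpresheaf F G)"
proof (intro module_presheaf.intro module_presheaf_axioms.intro ring_presheaf_axioms)
  fix U assume U: "opn U"
  interpret module "R U" "M U" by (rule module[OF U])
  show "module (R U) (Sec (subpresheaf F G) U)"
    by (rule module_from_smult)
      (use U in \<open>auto simp: subpresheaf_def sub_add sub_zero sub_smult sub_carrier M.add.m_assoc
         M.add.m_comm M.add.m_lcomm smult_l_distr smult_r_distr smult_assoc1 is_cring\<close>)
qed (auto simp: subpresheaf_def sub_res sub_carrier res_add res_smult res_id res_res)

abbreviation g where "g \<equiv> quot_germ S F G"
abbreviation stalk where "stalk \<equiv> quot_stalk S F G"

lemma diff_sym:
  assumes "opn W" "x \<in> carrier (M W)" "y \<in> carrier (M W)" "x \<ominus>\<^bsub>M W\<^esub> y \<in> G W"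
  shows "y \<ominus>\<^bsub>M W\<^esub> x \<in> G W"
proof -
  interpret abelian_group "M W" by (rule abelian) fact
  have "y \<ominus>\<^bsub>M W\<^esub> x = \<ominus>\<^bsub>M W\<^esub> (x \<ominus>\<^bsub>M W\<^esub> y)"
    using assms by (simp add: a_minus_def minus_add a_comm)
  then show ?thesis using assms sub_inv by simp
qed

lemma diff_trans:
  assumes "opn W" "x \<in> carrier (M W)" "y \<in> carrier (M W)" "z \<in> carrier (M W)"
    "x \<ominus>\<^bsub>M W\<^esub> y \<in> G W" "y \<ominus>\<^bsub>M W\<^esub> z \<in> G W"
  shows "x \<ominus>\<^bsub>M W\<^esub> z \<in> G W"
proof -
  interpret abelian_group "M W" by (rule abelian) fact
  have "x \<ominus>\<^bsub>M W\<^esub> z = (x \<ominus>\<^bsub>M W\<^esub> y) \<oplus>\<^bsub>M W\<^esub> (y \<ominus>\<^bsub>M W\<^esub> z)"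
    using assms by (simp add: a_minus_def a_assoc r_neg1)
  then show ?thesis using assms sub_add by simp
qed

definition germ_eq where
  "germ_eq p U s V t \<longleftrightarrow> (\<exists>W. opn W \<and> p \<in> W \<and> W \<subseteq> U \<inter> V \<and> Res F U W s \<ominus>\<^bsub>M W\<^esub> Res F V W t \<in> G W)"

lemma germ_eq_sym:
  assumes "opn U" "opn V" "s \<in> carrier (M U)" "t \<in> carrier (M V)" "germ_eq p U s V t"
  shows "germ_eq p V t U s"
proof -
  obtain W where "opn W" "p \<in> W" "W \<subseteq> U \<inter> V" "Res F U W s \<ominus>\<^bsub>M W\<^esub> Res F V W t \<in> G W"
    using assms(5) unfolding germ_eq_def by blast
  then show ?thesis
    unfolding germ_eq_def using assms diff_sym[of W "Res F U W s" "Res F V W t"]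
    by (intro exI[of _ W]) auto
qed

lemma minus_in_res:
  assumes "opn U" "opn V" "opn W" "opn W'" "s \<in> carrier (M U)" "t \<in> carrier (M V)"
    "W \<subseteq> U" "W \<subseteq> V" "W' \<subseteq> W" "Res F U W s \<ominus>\<^bsub>M W\<^esub> Res F V W t \<in> G W"
  shows "Res F U W' s \<ominus>\<^bsub>M W'\<^esub> Res F V W' t \<in> G W'"
proof -
  have "Res F W W' (Res F U W s \<ominus>\<^bsub>M W\<^esub> Res F V W t) \<in> G W'"
    using assms by (intro sub_res) auto
  then show ?thesis
    using assms by (simp add: res_minus res_res)
qed

lemma germ_eq_trans:
  assumes "opn U" "opn V" "opn V'" "s \<in> carrier (M U)" "t \<in> carrier (M V)" "u \<in> carrier (M V')"
    "germ_eq p U s V t" "germ_eq p V t V' u"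
  shows "germ_eq p U s V' u"
proof -
  obtain W where W: "opn W" "p \<in> W" "W \<subseteq> U \<inter> V" "Res F U W s \<ominus>\<^bsub>M W\<^esub> Res F V W t \<in> G W"
    using assms(7) unfolding germ_eq_def by blast
  obtain W' where W': "opn W'" "p \<in> W'" "W' \<subseteq> V \<inter> V'" "Res F V W' t \<ominus>\<^bsub>M W'\<^esub> Res F V' W' u \<in> G W'"
    using assms(8) unfolding germ_eq_def by blast
  let ?W = "W \<inter> W'"
  have "Res F U ?W s \<ominus>\<^bsub>M ?W\<^esub> Res F V ?W t \<in> G ?W"
    by (rule minus_in_res[of _ _ W]) (use W W' assms in auto)
  moreover have "Res F V ?W t \<ominus>\<^bsub>M ?W\<^esub> Res F V' ?W u \<in> G ?W"
    by (rule minus_in_res[of _ _ W']) (use W W' assms in auto)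
  ultimately have "Res F U ?W s \<ominus>\<^bsub>M ?W\<^esub> Res F V' ?W u \<in> G ?W"
    by (rule diff_trans[rotated 4]) (use W W' assms in \<open>auto intro!: res_closed\<close>)
  then show ?thesis
    unfolding germ_eq_def using W W' by (intro exI[of _ ?W]) auto
qed

lemma germ_eq_refl:
  assumes "opn U" "p \<in> U" "s \<in> carrier (M U)"
  shows "germ_eq p U s U s"
proof -
  interpret abelian_group "M U" by (rule abelian) fact
  show ?thesis
    unfolding germ_eq_def using assms
    by (intro exI[of _ U]) (auto simp: res_id a_minus_def r_neg sub_zero)
qed

text \<open>A germ is stored as the class of \<open>(U, s)\<close> under the equivalence relation
  \<open>germ_eq p\<close>, so equality of two classes amounts to the relation between their
  representatives.\<close>

lemma germ_iff:
  assumes "opn U" "opn V" "p \<in> U" "p \<in> V" "s \<in> carrier (M U)" "t \<in> carrier (M V)"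
  shows "g p U s = g p V t \<longleftrightarrow> germ_eq p U s V t"
proof -
  have *: "g p U s = {(V, t). opn V \<and> p \<in> V \<and> t \<in> carrier (M V) \<and> germ_eq p U s V t}" for U s
    by (simp add: quot_germ_def germ_eq_def conj_assoc)
  show ?thesis
  proof
    assume eq: "g p U s = g p V t"
    have "(V, t) \<in> g p V t"
      using germ_eq_refl[of V p t] assms by (simp add: *)
    then have "(V, t) \<in> g p U s"
      by (simp only: eq)
    then show "germ_eq p U s V t"
      by (simp add: *)
  next
    assume eq: "germ_eq p U s V t"
    have eq': "germ_eq p V t U s"
      by (rule germ_eq_sym) (use assms eq in auto)
    have "germ_eq p U s W u \<longleftrightarrow> germ_eq p V t W u" if "opn W" "u \<in> carrier (M W)" for W u
      using germ_eq_trans[OF assms(1,2) that(1) assms(5,6) that(2) eq]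
        germ_eq_trans[OF assms(2,1) that(1) assms(6,5) that(2) eq'] by blast
    then show "g p U s = g p V t"
      unfolding * by auto
  qed
qed

lemma germ_eqI:
  assumes "opn U" "opn V" "opn W" "p \<in> W" "W \<subseteq> U" "W \<subseteq> V" "s \<in> carrier (M U)" "t \<in> carrier (M V)"
    "Res F U W s \<ominus>\<^bsub>M W\<^esub> Res F V W t \<in> G W"
  shows "g p U s = g p V t"
  using assms by (subst germ_iff) (auto simp: germ_eq_def)

lemma mem_germ:
  assumes "opn U" "p \<in> U" "s \<in> carrier (M U)"
  shows "(V, t) \<in> g p U s \<longleftrightarrow> opn V \<and> p \<in> V \<and> t \<in> carrier (M V) \<and> g p V t = g p U s"
proof -
  have "(V, t) \<in> g p U s \<longleftrightarrow> opn V \<and> p \<in> V \<and> t \<in> carrier (M V) \<and> germ_eq p U s V t"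
    by (auto simp: quot_germ_def germ_eq_def)
  then show ?thesis
    using germ_iff[OF assms(1) _ assms(2) _ assms(3), of V t] by auto
qed

lemma germ_res:
  assumes "opn U" "opn W" "p \<in> W" "W \<subseteq> U" "s \<in> carrier (M U)"
  shows "g p W (Res F U W s) = g p U s"
proof -
  interpret abelian_group "M W" by (rule abelian) fact
  show ?thesis
    using assms
    by (intro germ_eqI[of _ _ W]) (auto simp: res_id r_neg a_minus_def sub_zero)
qed

text \<open>Operations on stalks are written as unions over all representatives of a germ; this
  evaluates such a union once its members coincide.\<close>

lemma UN_germ:
  assumes "opn U" "p \<in> U" "s \<in> carrier (M U)"
    and "\<And>V t. opn V \<Longrightarrow> p \<in> V \<Longrightarrow> t \<in> carrier (M V) \<Longrightarrow> g p V t = g p U s \<Longrightarrow> f V t = c"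
  shows "(\<Union>(V, t)\<in>g p U s. f V t) = c"
proof -
  have "(U, s) \<in> g p U s" using assms by (simp add: mem_germ)
  moreover have "f V t = c" if "(V, t) \<in> g p U s" for V t
    using that assms by (auto simp: mem_germ)
  ultimately show ?thesis by fast
qed

text \<open>Serves addition and multiplication alike. Two choices of representatives are compared on
  an open set where both congruences modulo \<open>G\<close> hold: \<open>f_res\<close> brings the
  values there, and \<open>f_cong\<close> compares them.\<close>

lemma germ_op_germ:
  assumes f_closed: "\<And>W x y. opn W \<Longrightarrow> x \<in> carrier (M W) \<Longrightarrow> y \<in> carrier (M W) \<Longrightarrow> f W x y \<in> carrier (M W)"
    and f_res: "\<And>W W' x y. opn W \<Longrightarrow> opn W' \<Longrightarrow> W' \<subseteq> W \<Longrightarrow> x \<in> carrier (M W) \<Longrightarrow> y \<in> carrier (M W) \<Longrightarrow>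
      Res F W W' (f W x y) = f W' (Res F W W' x) (Res F W W' y)"
    and f_cong: "\<And>W x x' y y'. opn W \<Longrightarrow> x \<in> carrier (M W) \<Longrightarrow> y \<in> carrier (M W) \<Longrightarrow>
      x' \<in> carrier (M W) \<Longrightarrow> y' \<in> carrier (M W) \<Longrightarrow> x \<ominus>\<^bsub>M W\<^esub> x' \<in> G W \<Longrightarrow> y \<ominus>\<^bsub>M W\<^esub> y' \<in> G W \<Longrightarrow>
      f W x y \<ominus>\<^bsub>M W\<^esub> f W x' y' \<in> G W"
    and U: "opn U" "p \<in> U" "s \<in> carrier (M U)" "t \<in> carrier (M U)"
  shows "germ_op S F G p f (g p U s) (g p U t) = g p U (f U s t)"
proof -
  have *: "g p (V \<inter> V') (f (V \<inter> V') (Res F V (V \<inter> V') s') (Res F V' (V \<inter> V') t')) = g p U (f U s t)"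
    if V: "opn V" "p \<in> V" "s' \<in> carrier (M V)" "g p V s' = g p U s"
      and V': "opn V'" "p \<in> V'" "t' \<in> carrier (M V')" "g p V' t' = g p U t" for V s' V' t'
  proof -
  obtain W where W: "opn W" "p \<in> W" "W \<subseteq> V \<inter> U" "Res F V W s' \<ominus>\<^bsub>M W\<^esub> Res F U W s \<in> G W"
    using V U germ_iff[of V U p s' s] by (auto simp: germ_eq_def)
  obtain W' where W': "opn W'" "p \<in> W'" "W' \<subseteq> V' \<inter> U" "Res F V' W' t' \<ominus>\<^bsub>M W'\<^esub> Res F U W' t \<in> G W'"
    using V' U germ_iff[of V' U p t' t] by (auto simp: germ_eq_def)
  define Q where "Q = W \<inter> W'"
  define P where "P = V \<inter> V'"
  have o: "opn P" "opn Q" "p \<in> Q" "Q \<subseteq> P" "Q \<subseteq> U" "P \<subseteq> V" "P \<subseteq> V'" "Q \<subseteq> W" "Q \<subseteq> W'"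
    "Q \<subseteq> V" "Q \<subseteq> V'" "W \<subseteq> V" "W' \<subseteq> V'" "W \<subseteq> U" "W' \<subseteq> U" "opn V" "opn V'" "opn W" "opn W'" "opn U"
    using V V' W W' U by (auto simp: P_def Q_def)
  note c = V(3) V'(3) U(3,4)
  have "Res F V Q s' \<ominus>\<^bsub>M Q\<^esub> Res F U Q s \<in> G Q"
    by (rule minus_in_res[of _ _ W]) (simp_all add: o c W(4))
  moreover have "Res F V' Q t' \<ominus>\<^bsub>M Q\<^esub> Res F U Q t \<in> G Q"
    by (rule minus_in_res[of _ _ W']) (simp_all add: o c W'(4))
  ultimately have *: "f Q (Res F V Q s') (Res F V' Q t') \<ominus>\<^bsub>M Q\<^esub> f Q (Res F U Q s) (Res F U Q t) \<in> G Q"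
    by (intro f_cong) (simp_all add: o c)
  have "Res F P Q (f P (Res F V P s') (Res F V' P t')) = f Q (Res F V Q s') (Res F V' Q t')"
    by (simp add: f_res res_res o c)
  moreover have "Res F U Q (f U s t) = f Q (Res F U Q s) (Res F U Q t)"
    by (simp add: f_res o c)
  ultimately have "g p P (f P (Res F V P s') (Res F V' P t')) = g p U (f U s t)"
    using * by (intro germ_eqI[of _ _ Q]) (simp_all add: o c f_closed)
  then show ?thesis
    by (simp add: P_def)
  qed
  have "(\<Union>(V', t')\<in>g p U t. g p (V \<inter> V') (f (V \<inter> V') (Res F V (V \<inter> V') s') (Res F V' (V \<inter> V') t'))) = g p U (f U s t)"
    if "opn V" "p \<in> V" "s' \<in> carrier (M V)" "g p V s' = g p U s" for V s'
    by (rule UN_germ[OF U(1,2,4)]) (rule *[OF that])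
  then show ?thesis
    unfolding germ_op_def by (rule UN_germ[OF U(1-3)])
qed

lemma diff_add:
  assumes "opn W" "x \<in> carrier (M W)" "y \<in> carrier (M W)" "x' \<in> carrier (M W)" "y' \<in> carrier (M W)"
    "x \<ominus>\<^bsub>M W\<^esub> x' \<in> G W" "y \<ominus>\<^bsub>M W\<^esub> y' \<in> G W"
  shows "(x \<oplus>\<^bsub>M W\<^esub> y) \<ominus>\<^bsub>M W\<^esub> (x' \<oplus>\<^bsub>M W\<^esub> y') \<in> G W"
proof -
  interpret abelian_group "M W" by (rule abelian) fact
  have "(x \<oplus>\<^bsub>M W\<^esub> y) \<ominus>\<^bsub>M W\<^esub> (x' \<oplus>\<^bsub>M W\<^esub> y') = (x \<ominus>\<^bsub>M W\<^esub> x') \<oplus>\<^bsub>M W\<^esub> (y \<ominus>\<^bsub>M W\<^esub> y')"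
    using assms(2-5) by (rule add_minus_add)
  then show ?thesis using assms(1,6,7) sub_add by simp
qed

lemma diff_smult:
  assumes "opn W" "a \<in> \<O> W" "x \<in> carrier (M W)" "y \<in> carrier (M W)" "x \<ominus>\<^bsub>M W\<^esub> y \<in> G W"
  shows "(a \<odot>\<^bsub>M W\<^esub> x) \<ominus>\<^bsub>M W\<^esub> (a \<odot>\<^bsub>M W\<^esub> y) \<in> G W"
proof -
  interpret module "R W" "M W" by (rule module) fact
  have "(a \<odot>\<^bsub>M W\<^esub> x) \<ominus>\<^bsub>M W\<^esub> (a \<odot>\<^bsub>M W\<^esub> y) = a \<odot>\<^bsub>M W\<^esub> (x \<ominus>\<^bsub>M W\<^esub> y)"
    using assms by (simp add: a_minus_def smult_r_distr smult_r_minus)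
  then show ?thesis using assms sub_smult by simp
qed

lemma stalk_add:
  assumes "opn U" "p \<in> U" "s \<in> carrier (M U)" "t \<in> carrier (M U)"
  shows "g p U s \<oplus>\<^bsub>stalk p\<^esub> g p U t = g p U (s \<oplus>\<^bsub>M U\<^esub> t)"
  unfolding quot_stalk_def ring_record_simps
  by (rule germ_op_germ) (use assms in \<open>auto simp: res_add diff_add\<close>)

lemma stalk_smult:
  assumes "opn U" "opn V" "p \<in> U" "p \<in> V" "a \<in> \<O> U" "s \<in> carrier (M V)"
  shows "(U, a) \<odot>\<^bsub>stalk p\<^esub> g p V s =
    g p (U \<inter> V) (rho U (U \<inter> V) a \<odot>\<^bsub>M (U \<inter> V)\<^esub> Res F V (U \<inter> V) s)"
proof -
  have *: "g p (U \<inter> V') (rho U (U \<inter> V') a \<odot>\<^bsub>M (U \<inter> V')\<^esub> Res F V' (U \<inter> V') t) =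
    g p (U \<inter> V) (rho U (U \<inter> V) a \<odot>\<^bsub>M (U \<inter> V)\<^esub> Res F V (U \<inter> V) s)"
    if V': "opn V'" "p \<in> V'" "t \<in> carrier (M V')" "g p V' t = g p V s" for V' t
  proof -
  obtain W where W: "opn W" "p \<in> W" "W \<subseteq> V' \<inter> V" "Res F V' W t \<ominus>\<^bsub>M W\<^esub> Res F V W s \<in> G W"
    using V' assms germ_iff[of V' V p t s] by (auto simp: germ_eq_def)
  define Q where "Q = U \<inter> W"
  define P where "P = U \<inter> V'"
  define P' where "P' = U \<inter> V"
  have o: "opn Q" "opn P" "opn P'" "Q \<subseteq> P" "Q \<subseteq> P'" "Q \<subseteq> U" "P \<subseteq> U" "P' \<subseteq> U" "P \<subseteq> V'" "P' \<subseteq> V"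
    "p \<in> Q" "Q \<subseteq> W" "W \<subseteq> V" "W \<subseteq> V'" "Q \<subseteq> V" "Q \<subseteq> V'" "opn U" "opn V" "opn W" "opn V'"
    using assms W V' by (auto simp: Q_def P_def P'_def)
  note c = V'(3) assms(5,6)
  have "Res F V' Q t \<ominus>\<^bsub>M Q\<^esub> Res F V Q s \<in> G Q"
    by (rule minus_in_res[of _ _ W]) (simp_all add: o c W(4))
  then have "rho U Q a \<odot>\<^bsub>M Q\<^esub> Res F V' Q t \<ominus>\<^bsub>M Q\<^esub> rho U Q a \<odot>\<^bsub>M Q\<^esub> Res F V Q s \<in> G Q"
    by (intro diff_smult) (simp_all add: o c)
  then have "g p P (rho U P a \<odot>\<^bsub>M P\<^esub> Res F V' P t) = g p P' (rho U P' a \<odot>\<^bsub>M P'\<^esub> Res F V P' s)"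
    by (intro germ_eqI[of _ _ Q]) (simp_all add: o c res_smult res_res str_res_res)
  then show ?thesis
    by (simp add: P_def P'_def)
  qed
  show ?thesis
    unfolding quot_stalk_def module.select_convs split_conv
    by (rule UN_germ[OF assms(2,4,6)]) (rule *)
qed

lemma stalk_smult_same:
  assumes "opn U" "opn V" "V \<subseteq> U" "p \<in> V" "a \<in> \<O> U" "s \<in> carrier (M V)"
  shows "(U, a) \<odot>\<^bsub>stalk p\<^esub> g p V s = g p V (rho U V a \<odot>\<^bsub>M V\<^esub> s)"
  using stalk_smult[of U V p a s] assms by (auto simp: Int_absorb1 res_id)

lemma stalk_zero:
  assumes "opn U" "p \<in> U"
  shows "\<zero>\<^bsub>stalk p\<^esub> = g p U \<zero>\<^bsub>M U\<^esub>"
proof -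
  have "U \<subseteq> X" using assms openin_subset by blast
  then have "g p U (Res F X U \<zero>\<^bsub>M X\<^esub>) = g p X \<zero>\<^bsub>M X\<^esub>"
    using assms by (intro germ_res) auto
  then show ?thesis
    using assms \<open>U \<subseteq> X\<close> by (simp add: quot_stalk_def res_zero)
qed

lemma germ_zero_iff:
  assumes "opn U" "p \<in> U" "s \<in> carrier (M U)"
  shows "g p U s = \<zero>\<^bsub>stalk p\<^esub> \<longleftrightarrow> (\<exists>W. opn W \<and> p \<in> W \<and> W \<subseteq> U \<and> Res F U W s \<in> G W)"
proof -
  have *: "Res F U W s \<ominus>\<^bsub>M W\<^esub> Res F U W \<zero>\<^bsub>M U\<^esub> = Res F U W s" if "opn W" "W \<subseteq> U" for W
  proof -
    interpret abelian_group "M W" by (rule abelian) fact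
    show ?thesis using that assms by (simp add: res_zero a_minus_def)
  qed
  have "g p U s = \<zero>\<^bsub>stalk p\<^esub> \<longleftrightarrow> germ_eq p U s U \<zero>\<^bsub>M U\<^esub>"
    using assms by (simp add: stalk_zero[of U] germ_iff)
  also have "\<dots> \<longleftrightarrow> (\<exists>W. opn W \<and> p \<in> W \<and> W \<subseteq> U \<and> Res F U W s \<in> G W)"
    unfolding germ_eq_def using * by auto
  finally show ?thesis .
qed

lemma stalk_carrierE:
  assumes "x \<in> carrier (stalk p)"
  obtains U s where "opn U" "p \<in> U" "s \<in> carrier (M U)" "x = g p U s"
  using assms by (auto simp: quot_stalk_def)

lemma germ_in_stalk: "opn U \<Longrightarrow> p \<in> U \<Longrightarrow> s \<in> carrier (M U) \<Longrightarrow> g p U s \<in> carrier (stalk p)"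
  by (auto simp: quot_stalk_def)

text \<open>Representatives over one common open set reduce the laws of the stalk to those of the
  modules \<open>Sec F U\<close>.\<close>

lemma stalk_common2:
  assumes "x \<in> carrier (stalk p)" "y \<in> carrier (stalk p)"
  obtains U s t where "opn U" "p \<in> U" "s \<in> carrier (M U)" "t \<in> carrier (M U)" "x = g p U s" "y = g p U t"
proof -
  obtain U s where U: "opn U" "p \<in> U" "s \<in> carrier (M U)" "x = g p U s"
    using assms(1) by (rule stalk_carrierE)
  obtain V t where V: "opn V" "p \<in> V" "t \<in> carrier (M V)" "y = g p V t"
    using assms(2) by (rule stalk_carrierE)
  show thesis
    by (rule that[of "U \<inter> V" "Res F U (U \<inter> V) s" "Res F V (U \<inter> V) t"]) (use U V germ_res[of U "U \<inter> V" p s] germ_res[of V "U \<inter> V" p t] in auto)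
qed

lemma stalk_common3:
  assumes "x \<in> carrier (stalk p)" "y \<in> carrier (stalk p)" "z \<in> carrier (stalk p)"
  obtains U s t u where "opn U" "p \<in> U" "s \<in> carrier (M U)" "t \<in> carrier (M U)" "u \<in> carrier (M U)"
    "x = g p U s" "y = g p U t" "z = g p U u"
proof -
  obtain U s t where U: "opn U" "p \<in> U" "s \<in> carrier (M U)" "t \<in> carrier (M U)" "x = g p U s" "y = g p U t"
    using assms(1,2) by (rule stalk_common2)
  obtain V u where V: "opn V" "p \<in> V" "u \<in> carrier (M V)" "z = g p V u"
    using assms(3) by (rule stalk_carrierE)
  show thesis
    by (rule that[of "U \<inter> V" "Res F U (U \<inter> V) s" "Res F U (U \<inter> V) t" "Res F V (U \<inter> V) u"])
      (use U V germ_res[of U "U \<inter> V" p s] germ_res[of U "U \<inter> V" p t] germ_res[of V "U \<inter> V" p u] in auto)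
qed

lemma stalk_add_closed: "x \<in> carrier (stalk p) \<Longrightarrow> y \<in> carrier (stalk p) \<Longrightarrow> x \<oplus>\<^bsub>stalk p\<^esub> y \<in> carrier (stalk p)"
  by (erule (1) stalk_common2) (simp add: stalk_add germ_in_stalk)

lemma stalk_assoc:
  assumes "x \<in> carrier (stalk p)" "y \<in> carrier (stalk p)" "z \<in> carrier (stalk p)"
  shows "(x \<oplus>\<^bsub>stalk p\<^esub> y) \<oplus>\<^bsub>stalk p\<^esub> z = x \<oplus>\<^bsub>stalk p\<^esub> (y \<oplus>\<^bsub>stalk p\<^esub> z)"
  using assms by (rule stalk_common3) (simp add: stalk_add abelian_monoid.a_assoc abelian_group.axioms(1) abelian)

lemma stalk_comm:
  assumes "x \<in> carrier (stalk p)" "y \<in> carrier (stalk p)"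
  shows "x \<oplus>\<^bsub>stalk p\<^esub> y = y \<oplus>\<^bsub>stalk p\<^esub> x"
  using assms by (rule stalk_common2) (simp add: stalk_add abelian_monoid.a_comm abelian_group.axioms(1) abelian)

lemma stalk_zero_closed: "p \<in> X \<Longrightarrow> \<zero>\<^bsub>stalk p\<^esub> \<in> carrier (stalk p)"
  by (subst stalk_zero[of X]) (auto simp: germ_in_stalk)

lemma stalk_zero_add:
  assumes "x \<in> carrier (stalk p)"
  shows "\<zero>\<^bsub>stalk p\<^esub> \<oplus>\<^bsub>stalk p\<^esub> x = x"
  using assms by (rule stalk_carrierE)
    (simp add: stalk_zero stalk_add abelian_monoid.l_zero abelian_group.axioms(1) abelian)

lemma stalk_smult_closed:
  assumes "opn U" "p \<in> U" "a \<in> \<O> U" "x \<in> carrier (stalk p)"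
  shows "(U, a) \<odot>\<^bsub>stalk p\<^esub> x \<in> carrier (stalk p)"
  using assms(4) by (rule stalk_carrierE) (use assms in \<open>auto simp: stalk_smult intro!: germ_in_stalk\<close>)

lemma stalk_carrierE':
  assumes "x \<in> carrier (stalk p)" "opn U" "p \<in> U"
  obtains V s where "opn V" "V \<subseteq> U" "p \<in> V" "s \<in> carrier (M V)" "x = g p V s"
proof -
  obtain V s where V: "opn V" "p \<in> V" "s \<in> carrier (M V)" "x = g p V s"
    using assms(1) by (rule stalk_carrierE)
  show thesis
    by (rule that[of "U \<inter> V" "Res F V (U \<inter> V) s"]) (use V assms germ_res[of V "U \<inter> V" p s] in auto)
qed

lemma stalk_smult_axioms:
  assumes U: "opn U" "p \<in> U" and a: "a \<in> \<O> U" and b: "b \<in> \<O> U"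
    and x: "x \<in> carrier (stalk p)" and y: "y \<in> carrier (stalk p)"
  shows stalk_l_distr: "(U, a \<oplus>\<^bsub>R U\<^esub> b) \<odot>\<^bsub>stalk p\<^esub> x = (U, a) \<odot>\<^bsub>stalk p\<^esub> x \<oplus>\<^bsub>stalk p\<^esub> (U, b) \<odot>\<^bsub>stalk p\<^esub> x"
    and stalk_r_distr: "(U, a) \<odot>\<^bsub>stalk p\<^esub> (x \<oplus>\<^bsub>stalk p\<^esub> y) = (U, a) \<odot>\<^bsub>stalk p\<^esub> x \<oplus>\<^bsub>stalk p\<^esub> (U, a) \<odot>\<^bsub>stalk p\<^esub> y"
    and stalk_assoc1: "(U, a \<otimes>\<^bsub>R U\<^esub> b) \<odot>\<^bsub>stalk p\<^esub> x = (U, a) \<odot>\<^bsub>stalk p\<^esub> ((U, b) \<odot>\<^bsub>stalk p\<^esub> x)"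
    and stalk_one: "(U, \<one>\<^bsub>R U\<^esub>) \<odot>\<^bsub>stalk p\<^esub> x = x"
    and stalk_zero_smult: "(U, \<zero>\<^bsub>R U\<^esub>) \<odot>\<^bsub>stalk p\<^esub> x = \<zero>\<^bsub>stalk p\<^esub>"
proof -
  obtain V0 s0 t0 where V0: "opn V0" "p \<in> V0" "s0 \<in> carrier (M V0)" "t0 \<in> carrier (M V0)" "x = g p V0 s0" "y = g p V0 t0"
    using x y by (rule stalk_common2)
  \<comment> \<open>The scalars live on \<open>U\<close>, so the representatives are restricted to
    an open subset of \<open>U\<close>, where \<open>stalk_smult_same\<close> applies.\<close>
  define V s t where "V = U \<inter> V0" and "s = Res F V0 V s0" and "t = Res F V0 V t0"
  have V: "opn V" "V \<subseteq> U" "p \<in> V" "s \<in> carrier (M V)" "t \<in> carrier (M V)" "x = g p V s" "y = g p V t"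
    using V0 U germ_res[of V0 "U \<inter> V0" p s0] germ_res[of V0 "U \<inter> V0" p t0]
    by (auto simp: V_def s_def t_def)
  interpret V: module "R V" "M V" by (rule module) fact
  interpret U: cring "R U" by (rule cring) fact
  have z: "rho U V \<zero>\<^bsub>R U\<^esub> = \<zero>\<^bsub>R V\<^esub>"
    using str_res_hom[OF U(1) V(1,2)] U.ring_axioms V.ring_axioms
    by (intro Ring.ring_hom_zero) auto
  note simps = V(6,7) stalk_smult_same stalk_add str_res_add str_res_mult str_res_one U V(1-5) a b
  show "(U, a \<oplus>\<^bsub>R U\<^esub> b) \<odot>\<^bsub>stalk p\<^esub> x = (U, a) \<odot>\<^bsub>stalk p\<^esub> x \<oplus>\<^bsub>stalk p\<^esub> (U, b) \<odot>\<^bsub>stalk p\<^esub> x"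
    by (simp add: simps V.smult_l_distr)
  show "(U, a) \<odot>\<^bsub>stalk p\<^esub> (x \<oplus>\<^bsub>stalk p\<^esub> y) = (U, a) \<odot>\<^bsub>stalk p\<^esub> x \<oplus>\<^bsub>stalk p\<^esub> (U, a) \<odot>\<^bsub>stalk p\<^esub> y"
    by (simp add: simps V.smult_r_distr)
  show "(U, a \<otimes>\<^bsub>R U\<^esub> b) \<odot>\<^bsub>stalk p\<^esub> x = (U, a) \<odot>\<^bsub>stalk p\<^esub> ((U, b) \<odot>\<^bsub>stalk p\<^esub> x)"
    by (simp add: simps V.smult_assoc1)
  show "(U, \<one>\<^bsub>R U\<^esub>) \<odot>\<^bsub>stalk p\<^esub> x = x"
    by (simp add: simps)
  show "(U, \<zero>\<^bsub>R U\<^esub>) \<odot>\<^bsub>stalk p\<^esub> x = \<zero>\<^bsub>stalk p\<^esub>"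
    by (simp add: simps z stalk_zero[of V])
qed

end

section \<open>The quotient sheaf and the projection onto it\<close>

context submodule_presheaf
begin

abbreviation Q where "Q \<equiv> quot_sheaf S F G"
abbreviation pr where "pr \<equiv> quot_proj S F G"

lemma Q_res [simp]: "Res Q U V \<mu> = restrict \<mu> V"
  by (simp add: quot_sheaf_def)

lemma Q_ops:
  shows Q_add: "\<mu> \<oplus>\<^bsub>Sec Q U\<^esub> \<tau> = (\<lambda>p\<in>U. \<mu> p \<oplus>\<^bsub>stalk p\<^esub> \<tau> p)"
    and Q_mult: "\<mu> \<otimes>\<^bsub>Sec Q U\<^esub> \<tau> = (\<lambda>p\<in>U. \<mu> p \<otimes>\<^bsub>stalk p\<^esub> \<tau> p)"
    and Q_zero: "\<zero>\<^bsub>Sec Q U\<^esub> = (\<lambda>p\<in>U. \<zero>\<^bsub>stalk p\<^esub>)"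
    and Q_one: "\<one>\<^bsub>Sec Q U\<^esub> = (\<lambda>p\<in>U. \<one>\<^bsub>stalk p\<^esub>)"
    and Q_smult: "a \<odot>\<^bsub>Sec Q U\<^esub> \<mu> = (\<lambda>p\<in>U. (U, a) \<odot>\<^bsub>stalk p\<^esub> \<mu> p)"
  by (simp_all add: quot_sheaf_def)

lemma pr_apply: "p \<in> U \<Longrightarrow> pr U s p = g p U s"
  by (simp add: quot_proj_def)

lemma pr_extensional [simp]: "pr U s \<in> extensional U"
  by (simp add: quot_proj_def)

lemma Q_extensional: "\<mu> \<in> carrier (Sec Q U) \<Longrightarrow> \<mu> \<in> extensional U"
  by (simp add: quot_sheaf_def)

lemma pr_closed [simp]: "opn U \<Longrightarrow> s \<in> carrier (M U) \<Longrightarrow> pr U s \<in> carrier (Sec Q U)"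
  by (auto simp: quot_sheaf_def quot_proj_def intro!: exI[of _ U] exI[of _ s])

lemma pr_res:
  "opn U \<Longrightarrow> opn V \<Longrightarrow> V \<subseteq> U \<Longrightarrow> s \<in> carrier (M U) \<Longrightarrow> restrict (pr U s) V = pr V (Res F U V s)"
  by (rule ext) (auto simp: quot_proj_def germ_res subset_eq)

lemma sec_local:
  assumes "\<mu> \<in> carrier (Sec Q U)" "p \<in> U"
  obtains V s where "opn V" "p \<in> V" "V \<subseteq> U" "s \<in> carrier (M V)" "restrict \<mu> V = pr V s"
proof -
  obtain V s where V: "opn V" "p \<in> V" "V \<subseteq> U" "s \<in> carrier (M V)" "\<forall>q\<in>V. \<mu> q = g q V s"
    using assms by (auto simp: quot_sheaf_def)
  show thesis
    by (rule that[OF V(1-4)]) (use V in \<open>auto simp: quot_proj_def fun_eq_iff restrict_def\<close>)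
qed

lemma pr_apply_eq: "restrict \<mu> V = pr V s \<Longrightarrow> q \<in> V \<Longrightarrow> \<mu> q = g q V s"
  by (metis pr_apply restrict_apply')

text \<open>Sections of the quotient sheaf are functions into the stalks subject to a local
  condition, so a function that is locally a section is a section.\<close>

lemma Q_glueI:
  assumes "\<mu> \<in> extensional U"
    and "\<And>p. p \<in> U \<Longrightarrow> \<exists>V. opn V \<and> p \<in> V \<and> V \<subseteq> U \<and> restrict \<mu> V \<in> carrier (Sec Q V)"
  shows "\<mu> \<in> carrier (Sec Q U)"
proof -
  have "\<exists>W s. opn W \<and> p \<in> W \<and> W \<subseteq> U \<and> s \<in> carrier (M W) \<and> (\<forall>q\<in>W. \<mu> q = g q W s)" if p: "p \<in> U" for p
  proof -
    obtain V where V: "opn V" "p \<in> V" "V \<subseteq> U" "restrict \<mu> V \<in> carrier (Sec Q V)"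
      using assms(2)[OF p] by blast
    obtain W s where W: "opn W" "p \<in> W" "W \<subseteq> V" "s \<in> carrier (M W)" "restrict (restrict \<mu> V) W = pr W s"
      using V(4,2) by (rule sec_local)
    have "restrict \<mu> W = pr W s" using W(3,5) by (simp add: Int_absorb1)
    then show ?thesis
      using W V by (intro exI[of _ W] exI[of _ s]) (auto simp: pr_apply_eq)
  qed
  then show ?thesis using assms(1) by (simp add: quot_sheaf_def)
qed

lemma Q_restrict_closed [simp]:
  assumes "opn U" "opn V" "V \<subseteq> U" "\<mu> \<in> carrier (Sec Q U)"
  shows "restrict \<mu> V \<in> carrier (Sec Q V)"
proof (rule Q_glueI)
  fix p assume p: "p \<in> V"
  obtain W s where W: "opn W" "p \<in> W" "W \<subseteq> U" "s \<in> carrier (M W)" "restrict \<mu> W = pr W s"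
    using assms(4) p assms(3) by (meson sec_local subsetD)
  have "restrict (restrict \<mu> V) (V \<inter> W) = restrict (restrict \<mu> W) (V \<inter> W)"
    by (auto simp: restrict_def fun_eq_iff)
  also have "\<dots> = pr (V \<inter> W) (Res F W (V \<inter> W) s)"
    using W assms by (simp add: pr_res)
  finally show "\<exists>W. opn W \<and> p \<in> W \<and> W \<subseteq> V \<and> restrict (restrict \<mu> V) W \<in> carrier (Sec Q W)"
    using W assms p by (intro exI[of _ "V \<inter> W"]) simp
qed simp

lemma sec_stalk: "\<mu> \<in> carrier (Sec Q U) \<Longrightarrow> p \<in> U \<Longrightarrow> \<mu> p \<in> carrier (stalk p)"
  by (erule (1) sec_local) (simp add: pr_apply_eq germ_in_stalk)

lemma sec_local2:
  assumes "opn U" "\<mu> \<in> carrier (Sec Q U)" "\<tau> \<in> carrier (Sec Q U)" "p \<in> U"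
  obtains V s t where "opn V" "p \<in> V" "V \<subseteq> U" "s \<in> carrier (M V)" "t \<in> carrier (M V)"
    "restrict \<mu> V = pr V s" "restrict \<tau> V = pr V t"
proof -
  obtain V s where V: "opn V" "p \<in> V" "V \<subseteq> U" "s \<in> carrier (M V)" "restrict \<mu> V = pr V s"
    using assms(2,4) by (rule sec_local)
  obtain W t where W: "opn W" "p \<in> W" "W \<subseteq> V" "t \<in> carrier (M W)" "restrict (restrict \<tau> V) W = pr W t"
    using Q_restrict_closed[OF assms(1) V(1,3) assms(3)] V(2) by (rule sec_local)
  show thesis
  proof (rule that[of W "Res F V W s" t])
    show "restrict \<mu> W = pr W (Res F V W s)"
      using V W by (simp flip: pr_res V(5)) (simp add: Int_absorb1)
    show "restrict \<tau> W = pr W t"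
      using W(3,5) by (simp add: Int_absorb1)
  qed (use V W in auto)
qed

lemma pr_add:
  "opn U \<Longrightarrow> s \<in> carrier (M U) \<Longrightarrow> t \<in> carrier (M U) \<Longrightarrow> pr U (s \<oplus>\<^bsub>M U\<^esub> t) = pr U s \<oplus>\<^bsub>Sec Q U\<^esub> pr U t"
  by (auto simp: Q_add quot_proj_def stalk_add fun_eq_iff)

lemma pr_smult:
  "opn U \<Longrightarrow> a \<in> \<O> U \<Longrightarrow> s \<in> carrier (M U) \<Longrightarrow> pr U (a \<odot>\<^bsub>M U\<^esub> s) = a \<odot>\<^bsub>Sec Q U\<^esub> pr U s"
  by (auto simp: Q_smult quot_proj_def stalk_smult_same str_res_id fun_eq_iff)

lemma pr_zero: "opn U \<Longrightarrow> pr U \<zero>\<^bsub>M U\<^esub> = \<zero>\<^bsub>Sec Q U\<^esub>"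
  by (auto simp: Q_zero quot_proj_def stalk_zero fun_eq_iff)

lemma Q_add_closed:
  assumes "opn U" "\<mu> \<in> carrier (Sec Q U)" "\<tau> \<in> carrier (Sec Q U)"
  shows "\<mu> \<oplus>\<^bsub>Sec Q U\<^esub> \<tau> \<in> carrier (Sec Q U)"
proof (rule Q_glueI)
  fix p assume p: "p \<in> U"
  obtain V s t where V: "opn V" "p \<in> V" "V \<subseteq> U" "s \<in> carrier (M V)" "t \<in> carrier (M V)"
    "restrict \<mu> V = pr V s" "restrict \<tau> V = pr V t"
    using assms p by (rule sec_local2)
  have "restrict (\<mu> \<oplus>\<^bsub>Sec Q U\<^esub> \<tau>) V = restrict \<mu> V \<oplus>\<^bsub>Sec Q V\<^esub> restrict \<tau> V"
    using V(3) by (auto simp: Q_add restrict_def fun_eq_iff)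
  also have "\<dots> = pr V (s \<oplus>\<^bsub>M V\<^esub> t)"
    using V by (simp add: pr_add)
  finally show "\<exists>V. opn V \<and> p \<in> V \<and> V \<subseteq> U \<and> restrict (\<mu> \<oplus>\<^bsub>Sec Q U\<^esub> \<tau>) V \<in> carrier (Sec Q V)"
    using V by (intro exI[of _ V]) simp
qed (simp add: Q_add)

text \<open>A scalar on a stalk is a pair \<open>(U, a)\<close>, so restriction replaces it by a
  different pair, \<open>(V, rho U V a)\<close>; both act in the same way because they restrict to
  the same section near the point.\<close>

lemma restrict_smult:
  assumes "opn U" "opn V" "V \<subseteq> U" "a \<in> \<O> U" "\<mu> \<in> carrier (Sec Q U)"
  shows "restrict (a \<odot>\<^bsub>Sec Q U\<^esub> \<mu>) V = rho U V a \<odot>\<^bsub>Sec Q V\<^esub> restrict \<mu> V"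
proof (rule ext)
  fix p
  show "restrict (a \<odot>\<^bsub>Sec Q U\<^esub> \<mu>) V p = (rho U V a \<odot>\<^bsub>Sec Q V\<^esub> restrict \<mu> V) p"
  proof (cases "p \<in> V")
    case True
    then have p: "p \<in> U" using assms by auto
    obtain W s where W: "opn W" "W \<subseteq> V" "p \<in> W" "s \<in> carrier (M W)" "\<mu> p = g p W s"
      using sec_stalk[OF assms(5) p] assms(2) True by (rule stalk_carrierE')
    then have "(U, a) \<odot>\<^bsub>stalk p\<^esub> \<mu> p = (V, rho U V a) \<odot>\<^bsub>stalk p\<^esub> \<mu> p"
      using assms by (simp add: stalk_smult_same str_res_res subset_trans[OF W(2)])
    then show ?thesis using True p by (simp add: Q_smult)
  qed (simp add: Q_smult)
qed

lemma Q_smult_closed: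
  assumes "opn U" "a \<in> \<O> U" "\<mu> \<in> carrier (Sec Q U)"
  shows "a \<odot>\<^bsub>Sec Q U\<^esub> \<mu> \<in> carrier (Sec Q U)"
proof (rule Q_glueI)
  fix p assume p: "p \<in> U"
  obtain V s where V: "opn V" "p \<in> V" "V \<subseteq> U" "s \<in> carrier (M V)" "restrict \<mu> V = pr V s"
    using assms(3) p by (rule sec_local)
  have "restrict (a \<odot>\<^bsub>Sec Q U\<^esub> \<mu>) V = pr V (rho U V a \<odot>\<^bsub>M V\<^esub> s)"
    using V assms by (simp add: pr_smult restrict_smult)
  then show "\<exists>V. opn V \<and> p \<in> V \<and> V \<subseteq> U \<and> restrict (a \<odot>\<^bsub>Sec Q U\<^esub> \<mu>) V \<in> carrier (Sec Q V)"
    using V assms by (intro exI[of _ V]) simp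
qed (simp add: Q_smult)

lemma Q_eqI:
  assumes "\<mu> \<in> extensional U" "\<tau> \<in> extensional U"
    and "\<And>p. p \<in> U \<Longrightarrow> \<mu> p = \<tau> p"
  shows "\<mu> = \<tau>"
  using assms by (rule extensionalityI)

lemma Q_eq_localI:
  assumes "\<mu> \<in> extensional U" "\<tau> \<in> extensional U"
    and "\<And>p. p \<in> U \<Longrightarrow> \<exists>V. p \<in> V \<and> restrict \<mu> V = restrict \<tau> V"
  shows "\<mu> = \<tau>"
  using assms(1,2)
proof (rule extensionalityI)
  fix p assume "p \<in> U"
  then show "\<mu> p = \<tau> p" using assms(3)[of p] by (metis restrict_apply')
qed

text \<open>The operations are defined point by point, so the module laws are inherited from the
  stalks; only closure needs local sections.\<close>

lemma Q_module: "module_presheaf S Q"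
proof (intro module_presheaf.intro module_presheaf_axioms.intro ring_presheaf_axioms)
  fix U assume U: "opn U"
  show "module (R U) (Sec Q U)"
  proof (rule module_from_smult)
    show "cring (R U)" by (rule cring[OF U])
    show "\<zero>\<^bsub>Sec Q U\<^esub> \<in> carrier (Sec Q U)"
      using U by (simp flip: pr_zero)
    fix x y z assume x: "x \<in> carrier (Sec Q U)" and y: "y \<in> carrier (Sec Q U)" and z: "z \<in> carrier (Sec Q U)"
    show "x \<oplus>\<^bsub>Sec Q U\<^esub> y \<in> carrier (Sec Q U)" using U x y by (rule Q_add_closed)
    show "x \<oplus>\<^bsub>Sec Q U\<^esub> y \<oplus>\<^bsub>Sec Q U\<^esub> z = x \<oplus>\<^bsub>Sec Q U\<^esub> (y \<oplus>\<^bsub>Sec Q U\<^esub> z)"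
      by (rule Q_eqI[of _ U]) (use x y z in \<open>auto simp: Q_add stalk_assoc sec_stalk\<close>)
    show "x \<oplus>\<^bsub>Sec Q U\<^esub> y = y \<oplus>\<^bsub>Sec Q U\<^esub> x"
      by (rule Q_eqI[of _ U]) (use x y in \<open>auto simp: Q_add intro!: stalk_comm sec_stalk\<close>)
    show "\<zero>\<^bsub>Sec Q U\<^esub> \<oplus>\<^bsub>Sec Q U\<^esub> x = x"
      by (rule Q_eqI[of _ U]) (use x in \<open>auto simp: Q_add Q_zero stalk_zero_add sec_stalk Q_extensional\<close>)
    have z: "\<zero>\<^bsub>R U\<^esub> \<in> \<O> U" using cring[OF U] by (simp add: cring.cring_simprules)
    note ax1 = stalk_smult_axioms[OF U _ z z sec_stalk[OF x] sec_stalk[OF x]]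
    show "\<one>\<^bsub>R U\<^esub> \<odot>\<^bsub>Sec Q U\<^esub> x = x"
      by (rule Q_eqI[of _ U]) (use U x in \<open>auto simp: Q_smult ax1 Q_extensional\<close>)
    show "\<zero>\<^bsub>R U\<^esub> \<odot>\<^bsub>Sec Q U\<^esub> x = \<zero>\<^bsub>Sec Q U\<^esub>"
      by (rule Q_eqI[of _ U]) (use U x in \<open>auto simp: Q_smult Q_zero ax1\<close>)
    fix a b assume a: "a \<in> \<O> U" and b: "b \<in> \<O> U"
    note ax = stalk_smult_axioms[OF U _ a b sec_stalk[OF x] sec_stalk[OF y]]
    show "a \<odot>\<^bsub>Sec Q U\<^esub> x \<in> carrier (Sec Q U)" using U a x by (rule Q_smult_closed)
    show "(a \<oplus>\<^bsub>R U\<^esub> b) \<odot>\<^bsub>Sec Q U\<^esub> x = a \<odot>\<^bsub>Sec Q U\<^esub> x \<oplus>\<^bsub>Sec Q U\<^esub> b \<odot>\<^bsub>Sec Q U\<^esub> x"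
      by (rule Q_eqI[of _ U]) (use U x a b in \<open>auto simp: Q_add Q_smult ax\<close>)
    show "a \<odot>\<^bsub>Sec Q U\<^esub> (x \<oplus>\<^bsub>Sec Q U\<^esub> y) = a \<odot>\<^bsub>Sec Q U\<^esub> x \<oplus>\<^bsub>Sec Q U\<^esub> a \<odot>\<^bsub>Sec Q U\<^esub> y"
      by (rule Q_eqI[of _ U]) (use U x y a in \<open>auto simp: Q_add Q_smult ax\<close>)
    show "(a \<otimes>\<^bsub>R U\<^esub> b) \<odot>\<^bsub>Sec Q U\<^esub> x = a \<odot>\<^bsub>Sec Q U\<^esub> (b \<odot>\<^bsub>Sec Q U\<^esub> x)"
      by (rule Q_eqI[of _ U]) (use U x a b in \<open>auto simp: Q_smult ax\<close>)
  qed
next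
  fix U V x assume "opn U" "opn V" "V \<subseteq> U" "x \<in> carrier (Sec Q U)"
  then show "Res Q U V x \<in> carrier (Sec Q V)" by simp
next
  fix U V :: "'p set" and x y assume "V \<subseteq> U"
  then show "Res Q U V (x \<oplus>\<^bsub>Sec Q U\<^esub> y) = Res Q U V x \<oplus>\<^bsub>Sec Q V\<^esub> Res Q U V y"
    by (auto simp: Q_add restrict_def fun_eq_iff)
next
  fix U V a x assume "opn U" "opn V" "V \<subseteq> U" "a \<in> \<O> U" "x \<in> carrier (Sec Q U)"
  then show "Res Q U V (a \<odot>\<^bsub>Sec Q U\<^esub> x) = rho U V a \<odot>\<^bsub>Sec Q V\<^esub> Res Q U V x"
    by (simp add: restrict_smult)
next
  fix U :: "'p set" and x assume "x \<in> carrier (Sec Q U)"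
  then show "Res Q U U x = x" by (simp add: Q_extensional extensional_restrict)
next
  fix U V W :: "'p set" and x assume "W \<subseteq> V"
  then show "Res Q V W (Res Q U V x) = Res Q U W x" by (simp add: Int_absorb1)
qed

lemma pr_zero_iff:
  assumes "opn U" "s \<in> carrier (M U)"
  shows "pr U s = \<zero>\<^bsub>Sec Q U\<^esub> \<longleftrightarrow> (\<forall>p\<in>U. \<exists>W. opn W \<and> p \<in> W \<and> W \<subseteq> U \<and> Res F U W s \<in> G W)"
proof -
  have "pr U s = \<zero>\<^bsub>Sec Q U\<^esub> \<longleftrightarrow> (\<forall>p\<in>U. g p U s = \<zero>\<^bsub>stalk p\<^esub>)"
    by (auto simp: Q_zero quot_proj_def fun_eq_iff restrict_def)
  then show ?thesis using assms by (simp add: germ_zero_iff)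
qed

lemma pr_minus:
  assumes "opn U" "s \<in> carrier (M U)" "t \<in> carrier (M U)"
  shows "pr U (s \<ominus>\<^bsub>M U\<^esub> t) = pr U s \<ominus>\<^bsub>Sec Q U\<^esub> pr U t"
proof -
  interpret QM: module_presheaf S Q by (rule Q_module)
  interpret cring "R U" by (rule cring) fact
  have "pr U (\<ominus>\<^bsub>M U\<^esub> t) = \<ominus>\<^bsub>Sec Q U\<^esub> pr U t"
    using assms by (simp flip: smult_minus_one QM.smult_minus_one add: pr_smult)
  then show ?thesis using assms by (simp add: a_minus_def pr_add)
qed

lemma pr_eq_iff:
  assumes "opn U" "s \<in> carrier (M U)" "t \<in> carrier (M U)"
  shows "pr U s = pr U t \<longleftrightarrow> (\<forall>p\<in>U. \<exists>W. opn W \<and> p \<in> W \<and> W \<subseteq> U \<and> Res F U W s \<ominus>\<^bsub>M W\<^esub> Res F U W t \<in> G W)"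
proof -
  interpret QM: module_presheaf S Q by (rule Q_module)
  interpret QA: abelian_group "Sec Q U" by (rule QM.abelian) fact
  have "pr U s = pr U t \<longleftrightarrow> pr U (s \<ominus>\<^bsub>M U\<^esub> t) = \<zero>\<^bsub>Sec Q U\<^esub>"
    using assms by (simp add: pr_minus QA.minus_eq_zero_iff)
  also have "\<dots> \<longleftrightarrow> (\<forall>p\<in>U. \<exists>W. opn W \<and> p \<in> W \<and> W \<subseteq> U \<and> Res F U W s \<ominus>\<^bsub>M W\<^esub> Res F U W t \<in> G W)"
    using assms by (simp add: pr_zero_iff res_minus cong: conj_cong)
  finally show ?thesis .
qed

end

section \<open>Morphisms and their factorization through quotients\<close>

lemma morphism_onI:
  assumes "\<And>V x. openin (Top S) V \<Longrightarrow> V \<subseteq> U \<Longrightarrow> x \<in> carrier (Sec F V) \<Longrightarrow> \<phi> V x \<in> carrier (Sec G V)"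
    and "\<And>V x y. openin (Top S) V \<Longrightarrow> V \<subseteq> U \<Longrightarrow> x \<in> carrier (Sec F V) \<Longrightarrow> y \<in> carrier (Sec F V) \<Longrightarrow>
      \<phi> V (x \<oplus>\<^bsub>Sec F V\<^esub> y) = \<phi> V x \<oplus>\<^bsub>Sec G V\<^esub> \<phi> V y"
    and "\<And>V a x. openin (Top S) V \<Longrightarrow> V \<subseteq> U \<Longrightarrow> a \<in> carrier (Sec (Str S) V) \<Longrightarrow> x \<in> carrier (Sec F V) \<Longrightarrow>
      \<phi> V (a \<odot>\<^bsub>Sec F V\<^esub> x) = a \<odot>\<^bsub>Sec G V\<^esub> \<phi> V x"
    and "\<And>V W x. openin (Top S) V \<Longrightarrow> openin (Top S) W \<Longrightarrow> W \<subseteq> V \<Longrightarrow> V \<subseteq> U \<Longrightarrow> x \<in> carrier (Sec F V) \<Longrightarrow>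
      \<phi> W (Res F V W x) = Res G V W (\<phi> V x)"
  shows "morphism_on S U F G \<phi>"
  using assms by (auto simp: morphism_on_def linear_maps_def hom_def)

lemma morD:
  assumes "morphism_on S U F G \<phi>"
  shows "openin (Top S) V \<Longrightarrow> V \<subseteq> U \<Longrightarrow> x \<in> carrier (Sec F V) \<Longrightarrow> \<phi> V x \<in> carrier (Sec G V)"
    and "openin (Top S) V \<Longrightarrow> V \<subseteq> U \<Longrightarrow> x \<in> carrier (Sec F V) \<Longrightarrow> y \<in> carrier (Sec F V) \<Longrightarrow>
      \<phi> V (x \<oplus>\<^bsub>Sec F V\<^esub> y) = \<phi> V x \<oplus>\<^bsub>Sec G V\<^esub> \<phi> V y"
    and "openin (Top S) V \<Longrightarrow> V \<subseteq> U \<Longrightarrow> a \<in> carrier (Sec (Str S) V) \<Longrightarrow> x \<in> carrier (Sec F V) \<Longrightarrow>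
      \<phi> V (a \<odot>\<^bsub>Sec F V\<^esub> x) = a \<odot>\<^bsub>Sec G V\<^esub> \<phi> V x"
    and "openin (Top S) V \<Longrightarrow> openin (Top S) W \<Longrightarrow> W \<subseteq> V \<Longrightarrow> V \<subseteq> U \<Longrightarrow> x \<in> carrier (Sec F V) \<Longrightarrow>
      \<phi> W (Res F V W x) = Res G V W (\<phi> V x)"
  using assms by (auto simp: morphism_on_def linear_maps_def hom_def Pi_def)

lemma morphism_on_subset: "morphism_on S U F G \<phi> \<Longrightarrow> V \<subseteq> U \<Longrightarrow> morphism_on S V F G \<phi>"
  by (auto simp: morphism_on_def)

context submodule_presheaf
begin

text \<open>The tool for descending maps to quotients. Local preimages under \<open>\<pi>\<close>
  exist, any two of them have equal images under \<open>h\<close> on the overlap, and the target is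
  a sheaf, so the values glue. Of \<open>B\<close> only closure under its operations is asked,
  because one application takes for it the presheaf of compatible pairs, whose zero is
  undefined.\<close>

lemma factor_through_local_surjection:
  assumes A: "module_presheaf S A" and U: "opn U"
    and cl: "\<And>V x y. opn V \<Longrightarrow> V \<subseteq> U \<Longrightarrow> x \<in> carrier (Sec B V) \<Longrightarrow> y \<in> carrier (Sec B V) \<Longrightarrow>
      x \<oplus>\<^bsub>Sec B V\<^esub> y \<in> carrier (Sec B V)"
      "\<And>V a x. opn V \<Longrightarrow> V \<subseteq> U \<Longrightarrow> a \<in> \<O> V \<Longrightarrow> x \<in> carrier (Sec B V) \<Longrightarrow>
      a \<odot>\<^bsub>Sec B V\<^esub> x \<in> carrier (Sec B V)"
      "\<And>V W x. opn V \<Longrightarrow> opn W \<Longrightarrow> W \<subseteq> V \<Longrightarrow> V \<subseteq> U \<Longrightarrow> x \<in> carrier (Sec B V) \<Longrightarrow>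
      Res B V W x \<in> carrier (Sec B W)"
    and \<pi>: "morphism_on S U B A \<pi>" and h: "morphism_on S U B Q h"
    and surj: "\<And>V x p. opn V \<Longrightarrow> V \<subseteq> U \<Longrightarrow> x \<in> carrier (Sec A V) \<Longrightarrow> p \<in> V \<Longrightarrow>
      \<exists>W y. opn W \<and> p \<in> W \<and> W \<subseteq> V \<and> y \<in> carrier (Sec B W) \<and> \<pi> W y = Res A V W x"
    and ker: "\<And>V y y'. opn V \<Longrightarrow> V \<subseteq> U \<Longrightarrow> y \<in> carrier (Sec B V) \<Longrightarrow> y' \<in> carrier (Sec B V) \<Longrightarrow>
      \<pi> V y = \<pi> V y' \<Longrightarrow> h V y = h V y'"
  obtains k where "morphism_on S U A Q k"
    "\<And>V y. opn V \<Longrightarrow> V \<subseteq> U \<Longrightarrow> y \<in> carrier (Sec B V) \<Longrightarrow> k V (\<pi> V y) = h V y"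
proof -
  interpret A: module_presheaf S A by (rule A)
  interpret QM: module_presheaf S Q by (rule Q_module)
  \<comment> \<open>Sections of the target are functions of points, so \<open>k V x\<close> can be
    defined point by point from an arbitrarily chosen local preimage; \<open>indep\<close> removes
    the dependence on the choice.\<close>
  define k where "k V x = (\<lambda>p\<in>V. SOME c. \<exists>W y. opn W \<and> p \<in> W \<and> W \<subseteq> V \<and> y \<in> carrier (Sec B W) \<and>
    \<pi> W y = Res A V W x \<and> c = h W y p)" for V x
  have k_ext: "k V x \<in> extensional V" for V x by (simp add: k_def)
  have indep: "h W y p = h W' y' p"
    if V: "opn V" "V \<subseteq> U" "x \<in> carrier (Sec A V)"
      and W: "opn W" "p \<in> W" "W \<subseteq> V" "y \<in> carrier (Sec B W)" "\<pi> W y = Res A V W x"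
      and W': "opn W'" "p \<in> W'" "W' \<subseteq> V" "y' \<in> carrier (Sec B W')" "\<pi> W' y' = Res A V W' x"
    for V x W W' y y' p
  proof -
    define P where "P = W \<inter> W'"
    have P: "opn P" "p \<in> P" "P \<subseteq> W" "P \<subseteq> W'" "P \<subseteq> V" "P \<subseteq> U" "W \<subseteq> U" "W' \<subseteq> U"
      using W W' V by (auto simp: P_def)
    have "\<pi> P (Res B W P y) = Res A V P x" "\<pi> P (Res B W' P y') = Res A V P x"
      using V W W' P by (simp_all add: morD(4)[OF \<pi>] A.res_res)
    then have "h P (Res B W P y) = h P (Res B W' P y')"
      using P W W' cl by (intro ker) auto
    then have "restrict (h W y) P = restrict (h W' y') P"
      using V W W' P by (simp add: morD(4)[OF h])
    then show ?thesis using P(2) by (metis restrict_apply')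
  qed
  have k_eq: "k V x p = h W y p"
    if V: "opn V" "V \<subseteq> U" "x \<in> carrier (Sec A V)"
      and W: "opn W" "p \<in> W" "W \<subseteq> V" "y \<in> carrier (Sec B W)" "\<pi> W y = Res A V W x"
    for V x W y p
  proof -
    have "(SOME c. \<exists>W y. opn W \<and> p \<in> W \<and> W \<subseteq> V \<and> y \<in> carrier (Sec B W) \<and> \<pi> W y = Res A V W x \<and> c = h W y p) = h W y p"
      by (rule some_equality) (use W indep[OF V] in blast)+
    then show ?thesis using W by (auto simp: k_def)
  qed
  have k_restrict: "restrict (k V x) W = h W y"
    if "opn V" "V \<subseteq> U" "x \<in> carrier (Sec A V)" "opn W" "W \<subseteq> V" "y \<in> carrier (Sec B W)" "\<pi> W y = Res A V W x"
    for V x W y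
  proof (rule extensionalityI[of _ W])
    have "W \<subseteq> U" using that by auto
    then show "h W y \<in> extensional W"
      using that morD(1)[OF h, of W y] by (simp add: Q_extensional)
    show "restrict (k V x) W p = h W y p" if "p \<in> W" for p
      using k_eq[of V x W p y] that \<open>opn V\<close> \<open>V \<subseteq> U\<close> \<open>x \<in> carrier (Sec A V)\<close> \<open>opn W\<close> \<open>W \<subseteq> V\<close>
        \<open>y \<in> carrier (Sec B W)\<close> \<open>\<pi> W y = Res A V W x\<close> by simp
  qed simp
  have k_closed: "k V x \<in> carrier (Sec Q V)" if V: "opn V" "V \<subseteq> U" "x \<in> carrier (Sec A V)" for V x
  proof (rule Q_glueI[OF k_ext])
    fix p assume p: "p \<in> V"
    obtain W y where W: "opn W" "p \<in> W" "W \<subseteq> V" "y \<in> carrier (Sec B W)" "\<pi> W y = Res A V W x"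
      using surj[OF V p] by blast
    then show "\<exists>W. opn W \<and> p \<in> W \<and> W \<subseteq> V \<and> restrict (k V x) W \<in> carrier (Sec Q W)"
      using k_restrict[OF V W(1,3-5)] V by (intro exI[of _ W]) (auto intro: morD(1)[OF h])
  qed
  have surj2: "\<exists>W y z. opn W \<and> p \<in> W \<and> W \<subseteq> V \<and> y \<in> carrier (Sec B W) \<and> \<pi> W y = Res A V W x \<and>
      z \<in> carrier (Sec B W) \<and> \<pi> W z = Res A V W x'"
    if V: "opn V" "V \<subseteq> U" "x \<in> carrier (Sec A V)" "x' \<in> carrier (Sec A V)" "p \<in> V" for V x x' p
  proof -
    obtain W y where W: "opn W" "p \<in> W" "W \<subseteq> V" "y \<in> carrier (Sec B W)" "\<pi> W y = Res A V W x"
      using surj[OF V(1-3,5)] by blast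
    obtain W' z where W': "opn W'" "p \<in> W'" "W' \<subseteq> V" "z \<in> carrier (Sec B W')" "\<pi> W' z = Res A V W' x'"
      using surj[OF V(1,2,4,5)] by blast
    define P where "P = W \<inter> W'"
    have P: "opn P" "p \<in> P" "P \<subseteq> W" "P \<subseteq> W'" "P \<subseteq> V" "P \<subseteq> U" "W \<subseteq> U" "W' \<subseteq> U"
      using W W' V by (auto simp: P_def)
    show ?thesis
      by (intro exI[of _ P] exI[of _ "Res B W P y"] exI[of _ "Res B W' P z"])
        (use P V W W' cl in \<open>simp add: morD(4)[OF \<pi>] A.res_res\<close>)
  qed
  have k_morphism: "morphism_on S U A Q k"
  proof (rule morphism_onI)
    fix V x y assume V: "opn V" "V \<subseteq> U" "x \<in> carrier (Sec A V)" "y \<in> carrier (Sec A V)"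
    show "k V (x \<oplus>\<^bsub>Sec A V\<^esub> y) = k V x \<oplus>\<^bsub>Sec Q V\<^esub> k V y"
    proof (rule Q_eq_localI[OF k_ext])
      show "k V x \<oplus>\<^bsub>Sec Q V\<^esub> k V y \<in> extensional V" by (simp add: Q_add)
      fix p assume p: "p \<in> V"
      obtain W x' y' where W: "opn W" "p \<in> W" "W \<subseteq> V" "x' \<in> carrier (Sec B W)" "\<pi> W x' = Res A V W x"
        "y' \<in> carrier (Sec B W)" "\<pi> W y' = Res A V W y"
        using surj2[OF V p] by blast
      have "W \<subseteq> U" using W V by auto
      then have "restrict (k V (x \<oplus>\<^bsub>Sec A V\<^esub> y)) W = h W (x' \<oplus>\<^bsub>Sec B W\<^esub> y')"
        using V W by (intro k_restrict) (simp_all add: cl morD(2)[OF \<pi>] A.res_add)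
      also have "\<dots> = restrict (k V x) W \<oplus>\<^bsub>Sec Q W\<^esub> restrict (k V y) W"
        using V W \<open>W \<subseteq> U\<close> k_restrict[OF V(1-3) W(1,3-5)] k_restrict[OF V(1,2,4) W(1,3,6,7)]
        by (simp add: morD(2)[OF h])
      also have "\<dots> = restrict (k V x \<oplus>\<^bsub>Sec Q V\<^esub> k V y) W"
        using V W QM.res_add[of V W "k V x" "k V y"] k_closed by simp
      finally show "\<exists>W. p \<in> W \<and> restrict (k V (x \<oplus>\<^bsub>Sec A V\<^esub> y)) W = restrict (k V x \<oplus>\<^bsub>Sec Q V\<^esub> k V y) W"
        using W(2) by blast
    qed
  next
    fix V a x assume V: "opn V" "V \<subseteq> U" and a: "a \<in> \<O> V" and x: "x \<in> carrier (Sec A V)"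
    show "k V (a \<odot>\<^bsub>Sec A V\<^esub> x) = a \<odot>\<^bsub>Sec Q V\<^esub> k V x"
    proof (rule Q_eq_localI[OF k_ext])
      show "a \<odot>\<^bsub>Sec Q V\<^esub> k V x \<in> extensional V" by (simp add: Q_smult)
      fix p assume p: "p \<in> V"
      obtain W y where W: "opn W" "p \<in> W" "W \<subseteq> V" "y \<in> carrier (Sec B W)" "\<pi> W y = Res A V W x"
        using surj[OF V x p] by blast
      have "W \<subseteq> U" using W V by auto
      then have "restrict (k V (a \<odot>\<^bsub>Sec A V\<^esub> x)) W = h W (rho V W a \<odot>\<^bsub>Sec B W\<^esub> y)"
        using V W x a by (intro k_restrict) (simp_all add: cl morD(3)[OF \<pi>] A.res_smult)
      also have "\<dots> = restrict (a \<odot>\<^bsub>Sec Q V\<^esub> k V x) W"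
        using V W x a \<open>W \<subseteq> U\<close> k_restrict[OF V x W(1,3-5)] k_closed
        by (simp add: morD(3)[OF h] restrict_smult)
      finally show "\<exists>W. p \<in> W \<and> restrict (k V (a \<odot>\<^bsub>Sec A V\<^esub> x)) W = restrict (a \<odot>\<^bsub>Sec Q V\<^esub> k V x) W"
        using W(2) by blast
    qed
  next
    fix V W x assume V: "opn V" "opn W" "W \<subseteq> V" "V \<subseteq> U" "x \<in> carrier (Sec A V)"
    show "k W (Res A V W x) = Res Q V W (k V x)"
      unfolding Q_res
    proof (rule Q_eqI[OF k_ext restrict_extensional])
      fix p assume p: "p \<in> W"
      have "W \<subseteq> U" "Res A V W x \<in> carrier (Sec A W)" using V by auto
      then obtain W' y where W': "opn W'" "p \<in> W'" "W' \<subseteq> W" "y \<in> carrier (Sec B W')" "\<pi> W' y = Res A W W' (Res A V W x)"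
        using surj[of W "Res A V W x" p] V p by blast
      then have "k W (Res A V W x) p = h W' y p"
        using V \<open>W \<subseteq> U\<close> by (intro k_eq) auto
      also have "\<dots> = k V x p"
        using V W' \<open>W \<subseteq> U\<close> by (intro k_eq[symmetric]) (auto simp: A.res_res)
      finally show "k W (Res A V W x) p = restrict (k V x) W p" using p by simp
    qed
  qed (rule k_closed)
  show thesis
  proof (rule that[OF k_morphism])
    fix V y assume V: "opn V" "V \<subseteq> U" "y \<in> carrier (Sec B V)"
    then have \<pi>y: "\<pi> V y \<in> carrier (Sec A V)" using morD(1)[OF \<pi>] by blast
    then have "restrict (k V (\<pi> V y)) V = h V y"
      using V by (intro k_restrict) (simp_all add: A.res_id)
    then show "k V (\<pi> V y) = h V y" using k_ext by (simp add: extensional_restrict)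
  qed
qed

end

section \<open>The sheaf Hom\<close>

lemma hom_restrict_apply [simp]:
  "openin (Top S) V \<Longrightarrow> V \<subseteq> U \<Longrightarrow> x \<in> carrier (Sec F V) \<Longrightarrow> hom_restrict S F U \<phi> V x = \<phi> V x"
  by (simp add: hom_restrict_def)

lemma hom_restrict_cong:
  assumes "\<And>V x. openin (Top S) V \<Longrightarrow> V \<subseteq> U \<Longrightarrow> x \<in> carrier (Sec F V) \<Longrightarrow> \<phi> V x = \<psi> V x"
  shows "hom_restrict S F U \<phi> = hom_restrict S F U \<psi>"
  using assms by (auto simp: hom_restrict_def fun_eq_iff)

lemma hom_restrict_restrict:
  "V \<subseteq> U \<Longrightarrow> hom_restrict S F V (hom_restrict S F U \<phi>) = hom_restrict S F V \<phi>"
  by (auto simp: hom_restrict_def fun_eq_iff)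

lemma sheaf_hom_carrier:
  "\<phi> \<in> carrier (Sec (sheaf_hom S F G) U) \<longleftrightarrow> morphism_on S U F G \<phi> \<and> hom_restrict S F U \<phi> = \<phi>"
  by (simp add: sheaf_hom_def)

lemma sheaf_hom_eqI:
  assumes "\<phi> \<in> carrier (Sec (sheaf_hom S F G) U)" "\<psi> \<in> carrier (Sec (sheaf_hom S F G) U)"
    and "\<And>V x. openin (Top S) V \<Longrightarrow> V \<subseteq> U \<Longrightarrow> x \<in> carrier (Sec F V) \<Longrightarrow> \<phi> V x = \<psi> V x"
  shows "\<phi> = \<psi>"
  using assms hom_restrict_cong[of S U F \<phi> \<psi>] by (simp add: sheaf_hom_carrier)

lemma sheaf_hom_ops:
  assumes "openin (Top S) V" "V \<subseteq> U" "x \<in> carrier (Sec F V)"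
  shows "(\<phi> \<oplus>\<^bsub>Sec (sheaf_hom S F G) U\<^esub> \<psi>) V x = \<phi> V x \<oplus>\<^bsub>Sec G V\<^esub> \<psi> V x"
    and "(a \<odot>\<^bsub>Sec (sheaf_hom S F G) U\<^esub> \<phi>) V x = Res (Str S) U V a \<odot>\<^bsub>Sec G V\<^esub> \<phi> V x"
    and "\<zero>\<^bsub>Sec (sheaf_hom S F G) U\<^esub> V x = \<zero>\<^bsub>Sec G V\<^esub>"
    and "Res (sheaf_hom S F G) U' U \<phi> V x = \<phi> V x"
  using assms by (simp_all add: sheaf_hom_def)

lemma (in ring_presheaf) hom_restrict_morphism:
  assumes "module_presheaf S F" "morphism_on S U F G \<phi>"
  shows "hom_restrict S F U \<phi> \<in> carrier (Sec (sheaf_hom S F G) U)"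
proof -
  interpret F: module_presheaf S F by fact
  have "morphism_on S U F G (hom_restrict S F U \<phi>)"
    using morD[OF assms(2)] by (intro morphism_onI) (auto simp: subset_trans[where C=U])
  then show ?thesis by (simp add: sheaf_hom_carrier hom_restrict_restrict)
qed

lemma (in ring_presheaf) sheaf_hom_module:
  assumes "module_presheaf S F" "module_presheaf S G"
  shows "module_presheaf S (sheaf_hom S F G)"
proof -
  interpret F: module_presheaf S F by fact
  interpret G: module_presheaf S G by fact
  let ?H = "sheaf_hom S F G"
  have add: "\<phi> \<oplus>\<^bsub>Sec ?H U\<^esub> \<psi> \<in> carrier (Sec ?H U)"
    if "opn U" "\<phi> \<in> carrier (Sec ?H U)" "\<psi> \<in> carrier (Sec ?H U)" for U \<phi> \<psi>
  proof -
    have \<phi>: "morphism_on S U F G \<phi>" and \<psi>: "morphism_on S U F G \<psi>"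
      using that by (auto simp: sheaf_hom_carrier)
    have "morphism_on S U F G (\<lambda>V x. \<phi> V x \<oplus>\<^bsub>Sec G V\<^esub> \<psi> V x)"
    proof (rule morphism_onI)
      fix V x y assume V: "opn V" "V \<subseteq> U" "x \<in> carrier (Sec F V)" "y \<in> carrier (Sec F V)"
      interpret module "R V" "G.M V" by (rule G.module) fact
      have "\<phi> V x \<in> carrier (G.M V)" "\<psi> V x \<in> carrier (G.M V)" "\<phi> V y \<in> carrier (G.M V)" "\<psi> V y \<in> carrier (G.M V)"
        using V morD(1)[OF \<phi>] morD(1)[OF \<psi>] by blast+
      then show "\<phi> V (x \<oplus>\<^bsub>Sec F V\<^esub> y) \<oplus>\<^bsub>Sec G V\<^esub> \<psi> V (x \<oplus>\<^bsub>Sec F V\<^esub> y) =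
          \<phi> V x \<oplus>\<^bsub>Sec G V\<^esub> \<psi> V x \<oplus>\<^bsub>Sec G V\<^esub> (\<phi> V y \<oplus>\<^bsub>Sec G V\<^esub> \<psi> V y)"
        using V by (simp add: morD(2)[OF \<phi>] morD(2)[OF \<psi>] M.add.m_ac)
    next
      fix V a x assume V: "opn V" "V \<subseteq> U" "a \<in> \<O> V" "x \<in> carrier (Sec F V)"
      interpret module "R V" "G.M V" by (rule G.module) fact
      have "\<phi> V x \<in> carrier (G.M V)" "\<psi> V x \<in> carrier (G.M V)"
        using V morD(1)[OF \<phi>] morD(1)[OF \<psi>] by blast+
      then show "\<phi> V (a \<odot>\<^bsub>Sec F V\<^esub> x) \<oplus>\<^bsub>Sec G V\<^esub> \<psi> V (a \<odot>\<^bsub>Sec F V\<^esub> x) =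
          a \<odot>\<^bsub>Sec G V\<^esub> (\<phi> V x \<oplus>\<^bsub>Sec G V\<^esub> \<psi> V x)"
        using V by (simp add: morD(3)[OF \<phi>] morD(3)[OF \<psi>] smult_r_distr)
    next
      fix V W x assume V: "opn V" "opn W" "W \<subseteq> V" "V \<subseteq> U" "x \<in> carrier (Sec F V)"
      have "\<phi> V x \<in> carrier (G.M V)" "\<psi> V x \<in> carrier (G.M V)"
        using V morD(1)[OF \<phi>] morD(1)[OF \<psi>] by blast+
      then show "\<phi> W (Res F V W x) \<oplus>\<^bsub>Sec G W\<^esub> \<psi> W (Res F V W x) = Res G V W (\<phi> V x \<oplus>\<^bsub>Sec G V\<^esub> \<psi> V x)"
        using V by (simp add: morD(4)[OF \<phi>] morD(4)[OF \<psi>] G.res_add)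
    qed (simp add: morD(1)[OF \<phi>] morD(1)[OF \<psi>])
    from hom_restrict_morphism[OF assms(1) this] show ?thesis
      by (simp add: sheaf_hom_def)
  qed
  have smult: "a \<odot>\<^bsub>Sec ?H U\<^esub> \<phi> \<in> carrier (Sec ?H U)"
    if U: "opn U" "a \<in> \<O> U" "\<phi> \<in> carrier (Sec ?H U)" for U a \<phi>
  proof -
    have \<phi>: "morphism_on S U F G \<phi>"
      using U by (auto simp: sheaf_hom_carrier)
    have "morphism_on S U F G (\<lambda>V x. rho U V a \<odot>\<^bsub>Sec G V\<^esub> \<phi> V x)"
    proof (rule morphism_onI)
      fix V x assume V: "opn V" "V \<subseteq> U" "x \<in> carrier (Sec F V)"
      then show "rho U V a \<odot>\<^bsub>Sec G V\<^esub> \<phi> V x \<in> carrier (Sec G V)"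
        using U by (simp add: morD(1)[OF \<phi>])
    next
      fix V x y assume V: "opn V" "V \<subseteq> U" "x \<in> carrier (Sec F V)" "y \<in> carrier (Sec F V)"
      interpret module "R V" "G.M V" by (rule G.module) fact
      show "rho U V a \<odot>\<^bsub>Sec G V\<^esub> \<phi> V (x \<oplus>\<^bsub>Sec F V\<^esub> y) =
          rho U V a \<odot>\<^bsub>Sec G V\<^esub> \<phi> V x \<oplus>\<^bsub>Sec G V\<^esub> rho U V a \<odot>\<^bsub>Sec G V\<^esub> \<phi> V y"
        using V U by (simp add: morD(1,2)[OF \<phi>] smult_r_distr)
    next
      fix V b x assume V: "opn V" "V \<subseteq> U" "b \<in> \<O> V" "x \<in> carrier (Sec F V)"
      interpret module "R V" "G.M V" by (rule G.module) fact
      have "rho U V a \<in> \<O> V" "\<phi> V x \<in> carrier (G.M V)"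
        using V U by (simp_all add: morD(1)[OF \<phi>])
      then show "rho U V a \<odot>\<^bsub>Sec G V\<^esub> \<phi> V (b \<odot>\<^bsub>Sec F V\<^esub> x) = b \<odot>\<^bsub>Sec G V\<^esub> (rho U V a \<odot>\<^bsub>Sec G V\<^esub> \<phi> V x)"
        using V by (simp add: morD(3)[OF \<phi>] m_comm flip: smult_assoc1)
    next
      fix V W x assume V: "opn V" "opn W" "W \<subseteq> V" "V \<subseteq> U" "x \<in> carrier (Sec F V)"
      then have "W \<subseteq> U" by auto
      then show "rho U W a \<odot>\<^bsub>Sec G W\<^esub> \<phi> W (Res F V W x) = Res G V W (rho U V a \<odot>\<^bsub>Sec G V\<^esub> \<phi> V x)"
        using V U by (simp add: morD(1,4)[OF \<phi>] G.res_smult str_res_res)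
    qed
    from hom_restrict_morphism[OF assms(1) this] show ?thesis
      by (simp add: sheaf_hom_def)
  qed
  have zero: "\<zero>\<^bsub>Sec ?H U\<^esub> \<in> carrier (Sec ?H U)" if "opn U" for U
  proof -
    have "morphism_on S U F G (\<lambda>V x. \<zero>\<^bsub>Sec G V\<^esub>)"
    proof (rule morphism_onI)
      fix V a x assume V: "opn V" "V \<subseteq> U" "a \<in> \<O> V"
      interpret module "R V" "G.M V" by (rule G.module) fact
      show "\<zero>\<^bsub>Sec G V\<^esub> = a \<odot>\<^bsub>Sec G V\<^esub> \<zero>\<^bsub>Sec G V\<^esub>"
        using V by simp
    next
      fix V x y assume V: "opn V" "x \<in> carrier (Sec F V)" "y \<in> carrier (Sec F V)"
      interpret module "R V" "G.M V" by (rule G.module) fact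
      show "\<zero>\<^bsub>Sec G V\<^esub> = \<zero>\<^bsub>Sec G V\<^esub> \<oplus>\<^bsub>Sec G V\<^esub> \<zero>\<^bsub>Sec G V\<^esub>" by simp
    qed (auto simp: G.res_zero)
    from hom_restrict_morphism[OF assms(1) this] show ?thesis
      by (simp add: sheaf_hom_def)
  qed
  show ?thesis
  proof (intro module_presheaf.intro module_presheaf_axioms.intro ring_presheaf_axioms)
    fix U assume U: "opn U"
    show "module (R U) (Sec ?H U)"
    proof (rule module_from_smult)
      show "cring (R U)" by (rule cring[OF U])
      show "\<zero>\<^bsub>Sec ?H U\<^esub> \<in> carrier (Sec ?H U)" by (rule zero[OF U])
      have cl: "\<phi> V x \<in> carrier (G.M V)"
        if "\<phi> \<in> carrier (Sec ?H U)" "opn V" "V \<subseteq> U" "x \<in> carrier (F.M V)" for \<phi> V x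
        using that by (auto simp: sheaf_hom_carrier intro: morD(1))
      note GM = module.smult_l_distr[OF G.module] module.smult_r_distr[OF G.module]
        module.smult_assoc1[OF G.module] module.smult_one[OF G.module]
        abelian_monoid.a_assoc[OF abelian_group.axioms(1)[OF G.abelian]]
        abelian_monoid.l_zero[OF abelian_group.axioms(1)[OF G.abelian]]
        module.smult_l_null[OF G.module]
      have zR: "\<zero>\<^bsub>R U\<^esub> \<in> \<O> U" "\<one>\<^bsub>R U\<^esub> \<in> \<O> U"
        using cring[OF U] by (simp_all add: cring.cring_simprules)
      have rz: "rho U V \<zero>\<^bsub>R U\<^esub> = \<zero>\<^bsub>R V\<^esub>" if "opn V" "V \<subseteq> U" for V
        using str_res_hom[OF U that] cring[OF U] cring[OF that(1)]
        by (intro Ring.ring_hom_zero) (auto intro: cring.axioms)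
      note eqI = sheaf_hom_eqI[where S=S and F=F and G=G and U=U]
      fix x assume x: "x \<in> carrier (Sec ?H U)"
      show "\<zero>\<^bsub>Sec ?H U\<^esub> \<oplus>\<^bsub>Sec ?H U\<^esub> x = x"
        by (rule eqI)
          (use U x in \<open>auto simp: sheaf_hom_ops GM cl zero intro!: add\<close>)
      show "\<one>\<^bsub>R U\<^esub> \<odot>\<^bsub>Sec ?H U\<^esub> x = x"
        by (rule eqI)
          (use U x zR in \<open>auto simp: sheaf_hom_ops GM cl str_res_one intro!: smult\<close>)
      show "\<zero>\<^bsub>R U\<^esub> \<odot>\<^bsub>Sec ?H U\<^esub> x = \<zero>\<^bsub>Sec ?H U\<^esub>"
        by (rule eqI)
          (use U x zR in \<open>auto simp: sheaf_hom_ops GM cl rz zero intro!: smult\<close>)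
      fix y z assume y: "y \<in> carrier (Sec ?H U)" and z: "z \<in> carrier (Sec ?H U)"
      show "x \<oplus>\<^bsub>Sec ?H U\<^esub> y \<in> carrier (Sec ?H U)" using U x y by (rule add)
      show "x \<oplus>\<^bsub>Sec ?H U\<^esub> y \<oplus>\<^bsub>Sec ?H U\<^esub> z = x \<oplus>\<^bsub>Sec ?H U\<^esub> (y \<oplus>\<^bsub>Sec ?H U\<^esub> z)"
        by (rule eqI)
          (use U x y z in \<open>auto simp: sheaf_hom_ops GM cl intro!: add\<close>)
      show "x \<oplus>\<^bsub>Sec ?H U\<^esub> y = y \<oplus>\<^bsub>Sec ?H U\<^esub> x"
        by (rule eqI)
          (use U x y in \<open>auto simp: sheaf_hom_ops cl intro!: add abelian_monoid.a_comm[OF abelian_group.axioms(1)[OF G.abelian]]\<close>)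
      fix a b assume a: "a \<in> \<O> U" and b: "b \<in> \<O> U"
      have ab: "a \<oplus>\<^bsub>R U\<^esub> b \<in> \<O> U" "a \<otimes>\<^bsub>R U\<^esub> b \<in> \<O> U"
        using cring[OF U] a b by (simp_all add: cring.cring_simprules)
      show "a \<odot>\<^bsub>Sec ?H U\<^esub> x \<in> carrier (Sec ?H U)" using U a x by (rule smult)
      show "(a \<oplus>\<^bsub>R U\<^esub> b) \<odot>\<^bsub>Sec ?H U\<^esub> x = a \<odot>\<^bsub>Sec ?H U\<^esub> x \<oplus>\<^bsub>Sec ?H U\<^esub> b \<odot>\<^bsub>Sec ?H U\<^esub> x"
        by (rule eqI)
          (use U x a b ab in \<open>auto simp: sheaf_hom_ops GM cl str_res_add intro!: add smult\<close>)
      show "a \<odot>\<^bsub>Sec ?H U\<^esub> (x \<oplus>\<^bsub>Sec ?H U\<^esub> y) = a \<odot>\<^bsub>Sec ?H U\<^esub> x \<oplus>\<^bsub>Sec ?H U\<^esub> a \<odot>\<^bsub>Sec ?H U\<^esub> y"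
        by (rule eqI)
          (use U x y a in \<open>auto simp: sheaf_hom_ops GM cl intro!: add smult\<close>)
      show "(a \<otimes>\<^bsub>R U\<^esub> b) \<odot>\<^bsub>Sec ?H U\<^esub> x = a \<odot>\<^bsub>Sec ?H U\<^esub> (b \<odot>\<^bsub>Sec ?H U\<^esub> x)"
        by (rule eqI)
          (use U x a b ab in \<open>auto simp: sheaf_hom_ops GM cl str_res_mult intro!: smult\<close>)
    qed
  next
    fix U V x assume V: "opn U" "opn V" "V \<subseteq> U" "x \<in> carrier (Sec ?H U)"
    have "Res ?H U V x = hom_restrict S F V x" by (simp add: sheaf_hom_def)
    then show *: "Res ?H U V x \<in> carrier (Sec ?H V)"
      using V by (auto simp: sheaf_hom_carrier[where U=U] intro!: hom_restrict_morphism assms intro: morphism_on_subset)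
    fix y assume y: "y \<in> carrier (Sec ?H U)"
    show "Res ?H U V (x \<oplus>\<^bsub>Sec ?H U\<^esub> y) = Res ?H U V x \<oplus>\<^bsub>Sec ?H V\<^esub> Res ?H U V y"
      using V(3) by (auto simp: sheaf_hom_def hom_restrict_def fun_eq_iff)
  next
    fix U V a x assume V: "opn U" "opn V" "V \<subseteq> U" "a \<in> \<O> U" "x \<in> carrier (Sec ?H U)"
    show "Res ?H U V (a \<odot>\<^bsub>Sec ?H U\<^esub> x) = rho U V a \<odot>\<^bsub>Sec ?H V\<^esub> Res ?H U V x"
      using V by (auto simp: sheaf_hom_def hom_restrict_def fun_eq_iff str_res_res)
  next
    fix U x assume "x \<in> carrier (Sec ?H U)"
    then show "Res ?H U U x = x" by (simp add: sheaf_hom_def)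
  next
    fix U V W x assume "W \<subseteq> V" "V \<subseteq> U" "x \<in> carrier (Sec ?H U)"
    then show "Res ?H V W (Res ?H U V x) = Res ?H U W x"
      by (simp add: sheaf_hom_def hom_restrict_restrict)
  qed
qed

lemma subpresheaf_simps [simp]:
  "carrier (Sec (subpresheaf F G) U) = G U"
  "Res (subpresheaf F G) = Res F"
  "ring.add (Sec (subpresheaf F G) U) = ring.add (Sec F U)"
  "ring.zero (Sec (subpresheaf F G) U) = ring.zero (Sec F U)"
  "module.smult (Sec (subpresheaf F G) U) = module.smult (Sec F U)"
  "monoid.mult (Sec (subpresheaf F G) U) = monoid.mult (Sec F U)"
  by (simp_all add: subpresheaf_def)

lemma (in ring_presheaf) str_presheaf: "module_presheaf S (Str S)"
  by (intro module_presheaf.intro module_presheaf_axioms.intro ring_presheaf_axioms str_module)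
    (auto simp: str_res_add str_res_mult smult_mult str_res_id str_res_res)

lemma (in module_presheaf) morphism_zero:
  assumes "module_presheaf S H" "morphism_on S U F H \<phi>" "opn V" "V \<subseteq> U"
  shows "\<phi> V \<zero>\<^bsub>Sec F V\<^esub> = \<zero>\<^bsub>Sec H V\<^esub>"
proof -
  interpret H: module_presheaf S H by fact
  interpret F': module "R V" "M V" by (rule module) fact
  interpret H': module "R V" "H.M V" by (rule H.module) fact
  have "\<phi> V (\<zero>\<^bsub>R V\<^esub> \<odot>\<^bsub>M V\<^esub> \<zero>\<^bsub>M V\<^esub>) = \<zero>\<^bsub>R V\<^esub> \<odot>\<^bsub>H.M V\<^esub> \<phi> V \<zero>\<^bsub>M V\<^esub>"
    using assms by (intro morD(3)[OF assms(2)]) auto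
  then show ?thesis
    using assms morD(1)[OF assms(2-4), of "\<zero>\<^bsub>M V\<^esub>"] by simp
qed

lemma (in module_presheaf) morphism_minus:
  assumes "module_presheaf S H" "morphism_on S U F H \<phi>" "opn V" "V \<subseteq> U" "x \<in> carrier (Sec F V)" "y \<in> carrier (Sec F V)"
  shows "\<phi> V (x \<ominus>\<^bsub>Sec F V\<^esub> y) = \<phi> V x \<ominus>\<^bsub>Sec H V\<^esub> \<phi> V y"
proof -
  interpret H: module_presheaf S H by fact
  interpret cring "R V" by (rule cring) fact
  have "\<phi> V (\<ominus>\<^bsub>Sec F V\<^esub> y) = \<ominus>\<^bsub>Sec H V\<^esub> \<phi> V y"
    using assms(3-6) morD(1)[OF assms(2-4) assms(6)]
    by (simp flip: smult_minus_one H.smult_minus_one add: morD(3)[OF assms(2)])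
  then show ?thesis
    using assms(3-6) by (simp add: a_minus_def morD(2)[OF assms(2)])
qed

text \<open>Used for the square of I in O_P and for that of I_{Z/X} in O_X; the hypotheses are the
  part of the ring structure that this takes, required on sections of \<open>G\<close>
  alone.\<close>

lemma (in submodule_presheaf) square_submodule:
  assumes mult: "\<And>U x y. opn U \<Longrightarrow> x \<in> G U \<Longrightarrow> y \<in> G U \<Longrightarrow> x \<otimes>\<^bsub>M U\<^esub> y \<in> G U"
    and smult: "\<And>U a x y. opn U \<Longrightarrow> a \<in> \<O> U \<Longrightarrow> x \<in> G U \<Longrightarrow> y \<in> G U \<Longrightarrow>
      a \<odot>\<^bsub>M U\<^esub> (x \<otimes>\<^bsub>M U\<^esub> y) = (a \<odot>\<^bsub>M U\<^esub> x) \<otimes>\<^bsub>M U\<^esub> y"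
    and res: "\<And>U V x y. opn U \<Longrightarrow> opn V \<Longrightarrow> V \<subseteq> U \<Longrightarrow> x \<in> G U \<Longrightarrow> y \<in> G U \<Longrightarrow>
      Res F U V (x \<otimes>\<^bsub>M U\<^esub> y) = Res F U V x \<otimes>\<^bsub>M V\<^esub> Res F U V y"
    and zero: "\<And>U. opn U \<Longrightarrow> \<zero>\<^bsub>M U\<^esub> \<otimes>\<^bsub>M U\<^esub> \<zero>\<^bsub>M U\<^esub> = \<zero>\<^bsub>M U\<^esub>"
  shows "submodule_presheaf S (subpresheaf F G) (square F G)"
proof (intro submodule_presheaf.intro submodule_presheaf_axioms.intro subpresheaf_module)
  show sub: "x \<in> carrier (Sec (subpresheaf F G) U)" if "opn U" "x \<in> square F G U" for U x
    using that(2) unfolding square_def by induction (use that in \<open>auto simp: mult sub_add\<close>)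
  show "\<zero>\<^bsub>Sec (subpresheaf F G) U\<^esub> \<in> square F G U" if "opn U" for U
    using ideal_prod.prod[of "\<zero>\<^bsub>M U\<^esub>" "G U" "\<zero>\<^bsub>M U\<^esub>" "G U" "Sec F U"] that
    by (simp add: square_def zero sub_zero)
  show "x \<oplus>\<^bsub>Sec (subpresheaf F G) U\<^esub> y \<in> square F G U" if "x \<in> square F G U" "y \<in> square F G U" for U x y
    using that by (simp add: square_def ideal_prod.sum)
  show "a \<odot>\<^bsub>Sec (subpresheaf F G) U\<^esub> x \<in> square F G U"
    if U: "opn U" "a \<in> \<O> U" and x: "x \<in> square F G U" for U a x
  proof -
    interpret module "R U" "M U" by (rule module) fact
    show ?thesis
      using x unfolding square_def
    proof induction
      case (prod i j)
      then show ?case using U by (simp add: smult ideal_prod.prod sub_smult)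
    next
      case (sum s t)
      have "s \<in> G U" "t \<in> G U" using sum(1,2) sub[OF U(1)] by (auto simp: square_def)
      then show ?case using U sum(3,4) by (simp add: smult_r_distr sub_carrier ideal_prod.sum)
    qed
  qed
  show "Res (subpresheaf F G) U V x \<in> square F G V"
    if U: "opn U" "opn V" "V \<subseteq> U" and x: "x \<in> square F G U" for U V x
    using x unfolding square_def
  proof induction
    case (prod i j)
    then show ?case using U by (simp add: res ideal_prod.prod sub_res)
  next
    case (sum s t)
    have "s \<in> G U" "t \<in> G U" using sum(1,2) sub[OF U(1)] by (auto simp: square_def)
    then show ?case using U sum(3,4) by (simp add: res_add sub_carrier ideal_prod.sum)
  qed
qed

section \<open>Ideal sheaves\<close>

locale ideal_presheaf = ring_presheaf S for S :: "('p, 'a) ringed_space" +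
  fixes I :: "'p set \<Rightarrow> 'a set"
  assumes ideal_sheaf: "ideal_sheaf S I"
begin

lemma ideal: "opn U \<Longrightarrow> ideal (I U) (R U)"
  using ideal_sheaf by (simp add: ideal_sheaf_def)

lemma ideal_localI:
  assumes "opn U" "s \<in> \<O> U"
    "\<And>p. p \<in> U \<Longrightarrow> \<exists>V. opn V \<and> p \<in> V \<and> V \<subseteq> U \<and> rho U V s \<in> I V"
  shows "s \<in> I U"
  by (rule ideal_sheaf[unfolded ideal_sheaf_def, THEN conjunct2, THEN conjunct2, THEN spec, THEN spec, THEN mp])
    (intro conjI ballI assms)

end

sublocale ideal_presheaf \<subseteq> submodule_presheaf S "Str S" I
proof (intro submodule_presheaf.intro submodule_presheaf_axioms.intro str_presheaf)
  fix U assume U: "opn U"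
  interpret ideal "I U" "R U" by (rule ideal[OF U])
  show "\<zero>\<^bsub>R U\<^esub> \<in> I U" by simp
  fix x assume x: "x \<in> I U"
  then show xR: "x \<in> \<O> U" by (rule a_Hcarr)
  show "x \<oplus>\<^bsub>R U\<^esub> y \<in> I U" if "y \<in> I U" for y
    using x that by (rule additive_subgroup.a_closed[OF ideal.axioms(1)[OF ideal[OF U]]])
  show "a \<odot>\<^bsub>R U\<^esub> x \<in> I U" if "a \<in> \<O> U" for a
    using x xR that U by (simp add: smult_mult I_l_closed)
  show "rho U V x \<in> I V" if "opn V" "V \<subseteq> U" for V
    using ideal_sheaf that U x unfolding ideal_sheaf_def by blast
qed

context ideal_presheaf
begin

lemma sub_mult: "opn U \<Longrightarrow> a \<in> \<O> U \<Longrightarrow> x \<in> I U \<Longrightarrow> a \<otimes>\<^bsub>R U\<^esub> x \<in> I U"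
  using sub_smult[of U a x] by (simp add: smult_mult sub_carrier)

lemma R_mult_closed [simp]:
  "opn U \<Longrightarrow> a \<in> \<O> U \<Longrightarrow> b \<in> \<O> U \<Longrightarrow> a \<otimes>\<^bsub>R U\<^esub> b \<in> \<O> U"
  by (simp add: cring cring.cring_simprules)

lemma R_one_closed [simp]: "opn U \<Longrightarrow> \<one>\<^bsub>R U\<^esub> \<in> \<O> U"
  by (simp add: cring cring.cring_simprules)

lemma diff_mult:
  assumes "opn W" "x \<in> \<O> W" "y \<in> \<O> W" "x' \<in> \<O> W" "y' \<in> \<O> W"
    "x \<ominus>\<^bsub>R W\<^esub> x' \<in> I W" "y \<ominus>\<^bsub>R W\<^esub> y' \<in> I W"
  shows "(x \<otimes>\<^bsub>R W\<^esub> y) \<ominus>\<^bsub>R W\<^esub> (x' \<otimes>\<^bsub>R W\<^esub> y') \<in> I W"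
proof -
  interpret cring "R W" by (rule cring) fact
  have "(x \<otimes>\<^bsub>R W\<^esub> y) \<ominus>\<^bsub>R W\<^esub> (x' \<otimes>\<^bsub>R W\<^esub> y') = y \<otimes>\<^bsub>R W\<^esub> (x \<ominus>\<^bsub>R W\<^esub> x') \<oplus>\<^bsub>R W\<^esub> x' \<otimes>\<^bsub>R W\<^esub> (y \<ominus>\<^bsub>R W\<^esub> y')"
    using assms(2-5) by algebra
  then show ?thesis
    using assms sub_mult sub_add by simp
qed

lemma stalk_mult:
  assumes "opn U" "p \<in> U" "s \<in> \<O> U" "t \<in> \<O> U"
  shows "g p U s \<otimes>\<^bsub>stalk p\<^esub> g p U t = g p U (s \<otimes>\<^bsub>R U\<^esub> t)"
  unfolding quot_stalk_def monoid.select_convs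
  by (rule germ_op_germ) (use assms in \<open>auto simp: str_res_mult diff_mult\<close>)

lemma pr_mult:
  "opn U \<Longrightarrow> s \<in> \<O> U \<Longrightarrow> t \<in> \<O> U \<Longrightarrow> pr U (s \<otimes>\<^bsub>R U\<^esub> t) = pr U s \<otimes>\<^bsub>Sec Q U\<^esub> pr U t"
  by (auto simp: Q_mult quot_proj_def stalk_mult fun_eq_iff)

lemma pr_one:
  assumes "opn U"
  shows "pr U \<one>\<^bsub>R U\<^esub> = \<one>\<^bsub>Sec Q U\<^esub>"
proof -
  have "g p U \<one>\<^bsub>R U\<^esub> = \<one>\<^bsub>stalk p\<^esub>" if "p \<in> U" for p
  proof -
    have "g p U (rho X U \<one>\<^bsub>R X\<^esub>) = g p X \<one>\<^bsub>R X\<^esub>"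
      using assms openin_subset[OF assms] that by (intro germ_res) auto
    then show ?thesis
      using assms openin_subset[OF assms] by (simp add: quot_stalk_def str_res_one)
  qed
  then show ?thesis by (auto simp: Q_one quot_proj_def fun_eq_iff)
qed

lemma restrict_mult: "V \<subseteq> U \<Longrightarrow> restrict (\<mu> \<otimes>\<^bsub>Sec Q U\<^esub> \<tau>) V = restrict \<mu> V \<otimes>\<^bsub>Sec Q V\<^esub> restrict \<tau> V"
  by (auto simp: Q_mult restrict_def fun_eq_iff)

text \<open>An ideal sheaf contains every section that lies in it locally, which absorbs the local
  quantifier of \<open>pr_zero_iff\<close>.\<close>

lemma pr_zero_iff': "opn U \<Longrightarrow> s \<in> \<O> U \<Longrightarrow> pr U s = \<zero>\<^bsub>Sec Q U\<^esub> \<longleftrightarrow> s \<in> I U"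
  using ideal_localI[of U s] sub_res by (auto simp: pr_zero_iff)

lemma pr_eq_iff':
  assumes "opn U" "s \<in> \<O> U" "t \<in> \<O> U"
  shows "pr U s = pr U t \<longleftrightarrow> s \<ominus>\<^bsub>R U\<^esub> t \<in> I U"
proof -
  interpret QM: module_presheaf S Q by (rule Q_module)
  interpret QA: abelian_group "Sec Q U" by (rule QM.abelian) fact
  have "pr U s = pr U t \<longleftrightarrow> pr U (s \<ominus>\<^bsub>R U\<^esub> t) = \<zero>\<^bsub>Sec Q U\<^esub>"
    using assms by (simp add: pr_minus QA.minus_eq_zero_iff)
  then show ?thesis using assms by (simp add: pr_zero_iff')
qed

lemma ideal_smult_zero:
  assumes "opn U" "a \<in> I U" "\<mu> \<in> carrier (Sec Q U)"
  shows "a \<odot>\<^bsub>Sec Q U\<^esub> \<mu> = \<zero>\<^bsub>Sec Q U\<^esub>"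
proof (rule Q_eq_localI[of _ U])
  fix p assume p: "p \<in> U"
  obtain V s where V: "opn V" "p \<in> V" "V \<subseteq> U" "s \<in> \<O> V" "restrict \<mu> V = pr V s"
    using assms(3) p by (rule sec_local)
  have "restrict (a \<odot>\<^bsub>Sec Q U\<^esub> \<mu>) V = pr V (rho U V a \<odot>\<^bsub>R V\<^esub> s)"
    using V assms by (simp add: restrict_smult sub_carrier pr_smult)
  also have "\<dots> = \<zero>\<^bsub>Sec Q V\<^esub>"
  proof -
    interpret cring "R V" by (rule cring) fact
    have "s \<otimes>\<^bsub>R V\<^esub> rho U V a \<in> I V" using V assms by (simp add: sub_mult sub_res)
    moreover have "s \<otimes>\<^bsub>R V\<^esub> rho U V a = rho U V a \<odot>\<^bsub>R V\<^esub> s"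
      using V assms by (simp add: smult_mult sub_carrier m_comm)
    ultimately show ?thesis using V assms by (simp add: pr_zero_iff' sub_carrier)
  qed
  finally show "\<exists>V. p \<in> V \<and> restrict (a \<odot>\<^bsub>Sec Q U\<^esub> \<mu>) V = restrict \<zero>\<^bsub>Sec Q U\<^esub> V"
    using V(2,3) by (intro exI[of _ V]) (auto simp: Q_zero fun_eq_iff)
qed (simp_all add: Q_smult Q_zero)

end

sublocale ideal_presheaf \<subseteq> sq: submodule_presheaf S "subpresheaf (Str S) I" "square (Str S) I"
proof (rule square_submodule)
  fix U assume U: "opn U"
  interpret cring "R U" by (rule cring[OF U])
  show "\<zero>\<^bsub>R U\<^esub> \<otimes>\<^bsub>R U\<^esub> \<zero>\<^bsub>R U\<^esub> = \<zero>\<^bsub>R U\<^esub>" by simp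
  fix x y assume "x \<in> I U" "y \<in> I U"
  then show "x \<otimes>\<^bsub>R U\<^esub> y \<in> I U" using U sub_carrier sub_mult by blast
  fix a assume "a \<in> \<O> U"
  then show "a \<odot>\<^bsub>R U\<^esub> (x \<otimes>\<^bsub>R U\<^esub> y) = (a \<odot>\<^bsub>R U\<^esub> x) \<otimes>\<^bsub>R U\<^esub> y"
    using U \<open>x \<in> I U\<close> \<open>y \<in> I U\<close> by (simp add: smult_mult sub_carrier m_assoc)
qed (auto simp: str_res_mult sub_carrier)

lemma (in ring_presheaf) ideal_presheafI:
  assumes sub: "submodule_presheaf S (Str S) K"
    and loc: "\<And>U s. opn U \<Longrightarrow> s \<in> \<O> U \<Longrightarrow>
      (\<And>p. p \<in> U \<Longrightarrow> \<exists>V. opn V \<and> p \<in> V \<and> V \<subseteq> U \<and> rho U V s \<in> K V) \<Longrightarrow> s \<in> K U"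
  shows "ideal_presheaf S K"
proof -
  interpret K: submodule_presheaf S "Str S" K by fact
  have "ideal (K U) (R U)" if U: "opn U" for U
  proof -
    interpret cring "R U" by (rule cring[OF U])
    have l: "x \<otimes>\<^bsub>R U\<^esub> a \<in> K U" if "a \<in> K U" "x \<in> \<O> U" for a x
      using that K.sub_smult[OF U that(2,1)] U by (simp add: smult_mult K.sub_carrier)
    show ?thesis
    proof (rule idealI)
      show "subgroup (K U) (add_monoid (R U))"
      proof (rule add.subgroupI)
        show "K U \<noteq> {}" using K.sub_zero[OF U] by auto
        show "\<ominus>\<^bsub>R U\<^esub> a \<in> K U" if "a \<in> K U" for a
          using U that by (rule K.sub_inv)
      qed (use K.sub_carrier[OF U] K.sub_add[OF U] in auto)
      show "x \<otimes>\<^bsub>R U\<^esub> a \<in> K U" if "a \<in> K U" "x \<in> \<O> U" for a x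
        using l that .
      show "a \<otimes>\<^bsub>R U\<^esub> x \<in> K U" if "a \<in> K U" "x \<in> \<O> U" for a x
        using l[OF that] m_comm[of a x] that K.sub_carrier[OF U] by simp
    qed unfold_locales
  qed
  then show ?thesis
    by unfold_locales (auto simp: ideal_sheaf_def K.sub_res intro: loc)
qed

section \<open>Sums of ideal sheaves: the scheme-theoretic intersection\<close>

locale ideal_pair = ring_presheaf S + I: ideal_presheaf S I + J: ideal_presheaf S J
  for S :: "('p, 'a) ringed_space" and I J :: "'p set \<Rightarrow> 'a set"
begin

abbreviation K where "K \<equiv> ideal_sum S I J"

lemma ideal_sumI:
  assumes "opn U" "a \<in> I U" "b \<in> J U"
  shows "a \<oplus>\<^bsub>R U\<^esub> b \<in> K U"
proof -
  have "rho U U (a \<oplus>\<^bsub>R U\<^esub> b) = a \<oplus>\<^bsub>R U\<^esub> b"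
    using assms by (simp add: str_res_id I.sub_carrier J.sub_carrier)
  then show ?thesis
    using assms by (auto simp: ideal_sum_def I.sub_carrier J.sub_carrier intro!: exI[of _ U])
qed

lemma I_sub_K: "opn U \<Longrightarrow> a \<in> I U \<Longrightarrow> a \<in> K U"
  using ideal_sumI[of U a "\<zero>\<^bsub>R U\<^esub>"] cring[of U]
  by (simp add: J.sub_zero I.sub_carrier cring.cring_simprules)

lemma J_sub_K: "opn U \<Longrightarrow> a \<in> J U \<Longrightarrow> a \<in> K U"
  using ideal_sumI[of U "\<zero>\<^bsub>R U\<^esub>" a] cring[of U]
  by (simp add: I.sub_zero J.sub_carrier cring.cring_simprules)

lemma ideal_sumE:
  assumes "s \<in> K U" "p \<in> U"
  obtains V a b where "opn V" "p \<in> V" "V \<subseteq> U" "a \<in> I V" "b \<in> J V" "rho U V s = a \<oplus>\<^bsub>R V\<^esub> b"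
  using assms unfolding ideal_sum_def by blast

lemma mem_ideal_sumI:
  assumes "s \<in> \<O> U"
    "\<And>p. p \<in> U \<Longrightarrow> \<exists>V. opn V \<and> p \<in> V \<and> V \<subseteq> U \<and> (\<exists>a\<in>I V. \<exists>b\<in>J V. rho U V s = a \<oplus>\<^bsub>R V\<^esub> b)"
  shows "s \<in> K U"
  unfolding ideal_sum_def by (rule CollectI) (intro conjI ballI assms)

lemma ideal_sum_localI:
  assumes "opn U" "s \<in> \<O> U"
    "\<And>p. p \<in> U \<Longrightarrow> \<exists>V. opn V \<and> p \<in> V \<and> V \<subseteq> U \<and> rho U V s \<in> K V"
  shows "s \<in> K U"
proof -
  have "\<exists>V. opn V \<and> p \<in> V \<and> V \<subseteq> U \<and> (\<exists>a\<in>I V. \<exists>b\<in>J V. rho U V s = a \<oplus>\<^bsub>R V\<^esub> b)" if p: "p \<in> U" for p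
  proof -
    obtain V where V: "opn V" "p \<in> V" "V \<subseteq> U" "rho U V s \<in> K V" using assms(3)[OF p] by blast
    obtain W a b where "opn W" "p \<in> W" "W \<subseteq> V" "a \<in> I W" "b \<in> J W" "rho V W (rho U V s) = a \<oplus>\<^bsub>R W\<^esub> b"
      using V(4,2) by (rule ideal_sumE)
    then show ?thesis
      using V assms by (intro exI[of _ W]) (auto simp: str_res_res)
  qed
  with assms(2) show ?thesis by (rule mem_ideal_sumI)
qed

lemma ideal_sum_ideal: "ideal_presheaf S K"
proof (rule ideal_presheafI)
  have carr: "x \<in> \<O> U" if "x \<in> K U" for x U
    using that by (simp add: ideal_sum_def)
  show "submodule_presheaf S (Str S) K"
  proof (intro submodule_presheaf.intro submodule_presheaf_axioms.intro str_presheaf carr)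
    show "\<zero>\<^bsub>R U\<^esub> \<in> K U" if "opn U" for U using I_sub_K[OF that] I.sub_zero[OF that] .
    show res: "rho U V x \<in> K V" if U: "opn U" "opn V" "V \<subseteq> U" "x \<in> K U" for U V x
    proof -
      have "\<exists>W. opn W \<and> p \<in> W \<and> W \<subseteq> V \<and> (\<exists>a\<in>I W. \<exists>b\<in>J W. rho V W (rho U V x) = a \<oplus>\<^bsub>R W\<^esub> b)" if p: "p \<in> V" for p
      proof -
        have "p \<in> U" using p U by auto
        with U(4) obtain W a b where W: "opn W" "p \<in> W" "W \<subseteq> U" "a \<in> I W" "b \<in> J W" "rho U W x = a \<oplus>\<^bsub>R W\<^esub> b"
          by (rule ideal_sumE)
        define P where "P = V \<inter> W"
        have P: "opn P" "p \<in> P" "P \<subseteq> V" "P \<subseteq> W" using W U p by (auto simp: P_def)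
        have "rho V P (rho U V x) = rho W P (rho U W x)"
          using P W(1-3) U carr by (simp add: str_res_res)
        also have "\<dots> = rho W P a \<oplus>\<^bsub>R P\<^esub> rho W P b"
          using P W by (simp add: str_res_add I.sub_carrier J.sub_carrier)
        finally show ?thesis
          using P(1-3) I.sub_res[OF W(1) P(1,4) W(4)] J.sub_res[OF W(1) P(1,4) W(5)] by blast
      qed
      with str_res_closed[OF U(1-3) carr[OF U(4)]] show ?thesis by (rule mem_ideal_sumI)
    qed
    show "x \<oplus>\<^bsub>R U\<^esub> y \<in> K U" if U: "opn U" "x \<in> K U" "y \<in> K U" for U x y
    proof (rule ideal_sum_localI)
      fix p assume p: "p \<in> U"
      obtain W a b where W: "opn W" "p \<in> W" "W \<subseteq> U" "a \<in> I W" "b \<in> J W" "rho U W x = a \<oplus>\<^bsub>R W\<^esub> b"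
        using U(2) p by (rule ideal_sumE)
      \<comment> \<open>The section y is decomposed only after restriction to the open set on which
        x is, so that both decompositions live on the same \<open>P\<close>.\<close>
      have "rho U W y \<in> K W" using U W by (intro res) auto
      then obtain P c d where P: "opn P" "p \<in> P" "P \<subseteq> W" "c \<in> I P" "d \<in> J P" "rho W P (rho U W y) = c \<oplus>\<^bsub>R P\<^esub> d"
        using W(2) by (rule ideal_sumE)
      interpret cring "R P" by (rule cring) fact
      have ab: "rho W P a \<in> I P" "rho W P b \<in> J P" using P W by (simp_all add: I.sub_res J.sub_res)
      have "P \<subseteq> U" using P W by auto
      have "rho U P x = rho W P (rho U W x)"
        using P(1-3) W(1-3) U carr by (simp add: str_res_res)
      then have "rho U P x = rho W P a \<oplus>\<^bsub>R P\<^esub> rho W P b"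
        using W P by (simp add: str_res_add I.sub_carrier J.sub_carrier)
      moreover have "rho U P y = c \<oplus>\<^bsub>R P\<^esub> d"
        using P W(1-3) U carr str_res_res[of U W P y] by simp
      ultimately have "rho U P (x \<oplus>\<^bsub>R U\<^esub> y) = (rho W P a \<oplus>\<^bsub>R P\<^esub> c) \<oplus>\<^bsub>R P\<^esub> (rho W P b \<oplus>\<^bsub>R P\<^esub> d)"
        using \<open>P \<subseteq> U\<close> U P ab carr by (simp add: str_res_add I.sub_carrier J.sub_carrier a_ac)
      also have "\<dots> \<in> K P" using P ab by (intro ideal_sumI) (simp_all add: I.sub_add J.sub_add)
      finally show "\<exists>V. opn V \<and> p \<in> V \<and> V \<subseteq> U \<and> rho U V (x \<oplus>\<^bsub>R U\<^esub> y) \<in> K V"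
        using P \<open>P \<subseteq> U\<close> by blast
    qed (use U carr in auto)
    show "s \<odot>\<^bsub>R U\<^esub> x \<in> K U" if U: "opn U" "s \<in> \<O> U" "x \<in> K U" for U s x
    proof (rule ideal_sum_localI)
      fix p assume p: "p \<in> U"
      obtain W a b where W: "opn W" "p \<in> W" "W \<subseteq> U" "a \<in> I W" "b \<in> J W" "rho U W x = a \<oplus>\<^bsub>R W\<^esub> b"
        using U(3) p by (rule ideal_sumE)
      interpret cring "R W" by (rule cring) fact
      have "rho U W (s \<odot>\<^bsub>R U\<^esub> x) = (rho U W s \<otimes>\<^bsub>R W\<^esub> a) \<oplus>\<^bsub>R W\<^esub> (rho U W s \<otimes>\<^bsub>R W\<^esub> b)"
        using W U carr by (simp add: smult_mult str_res_mult I.sub_carrier J.sub_carrier r_distr)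
      also have "\<dots> \<in> K W" using W U by (intro ideal_sumI) (simp_all add: I.sub_mult J.sub_mult)
      finally show "\<exists>V. opn V \<and> p \<in> V \<and> V \<subseteq> U \<and> rho U V (s \<odot>\<^bsub>R U\<^esub> x) \<in> K V"
        using W by blast
    qed (use U carr I.M_smult_closed in auto)
  qed
qed (rule ideal_sum_localI)

end

sublocale ideal_pair \<subseteq> K: ideal_presheaf S "ideal_sum S I J"
  by (rule ideal_sum_ideal)

text \<open>Lets both sides of the symmetry take values in the same O_Z.\<close>

lemma (in ideal_pair) ideal_sum_commute: "ideal_sum S J I = ideal_sum S I J"
proof -
  have "(\<exists>a\<in>J V. \<exists>b\<in>I V. x = a \<oplus>\<^bsub>R V\<^esub> b) \<longleftrightarrow> (\<exists>a\<in>I V. \<exists>b\<in>J V. x = a \<oplus>\<^bsub>R V\<^esub> b)" if V: "opn V" for V x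
  proof -
    interpret cring "R V" by (rule cring[OF V])
    show ?thesis using I.sub_carrier[OF V] J.sub_carrier[OF V] a_comm by blast
  qed
  then show ?thesis
    by (simp add: ideal_sum_def fun_eq_iff cong: conj_cong)
qed

section \<open>Maps induced on quotient sheaves\<close>

lemma quot_map_local:
  assumes FG: "submodule_presheaf S F G" and FG': "submodule_presheaf S F' G'"
    and \<psi>: "sheaf_morphism S F F' \<psi>"
    and G: "\<And>V x. openin (Top S) V \<Longrightarrow> x \<in> G V \<Longrightarrow> \<psi> V x \<in> G' V"
    and W: "openin (Top S) W" "W \<subseteq> V" and s: "s \<in> carrier (Sec F W)"
    and \<mu>: "restrict \<mu> W = quot_proj S F G W s"
  shows "restrict (quot_map S F' G' \<psi> V \<mu>) W = quot_proj S F' G' W (\<psi> W s)"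
proof (rule ext)
  interpret P: submodule_presheaf S F G by fact
  interpret P': submodule_presheaf S F' G' by fact
  fix q
  show "restrict (quot_map S F' G' \<psi> V \<mu>) W q = P'.pr W (\<psi> W s) q"
  proof (cases "q \<in> W")
    case q: True
    have top: "V \<subseteq> topspace (Top S)" if "openin (Top S) V" for V using that by (rule openin_subset)
    \<comment> \<open>The union in \<open>quot_map\<close> runs over all representatives of the
      germ; it collapses because \<open>\<psi>\<close> carries \<open>G\<close> into
      \<open>G'\<close>.\<close>
    have "(\<Union>(V', t)\<in>P.g q W s. P'.g q V' (\<psi> V' t)) = P'.g q W (\<psi> W s)"
    proof (rule P.UN_germ)
      fix V' t assume V': "openin (Top S) V'" "q \<in> V'" "t \<in> carrier (Sec F V')" "P.g q V' t = P.g q W s"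
      then obtain N where N: "openin (Top S) N" "q \<in> N" "N \<subseteq> V'" "N \<subseteq> W"
        "Res F V' N t \<ominus>\<^bsub>Sec F N\<^esub> Res F W N s \<in> G N"
        using P.germ_iff[of V' W q t s] W s q by (auto simp: P.germ_eq_def)
      have "\<psi> N (Res F V' N t \<ominus>\<^bsub>Sec F N\<^esub> Res F W N s) = \<psi> N (Res F V' N t) \<ominus>\<^bsub>Sec F' N\<^esub> \<psi> N (Res F W N s)"
        using N V' W s by (intro P.morphism_minus[OF P'.module_presheaf_axioms \<psi>]) (auto simp: top)
      also have "\<dots> = Res F' V' N (\<psi> V' t) \<ominus>\<^bsub>Sec F' N\<^esub> Res F' W N (\<psi> W s)"
        using N V' W s by (simp add: morD(4)[OF \<psi>] top)
      finally have "Res F' V' N (\<psi> V' t) \<ominus>\<^bsub>Sec F' N\<^esub> Res F' W N (\<psi> W s) \<in> G' N"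
        using G[OF N(1,5)] by simp
      then show "P'.g q V' (\<psi> V' t) = P'.g q W (\<psi> W s)"
        using N V' W s by (intro P'.germ_eqI[of V' W N]) (auto intro!: morD(1)[OF \<psi>] top)
    qed (use W q s in auto)
    moreover have "\<mu> q = P.g q W s" using \<mu> q by (rule P.pr_apply_eq)
    ultimately show ?thesis
      using q W by (auto simp: quot_map_def P'.pr_apply)
  qed (simp add: quot_proj_def)
qed

lemma quot_map_morphism:
  assumes FG: "submodule_presheaf S F G" and FG': "submodule_presheaf S F' G'"
    and \<psi>: "sheaf_morphism S F F' \<psi>"
    and G: "\<And>V x. openin (Top S) V \<Longrightarrow> x \<in> G V \<Longrightarrow> \<psi> V x \<in> G' V"
  shows "sheaf_morphism S (quot_sheaf S F G) (quot_sheaf S F' G') (quot_map S F' G' \<psi>)"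
proof -
  interpret P: submodule_presheaf S F G by fact
  interpret P': submodule_presheaf S F' G' by fact
  interpret PQ: module_presheaf S P.Q by (rule P.Q_module)
  interpret PQ': module_presheaf S P'.Q by (rule P'.Q_module)
  let ?m = "quot_map S F' G' \<psi>"
  have top: "V \<subseteq> topspace (Top S)" if "openin (Top S) V" for V using that by (rule openin_subset)
  have loc: "restrict (?m V \<mu>) W = P'.pr W (\<psi> W s)"
    if "openin (Top S) W" "W \<subseteq> V" "s \<in> carrier (Sec F W)" "restrict \<mu> W = P.pr W s" for V W s \<mu>
    by (rule quot_map_local[OF FG FG' \<psi>]) (use G that in auto)
  note \<psi>c = morD(1)[OF \<psi> _ top]
  have ext: "?m V \<mu> \<in> extensional V" for V \<mu> by (simp add: quot_map_def)
  have closed: "?m V \<mu> \<in> carrier (Sec P'.Q V)" if V: "openin (Top S) V" "\<mu> \<in> carrier (Sec P.Q V)" for V \<mu>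
  proof (rule P'.Q_glueI[OF ext])
    fix p assume "p \<in> V"
    with V(2) obtain W s where W: "openin (Top S) W" "p \<in> W" "W \<subseteq> V" "s \<in> carrier (Sec F W)" "restrict \<mu> W = P.pr W s"
      by (rule P.sec_local)
    then show "\<exists>W. openin (Top S) W \<and> p \<in> W \<and> W \<subseteq> V \<and> restrict (?m V \<mu>) W \<in> carrier (Sec P'.Q W)"
      using loc[OF W(1,3,4,5)] by (intro exI[of _ W]) (auto simp: \<psi>c)
  qed
  show ?thesis
  proof (rule morphism_onI)
    fix V \<mu> assume "openin (Top S) V" "\<mu> \<in> carrier (Sec P.Q V)"
    then show "?m V \<mu> \<in> carrier (Sec P'.Q V)" by (rule closed)
  next
    fix V \<mu> \<tau> assume V: "openin (Top S) V" and \<mu>: "\<mu> \<in> carrier (Sec P.Q V)" and \<tau>: "\<tau> \<in> carrier (Sec P.Q V)"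
    show "?m V (\<mu> \<oplus>\<^bsub>Sec P.Q V\<^esub> \<tau>) = ?m V \<mu> \<oplus>\<^bsub>Sec P'.Q V\<^esub> ?m V \<tau>"
    proof (rule P'.Q_eq_localI[OF ext])
      fix p assume "p \<in> V"
      with V \<mu> \<tau> obtain W s t where W: "openin (Top S) W" "p \<in> W" "W \<subseteq> V" "s \<in> carrier (Sec F W)" "t \<in> carrier (Sec F W)"
        "restrict \<mu> W = P.pr W s" "restrict \<tau> W = P.pr W t"
        by (rule P.sec_local2)
      have "restrict (\<mu> \<oplus>\<^bsub>Sec P.Q V\<^esub> \<tau>) W = P.pr W (s \<oplus>\<^bsub>Sec F W\<^esub> t)"
        using PQ.res_add[of V W \<mu> \<tau>] V W \<mu> \<tau> by (simp add: P.pr_add)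
      then have "restrict (?m V (\<mu> \<oplus>\<^bsub>Sec P.Q V\<^esub> \<tau>)) W = P'.pr W (\<psi> W (s \<oplus>\<^bsub>Sec F W\<^esub> t))"
        using W by (intro loc) auto
      also have "\<dots> = restrict (?m V \<mu>) W \<oplus>\<^bsub>Sec P'.Q W\<^esub> restrict (?m V \<tau>) W"
        using W loc[OF W(1,3,4,6)] loc[OF W(1,3,5,7)] by (simp add: morD(2)[OF \<psi>] top P'.pr_add \<psi>c)
      also have "\<dots> = restrict (?m V \<mu> \<oplus>\<^bsub>Sec P'.Q V\<^esub> ?m V \<tau>) W"
        using PQ'.res_add[of V W "?m V \<mu>" "?m V \<tau>"] V W \<mu> \<tau> closed by simp
      finally show "\<exists>W. p \<in> W \<and> restrict (?m V (\<mu> \<oplus>\<^bsub>Sec P.Q V\<^esub> \<tau>)) W = restrict (?m V \<mu> \<oplus>\<^bsub>Sec P'.Q V\<^esub> ?m V \<tau>) W"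
        using W(2) by blast
    qed (simp add: P'.Q_add)
  next
    fix V a \<mu> assume V: "openin (Top S) V" and a: "a \<in> carrier (Sec (Str S) V)" and \<mu>: "\<mu> \<in> carrier (Sec P.Q V)"
    show "?m V (a \<odot>\<^bsub>Sec P.Q V\<^esub> \<mu>) = a \<odot>\<^bsub>Sec P'.Q V\<^esub> ?m V \<mu>"
    proof (rule P'.Q_eq_localI[OF ext])
      fix p assume "p \<in> V"
      with \<mu> obtain W s where W: "openin (Top S) W" "p \<in> W" "W \<subseteq> V" "s \<in> carrier (Sec F W)" "restrict \<mu> W = P.pr W s"
        by (rule P.sec_local)
      have "restrict (a \<odot>\<^bsub>Sec P.Q V\<^esub> \<mu>) W = P.pr W (P.rho V W a \<odot>\<^bsub>Sec F W\<^esub> s)"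
        using V W \<mu> a by (simp add: P.restrict_smult P.pr_smult)
      then have "restrict (?m V (a \<odot>\<^bsub>Sec P.Q V\<^esub> \<mu>)) W = P'.pr W (\<psi> W (P.rho V W a \<odot>\<^bsub>Sec F W\<^esub> s))"
        using V W a by (intro loc) auto
      also have "\<dots> = restrict (a \<odot>\<^bsub>Sec P'.Q V\<^esub> ?m V \<mu>) W"
        using V W a \<mu> loc[OF W(1,3,4,5)] closed
        by (simp add: morD(3)[OF \<psi>] top P'.pr_smult \<psi>c P'.restrict_smult)
      finally show "\<exists>W. p \<in> W \<and> restrict (?m V (a \<odot>\<^bsub>Sec P.Q V\<^esub> \<mu>)) W = restrict (a \<odot>\<^bsub>Sec P'.Q V\<^esub> ?m V \<mu>) W"
        using W(2) by blast
    qed (simp add: P'.Q_smult)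
  next
    fix V W \<mu> assume "openin (Top S) V" "W \<subseteq> V"
    then show "?m W (Res P.Q V W \<mu>) = Res P'.Q V W (?m V \<mu>)"
      by (auto simp: quot_map_def fun_eq_iff)
  qed
qed

lemma (in submodule_presheaf) pr_morphism: "morphism_on S U F Q pr"
  by (rule morphism_onI) (auto simp: pr_add pr_smult pr_res)

section \<open>Nested ideal sheaves: the ideal of Z in a larger subscheme\<close>

locale ideal_inclusion = ring_presheaf S + I: ideal_presheaf S I + K: ideal_presheaf S K
  for S :: "('p, 'a) ringed_space" and I K :: "'p set \<Rightarrow> 'a set" +
  assumes incl: "openin (Top S) U \<Longrightarrow> a \<in> I U \<Longrightarrow> a \<in> K U"
begin

abbreviation rel where "rel \<equiv> rel_ideal S I K"

lemma id_morphism: "sheaf_morphism S (Str S) (Str S) (\<lambda>V s. s)"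
  by (rule morphism_onI) auto

lemma struct_restriction_local:
  assumes "opn W" "W \<subseteq> V" "s \<in> \<O> W" "restrict \<mu> W = I.pr W s"
  shows "restrict (struct_restriction S K V \<mu>) W = K.pr W s"
  unfolding struct_restriction_def
  by (rule quot_map_local[OF I.submodule_presheaf_axioms K.submodule_presheaf_axioms id_morphism])
    (use incl assms in auto)

lemma struct_restriction_morphism: "sheaf_morphism S I.Q K.Q (struct_restriction S K)"
  unfolding struct_restriction_def
  by (rule quot_map_morphism[OF I.submodule_presheaf_axioms K.submodule_presheaf_axioms id_morphism])
    (use incl in auto)

lemma struct_restriction_pr:
  assumes "opn W" "s \<in> \<O> W"
  shows "struct_restriction S K W (I.pr W s) = K.pr W s"
proof -
  have "struct_restriction S K W (I.pr W s) \<in> extensional W"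
    by (simp add: struct_restriction_def quot_map_def)
  then show ?thesis
    using struct_restriction_local[of W W s "I.pr W s"] assms by (simp add: extensional_restrict)
qed

text \<open>The definition asks for one representative in \<open>K\<close> of each germ. Equality of
  germs spreads to a neighbourhood, and there this representative describes the section.\<close>

lemma mem_rel_ideal_iff:
  assumes "opn U"
  shows "\<mu> \<in> rel U \<longleftrightarrow> \<mu> \<in> carrier (Sec I.Q U) \<and>
    (\<forall>p\<in>U. \<exists>V s. opn V \<and> p \<in> V \<and> V \<subseteq> U \<and> s \<in> K V \<and> restrict \<mu> V = I.pr V s)"
proof -
  have "(\<exists>(V, s)\<in>\<mu> p. s \<in> K V) \<longleftrightarrow> (\<exists>V s. opn V \<and> p \<in> V \<and> V \<subseteq> U \<and> s \<in> K V \<and> restrict \<mu> V = I.pr V s)"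
    if \<mu>: "\<mu> \<in> carrier (Sec I.Q U)" and p: "p \<in> U" for p
  proof
    obtain W t where W: "opn W" "p \<in> W" "W \<subseteq> U" "t \<in> \<O> W" "restrict \<mu> W = I.pr W t"
      using \<mu> p by (rule I.sec_local)
    have \<mu>p: "\<mu> p = I.g p W t" using W(5,2) by (rule I.pr_apply_eq)
    assume "\<exists>(V, s)\<in>\<mu> p. s \<in> K V"
    then obtain V s where V: "opn V" "p \<in> V" "s \<in> \<O> V" "I.g p V s = I.g p W t" "s \<in> K V"
      using W by (auto simp: \<mu>p I.mem_germ)
    then obtain N where N: "opn N" "p \<in> N" "N \<subseteq> V" "N \<subseteq> W" "rho V N s \<ominus>\<^bsub>R N\<^esub> rho W N t \<in> I N"
      using W I.germ_iff[of V W p s t] by (auto simp: I.germ_eq_def)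
    have "restrict \<mu> N = restrict (restrict \<mu> W) N" using N(4) by (simp add: Int_absorb1)
    also have "\<dots> = I.pr N (rho W N t)" unfolding W(5) using N W by (intro I.pr_res) auto
    also have "\<dots> = I.pr N (rho V N s)"
      using N W V by (intro I.pr_eq_iff'[THEN iffD2, symmetric]) auto
    finally show "\<exists>V s. opn V \<and> p \<in> V \<and> V \<subseteq> U \<and> s \<in> K V \<and> restrict \<mu> V = I.pr V s"
      using N W V K.sub_res[of V N s] by (intro exI[of _ N] exI[of _ "rho V N s"]) auto
  next
    assume "\<exists>V s. opn V \<and> p \<in> V \<and> V \<subseteq> U \<and> s \<in> K V \<and> restrict \<mu> V = I.pr V s"
    then obtain V s where V: "opn V" "p \<in> V" "s \<in> K V" "restrict \<mu> V = I.pr V s" by blast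
    then have "(V, s) \<in> \<mu> p" by (simp add: I.pr_apply_eq I.mem_germ K.sub_carrier)
    then show "\<exists>(V, s)\<in>\<mu> p. s \<in> K V" using V(3) by blast
  qed
  then show ?thesis by (auto simp: rel_ideal_def)
qed

text \<open>Presents \<open>rel\<close> as the kernel of a sheaf morphism, from which its submodule
  properties are read off below.\<close>

lemma struct_restriction_zero_iff:
  assumes "opn U" "\<mu> \<in> carrier (Sec I.Q U)"
  shows "struct_restriction S K U \<mu> = \<zero>\<^bsub>Sec K.Q U\<^esub> \<longleftrightarrow> \<mu> \<in> rel U"
proof
  interpret KQ: module_presheaf S K.Q by (rule K.Q_module)
  assume eq: "struct_restriction S K U \<mu> = \<zero>\<^bsub>Sec K.Q U\<^esub>"
  have "\<exists>V s. opn V \<and> p \<in> V \<and> V \<subseteq> U \<and> s \<in> K V \<and> restrict \<mu> V = I.pr V s" if p: "p \<in> U" for p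
  proof -
    obtain W s where W: "opn W" "p \<in> W" "W \<subseteq> U" "s \<in> \<O> W" "restrict \<mu> W = I.pr W s"
      using assms(2) p by (rule I.sec_local)
    have "K.pr W s = Res K.Q U W \<zero>\<^bsub>Sec K.Q U\<^esub>"
      using struct_restriction_local[OF W(1,3-5)] eq by simp
    also have "\<dots> = \<zero>\<^bsub>Sec K.Q W\<^esub>" using W assms by (intro KQ.res_zero) auto
    finally show ?thesis using W by (auto simp: K.pr_zero_iff')
  qed
  then show "\<mu> \<in> rel U" using assms by (simp add: mem_rel_ideal_iff)
next
  interpret KQ: module_presheaf S K.Q by (rule K.Q_module)
  assume \<mu>: "\<mu> \<in> rel U"
  show "struct_restriction S K U \<mu> = \<zero>\<^bsub>Sec K.Q U\<^esub>"
  proof (rule K.Q_eq_localI[of _ U])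
    fix p assume "p \<in> U"
    then obtain V s where V: "opn V" "p \<in> V" "V \<subseteq> U" "s \<in> K V" "restrict \<mu> V = I.pr V s"
      using \<mu> assms by (auto simp: mem_rel_ideal_iff)
    then have "restrict (struct_restriction S K U \<mu>) V = \<zero>\<^bsub>Sec K.Q V\<^esub>"
      using struct_restriction_local[OF V(1,3) _ V(5)] by (simp add: K.sub_carrier K.pr_zero_iff')
    also have "\<dots> = restrict \<zero>\<^bsub>Sec K.Q U\<^esub> V"
      using KQ.res_zero[of U V] V assms by simp
    finally show "\<exists>V. p \<in> V \<and> restrict (struct_restriction S K U \<mu>) V = restrict \<zero>\<^bsub>Sec K.Q U\<^esub> V"
      using V(2) by blast
  qed (simp_all add: struct_restriction_def quot_map_def K.Q_zero)
qed

lemma pr_rel_iff: "opn U \<Longrightarrow> s \<in> \<O> U \<Longrightarrow> I.pr U s \<in> rel U \<longleftrightarrow> s \<in> K U"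
  by (simp flip: struct_restriction_zero_iff add: struct_restriction_pr K.pr_zero_iff')

lemma rel_submodule: "submodule_presheaf S I.Q rel"
proof -
  interpret IQ: module_presheaf S I.Q by (rule I.Q_module)
  interpret KQ: module_presheaf S K.Q by (rule K.Q_module)
  note m = struct_restriction_morphism
  have top: "V \<subseteq> X" if "opn V" for V using that by (rule openin_subset)
  have carr: "x \<in> carrier (IQ.M U)" if "x \<in> rel U" for x U using that by (simp add: rel_ideal_def)
  show ?thesis
  proof (intro submodule_presheaf.intro submodule_presheaf_axioms.intro I.Q_module carr)
    fix U assume U: "opn U"
    interpret M: module "R U" "KQ.M U" by (rule KQ.module[OF U])
    show "\<zero>\<^bsub>Sec I.Q U\<^esub> \<in> rel U"
      using U by (simp flip: struct_restriction_zero_iff add: IQ.morphism_zero[OF K.Q_module m _ top])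
    fix x y assume "x \<in> rel U" "y \<in> rel U"
    then show "x \<oplus>\<^bsub>Sec I.Q U\<^esub> y \<in> rel U"
      using U carr[of x U] carr[of y U]
      by (simp flip: struct_restriction_zero_iff add: morD(2)[OF m _ top])
  next
    fix U a x assume U: "opn U" and a: "a \<in> \<O> U" and x: "x \<in> rel U"
    interpret M: module "R U" "KQ.M U" by (rule KQ.module[OF U])
    show "a \<odot>\<^bsub>Sec I.Q U\<^esub> x \<in> rel U"
      using U a x carr[of x U]
      by (simp flip: struct_restriction_zero_iff add: morD(3)[OF m _ top])
  next
    fix U V x assume U: "opn U" "opn V" "V \<subseteq> U" and x: "x \<in> rel U"
    have "struct_restriction S K V (Res I.Q U V x) = Res K.Q U V (struct_restriction S K U x)"
      using U carr[OF x] by (intro morD(4)[OF m]) (auto simp: top)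
    also have "\<dots> = \<zero>\<^bsub>Sec K.Q V\<^esub>"
      using U x carr[OF x] by (simp add: struct_restriction_zero_iff[THEN iffD2] KQ.res_zero del: K.Q_res)
    finally show "Res I.Q U V x \<in> rel V"
      using U IQ.res_closed[OF U carr[OF x]] by (simp only: struct_restriction_zero_iff)
  qed
qed

end

sublocale ideal_inclusion \<subseteq> rel: submodule_presheaf S "struct_sheaf S I" "rel_ideal S I K"
  by (rule rel_submodule)

sublocale ideal_inclusion \<subseteq> relsq: submodule_presheaf S "subpresheaf (struct_sheaf S I) (rel_ideal S I K)"
  "square (struct_sheaf S I) (rel_ideal S I K)"
proof (rule rel.square_submodule)
  fix U assume U: "opn U"
  show "\<zero>\<^bsub>Sec I.Q U\<^esub> \<otimes>\<^bsub>Sec I.Q U\<^esub> \<zero>\<^bsub>Sec I.Q U\<^esub> = \<zero>\<^bsub>Sec I.Q U\<^esub>"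
  proof -
    interpret cring "R U" by (rule cring[OF U])
    show ?thesis using U by (simp flip: I.pr_zero I.pr_mult)
  qed
  fix x y assume x: "x \<in> rel U" and y: "y \<in> rel U"
  \<comment> \<open>Multiplication of germs is computed on representatives, so both factors are
    first lifted to sections of \<open>K\<close> over one open set.\<close>
  have xy: "\<exists>W s t. opn W \<and> p \<in> W \<and> W \<subseteq> U \<and> s \<in> K W \<and> t \<in> K W \<and> restrict x W = I.pr W s \<and> restrict y W = I.pr W t"
    if p: "p \<in> U" for p
  proof -
    obtain W s t where W: "opn W" "p \<in> W" "W \<subseteq> U" "s \<in> \<O> W" "t \<in> \<O> W"
      "restrict x W = I.pr W s" "restrict y W = I.pr W t"
      using U x y p by (auto intro: I.sec_local2 rel.sub_carrier)
    have "I.pr W s \<in> rel W" "I.pr W t \<in> rel W"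
      using rel.sub_res[of U W x] rel.sub_res[of U W y] W U x y by simp_all
    then have "s \<in> K W" "t \<in> K W" using W by (simp_all add: pr_rel_iff)
    then show ?thesis using W by blast
  qed
  show "x \<otimes>\<^bsub>Sec I.Q U\<^esub> y \<in> rel U"
    unfolding mem_rel_ideal_iff[OF U]
  proof (intro conjI ballI I.Q_glueI)
    fix p assume p: "p \<in> U"
    obtain W s t where W: "opn W" "p \<in> W" "W \<subseteq> U" "s \<in> K W" "t \<in> K W" "restrict x W = I.pr W s" "restrict y W = I.pr W t"
      using xy[OF p] by blast
    then have "restrict (x \<otimes>\<^bsub>Sec I.Q U\<^esub> y) W = I.pr W (s \<otimes>\<^bsub>R W\<^esub> t)"
      by (simp add: I.restrict_mult I.pr_mult K.sub_carrier)
    moreover have "s \<otimes>\<^bsub>R W\<^esub> t \<in> K W" using W by (simp add: K.sub_mult K.sub_carrier)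
    ultimately show "\<exists>V s. opn V \<and> p \<in> V \<and> V \<subseteq> U \<and> s \<in> K V \<and> restrict (x \<otimes>\<^bsub>Sec I.Q U\<^esub> y) V = I.pr V s"
      "\<exists>V. opn V \<and> p \<in> V \<and> V \<subseteq> U \<and> restrict (x \<otimes>\<^bsub>Sec I.Q U\<^esub> y) V \<in> carrier (Sec I.Q V)"
      using W K.sub_carrier[of W "s \<otimes>\<^bsub>R W\<^esub> t"] by auto
  qed (simp add: I.Q_mult)
  fix a assume a: "a \<in> \<O> U"
  show "a \<odot>\<^bsub>Sec I.Q U\<^esub> (x \<otimes>\<^bsub>Sec I.Q U\<^esub> y) = (a \<odot>\<^bsub>Sec I.Q U\<^esub> x) \<otimes>\<^bsub>Sec I.Q U\<^esub> y"
  proof (rule I.Q_eqI[of _ U])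
    fix p assume p: "p \<in> U"
    obtain W s t where W: "opn W" "p \<in> W" "W \<subseteq> U" "s \<in> K W" "t \<in> K W" "restrict x W = I.pr W s" "restrict y W = I.pr W t"
      using xy[OF p] by blast
    interpret cring "R W" by (rule cring) fact
    have "x p = I.g p W s" "y p = I.g p W t" using W(2,6,7) by (simp_all add: I.pr_apply_eq)
    then show "(a \<odot>\<^bsub>Sec I.Q U\<^esub> (x \<otimes>\<^bsub>Sec I.Q U\<^esub> y)) p = ((a \<odot>\<^bsub>Sec I.Q U\<^esub> x) \<otimes>\<^bsub>Sec I.Q U\<^esub> y) p"
      using p U a W by (simp add: I.Q_smult I.Q_mult I.stalk_smult_same I.stalk_mult K.sub_carrier smult_mult m_assoc)
  qed (simp_all add: I.Q_smult I.Q_mult)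
qed (auto simp: I.restrict_mult)

lemma (in ideal_inclusion) pr_square:
  assumes "opn U" "J \<subseteq> K U" "x \<in> ideal_prod (R U) J J"
  shows "x \<in> \<O> U \<and> I.pr U x \<in> square I.Q rel U"
  using assms(3)
proof induction
  case (prod i j)
  then have "i \<in> K U" "j \<in> K U" using assms(2) by auto
  then show ?case
    using assms(1) by (simp add: I.pr_mult K.sub_carrier square_def pr_rel_iff ideal_prod.prod)
next
  case (sum s t)
  interpret cring "R U" by (rule cring) fact
  show ?case using sum assms(1) by (simp add: I.pr_add square_def ideal_prod.sum)
qed

text \<open>For i, j in I linearity gives h (i j) = i h (j), and i acts as zero on O_P / K because I
  lies in K. Hence a homomorphism from I to O_P / K is the same as one from I / I^2.\<close>

lemma (in ideal_inclusion) vanish_on_square: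
  assumes h: "morphism_on S U (subpresheaf (Str S) I) K.Q h" and V: "opn V" "V \<subseteq> U" and x: "x \<in> square (Str S) I V"
  shows "h V x = \<zero>\<^bsub>Sec K.Q V\<^esub>"
proof -
  interpret KQ: module_presheaf S K.Q by (rule K.Q_module)
  interpret MV: abelian_group "KQ.M V" by (rule KQ.abelian) fact
  show ?thesis
    using x unfolding square_def
  proof induction
    case (prod i j)
    have "h V (i \<odot>\<^bsub>R V\<^esub> j) = i \<odot>\<^bsub>Sec K.Q V\<^esub> h V j"
      using morD(3)[OF h V, of i j] prod V by (simp add: I.sub_carrier)
    also have "\<dots> = \<zero>\<^bsub>Sec K.Q V\<^esub>"
      using V prod morD(1)[OF h V, of j] by (intro K.ideal_smult_zero) (auto simp: incl)
    finally show ?case using prod V by (simp add: smult_mult I.sub_carrier)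
  next
    case (sum s t)
    then have "s \<in> I V" "t \<in> I V" using I.sq.sub_carrier[OF V(1)] by (auto simp: square_def)
    then show ?case using sum morD(2)[OF h V, of s t] by simp
  qed
qed

section \<open>The sheaf Q\<close>

sublocale ideal_pair \<subseteq> IK: ideal_inclusion S I "ideal_sum S I J"
  by unfold_locales (rule I_sub_K)

sublocale ideal_pair \<subseteq> JK: ideal_inclusion S J "ideal_sum S I J"
  by unfold_locales (rule J_sub_K)

context ideal_pair
begin

abbreviation H where "H \<equiv> hom_conormal S I J"
abbreviation OJ where "OJ \<equiv> subpresheaf (Str S) J"

text \<open>A section of Hom (I_Y / I_Y^2, O_Z) viewed as a homomorphism on I_Y itself; such
  sections are compared through it from here on.\<close>

definition hat where "hat \<xi> V f = \<xi> V (J.sq.pr V f)"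

lemma conormal_J: "conormal S (Str S) J = J.sq.Q"
  by (simp add: conormal_def)

lemma H_eq: "H = sheaf_hom S J.sq.Q K.Q"
  by (simp add: hom_conormal_def conormal_def)

lemma KQ_module: "module_presheaf S K.Q"
  by (rule K.Q_module)

lemma JsqQ_module: "module_presheaf S J.sq.Q"
  by (rule J.sq.Q_module)

lemma OJ_module: "module_presheaf S OJ"
  by (rule J.subpresheaf_module)

text \<open>Equal classes in the sheafified quotient have a difference in the square of J only
  locally, so the comparison is made on small open sets and glued.\<close>

lemma hom_J_cong:
  assumes h: "morphism_on S U OJ K.Q h" and V: "opn V" "V \<subseteq> U"
    and x: "x \<in> J V" and y: "y \<in> J V" and eq: "J.sq.pr V x = J.sq.pr V y"
  shows "h V x = h V y"
proof (rule K.Q_eq_localI)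
  interpret KQ: module_presheaf S K.Q by (rule KQ_module)
  show "h V x \<in> extensional V" "h V y \<in> extensional V"
    using morD(1)[OF h V] x y by (auto intro: K.Q_extensional)
  fix p assume "p \<in> V"
  then obtain W where W: "opn W" "p \<in> W" "W \<subseteq> V" "rho V W x \<ominus>\<^bsub>Sec OJ W\<^esub> rho V W y \<in> square (Str S) J W"
    using J.sq.pr_eq_iff[of V x y] V x y eq by auto
  have WU: "W \<subseteq> U" using W V by auto
  interpret MW: abelian_group "KQ.M W" by (rule KQ.abelian) fact
  have rc: "rho V W x \<in> J W" "rho V W y \<in> J W" using W V x y by (auto intro: J.sub_res)
  have "h W (rho V W x) \<ominus>\<^bsub>Sec K.Q W\<^esub> h W (rho V W y) = h W (rho V W x \<ominus>\<^bsub>Sec OJ W\<^esub> rho V W y)"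
    using W WU rc by (intro J.sq.morphism_minus[OF KQ_module h, symmetric]) auto
  also have "\<dots> = \<zero>\<^bsub>Sec K.Q W\<^esub>"
    using W WU by (intro JK.vanish_on_square[OF h])
  finally have "h W (rho V W x) = h W (rho V W y)"
    using W WU rc morD(1)[OF h W(1) WU] by (simp add: MW.minus_eq_zero_iff)
  then show "\<exists>W. p \<in> W \<and> restrict (h V x) W = restrict (h V y) W"
    using morD(4)[OF h V(1) W(1,3) V(2), of x] morD(4)[OF h V(1) W(1,3) V(2), of y] x y W(2)
    by auto
qed

lemma hat_morphism:
  assumes "\<xi> \<in> carrier (Sec H U)"
  shows "morphism_on S U OJ K.Q (hat \<xi>)"
proof -
  have \<xi>: "morphism_on S U J.sq.Q K.Q \<xi>" using assms by (simp add: H_eq sheaf_hom_carrier)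
  show ?thesis
  proof (rule morphism_onI)
    fix V x assume V: "opn V" "V \<subseteq> U" "x \<in> carrier (Sec OJ V)"
    then show "hat \<xi> V x \<in> carrier (Sec K.Q V)"
      unfolding hat_def by (intro morD(1)[OF \<xi>] J.sq.pr_closed)
    fix y assume y: "y \<in> carrier (Sec OJ V)"
    then show "hat \<xi> V (x \<oplus>\<^bsub>Sec OJ V\<^esub> y) = hat \<xi> V x \<oplus>\<^bsub>Sec K.Q V\<^esub> hat \<xi> V y"
      unfolding hat_def J.sq.pr_add[OF V(1,3) y] using V by (intro morD(2)[OF \<xi>] J.sq.pr_closed)
  next
    fix V a x assume V: "opn V" "V \<subseteq> U" "a \<in> \<O> V" "x \<in> carrier (Sec OJ V)"
    then show "hat \<xi> V (a \<odot>\<^bsub>Sec OJ V\<^esub> x) = a \<odot>\<^bsub>Sec K.Q V\<^esub> hat \<xi> V x"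
      unfolding hat_def J.sq.pr_smult[OF V(1,3,4)] by (intro morD(3)[OF \<xi>] J.sq.pr_closed)
  next
    fix V W x assume V: "opn V" "opn W" "W \<subseteq> V" "V \<subseteq> U" "x \<in> carrier (Sec OJ V)"
    then show "hat \<xi> W (Res OJ V W x) = Res K.Q V W (hat \<xi> V x)"
      using morD(4)[OF \<xi> V(1-4), of "J.sq.pr V x"]
      unfolding hat_def J.sq.pr_res[OF V(1,2,3,5), symmetric] by simp
  qed
qed

text \<open>Sections of I_Y / I_Y^2 are locally classes of sections of I_Y, so passing to
  \<open>hat\<close> loses nothing.\<close>

lemma hom_ext:
  assumes \<xi>: "\<xi> \<in> carrier (Sec H U)" and \<psi>: "\<psi> \<in> carrier (Sec H U)"
    and eq: "\<And>V f. opn V \<Longrightarrow> V \<subseteq> U \<Longrightarrow> f \<in> J V \<Longrightarrow> hat \<xi> V f = hat \<psi> V f"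
  shows "\<xi> = \<psi>"
proof (rule sheaf_hom_eqI[where F=J.sq.Q and G=K.Q])
  show "\<xi> \<in> carrier (Sec (sheaf_hom S J.sq.Q K.Q) U)" "\<psi> \<in> carrier (Sec (sheaf_hom S J.sq.Q K.Q) U)"
    using \<xi> \<psi> by (simp_all add: H_eq)
  then have m: "morphism_on S U J.sq.Q K.Q \<xi>" "morphism_on S U J.sq.Q K.Q \<psi>"
    by (simp_all add: sheaf_hom_carrier)
  fix V \<mu> assume V: "opn V" "V \<subseteq> U" and \<mu>: "\<mu> \<in> carrier (Sec J.sq.Q V)"
  show "\<xi> V \<mu> = \<psi> V \<mu>"
  proof (rule K.Q_eq_localI)
    show "\<xi> V \<mu> \<in> extensional V" "\<psi> V \<mu> \<in> extensional V"
      using morD(1)[OF m(1) V \<mu>] morD(1)[OF m(2) V \<mu>] by (auto intro: K.Q_extensional)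
    fix p assume "p \<in> V"
    with \<mu> obtain W f where W: "opn W" "p \<in> W" "W \<subseteq> V" "f \<in> carrier (Sec OJ W)" "restrict \<mu> W = J.sq.pr W f"
      by (rule J.sq.sec_local)
    have "restrict (\<xi> V \<mu>) W = \<xi> W (J.sq.pr W f)" "restrict (\<psi> V \<mu>) W = \<psi> W (J.sq.pr W f)"
      using morD(4)[OF m(1) V(1) W(1,3) V(2) \<mu>] morD(4)[OF m(2) V(1) W(1,3) V(2) \<mu>] W(5) by simp_all
    moreover have "\<xi> W (J.sq.pr W f) = \<psi> W (J.sq.pr W f)"
      using eq[of W f] W V by (simp add: hat_def)
    ultimately show "\<exists>W. p \<in> W \<and> restrict (\<xi> V \<mu>) W = restrict (\<psi> V \<mu>) W"
      using W(2) by auto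
  qed
qed

text \<open>Inverse to \<open>hat\<close>. It has the shape of \<open>normal_to_hom\<close>, which
  is the instance where \<open>h\<close> is \<eta> followed by O_Y -> O_Z.\<close>

definition descend where
  "descend U h = hom_restrict S (conormal S (Str S) J) U (quot_descend OJ h)"

lemma descend:
  assumes U: "opn U" and h: "morphism_on S U OJ K.Q h"
  shows descend_closed: "descend U h \<in> carrier (Sec H U)"
    and hat_descend: "opn V \<Longrightarrow> V \<subseteq> U \<Longrightarrow> f \<in> J V \<Longrightarrow> hat (descend U h) V f = h V f"
proof -
  interpret JsqQ: module_presheaf S J.sq.Q by (rule JsqQ_module)
  obtain k where k: "morphism_on S U J.sq.Q K.Q k"
    and kh: "\<And>V y. opn V \<Longrightarrow> V \<subseteq> U \<Longrightarrow> y \<in> carrier (Sec OJ V) \<Longrightarrow> k V (J.sq.pr V y) = h V y"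
  proof (rule K.factor_through_local_surjection[where A=J.sq.Q and B=OJ and \<pi>=J.sq.pr and h=h and U=U])
    show "\<exists>W y. opn W \<and> p \<in> W \<and> W \<subseteq> V \<and> y \<in> carrier (Sec OJ W) \<and> J.sq.pr W y = Res J.sq.Q V W x"
      if "x \<in> carrier (Sec J.sq.Q V)" "p \<in> V" for V x p
      using J.sq.sec_local[OF that] by (metis J.sq.Q_res)
    show "h V y = h V y'"
      if "opn V" "V \<subseteq> U" "y \<in> carrier (Sec OJ V)" "y' \<in> carrier (Sec OJ V)" "J.sq.pr V y = J.sq.pr V y'" for V y y'
      using that by (intro hom_J_cong[OF h]) auto
  qed (use U h JsqQ_module J.sq.pr_morphism in \<open>auto simp: J.sub_add J.sub_smult J.sub_res\<close>)
  \<comment> \<open>Here \<open>k\<close> comes from the factorization lemma, while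
    \<open>quot_descend\<close> is a formula over all representatives; near the point both take the
    value of \<open>h\<close> on a lift of the section.\<close>
  have "quot_descend OJ h V \<mu> = k V \<mu>" if V: "opn V" "V \<subseteq> U" and \<mu>: "\<mu> \<in> carrier (Sec J.sq.Q V)" for V \<mu>
  proof (rule K.Q_eqI[of _ V])
    show "k V \<mu> \<in> extensional V" using morD(1)[OF k V \<mu>] by (rule K.Q_extensional)
    fix p assume p: "p \<in> V"
    obtain W f where W: "opn W" "p \<in> W" "W \<subseteq> V" "f \<in> carrier (Sec OJ W)" "restrict \<mu> W = J.sq.pr W f"
      using \<mu> p by (rule J.sq.sec_local)
    have \<mu>p: "\<mu> p = J.sq.g p W f" using W(5,2) by (rule J.sq.pr_apply_eq)
    have "(\<Union>(W', s)\<in>J.sq.g p W f. h (V \<inter> W') (Res OJ W' (V \<inter> W') s) p) = k V \<mu> p"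
    proof (rule J.sq.UN_germ[OF W(1,2,4)])
      fix W' s assume W': "opn W'" "p \<in> W'" "s \<in> carrier (Sec OJ W')" "J.sq.g p W' s = J.sq.g p W f"
      then obtain N where N: "opn N" "p \<in> N" "N \<subseteq> W'" "N \<subseteq> W"
        "Res OJ W' N s \<ominus>\<^bsub>Sec OJ N\<^esub> Res OJ W N f \<in> square (Str S) J N"
        using W J.sq.germ_iff[of W' W p s f] by (auto simp: J.sq.germ_eq_def)
      define P where "P = V \<inter> W'"
      have P: "opn P" "P \<subseteq> V" "P \<subseteq> W'" "N \<subseteq> P" "P \<subseteq> U" "N \<subseteq> U" "p \<in> P" "N \<subseteq> V"
        using V W W' N p by (auto simp: P_def)
      have "N \<subseteq> N" "opn N" by (auto simp: N)
      have "J.sq.pr N (rho W' N s) = J.sq.pr N (rho W N f)"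
      proof (rule J.sq.pr_eq_iff[THEN iffD2, rule_format])
        fix q assume "q \<in> N"
        moreover have "Res OJ N N (Res OJ W' N s) = Res OJ W' N s" "Res OJ N N (Res OJ W N f) = Res OJ W N f"
          using N W W' by (simp_all add: str_res_id J.sub_res J.sub_carrier)
        ultimately show "\<exists>N'. opn N' \<and> q \<in> N' \<and> N' \<subseteq> N \<and>
          Res OJ N N' (rho W' N s) \<ominus>\<^bsub>Sec OJ N'\<^esub> Res OJ N N' (rho W N f) \<in> square (Str S) J N'"
          using N by (intro exI[of _ N]) simp
      qed (use N W W' in \<open>auto simp: J.sub_res\<close>)
      also have "\<dots> = restrict \<mu> N"
      proof -
        have "restrict \<mu> N = restrict (restrict \<mu> W) N" using N(4) by (simp add: Int_absorb1)
        then show ?thesis unfolding W(5) using N W J.sq.pr_res[of W N f] by simp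
      qed
      finally have *: "J.sq.pr N (rho W' N s) = restrict \<mu> N" .
      have "restrict (h P (rho W' P s)) N = h N (rho W' N s)"
        using morD(4)[OF h P(1) N(1) P(4,5), of "rho W' P s"] P N W' by (simp add: J.sub_res str_res_res J.sub_carrier)
      also have "\<dots> = k N (restrict \<mu> N)"
        using kh[OF N(1) P(6), of "rho W' N s"] N W' * by (simp add: J.sub_res)
      also have "\<dots> = restrict (k V \<mu>) N"
        using morD(4)[OF k V(1) N(1) P(8) V(2) \<mu>] by simp
      finally have "h P (rho W' P s) p = k V \<mu> p"
        using N(2) by (metis restrict_apply')
      then show "h (V \<inter> W') (Res OJ W' (V \<inter> W') s) p = k V \<mu> p" by (simp add: P_def)
    qed
    then show "quot_descend OJ h V \<mu> p = k V \<mu> p"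
      using p by (simp add: quot_descend_def \<mu>p)
  qed (simp add: quot_descend_def)
  then have eq: "descend U h = hom_restrict S J.sq.Q U k"
    unfolding descend_def conormal_J by (rule hom_restrict_cong)
  show "descend U h \<in> carrier (Sec H U)"
    unfolding eq H_eq by (rule hom_restrict_morphism[OF JsqQ_module k])
  show "hat (descend U h) V f = h V f" if "opn V" "V \<subseteq> U" "f \<in> J V"
    using that kh by (simp add: eq hat_def)
qed

lemma hat_ops:
  assumes "opn V" "V \<subseteq> U" "f \<in> J V"
  shows "hat (\<xi> \<oplus>\<^bsub>Sec H U\<^esub> \<psi>) V f = hat \<xi> V f \<oplus>\<^bsub>Sec K.Q V\<^esub> hat \<psi> V f"
    and "hat (a \<odot>\<^bsub>Sec H U\<^esub> \<xi>) V f = rho U V a \<odot>\<^bsub>Sec K.Q V\<^esub> hat \<xi> V f"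
    and "hat \<zero>\<^bsub>Sec H U\<^esub> V f = \<zero>\<^bsub>Sec K.Q V\<^esub>"
    and "hat (Res H U' U \<xi>) V f = hat \<xi> V f"
  using assms by (simp_all add: hat_def H_eq sheaf_hom_ops)

lemma H_module: "module_presheaf S H"
  unfolding H_eq by (rule sheaf_hom_module[OF JsqQ_module KQ_module])

definition vanishing where
  "vanishing U \<xi> \<longleftrightarrow> (\<forall>V. opn V \<and> V \<subseteq> U \<longrightarrow> (\<forall>f\<in>I V \<inter> J V. hat \<xi> V f = \<zero>\<^bsub>Sec K.Q V\<^esub>))"

lemma conormal_restriction_eq:
  "conormal_restriction S I J = quot_map S (subpresheaf I.Q IK.rel) (square I.Q IK.rel) I.pr"
  by (simp add: conormal_restriction_def Let_def)

lemma pr_rel_morphism: "sheaf_morphism S OJ (subpresheaf I.Q IK.rel) I.pr"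
  by (rule morphism_onI) (auto simp: IK.pr_rel_iff J.sub_carrier J_sub_K I.pr_add I.pr_smult I.pr_res)

lemma pr_rel_square:
  assumes "opn V" "x \<in> square (Str S) J V"
  shows "I.pr V x \<in> square I.Q IK.rel V"
  using IK.pr_square[of V "J V" x] assms J_sub_K by (auto simp: square_def)

lemma conormal_restriction_morphism: "sheaf_morphism S J.sq.Q IK.relsq.Q (conormal_restriction S I J)"
  unfolding conormal_restriction_eq
  by (rule quot_map_morphism[OF J.sq.submodule_presheaf_axioms IK.relsq.submodule_presheaf_axioms pr_rel_morphism pr_rel_square])

lemma conormal_restriction_pr:
  assumes "opn V" "f \<in> J V"
  shows "conormal_restriction S I J V (J.sq.pr V f) = IK.relsq.pr V (I.pr V f)"
proof -
  have "restrict (conormal_restriction S I J V (J.sq.pr V f)) V = IK.relsq.pr V (I.pr V f)"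
    unfolding conormal_restriction_eq
    by (rule quot_map_local[OF J.sq.submodule_presheaf_axioms IK.relsq.submodule_presheaf_axioms pr_rel_morphism])
      (use assms pr_rel_square in \<open>auto simp: extensional_restrict\<close>)
  moreover have "conormal_restriction S I J V (J.sq.pr V f) \<in> extensional V"
    by (simp add: conormal_restriction_eq quot_map_def)
  ultimately show ?thesis by (simp add: extensional_restrict)
qed

end

lemma morphism_on_comp:
  "morphism_on S U F G \<psi> \<Longrightarrow> morphism_on S U G H \<phi> \<Longrightarrow> morphism_on S U F H (\<lambda>V x. \<phi> V (\<psi> V x))"
  by (rule morphism_onI) (auto simp: morD)

lemma (in submodule_presheaf) subpresheaf_minus:
  assumes "opn U" "x \<in> G U" "y \<in> G U"
  shows "x \<ominus>\<^bsub>Sec (subpresheaf F G) U\<^esub> y = x \<ominus>\<^bsub>M U\<^esub> y"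
proof -
  interpret sub: module_presheaf S "subpresheaf F G" by (rule subpresheaf_module)
  have "\<ominus>\<^bsub>Sec (subpresheaf F G) U\<^esub> y = \<ominus>\<^bsub>M U\<^esub> y"
    using sub.smult_minus_one[OF assms(1), of y] smult_minus_one[OF assms(1), of y] assms
    by (simp add: sub_carrier)
  then show ?thesis by (simp add: a_minus_def)
qed

context ideal_pair
begin

lemma openin_sub_top: "opn U \<Longrightarrow> U \<subseteq> X"
  by (rule openin_subset)

lemma rel_conormal_eq: "rel_conormal S I J = IK.relsq.Q"
  by (simp add: rel_conormal_def conormal_def)

lemma hom_pullback_carrier:
  assumes U: "opn U" and \<phi>: "\<phi> \<in> carrier (Sec (hom_rel_conormal S I J) U)"
  shows "hom_pullback S I J U \<phi> \<in> carrier (Sec H U)"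
proof -
  have "morphism_on S U IK.relsq.Q K.Q \<phi>"
    using \<phi> by (simp add: hom_rel_conormal_def rel_conormal_eq sheaf_hom_carrier)
  then have "morphism_on S U J.sq.Q K.Q (\<lambda>V \<mu>. \<phi> V (conormal_restriction S I J V \<mu>))"
    using morphism_on_subset[OF conormal_restriction_morphism openin_sub_top[OF U]] by (rule morphism_on_comp[rotated])
  then show ?thesis
    unfolding hom_pullback_def conormal_J H_eq by (rule hom_restrict_morphism[OF JsqQ_module])
qed

lemma hat_pullback:
  assumes "opn V" "V \<subseteq> U" "f \<in> J V"
  shows "hat (hom_pullback S I J U \<phi>) V f = \<phi> V (IK.relsq.pr V (I.pr V f))"
  using assms by (simp add: hat_def hom_pullback_def conormal_J conormal_restriction_pr)

text \<open>In O_P / I a section a + b of I + J equals b, so J maps locally onto I_{Z/X} = (I + J) /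
  I.\<close>

lemma rel_lift:
  assumes "opn U" "\<mu> \<in> IK.rel U" "p \<in> U"
  shows "\<exists>V f. opn V \<and> p \<in> V \<and> V \<subseteq> U \<and> f \<in> J V \<and> restrict \<mu> V = I.pr V f"
proof -
  obtain V s where V: "opn V" "p \<in> V" "V \<subseteq> U" "s \<in> K V" "restrict \<mu> V = I.pr V s"
    using assms by (auto simp: IK.mem_rel_ideal_iff)
  obtain W a b where W: "opn W" "p \<in> W" "W \<subseteq> V" "a \<in> I W" "b \<in> J W" "rho V W s = a \<oplus>\<^bsub>R W\<^esub> b"
    using V(4,2) by (rule ideal_sumE)
  interpret cring "R W" by (rule cring) fact
  have c: "a \<in> \<O> W" "b \<in> \<O> W"
    using W by (simp_all add: I.sub_carrier J.sub_carrier)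
  have "restrict \<mu> W = restrict (restrict \<mu> V) W" using W(3) by (simp add: Int_absorb1)
  also have "\<dots> = I.pr W (a \<oplus>\<^bsub>R W\<^esub> b)"
    unfolding V(5) W(6)[symmetric] using V W by (intro I.pr_res) (auto simp: K.sub_carrier)
  also have "\<dots> = I.pr W b"
  proof (rule I.pr_eq_iff'[THEN iffD2])
    have "a \<oplus>\<^bsub>R W\<^esub> b \<ominus>\<^bsub>R W\<^esub> b = a" using c by (simp add: a_minus_def a_assoc r_neg)
    then show "a \<oplus>\<^bsub>R W\<^esub> b \<ominus>\<^bsub>R W\<^esub> b \<in> I W" using W(4) by simp
  qed (use W c in auto)
  finally show ?thesis using V W by (intro exI[of _ W] exI[of _ b]) auto
qed

text \<open>Both factors of each product lift by \<open>rel_lift\<close>. This determines the kernel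
  of I_Y -> I_{Z/X} / I_{Z/X}^2.\<close>

lemma square_rel_lift:
  assumes U: "opn U" and \<tau>: "\<tau> \<in> square I.Q IK.rel U" and p: "p \<in> U"
  shows "\<exists>V c. opn V \<and> p \<in> V \<and> V \<subseteq> U \<and> c \<in> square (Str S) J V \<and> restrict \<tau> V = I.pr V c"
  using \<tau> unfolding square_def[of I.Q]
proof induction
  case (prod i j)
  obtain V f where V: "opn V" "p \<in> V" "V \<subseteq> U" "f \<in> J V" "restrict i V = I.pr V f"
    using rel_lift[OF U prod(1) p] by blast
  obtain W g where W: "opn W" "p \<in> W" "W \<subseteq> U" "g \<in> J W" "restrict j W = I.pr W g"
    using rel_lift[OF U prod(2) p] by blast
  define P where "P = V \<inter> W"
  have P: "opn P" "p \<in> P" "P \<subseteq> V" "P \<subseteq> W" "P \<subseteq> U" using V W by (auto simp: P_def)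
  have r: "rho V P f \<in> J P" "rho W P g \<in> J P" using V W P by (auto intro: J.sub_res)
  have "restrict i P = restrict (restrict i V) P" "restrict j P = restrict (restrict j W) P"
    using P by (simp_all add: Int_absorb1)
  then have "restrict i P = I.pr P (rho V P f)" "restrict j P = I.pr P (rho W P g)"
    unfolding V(5) W(5) using P V W by (simp_all add: I.pr_res J.sub_carrier)
  then have "restrict (i \<otimes>\<^bsub>Sec I.Q U\<^esub> j) P = I.pr P (rho V P f \<otimes>\<^bsub>R P\<^esub> rho W P g)"
    using P r by (simp add: I.restrict_mult I.pr_mult J.sub_carrier)
  moreover have "rho V P f \<otimes>\<^bsub>R P\<^esub> rho W P g \<in> square (Str S) J P"
    using r by (simp add: square_def ideal_prod.prod)
  ultimately show ?case
    using P by blast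
next
  case (sum s t)
  obtain V c where V: "opn V" "p \<in> V" "V \<subseteq> U" "c \<in> square (Str S) J V" "restrict s V = I.pr V c"
    using sum by blast
  obtain W d where W: "opn W" "p \<in> W" "W \<subseteq> U" "d \<in> square (Str S) J W" "restrict t W = I.pr W d"
    using sum by blast
  define P where "P = V \<inter> W"
  have P: "opn P" "p \<in> P" "P \<subseteq> V" "P \<subseteq> W" "P \<subseteq> U" using V W by (auto simp: P_def)
  have r: "rho V P c \<in> square (Str S) J P" "rho W P d \<in> square (Str S) J P"
    using V W P J.sq.sub_res by auto
  have cc: "c \<in> \<O> V" "d \<in> \<O> W" "rho V P c \<in> \<O> P" "rho W P d \<in> \<O> P"
    using V(1,4) W(1,4) r P(1) J.sq.sub_carrier[of _ _] J.sub_carrier by auto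
  have "restrict s P = restrict (restrict s V) P" "restrict t P = restrict (restrict t W) P"
    using P by (simp_all add: Int_absorb1)
  then have *: "restrict s P = I.pr P (rho V P c)" "restrict t P = I.pr P (rho W P d)"
    unfolding V(5) W(5) using P V W cc by (simp_all add: I.pr_res)
  have "restrict (s \<oplus>\<^bsub>Sec I.Q U\<^esub> t) P = restrict s P \<oplus>\<^bsub>Sec I.Q P\<^esub> restrict t P"
    using P(5) by (auto simp: I.Q_add fun_eq_iff)
  then have "restrict (s \<oplus>\<^bsub>Sec I.Q U\<^esub> t) P = I.pr P (rho V P c \<oplus>\<^bsub>R P\<^esub> rho W P d)"
    using P cc * by (simp add: I.pr_add)
  then show ?case
    using P r J.sq.sub_add[of P "rho V P c" "rho W P d"] by (intro exI[of _ P]) auto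
qed

lemma vanishingD:
  "vanishing U \<xi> \<Longrightarrow> opn V \<Longrightarrow> V \<subseteq> U \<Longrightarrow> f \<in> I V \<Longrightarrow> f \<in> J V \<Longrightarrow> hat \<xi> V f = \<zero>\<^bsub>Sec K.Q V\<^esub>"
  by (auto simp: vanishing_def)

text \<open>If y and y' have the same class in I_{Z/X} / I_{Z/X}^2, then locally y - y' = d + c with
  d in I \<inter> J and c in J^2. The first is killed by assumption, the second because \<xi> has
  values in O_Z, so \<xi> depends only on the class.\<close>

lemma vanishing_factors:
  assumes U: "opn U" and \<xi>: "\<xi> \<in> carrier (Sec H U)" and van: "vanishing U \<xi>"
  shows "\<xi> \<in> pullback_image S I J U"
proof -
  interpret relsqQ: module_presheaf S IK.relsq.Q by (rule IK.relsq.Q_module)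
  interpret KQ: module_presheaf S K.Q by (rule KQ_module)
  let ?\<pi> = "\<lambda>V f. IK.relsq.pr V (I.pr V f)"
  have \<pi>: "morphism_on S U OJ IK.relsq.Q ?\<pi>"
    using morphism_on_subset[OF pr_rel_morphism openin_sub_top[OF U]] IK.relsq.pr_morphism by (rule morphism_on_comp)
  note h = hat_morphism[OF \<xi>]
  obtain k where k: "morphism_on S U IK.relsq.Q K.Q k"
    and kh: "\<And>V y. opn V \<Longrightarrow> V \<subseteq> U \<Longrightarrow> y \<in> carrier (Sec OJ V) \<Longrightarrow> k V (?\<pi> V y) = hat \<xi> V y"
  proof (rule K.factor_through_local_surjection[where A=IK.relsq.Q and B=OJ and \<pi>="?\<pi>" and h="hat \<xi>" and U=U])
    show "\<exists>W y. opn W \<and> p \<in> W \<and> W \<subseteq> V \<and> y \<in> carrier (Sec OJ W) \<and> ?\<pi> W y = Res IK.relsq.Q V W x"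
      if x: "x \<in> carrier (Sec IK.relsq.Q V)" "p \<in> V" for V x p
    proof -
      obtain W s where W: "opn W" "p \<in> W" "W \<subseteq> V" "s \<in> IK.rel W" "restrict x W = IK.relsq.pr W s"
        using IK.relsq.sec_local[OF x] by auto
      obtain N f where N: "opn N" "p \<in> N" "N \<subseteq> W" "f \<in> J N" "restrict s N = I.pr N f"
        using rel_lift[OF W(1,4,2)] by blast
      have "restrict x N = restrict (restrict x W) N" using N(3) by (simp add: Int_absorb1)
      also have "\<dots> = IK.relsq.pr N (restrict s N)"
        unfolding W(5) using IK.relsq.pr_res[of W N s] N W by simp
      finally have "restrict x N = ?\<pi> N f" using N(5) by simp
      then show ?thesis using N W by (intro exI[of _ N] exI[of _ f]) auto
    qed
    show "hat \<xi> V y = hat \<xi> V y'"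
      if V: "opn V" "V \<subseteq> U" and y: "y \<in> carrier (Sec OJ V)" "y' \<in> carrier (Sec OJ V)" and eq: "?\<pi> V y = ?\<pi> V y'" for V y y'
    proof (rule K.Q_eq_localI)
      show "hat \<xi> V y \<in> extensional V" "hat \<xi> V y' \<in> extensional V"
        using morD(1)[OF h V] y by (auto intro: K.Q_extensional)
      fix p assume p: "p \<in> V"
      have yJ: "y \<in> J V" "y' \<in> J V" and yR: "y \<in> \<O> V" "y' \<in> \<O> V"
        using y V by (auto simp: J.sub_carrier)
      have relc: "I.pr V y \<in> IK.rel V" "I.pr V y' \<in> IK.rel V"
        using V y by (simp_all add: IK.pr_rel_iff J.sub_carrier J_sub_K)
      then obtain W where W: "opn W" "p \<in> W" "W \<subseteq> V"
        and sq: "restrict (I.pr V y) W \<ominus>\<^bsub>Sec (subpresheaf I.Q IK.rel) W\<^esub> restrict (I.pr V y') W \<in> square I.Q IK.rel W"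
        using IK.relsq.pr_eq_iff[of V "I.pr V y" "I.pr V y'"] V eq p by auto
      define z where "z = rho V W y \<ominus>\<^bsub>R W\<^esub> rho V W y'"
      have rJ: "rho V W y \<in> J W" "rho V W y' \<in> J W" using yJ V W by (auto intro: J.sub_res)
      have zJ: "z \<in> J W" unfolding z_def using rJ W by (intro J.sub_minus) auto
      have "I.pr W z = restrict (I.pr V y) W \<ominus>\<^bsub>Sec (subpresheaf I.Q IK.rel) W\<^esub> restrict (I.pr V y') W"
        using J.sq.morphism_minus[OF IK.relsq.module_presheaf_axioms pr_rel_morphism W(1) openin_sub_top[OF W(1)], of "rho V W y" "rho V W y'"]
          rJ V W yR by (simp add: z_def I.pr_res J.subpresheaf_minus)
      then have "I.pr W z \<in> square I.Q IK.rel W" using sq by simp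
      then obtain N c where N: "opn N" "p \<in> N" "N \<subseteq> W" "c \<in> square (Str S) J N" "restrict (I.pr W z) N = I.pr N c"
        using square_rel_lift[OF W(1) _ W(2)] by blast
      have NU: "N \<subseteq> U" "N \<subseteq> V" "W \<subseteq> U" using N W V by auto
      have cJ: "c \<in> J N" using J.sq.sub_carrier[OF N(1,4)] by simp
      have zN: "rho W N z \<in> J N" using zJ N W by (auto intro: J.sub_res)
      have "I.pr N (rho W N z) = I.pr N c"
        using N(5) I.pr_res[OF W(1) N(1,3), of z] zJ W by (simp add: J.sub_carrier)
      then have dI: "rho W N z \<ominus>\<^bsub>R N\<^esub> c \<in> I N"
        using I.pr_eq_iff'[OF N(1), of "rho W N z" c] zN cJ N(1) by (simp add: J.sub_carrier)
      have dJ: "rho W N z \<ominus>\<^bsub>R N\<^esub> c \<in> J N" using N zN cJ by (intro J.sub_minus) auto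
      interpret KN: abelian_group "KQ.M N" by (rule KQ.abelian) fact
      interpret RN: cring "R N" by (rule cring) fact
      have c1: "rho W N z \<in> \<O> N" "c \<in> \<O> N" using zN cJ N by (simp_all add: J.sub_carrier)
      have "hat \<xi> N (rho W N z) = hat \<xi> N ((rho W N z \<ominus>\<^bsub>R N\<^esub> c) \<oplus>\<^bsub>R N\<^esub> c)"
        using c1 by (simp add: a_minus_def RN.a_assoc RN.l_neg)
      also have "\<dots> = hat \<xi> N (rho W N z \<ominus>\<^bsub>R N\<^esub> c) \<oplus>\<^bsub>Sec K.Q N\<^esub> hat \<xi> N c"
        using morD(2)[OF h N(1) NU(1), of "rho W N z \<ominus>\<^bsub>R N\<^esub> c" c] dJ cJ by simp
      also have "\<dots> = \<zero>\<^bsub>Sec K.Q N\<^esub>"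
        using vanishingD[OF van N(1) NU(1) dI dJ] JK.vanish_on_square[OF h N(1) NU(1) N(4)] by simp
      finally have "hat \<xi> N (rho W N z) = \<zero>\<^bsub>Sec K.Q N\<^esub>" .
      moreover have "rho W N z = rho V N y \<ominus>\<^bsub>R N\<^esub> rho V N y'"
        using V W N NU yR by (simp add: z_def I.res_minus str_res_res)
      moreover have rN: "rho V N y \<in> J N" "rho V N y' \<in> J N" using yJ V N NU by (auto intro: J.sub_res)
      moreover have "rho V N y \<ominus>\<^bsub>Sec OJ N\<^esub> rho V N y' = rho V N y \<ominus>\<^bsub>R N\<^esub> rho V N y'"
        using N(1) rN by (rule J.subpresheaf_minus)
      ultimately have "hat \<xi> N (rho V N y) \<ominus>\<^bsub>Sec K.Q N\<^esub> hat \<xi> N (rho V N y') = \<zero>\<^bsub>Sec K.Q N\<^esub>"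
        using J.sq.morphism_minus[OF KQ_module h N(1) NU(1), of "rho V N y" "rho V N y'"] by simp
      then have "hat \<xi> N (rho V N y) = hat \<xi> N (rho V N y')"
        using rN N NU morD(1)[OF h N(1) NU(1)] by (simp add: KN.minus_eq_zero_iff)
      then show "\<exists>N. p \<in> N \<and> restrict (hat \<xi> V y) N = restrict (hat \<xi> V y') N"
        using morD(4)[OF h V(1) N(1) NU(2) V(2), of y] morD(4)[OF h V(1) N(1) NU(2) V(2), of y'] y N(2)
        by auto
    qed
  qed (use U h \<pi> IK.relsq.Q_module in \<open>auto simp: J.sub_add J.sub_smult J.sub_res\<close>)
  let ?\<phi> = "hom_restrict S IK.relsq.Q U k"
  have \<phi>: "?\<phi> \<in> carrier (Sec (hom_rel_conormal S I J) U)"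
    unfolding hom_rel_conormal_def rel_conormal_eq by (rule hom_restrict_morphism[OF IK.relsq.Q_module k])
  have "hom_pullback S I J U ?\<phi> = \<xi>"
  proof (rule hom_ext[OF hom_pullback_carrier[OF U \<phi>] \<xi>])
    fix V f assume V: "opn V" "V \<subseteq> U" "f \<in> J V"
    have "IK.relsq.pr V (I.pr V f) \<in> carrier (Sec IK.relsq.Q V)"
      using V by (intro IK.relsq.pr_closed) (auto simp: IK.pr_rel_iff J.sub_carrier J_sub_K)
    then show "hat (hom_pullback S I J U ?\<phi>) V f = hat \<xi> V f"
      using V kh[of V f] by (simp add: hat_pullback)
  qed
  then show ?thesis using \<phi> by (auto simp: pullback_image_def)
qed

text \<open>Turns membership in the image of Hom (I_{Z/X} / I_{Z/X}^2, O_Z) into a condition on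
  values, which passes to smaller open sets and can be checked locally
  (\<open>vanishing_local\<close>).\<close>

lemma pullback_image_iff:
  assumes U: "opn U"
  shows "\<xi> \<in> pullback_image S I J U \<longleftrightarrow> \<xi> \<in> carrier (Sec H U) \<and> vanishing U \<xi>"
proof
  assume "\<xi> \<in> pullback_image S I J U"
  then obtain \<phi> where \<phi>: "\<phi> \<in> carrier (Sec (hom_rel_conormal S I J) U)" and \<xi>: "\<xi> = hom_pullback S I J U \<phi>"
    by (auto simp: pullback_image_def)
  have m: "morphism_on S U IK.relsq.Q K.Q \<phi>"
    using \<phi> by (simp add: hom_rel_conormal_def rel_conormal_eq sheaf_hom_carrier)
  interpret relsqQ: module_presheaf S IK.relsq.Q by (rule IK.relsq.Q_module)
  have "hat \<xi> V f = \<zero>\<^bsub>Sec K.Q V\<^esub>" if V: "opn V" "V \<subseteq> U" "f \<in> I V" "f \<in> J V" for V f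
  proof -
    have "I.pr V f = \<zero>\<^bsub>Sec (subpresheaf I.Q IK.rel) V\<^esub>" using V by (simp add: I.pr_zero_iff' I.sub_carrier)
    then have "IK.relsq.pr V (I.pr V f) = \<zero>\<^bsub>Sec IK.relsq.Q V\<^esub>" using IK.relsq.pr_zero[OF V(1)] by simp
    then show ?thesis
      using V relsqQ.morphism_zero[OF KQ_module m V(1,2)] by (simp add: \<xi> hat_pullback)
  qed
  then show "\<xi> \<in> carrier (Sec H U) \<and> vanishing U \<xi>"
    using hom_pullback_carrier[OF U \<phi>] by (auto simp: \<xi> vanishing_def)
qed (use U vanishing_factors in auto)

lemma pullback_image_submodule: "submodule_presheaf S H (pullback_image S I J)"
proof -
  interpret H: module_presheaf S H by (rule H_module)
  interpret KQ: module_presheaf S K.Q by (rule KQ_module)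
  have M: "module (R V) (KQ.M V)" if "opn V" for V using that by (rule KQ.module)
  have z: "\<zero>\<^bsub>Sec K.Q V\<^esub> \<oplus>\<^bsub>Sec K.Q V\<^esub> \<zero>\<^bsub>Sec K.Q V\<^esub> = \<zero>\<^bsub>Sec K.Q V\<^esub>" if "opn V" for V
  proof -
    interpret module "R V" "KQ.M V" by (rule M[OF that])
    show ?thesis by simp
  qed
  have sz: "a \<odot>\<^bsub>Sec K.Q V\<^esub> \<zero>\<^bsub>Sec K.Q V\<^esub> = \<zero>\<^bsub>Sec K.Q V\<^esub>" if "opn V" "a \<in> \<O> V" for V a
    using module.smult_r_null[OF M[OF that(1)] that(2)] .
  show ?thesis
  proof (intro submodule_presheaf.intro submodule_presheaf_axioms.intro H_module)
    fix U V x assume U: "opn U" "opn V" "V \<subseteq> U" "x \<in> pullback_image S I J U"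
    then show "Res H U V x \<in> pullback_image S I J V"
      by (auto simp: pullback_image_iff vanishing_def hat_ops subset_trans)
  qed (auto simp: pullback_image_iff vanishing_def hat_ops z sz)
qed

end

sublocale ideal_pair \<subseteq> HQ: submodule_presheaf S "hom_conormal S I J" "pullback_image S I J"
  by (rule pullback_image_submodule)

section \<open>Derivations of the structure sheaf\<close>

context ring_presheaf
begin

text \<open>Values are taken in O_P and not in a quotient, so that the same derivation can be
  reduced modulo I_Y as well as modulo I_Z.\<close>

definition derivation_on where
  "derivation_on V E \<longleftrightarrow>
    (\<forall>W. opn W \<and> W \<subseteq> V \<longrightarrow> (\<forall>f\<in>\<O> W. E W f \<in> \<O> W) \<and>
      (\<forall>f\<in>\<O> W. \<forall>g\<in>\<O> W. E W (f \<oplus>\<^bsub>R W\<^esub> g) = E W f \<oplus>\<^bsub>R W\<^esub> E W g \<and>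
        E W (f \<otimes>\<^bsub>R W\<^esub> g) = f \<otimes>\<^bsub>R W\<^esub> E W g \<oplus>\<^bsub>R W\<^esub> g \<otimes>\<^bsub>R W\<^esub> E W f)) \<and>
    (\<forall>W W'. opn W \<and> opn W' \<and> W' \<subseteq> W \<and> W \<subseteq> V \<longrightarrow>
      (\<forall>f\<in>\<O> W. E W' (rho W W' f) = rho W W' (E W f)))"

text \<open>For smooth \<open>Y \<subseteq> P\<close> the conormal sequence \<open>I\<^sub>Y/I\<^sub>Y\<^sup>2 \<rightarrow> \<Omega>\<^sub>P|\<^sub>Y \<rightarrow> \<Omega>\<^sub>Y\<close> is split injective with \<open>\<Omega>\<^sub>P\<close>
  locally free; this is what the splitting means for homomorphisms into \<open>O\<^sub>Z\<close>, \<open>Z \<subseteq> Y\<close>.\<close>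

definition homs_from_derivations where
  "homs_from_derivations J \<longleftrightarrow> (\<forall>K U h p. ideal_inclusion S J K \<and> opn U \<and> p \<in> U \<and>
     morphism_on S U (subpresheaf (Str S) J) (struct_sheaf S K) h \<longrightarrow>
     (\<exists>V E. opn V \<and> p \<in> V \<and> V \<subseteq> U \<and> derivation_on V E \<and>
        (\<forall>W f. opn W \<and> W \<subseteq> V \<and> f \<in> J W \<longrightarrow> h W f = quot_proj S (Str S) K W (E W f))))"

lemma homs_from_derivationsE:
  assumes "homs_from_derivations J" "ideal_inclusion S J K" "opn U" "p \<in> U"
    "morphism_on S U (subpresheaf (Str S) J) (struct_sheaf S K) h"
  obtains V E where "opn V" "p \<in> V" "V \<subseteq> U" "derivation_on V E"
    "\<And>W f. opn W \<Longrightarrow> W \<subseteq> V \<Longrightarrow> f \<in> J W \<Longrightarrow> h W f = quot_proj S (Str S) K W (E W f)"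
proof -
  have "\<exists>V E. opn V \<and> p \<in> V \<and> V \<subseteq> U \<and> derivation_on V E \<and>
      (\<forall>W f. opn W \<and> W \<subseteq> V \<and> f \<in> J W \<longrightarrow> h W f = quot_proj S (Str S) K W (E W f))"
    by (rule assms(1)[unfolded homs_from_derivations_def, THEN spec, THEN spec, THEN spec, THEN spec, THEN mp])
      (intro conjI assms)
  then show thesis using that by (elim exE conjE) simp
qed

end

text \<open>In E (a x) = a E x + x E a the second summand lies in K when x is in I, so modulo K the
  derivation is O-linear on I.\<close>

lemma (in ideal_inclusion) derivation_morphism:
  assumes E: "derivation_on V E"
  shows "morphism_on S V (subpresheaf (Str S) I) K.Q (\<lambda>W f. K.pr W (E W f))"
proof (rule morphism_onI)
  fix W x assume W: "opn W" "W \<subseteq> V" and x: "x \<in> carrier (Sec (subpresheaf (Str S) I) W)"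
  have xR: "x \<in> \<O> W" using W x by (simp add: I.sub_carrier)
  have Ex: "E W x \<in> \<O> W" using E W xR by (simp add: derivation_on_def)
  then show "K.pr W (E W x) \<in> carrier (Sec K.Q W)" using W by simp
  show "K.pr W (E W (x \<oplus>\<^bsub>Sec (subpresheaf (Str S) I) W\<^esub> y)) = K.pr W (E W x) \<oplus>\<^bsub>Sec K.Q W\<^esub> K.pr W (E W y)"
    if "y \<in> carrier (Sec (subpresheaf (Str S) I) W)" for y
    using E W xR that by (simp add: derivation_on_def I.sub_carrier K.pr_add)
  show "K.pr W (E W (a \<odot>\<^bsub>Sec (subpresheaf (Str S) I) W\<^esub> x)) = a \<odot>\<^bsub>Sec K.Q W\<^esub> K.pr W (E W x)"
    if a: "a \<in> \<O> W" for a
  proof -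
    interpret cring "R W" by (rule cring) fact
    have Ea: "E W a \<in> \<O> W" using E W a by (simp add: derivation_on_def)
    have "E W (a \<odot>\<^bsub>R W\<^esub> x) = a \<otimes>\<^bsub>R W\<^esub> E W x \<oplus>\<^bsub>R W\<^esub> x \<otimes>\<^bsub>R W\<^esub> E W a"
      using E W a xR by (simp add: derivation_on_def smult_mult)
    moreover have "E W a \<otimes>\<^bsub>R W\<^esub> x \<in> K W" using W x Ea by (intro K.sub_mult) (auto simp: incl)
    ultimately have "E W (a \<odot>\<^bsub>R W\<^esub> x) \<ominus>\<^bsub>R W\<^esub> a \<otimes>\<^bsub>R W\<^esub> E W x \<in> K W"
      using a xR Ea Ex W by (simp add: m_comm[of x] a_comm[of "a \<otimes>\<^bsub>R W\<^esub> E W x"] a_minus_def a_assoc r_neg)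
    then have "K.pr W (E W (a \<odot>\<^bsub>R W\<^esub> x)) = K.pr W (a \<otimes>\<^bsub>R W\<^esub> E W x)"
      using E W a xR Ex by (subst K.pr_eq_iff') (auto simp: derivation_on_def smult_mult)
    then show ?thesis using W a Ex by (simp flip: smult_mult add: K.pr_smult)
  qed
next
  fix W W' x assume W: "opn W" "opn W'" "W' \<subseteq> W" "W \<subseteq> V" and x: "x \<in> carrier (Sec (subpresheaf (Str S) I) W)"
  then show "K.pr W' (E W' (Res (subpresheaf (Str S) I) W W' x)) = Res K.Q W W' (K.pr W (E W x))"
    using E by (simp add: derivation_on_def I.sub_carrier K.pr_res)
qed

section \<open>Classes in Q and the map from the normal sheaf\<close>

context ideal_pair
begin

lemma hat_in_Q: "\<xi> \<in> carrier (Sec H U) \<Longrightarrow> opn V \<Longrightarrow> V \<subseteq> U \<Longrightarrow> f \<in> J V \<Longrightarrow> hat \<xi> V f \<in> carrier (Sec K.Q V)"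
  using morD(1)[OF hat_morphism] by simp

lemma hat_restrict:
  "\<xi> \<in> carrier (Sec H U) \<Longrightarrow> opn V \<Longrightarrow> opn W \<Longrightarrow> W \<subseteq> V \<Longrightarrow> V \<subseteq> U \<Longrightarrow> f \<in> J V \<Longrightarrow>
    restrict (hat \<xi> V f) W = hat \<xi> W (rho V W f)"
  using morD(4)[OF hat_morphism, of \<xi> U V W f] by simp

definition agree_on_IJ where
  "agree_on_IJ U a b \<longleftrightarrow> (\<forall>V f. opn V \<and> V \<subseteq> U \<and> f \<in> I V \<and> f \<in> J V \<longrightarrow> a V f = b V f)"

text \<open>Stated for arbitrary families compatible with restriction: it is applied with the zero
  family, and with a pair of homomorphisms from the two sides of the symmetry.\<close>

lemma agree_on_IJ_hat_local:
  assumes U: "opn U"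
    and a: "\<And>V W f. opn V \<Longrightarrow> opn W \<Longrightarrow> W \<subseteq> V \<Longrightarrow> V \<subseteq> U \<Longrightarrow> f \<in> I V \<Longrightarrow> f \<in> J V \<Longrightarrow> restrict (a V f) W = a W (rho V W f)"
    and b: "\<And>V W f. opn V \<Longrightarrow> opn W \<Longrightarrow> W \<subseteq> V \<Longrightarrow> V \<subseteq> U \<Longrightarrow> f \<in> I V \<Longrightarrow> f \<in> J V \<Longrightarrow> restrict (b V f) W = b W (rho V W f)"
    and ext: "\<And>V f. opn V \<Longrightarrow> V \<subseteq> U \<Longrightarrow> f \<in> I V \<Longrightarrow> f \<in> J V \<Longrightarrow> a V f \<in> extensional V \<and> b V f \<in> extensional V"
    and loc: "\<And>p. p \<in> U \<Longrightarrow> \<exists>V. opn V \<and> p \<in> V \<and> V \<subseteq> U \<and> agree_on_IJ V a b"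
  shows "agree_on_IJ U a b"
  unfolding agree_on_IJ_def
proof (intro allI impI, elim conjE)
  fix V f assume V: "opn V" "V \<subseteq> U" "f \<in> I V" "f \<in> J V"
  show "a V f = b V f"
  proof (rule extensionalityI[of _ V])
    show "a V f \<in> extensional V" "b V f \<in> extensional V" using ext[OF V] by auto
    fix p assume p: "p \<in> V"
    then obtain W where W: "opn W" "p \<in> W" "W \<subseteq> U" "agree_on_IJ W a b" using loc V by blast
    define P where "P = V \<inter> W"
    have P: "opn P" "p \<in> P" "P \<subseteq> V" "P \<subseteq> W" using V W p by (auto simp: P_def)
    have "rho V P f \<in> I P" "rho V P f \<in> J P" using V P by (auto intro: I.sub_res J.sub_res)
    then have "restrict (a V f) P = restrict (b V f) P"
      using a[OF V(1) P(1,3) V(2-4)] b[OF V(1) P(1,3) V(2-4)] W(4) P by (auto simp: agree_on_IJ_def)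
    then show "a V f p = b V f p" using P(2) by (metis restrict_apply')
  qed
qed

lemma vanishing_local:
  assumes U: "opn U" and \<xi>: "\<xi> \<in> carrier (Sec H U)"
    and loc: "\<And>p. p \<in> U \<Longrightarrow> \<exists>V. opn V \<and> p \<in> V \<and> V \<subseteq> U \<and> vanishing V \<xi>"
  shows "vanishing U \<xi>"
proof -
  interpret KQ: module_presheaf S K.Q by (rule KQ_module)
  have *: "vanishing V \<xi> \<longleftrightarrow> agree_on_IJ V (hat \<xi>) (\<lambda>V f. \<zero>\<^bsub>Sec K.Q V\<^esub>)" for V
    by (auto simp: vanishing_def agree_on_IJ_def)
  have "agree_on_IJ U (hat \<xi>) (\<lambda>V f. \<zero>\<^bsub>Sec K.Q V\<^esub>)"
  proof (rule agree_on_IJ_hat_local[OF U])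
    fix V W f assume "opn V" "opn W" "W \<subseteq> V"
    then show "restrict \<zero>\<^bsub>Sec K.Q V\<^esub> W = \<zero>\<^bsub>Sec K.Q W\<^esub>"
      using KQ.res_zero[of V W] by simp
  next
    fix V f assume V: "opn V" "V \<subseteq> U" "f \<in> I V" "f \<in> J V"
    show "hat \<xi> V f \<in> extensional V \<and> \<zero>\<^bsub>Sec K.Q V\<^esub> \<in> extensional V"
      using K.Q_extensional[OF hat_in_Q[OF \<xi> V(1,2,4)]] by (simp add: K.Q_zero)
  next
    fix p assume "p \<in> U"
    then show "\<exists>V. opn V \<and> p \<in> V \<and> V \<subseteq> U \<and> agree_on_IJ V (hat \<xi>) (\<lambda>V f. \<zero>\<^bsub>Sec K.Q V\<^esub>)"
      using loc unfolding * by blast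
  qed (use \<xi> hat_restrict in auto)
  then show ?thesis unfolding * .
qed

lemma vanishing_Res: "opn W \<Longrightarrow> W \<subseteq> U \<Longrightarrow> vanishing W (Res H U W \<xi>) \<longleftrightarrow> vanishing W \<xi>"
  by (auto simp: vanishing_def hat_ops)

lemma Q_class_eq: "Q_class S I J = HQ.pr"
  by (simp add: Q_class_def)

lemma Q_sheaf_eq: "Q_sheaf S I J = HQ.Q"
  by (simp add: Q_sheaf_def)

lemma Q_class_zero_iff:
  assumes U: "opn U" and \<xi>: "\<xi> \<in> carrier (Sec H U)"
  shows "HQ.pr U \<xi> = \<zero>\<^bsub>Sec HQ.Q U\<^esub> \<longleftrightarrow> vanishing U \<xi>"
proof -
  have "HQ.pr U \<xi> = \<zero>\<^bsub>Sec HQ.Q U\<^esub> \<longleftrightarrow> (\<forall>p\<in>U. \<exists>W. opn W \<and> p \<in> W \<and> W \<subseteq> U \<and> vanishing W \<xi>)"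
  proof -
    have "Res H U W \<xi> \<in> pullback_image S I J W \<longleftrightarrow> vanishing W \<xi>" if "opn W" "W \<subseteq> U" for W
      using that assms by (simp add: pullback_image_iff vanishing_Res)
    then show ?thesis using assms by (simp add: HQ.pr_zero_iff cong: conj_cong)
  qed
  also have "\<dots> \<longleftrightarrow> vanishing U \<xi>"
    using vanishing_local[OF U \<xi>] U by blast
  finally show ?thesis .
qed

lemma hat_minus:
  assumes U: "opn U" and \<xi>: "\<xi> \<in> carrier (Sec H U)" "\<psi> \<in> carrier (Sec H U)" and V: "opn V" "V \<subseteq> U" "f \<in> J V"
  shows "hat (\<xi> \<ominus>\<^bsub>Sec H U\<^esub> \<psi>) V f = hat \<xi> V f \<ominus>\<^bsub>Sec K.Q V\<^esub> hat \<psi> V f"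
proof -
  interpret KQ: module_presheaf S K.Q by (rule KQ_module)
  interpret cring "R U" by (rule cring[OF U])
  interpret RV: cring "R V" by (rule cring[OF V(1)])
  have "hat (\<ominus>\<^bsub>Sec H U\<^esub> \<psi>) V f = rho U V (\<ominus>\<^bsub>R U\<^esub> \<one>\<^bsub>R U\<^esub>) \<odot>\<^bsub>Sec K.Q V\<^esub> hat \<psi> V f"
    unfolding HQ.smult_minus_one[OF U \<xi>(2), symmetric] using V by (rule hat_ops)
  also have "\<dots> = \<ominus>\<^bsub>Sec K.Q V\<^esub> hat \<psi> V f"
    using U V I.res_inv[of U V "\<one>\<^bsub>R U\<^esub>"] hat_in_Q[OF \<xi>(2) V] by (simp add: str_res_one KQ.smult_minus_one)
  finally show ?thesis using V by (simp add: a_minus_def hat_ops)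
qed

text \<open>Embeds Q(X, Y) into Hom (I_X \<inter> I_Y, O_Z). The condition on the right treats I and
  J alike, which is what makes the comparison with Q(Y, X) possible.\<close>

lemma Q_class_eq_iff:
  assumes U: "opn U" and \<xi>: "\<xi> \<in> carrier (Sec H U)" "\<psi> \<in> carrier (Sec H U)"
  shows "HQ.pr U \<xi> = HQ.pr U \<psi> \<longleftrightarrow> agree_on_IJ U (hat \<xi>) (hat \<psi>)"
proof -
  interpret HQQ: module_presheaf S HQ.Q by (rule HQ.Q_module)
  interpret KQ: module_presheaf S K.Q by (rule KQ_module)
  interpret HQA: abelian_group "HQQ.M U" by (rule HQQ.abelian[OF U])
  have "HQ.pr U \<xi> = HQ.pr U \<psi> \<longleftrightarrow> HQ.pr U (\<xi> \<ominus>\<^bsub>Sec H U\<^esub> \<psi>) = \<zero>\<^bsub>Sec HQ.Q U\<^esub>"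
    using assms by (simp add: HQ.pr_minus HQA.minus_eq_zero_iff)
  also have "\<dots> \<longleftrightarrow> vanishing U (\<xi> \<ominus>\<^bsub>Sec H U\<^esub> \<psi>)"
    using assms by (simp add: Q_class_zero_iff)
  also have "\<dots> \<longleftrightarrow> agree_on_IJ U (hat \<xi>) (hat \<psi>)"
  proof -
    have "hat (\<xi> \<ominus>\<^bsub>Sec H U\<^esub> \<psi>) V f = \<zero>\<^bsub>Sec K.Q V\<^esub> \<longleftrightarrow> hat \<xi> V f = hat \<psi> V f"
      if V: "opn V" "V \<subseteq> U" "f \<in> J V" for V f
    proof -
      interpret abelian_group "KQ.M V" by (rule KQ.abelian[OF V(1)])
      show ?thesis using V assms by (simp add: hat_minus minus_eq_zero_iff hat_in_Q)
    qed
    then show ?thesis by (auto simp: vanishing_def agree_on_IJ_def)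
  qed
  finally show ?thesis .
qed

abbreviation N where "N \<equiv> normal_sheaf S J"

lemma N_eq: "N = sheaf_hom S OJ J.Q"
  by (simp add: normal_sheaf_def)

lemma N_module: "module_presheaf S N"
  unfolding N_eq by (rule sheaf_hom_module[OF OJ_module J.Q_module])

lemma N_morphism: "\<eta> \<in> carrier (Sec N U) \<Longrightarrow> morphism_on S U OJ J.Q \<eta>"
  by (simp add: N_eq sheaf_hom_carrier)

abbreviation sr where "sr \<equiv> struct_restriction S K"

lemma normal_to_hom_eq: "normal_to_hom S I J U \<eta> = descend U (\<lambda>V s. sr V (\<eta> V s))"
  by (simp add: normal_to_hom_def descend_def)

lemma sr_morphism: "opn U \<Longrightarrow> morphism_on S U J.Q K.Q sr"
  by (rule morphism_on_subset[OF JK.struct_restriction_morphism]) (rule openin_sub_top)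

lemma normal_to_hom:
  assumes U: "opn U" and \<eta>: "\<eta> \<in> carrier (Sec N U)"
  shows normal_to_hom_closed: "normal_to_hom S I J U \<eta> \<in> carrier (Sec H U)"
    and hat_normal_to_hom: "opn V \<Longrightarrow> V \<subseteq> U \<Longrightarrow> f \<in> J V \<Longrightarrow> hat (normal_to_hom S I J U \<eta>) V f = sr V (\<eta> V f)"
  using descend[OF U morphism_on_comp[OF N_morphism[OF \<eta>] sr_morphism[OF U]]]
  by (simp_all add: normal_to_hom_eq)

lemma N_ops:
  assumes "opn V" "V \<subseteq> U" "f \<in> J V"
  shows "(\<eta> \<oplus>\<^bsub>Sec N U\<^esub> \<eta>') V f = \<eta> V f \<oplus>\<^bsub>Sec J.Q V\<^esub> \<eta>' V f"
    and "(a \<odot>\<^bsub>Sec N U\<^esub> \<eta>) V f = rho U V a \<odot>\<^bsub>Sec J.Q V\<^esub> \<eta> V f"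
    and "Res N U' U \<eta> V f = \<eta> V f"
  using assms by (simp_all add: N_eq sheaf_hom_ops)

lemma N_closed: "\<eta> \<in> carrier (Sec N U) \<Longrightarrow> opn V \<Longrightarrow> V \<subseteq> U \<Longrightarrow> f \<in> J V \<Longrightarrow> \<eta> V f \<in> carrier (Sec J.Q V)"
  using morD(1)[OF N_morphism] by simp

lemma normal_to_hom_morphism: "sheaf_morphism S N H (normal_to_hom S I J)"
proof -
  interpret N: module_presheaf S N by (rule N_module)
  show ?thesis
  proof (rule morphism_onI)
    fix U \<eta> \<eta>' assume U: "opn U" and \<eta>: "\<eta> \<in> carrier (Sec N U)" and \<eta>': "\<eta>' \<in> carrier (Sec N U)"
    show "normal_to_hom S I J U (\<eta> \<oplus>\<^bsub>Sec N U\<^esub> \<eta>') = normal_to_hom S I J U \<eta> \<oplus>\<^bsub>Sec H U\<^esub> normal_to_hom S I J U \<eta>'"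
      by (rule hom_ext[of _ U])
        (use U \<eta> \<eta>' in \<open>simp_all add: normal_to_hom hat_ops N_ops N_closed morD(2)[OF sr_morphism[OF U]]\<close>)
  next
    fix U a \<eta> assume U: "opn U" and a: "a \<in> \<O> U" and \<eta>: "\<eta> \<in> carrier (Sec N U)"
    show "normal_to_hom S I J U (a \<odot>\<^bsub>Sec N U\<^esub> \<eta>) = a \<odot>\<^bsub>Sec H U\<^esub> normal_to_hom S I J U \<eta>"
      by (rule hom_ext[of _ U])
        (use U a \<eta> in \<open>simp_all add: normal_to_hom hat_ops N_ops N_closed morD(3)[OF sr_morphism[OF U]]\<close>)
  next
    fix U V \<eta> assume U: "opn U" "opn V" "V \<subseteq> U" and \<eta>: "\<eta> \<in> carrier (Sec N U)"
    show "normal_to_hom S I J V (Res N U V \<eta>) = Res H U V (normal_to_hom S I J U \<eta>)"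
      by (rule hom_ext[of _ V])
        (use U \<eta> in \<open>auto simp: normal_to_hom hat_ops N_ops subset_trans\<close>)
  qed (auto simp: normal_to_hom)
qed

lemma normal_to_Q_morphism: "sheaf_morphism S N HQ.Q (normal_to_Q S I J)"
proof -
  have "normal_to_Q S I J = (\<lambda>U \<eta>. HQ.pr U (normal_to_hom S I J U \<eta>))"
    by (simp add: normal_to_Q_def Q_class_eq fun_eq_iff)
  then show ?thesis
    using morphism_on_comp[OF normal_to_hom_morphism HQ.pr_morphism] by (simp only:)
qed

text \<open>The class of \<eta> vanishes iff \<eta> followed by O_Y -> O_Z is zero on I \<inter> J,
  and the kernel of O_Y -> O_Z is I_{Z/Y}: this is the condition that defines F.\<close>

lemma normal_to_Q_zero_iff:
  assumes U: "opn U" and \<eta>: "\<eta> \<in> carrier (Sec N U)"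
  shows "normal_to_Q S I J U \<eta> = \<zero>\<^bsub>Sec HQ.Q U\<^esub> \<longleftrightarrow> \<eta> \<in> F_sections S I J U"
proof -
  have "normal_to_Q S I J U \<eta> = \<zero>\<^bsub>Sec HQ.Q U\<^esub> \<longleftrightarrow> vanishing U (normal_to_hom S I J U \<eta>)"
    using U \<eta> by (simp add: normal_to_Q_def Q_class_eq Q_class_zero_iff normal_to_hom)
  also have "\<dots> \<longleftrightarrow> (\<forall>V. opn V \<and> V \<subseteq> U \<longrightarrow> (\<forall>f\<in>I V \<inter> J V. \<eta> V f \<in> JK.rel V))"
    using U \<eta> by (auto simp: vanishing_def normal_to_hom JK.struct_restriction_zero_iff N_closed)
  also have "\<dots> \<longleftrightarrow> \<eta> \<in> F_sections S I J U"
    using \<eta> by (auto simp: F_sections_def)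
  finally show ?thesis .
qed

lemma short_exact_normal:
  assumes der: "homs_from_derivations J"
  shows "short_exact S (F_sheaf S I J) N (Q_sheaf S I J) (\<lambda>U \<eta>. \<eta>) (normal_to_Q S I J)"
  unfolding short_exact_def Q_sheaf_eq
proof (intro conjI allI impI ballI)
  have FN: "F_sections S I J U \<subseteq> carrier (Sec N U)" for U
    by (auto simp: F_sections_def)
  show "sheaf_morphism S (F_sheaf S I J) N (\<lambda>U \<eta>. \<eta>)"
    by (rule morphism_onI) (use FN in \<open>auto simp: F_sheaf_def\<close>)
  show "sheaf_morphism S N HQ.Q (normal_to_Q S I J)" by (rule normal_to_Q_morphism)
  fix U assume U: "opn U"
  show "inj_on (\<lambda>\<eta>. \<eta>) (carrier (Sec (F_sheaf S I J) U))" by simp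
  show "(\<lambda>\<eta>. \<eta>) ` carrier (Sec (F_sheaf S I J) U) =
    {x \<in> carrier (Sec N U). normal_to_Q S I J U x = \<zero>\<^bsub>Sec HQ.Q U\<^esub>}"
    using U FN[of U] by (auto simp: F_sheaf_def normal_to_Q_zero_iff)
  fix z p assume z: "z \<in> carrier (Sec HQ.Q U)" and p: "p \<in> U"
  obtain V \<xi> where V: "opn V" "p \<in> V" "V \<subseteq> U" and \<xi>: "\<xi> \<in> carrier (Sec H V)" "restrict z V = HQ.pr V \<xi>"
    using z p by (rule HQ.sec_local)
  obtain W E where W: "opn W" "p \<in> W" "W \<subseteq> V" and E: "derivation_on W E"
    and hE: "\<And>W' f. opn W' \<Longrightarrow> W' \<subseteq> W \<Longrightarrow> f \<in> J W' \<Longrightarrow> hat \<xi> W' f = K.pr W' (E W' f)"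
    using homs_from_derivationsE[OF der JK.ideal_inclusion_axioms V(1,2) hat_morphism[OF \<xi>(1)]] by metis
  \<comment> \<open>The derivation represents \<xi> modulo \<open>K\<close>. Reduced modulo
    \<open>J\<close> instead, it is linear on \<open>J\<close> by \<open>derivation_morphism\<close>
    for the inclusion of \<open>J\<close> in itself, which gives the preimage in the normal
    sheaf.\<close>
  interpret JJ: ideal_inclusion S J J by unfold_locales
  define \<eta> where "\<eta> = hom_restrict S OJ W (\<lambda>W f. J.pr W (E W f))"
  have \<eta>: "\<eta> \<in> carrier (Sec N W)"
    unfolding \<eta>_def N_eq by (rule hom_restrict_morphism[OF OJ_module JJ.derivation_morphism[OF E]])
  have "normal_to_hom S I J W \<eta> = Res H V W \<xi>"
  proof (rule hom_ext[of _ W])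
    fix W' f assume W': "opn W'" "W' \<subseteq> W" "f \<in> J W'"
    have "E W' f \<in> \<O> W'" using E W' by (simp add: derivation_on_def J.sub_carrier)
    then show "hat (normal_to_hom S I J W \<eta>) W' f = hat (Res H V W \<xi>) W' f"
      using W W' \<eta> hE[OF W'] by (simp add: hat_normal_to_hom hat_ops \<eta>_def JK.struct_restriction_pr)
  qed (use V W \<eta> \<xi> normal_to_hom_closed[OF W(1) \<eta>] in auto)
  moreover have "restrict z W = HQ.pr W (Res H V W \<xi>)"
  proof -
    have "restrict z W = restrict (restrict z V) W" using W(3) by (simp add: Int_absorb1)
    then show ?thesis unfolding \<xi>(2) using HQ.pr_res[OF V(1) W(1,3) \<xi>(1)] by simp
  qed
  ultimately have "normal_to_Q S I J W \<eta> = Res HQ.Q U W z"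
    by (simp add: normal_to_Q_def Q_class_eq)
  then show "\<exists>V. opn V \<and> p \<in> V \<and> V \<subseteq> U \<and>
    (\<exists>x\<in>carrier (Sec N V). normal_to_Q S I J V x = Res HQ.Q U V z)"
    using W V \<eta> by (intro exI[of _ W]) auto
qed

end

section \<open>Symmetry of Q\<close>

context ideal_pair
begin

lemma swap: "ideal_pair S J I"
  by unfold_locales

abbreviation hat' where "hat' \<equiv> ideal_pair.hat S I"
abbreviation H' where "H' \<equiv> hom_conormal S J I"

lemma agree_on_inter_iff: "agree_on_inter S I J U \<xi> \<xi>' \<longleftrightarrow> agree_on_IJ U (hat \<xi>) (hat' \<xi>')"
  by (auto simp: agree_on_inter_def agree_on_IJ_def hat_def ideal_pair.hat_def[OF swap])

lemma swap_agree: "ideal_pair.agree_on_IJ S J I U a b \<longleftrightarrow> agree_on_IJ U a b"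
  by (auto simp: agree_on_IJ_def ideal_pair.agree_on_IJ_def[OF swap])

text \<open>A derivation that represents \<xi> on J can equally be restricted to I. There it is
  again linear modulo \<open>K\<close>, and on I \<inter> J both restrictions coincide.\<close>

lemma partner:
  assumes der: "homs_from_derivations J" and U: "opn U" "p \<in> U" and \<xi>: "\<xi> \<in> carrier (Sec H U)"
  shows "\<exists>V \<xi>'. opn V \<and> p \<in> V \<and> V \<subseteq> U \<and> \<xi>' \<in> carrier (Sec H' V) \<and> agree_on_IJ V (hat \<xi>) (hat' \<xi>')"
proof -
  interpret swap: ideal_pair S J I by (rule swap)
  obtain V E where V: "opn V" "p \<in> V" "V \<subseteq> U" and E: "derivation_on V E"
    and hE: "\<And>W f. opn W \<Longrightarrow> W \<subseteq> V \<Longrightarrow> f \<in> J W \<Longrightarrow> hat \<xi> W f = K.pr W (E W f)"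
    using homs_from_derivationsE[OF der JK.ideal_inclusion_axioms U hat_morphism[OF \<xi>]] by metis
  have m: "morphism_on S V (subpresheaf (Str S) I) (struct_sheaf S (ideal_sum S J I)) (\<lambda>W f. K.pr W (E W f))"
    using IK.derivation_morphism[OF E] by (simp add: ideal_sum_commute)
  define \<xi>' where "\<xi>' = swap.descend V (\<lambda>W f. K.pr W (E W f))"
  have "agree_on_IJ V (hat \<xi>) (hat' \<xi>')"
    using hE swap.hat_descend[OF V(1) m] by (auto simp: agree_on_IJ_def \<xi>'_def)
  then show ?thesis
    using V swap.descend_closed[OF V(1) m] by (auto simp: \<xi>'_def)
qed

text \<open>The fibre product of Hom (I_Y / I_Y^2, O_Z) and Hom (I_X / I_X^2, O_Z) over Hom (I_X
  \<inter> I_Y, O_Z): the graph of the isomorphism before passing to classes.\<close>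

definition pair_presheaf where
  "pair_presheaf = \<lparr>Sec = \<lambda>U. \<lparr>
     carrier = {(\<xi>, \<xi>'). \<xi> \<in> carrier (Sec H U) \<and> \<xi>' \<in> carrier (Sec H' U) \<and> agree_on_IJ U (hat \<xi>) (hat' \<xi>')},
     monoid.mult = undefined, monoid.one = undefined, ring.zero = undefined,
     ring.add = (\<lambda>(\<xi>, \<xi>') (\<psi>, \<psi>'). (\<xi> \<oplus>\<^bsub>Sec H U\<^esub> \<psi>, \<xi>' \<oplus>\<^bsub>Sec H' U\<^esub> \<psi>')),
     module.smult = (\<lambda>a (\<xi>, \<xi>'). (a \<odot>\<^bsub>Sec H U\<^esub> \<xi>, a \<odot>\<^bsub>Sec H' U\<^esub> \<xi>'))\<rparr>,
   Res = \<lambda>U V (\<xi>, \<xi>'). (Res H U V \<xi>, Res H' U V \<xi>')\<rparr>"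

lemma Q_swap_morphism:
  assumes der: "homs_from_derivations J"
  shows "\<exists>\<beta>. sheaf_morphism S (Q_sheaf S I J) (Q_sheaf S J I) \<beta> \<and>
    (\<forall>U \<xi> \<xi>'. opn U \<longrightarrow> \<xi> \<in> carrier (Sec H U) \<longrightarrow> \<xi>' \<in> carrier (Sec H' U) \<longrightarrow>
      agree_on_IJ U (hat \<xi>) (hat' \<xi>') \<longrightarrow> \<beta> U (Q_class S I J U \<xi>) = Q_class S J I U \<xi>')"
proof -
  interpret swap: ideal_pair S J I by (rule swap)
  let ?P = pair_presheaf
  have carr: "(\<xi>, \<xi>') \<in> carrier (Sec ?P V) \<longleftrightarrow>
    \<xi> \<in> carrier (Sec H V) \<and> \<xi>' \<in> carrier (Sec H' V) \<and> agree_on_IJ V (hat \<xi>) (hat' \<xi>')" for \<xi> \<xi>' V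
    by (simp add: pair_presheaf_def)
  have ops: "(\<xi>, \<xi>') \<oplus>\<^bsub>Sec ?P V\<^esub> (\<psi>, \<psi>') = (\<xi> \<oplus>\<^bsub>Sec H V\<^esub> \<psi>, \<xi>' \<oplus>\<^bsub>Sec H' V\<^esub> \<psi>')"
    "a \<odot>\<^bsub>Sec ?P V\<^esub> (\<xi>, \<xi>') = (a \<odot>\<^bsub>Sec H V\<^esub> \<xi>, a \<odot>\<^bsub>Sec H' V\<^esub> \<xi>')"
    "Res ?P V W (\<xi>, \<xi>') = (Res H V W \<xi>, Res H' V W \<xi>')" for \<xi> \<xi>' \<psi> \<psi>' a V W
    by (simp_all add: pair_presheaf_def)
  have "\<exists>k. sheaf_morphism S HQ.Q swap.HQ.Q k \<and>
    (\<forall>V y. opn V \<longrightarrow> y \<in> carrier (Sec ?P V) \<longrightarrow> k V (HQ.pr V (fst y)) = swap.HQ.pr V (snd y))"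
  \<comment> \<open>The first component is sent to Q(X, Y), the second to Q(Y, X). The first
    projection is locally onto by \<open>partner\<close>; pairs with equal first classes have equal
    second classes because either class is determined by the common values on I \<inter> J.\<close>
  proof (rule swap.HQ.factor_through_local_surjection[where A=HQ.Q and B="?P" and U=X
        and \<pi>="\<lambda>V y. HQ.pr V (fst y)" and h="\<lambda>V y. swap.HQ.pr V (snd y)"])
    show "module_presheaf S HQ.Q" by (rule HQ.Q_module)
    show "opn X" by simp
    show "x \<oplus>\<^bsub>Sec ?P V\<^esub> y \<in> carrier (Sec ?P V)"
      if "opn V" "x \<in> carrier (Sec ?P V)" "y \<in> carrier (Sec ?P V)" for V x y
      using that by (cases x; cases y)
        (auto simp: carr ops agree_on_IJ_def hat_ops swap.hat_ops ideal_sum_commute)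
    show "a \<odot>\<^bsub>Sec ?P V\<^esub> x \<in> carrier (Sec ?P V)"
      if "opn V" "a \<in> \<O> V" "x \<in> carrier (Sec ?P V)" for V a x
      using that by (cases x)
        (auto simp: carr ops agree_on_IJ_def hat_ops swap.hat_ops ideal_sum_commute)
    show "Res ?P V W x \<in> carrier (Sec ?P W)"
      if "opn V" "opn W" "W \<subseteq> V" "x \<in> carrier (Sec ?P V)" for V W x
      using that by (cases x)
        (auto simp: carr ops agree_on_IJ_def hat_ops swap.hat_ops subset_trans)
    show "sheaf_morphism S ?P HQ.Q (\<lambda>V y. HQ.pr V (fst y))"
      by (rule morphism_onI) (auto simp: carr ops HQ.pr_add HQ.pr_smult HQ.pr_res)
    show "sheaf_morphism S ?P swap.HQ.Q (\<lambda>V y. swap.HQ.pr V (snd y))"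
      by (rule morphism_onI) (auto simp: carr ops swap.HQ.pr_add swap.HQ.pr_smult swap.HQ.pr_res)
    show "\<exists>W y. opn W \<and> p \<in> W \<and> W \<subseteq> V \<and> y \<in> carrier (Sec ?P W) \<and> HQ.pr W (fst y) = Res HQ.Q V W x"
      if x: "x \<in> carrier (Sec HQ.Q V)" "p \<in> V" for V x p
    proof -
      obtain W \<xi> where W: "opn W" "p \<in> W" "W \<subseteq> V" "\<xi> \<in> carrier (Sec H W)" "restrict x W = HQ.pr W \<xi>"
        using x by (rule HQ.sec_local)
      obtain W' \<xi>' where W': "opn W'" "p \<in> W'" "W' \<subseteq> W" "\<xi>' \<in> carrier (Sec H' W')" "agree_on_IJ W' (hat \<xi>) (hat' \<xi>')"
        using partner[OF der W(1,2,4)] by blast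
      have "agree_on_IJ W' (hat (Res H W W' \<xi>)) (hat' \<xi>')"
        using W'(5) by (auto simp: agree_on_IJ_def hat_ops)
      then have "(Res H W W' \<xi>, \<xi>') \<in> carrier (Sec ?P W')"
        using W W' by (simp add: carr)
      moreover have "HQ.pr W' (Res H W W' \<xi>) = restrict x W'"
      proof -
        have "restrict x W' = restrict (restrict x W) W'" using W'(3) by (simp add: Int_absorb1)
        then show ?thesis unfolding W(5) using HQ.pr_res[OF W(1) W'(1,3) W(4)] by simp
      qed
      ultimately show ?thesis
        using W W' by (intro exI[of _ W'] exI[of _ "(Res H W W' \<xi>, \<xi>')"]) auto
    qed
    show "swap.HQ.pr V (snd y) = swap.HQ.pr V (snd y')"
      if "opn V" "y \<in> carrier (Sec ?P V)" "y' \<in> carrier (Sec ?P V)" "HQ.pr V (fst y) = HQ.pr V (fst y')" for V y y'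
      using that by (cases y; cases y')
        (auto simp: carr Q_class_eq_iff swap.Q_class_eq_iff swap_agree agree_on_IJ_def)
  qed (use openin_sub_top in auto)
  then obtain \<beta> where \<beta>: "sheaf_morphism S HQ.Q swap.HQ.Q \<beta>"
    "\<And>V y. opn V \<Longrightarrow> y \<in> carrier (Sec ?P V) \<Longrightarrow> \<beta> V (HQ.pr V (fst y)) = swap.HQ.pr V (snd y)"
    by blast
  have "\<beta> U (HQ.pr U \<xi>) = swap.HQ.pr U \<xi>'"
    if "opn U" "\<xi> \<in> carrier (Sec H U)" "\<xi>' \<in> carrier (Sec H' U)" "agree_on_IJ U (hat \<xi>) (hat' \<xi>')" for U \<xi> \<xi>'
    using \<beta>(2)[of U "(\<xi>, \<xi>')"] that by (simp add: carr)
  then show ?thesis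
    using \<beta>(1) by (intro exI[of _ \<beta>]) (simp add: Q_sheaf_eq Q_class_eq swap.Q_sheaf_eq swap.Q_class_eq)
qed

lemma Q_symmetric:
  assumes derI: "homs_from_derivations I" and derJ: "homs_from_derivations J"
  shows "\<exists>\<beta>. natural_iso S I J \<beta>"
proof -
  interpret swap: ideal_pair S J I by (rule swap)
  have hat_swap: "swap.hat' = hat" by simp
  have agree_sym: "agree_on_IJ U a b \<longleftrightarrow> agree_on_IJ U b a" for U a b
    by (auto simp: agree_on_IJ_def)
  obtain \<beta> where \<beta>: "sheaf_morphism S HQ.Q swap.HQ.Q \<beta>"
    and \<beta>_eq: "\<And>U \<xi> \<xi>'. opn U \<Longrightarrow> \<xi> \<in> carrier (Sec H U) \<Longrightarrow> \<xi>' \<in> carrier (Sec H' U) \<Longrightarrow>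
      agree_on_IJ U (hat \<xi>) (hat' \<xi>') \<Longrightarrow> \<beta> U (HQ.pr U \<xi>) = swap.HQ.pr U \<xi>'"
    using Q_swap_morphism[OF derJ] by (auto simp: Q_sheaf_eq Q_class_eq swap.Q_sheaf_eq swap.Q_class_eq)
  \<comment> \<open>The candidate inverse arises with the roles of I and J exchanged, hence from
    derivations that represent homomorphisms on I.\<close>
  obtain \<gamma> where \<gamma>: "sheaf_morphism S swap.HQ.Q HQ.Q \<gamma>"
    and \<gamma>': "\<forall>U \<xi>' \<xi>. opn U \<longrightarrow> \<xi>' \<in> carrier (Sec H' U) \<longrightarrow> \<xi> \<in> carrier (Sec H U) \<longrightarrow>
      agree_on_IJ U (hat' \<xi>') (hat \<xi>) \<longrightarrow> \<gamma> U (swap.HQ.pr U \<xi>') = HQ.pr U \<xi>"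
    using swap.Q_swap_morphism[OF derI]
    unfolding Q_sheaf_eq Q_class_eq swap.Q_sheaf_eq swap.Q_class_eq swap_agree by (elim exE conjE)
  have \<gamma>_eq: "\<gamma> U (swap.HQ.pr U \<xi>') = HQ.pr U \<xi>"
    if "opn U" "\<xi> \<in> carrier (Sec H U)" "\<xi>' \<in> carrier (Sec H' U)" "agree_on_IJ U (hat \<xi>) (hat' \<xi>')" for U \<xi> \<xi>'
    using that \<gamma>' agree_sym[of U "hat \<xi>" "hat' \<xi>'"] by simp
  have top: "U \<subseteq> X" if "opn U" for U using that by (rule openin_sub_top)
  have loc: "\<exists>V \<xi> \<xi>'. opn V \<and> p \<in> V \<and> V \<subseteq> U \<and> \<xi> \<in> carrier (Sec H V) \<and> \<xi>' \<in> carrier (Sec H' V) \<and>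
      agree_on_IJ V (hat \<xi>) (hat' \<xi>') \<and> restrict x V = HQ.pr V \<xi>"
    if x: "x \<in> carrier (Sec HQ.Q U)" "p \<in> U" for x U p
  proof -
    obtain W \<xi> where W: "opn W" "p \<in> W" "W \<subseteq> U" "\<xi> \<in> carrier (Sec H W)" "restrict x W = HQ.pr W \<xi>"
      using x by (rule HQ.sec_local)
    obtain W' \<xi>' where W': "opn W'" "p \<in> W'" "W' \<subseteq> W" "\<xi>' \<in> carrier (Sec H' W')" "agree_on_IJ W' (hat \<xi>) (hat' \<xi>')"
      using partner[OF derJ W(1,2,4)] by blast
    have "agree_on_IJ W' (hat (Res H W W' \<xi>)) (hat' \<xi>')"
      using W'(5) by (auto simp: agree_on_IJ_def hat_ops)
    moreover have "HQ.pr W' (Res H W W' \<xi>) = restrict x W'"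
    proof -
      have "restrict x W' = restrict (restrict x W) W'" using W'(3) by (simp add: Int_absorb1)
      then show ?thesis unfolding W(5) using HQ.pr_res[OF W(1) W'(1,3) W(4)] by simp
    qed
    ultimately show ?thesis
      using W W' by (intro exI[of _ W'] exI[of _ "Res H W W' \<xi>"] exI[of _ \<xi>']) auto
  qed
  have loc': "\<exists>V \<xi> \<xi>'. opn V \<and> p \<in> V \<and> V \<subseteq> U \<and> \<xi> \<in> carrier (Sec H V) \<and> \<xi>' \<in> carrier (Sec H' V) \<and>
      agree_on_IJ V (hat \<xi>) (hat' \<xi>') \<and> restrict x V = swap.HQ.pr V \<xi>'"
    if x: "x \<in> carrier (Sec swap.HQ.Q U)" "p \<in> U" for x U p
  proof -
    obtain W \<xi>' where W: "opn W" "p \<in> W" "W \<subseteq> U" "\<xi>' \<in> carrier (Sec H' W)" "restrict x W = swap.HQ.pr W \<xi>'"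
      using x by (rule swap.HQ.sec_local)
    obtain W' \<xi> where W': "opn W'" "p \<in> W'" "W' \<subseteq> W" "\<xi> \<in> carrier (Sec H W')" "agree_on_IJ W' (hat' \<xi>') (hat \<xi>)"
      using swap.partner[OF derI W(1,2,4)] unfolding swap_agree by blast
    have "agree_on_IJ W' (hat \<xi>) (hat' (Res H' W W' \<xi>'))"
      using W'(5) by (auto simp: agree_on_IJ_def swap.hat_ops)
    moreover have "swap.HQ.pr W' (Res H' W W' \<xi>') = restrict x W'"
    proof -
      have "restrict x W' = restrict (restrict x W) W'" using W'(3) by (simp add: Int_absorb1)
      then show ?thesis unfolding W(5) using swap.HQ.pr_res[OF W(1) W'(1,3) W(4)] by simp
    qed
    ultimately show ?thesis
      using W W' by (intro exI[of _ W'] exI[of _ \<xi>] exI[of _ "Res H' W W' \<xi>'"]) auto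
  qed
  have res_\<beta>: "restrict (\<beta> U x) V = \<beta> V (restrict x V)"
    if "opn U" "opn V" "V \<subseteq> U" "x \<in> carrier (Sec HQ.Q U)" for U V x
    using morD(4)[OF \<beta> that(1,2,3) top[OF that(1)] that(4)] by simp
  have res_\<gamma>: "restrict (\<gamma> U x) V = \<gamma> V (restrict x V)"
    if "opn U" "opn V" "V \<subseteq> U" "x \<in> carrier (Sec swap.HQ.Q U)" for U V x
    using morD(4)[OF \<gamma> that(1,2,3) top[OF that(1)] that(4)] by simp
  have \<beta>c: "\<beta> U x \<in> carrier (Sec swap.HQ.Q U)" if "opn U" "x \<in> carrier (Sec HQ.Q U)" for U x
    using morD(1)[OF \<beta> that(1) top[OF that(1)] that(2)] .
  have \<gamma>c: "\<gamma> U x \<in> carrier (Sec HQ.Q U)" if "opn U" "x \<in> carrier (Sec swap.HQ.Q U)" for U x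
    using morD(1)[OF \<gamma> that(1) top[OF that(1)] that(2)] .
  have \<gamma>\<beta>: "\<gamma> U (\<beta> U x) = x" if U: "opn U" and x: "x \<in> carrier (Sec HQ.Q U)" for U x
  proof (rule HQ.Q_eq_localI)
    show "\<gamma> U (\<beta> U x) \<in> extensional U" "x \<in> extensional U"
      using U x \<beta>c \<gamma>c by (auto intro: HQ.Q_extensional)
    fix p assume p: "p \<in> U"
    obtain V \<xi> \<xi>' where V: "opn V" "p \<in> V" "V \<subseteq> U" "\<xi> \<in> carrier (Sec H V)" "\<xi>' \<in> carrier (Sec H' V)"
      "agree_on_IJ V (hat \<xi>) (hat' \<xi>')" "restrict x V = HQ.pr V \<xi>"
      using loc[OF x p] by (elim exE conjE)
    have "restrict (\<gamma> U (\<beta> U x)) V = restrict x V"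
      using V U x by (simp add: res_\<gamma> \<beta>c res_\<beta> \<beta>_eq[of V \<xi> \<xi>'] \<gamma>_eq[of V \<xi> \<xi>'])
    then show "\<exists>V. p \<in> V \<and> restrict (\<gamma> U (\<beta> U x)) V = restrict x V" using V(2) by blast
  qed
  have \<beta>\<gamma>: "\<beta> U (\<gamma> U x) = x" if U: "opn U" and x: "x \<in> carrier (Sec swap.HQ.Q U)" for U x
  proof (rule swap.HQ.Q_eq_localI)
    show "\<beta> U (\<gamma> U x) \<in> extensional U" "x \<in> extensional U"
      using U x \<beta>c \<gamma>c by (auto intro: swap.HQ.Q_extensional)
    fix p assume p: "p \<in> U"
    obtain V \<xi> \<xi>' where V: "opn V" "p \<in> V" "V \<subseteq> U" "\<xi> \<in> carrier (Sec H V)" "\<xi>' \<in> carrier (Sec H' V)"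
      "agree_on_IJ V (hat \<xi>) (hat' \<xi>')" "restrict x V = swap.HQ.pr V \<xi>'"
      using loc'[OF x p] by (elim exE conjE)
    have "restrict (\<beta> U (\<gamma> U x)) V = restrict x V"
      using V U x by (simp add: res_\<gamma> \<gamma>c res_\<beta> \<beta>_eq[of V \<xi> \<xi>'] \<gamma>_eq[of V \<xi> \<xi>'])
    then show "\<exists>V. p \<in> V \<and> restrict (\<beta> U (\<gamma> U x)) V = restrict x V" using V(2) by blast
  qed
  have iso: "sheaf_isomorphism S HQ.Q swap.HQ.Q \<beta>"
    unfolding sheaf_isomorphism_def
  proof (intro conjI allI impI \<beta>)
    fix U assume U: "opn U"
    show "bij_betw (\<beta> U) (carrier (Sec HQ.Q U)) (carrier (Sec swap.HQ.Q U))"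
      by (rule bij_betwI[where g="\<gamma> U"]) (use U \<beta>c \<gamma>c \<beta>\<gamma> \<gamma>\<beta> in auto)
  qed
  have iff: "\<beta> U (HQ.pr U \<xi>) = swap.HQ.pr U \<xi>' \<longleftrightarrow> agree_on_IJ U (hat \<xi>) (hat' \<xi>')"
    if U: "opn U" and \<xi>: "\<xi> \<in> carrier (Sec H U)" and \<xi>': "\<xi>' \<in> carrier (Sec H' U)" for U \<xi> \<xi>'
  proof
    assume eq: "\<beta> U (HQ.pr U \<xi>) = swap.HQ.pr U \<xi>'"
    show "agree_on_IJ U (hat \<xi>) (hat' \<xi>')"
    proof (rule agree_on_IJ_hat_local[OF U])
      fix p assume p: "p \<in> U"
      \<comment> \<open>A partner \<psi> of \<xi> represents the image under \<beta> of the class of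
        \<xi>, which by assumption is the class of \<xi>'. So \<psi> and \<xi>' agree on I \<inter>
        J, and agreement of \<xi> with \<xi>' follows by transitivity.\<close>
      obtain V \<psi> where V: "opn V" "p \<in> V" "V \<subseteq> U" and \<psi>: "\<psi> \<in> carrier (Sec H' V)" "agree_on_IJ V (hat \<xi>) (hat' \<psi>)"
        using partner[OF derJ U p \<xi>] by blast
      have "agree_on_IJ V (hat (Res H U V \<xi>)) (hat' \<psi>)"
        using \<psi>(2) by (auto simp: agree_on_IJ_def hat_ops)
      then have "swap.HQ.pr V \<psi> = \<beta> V (HQ.pr V (Res H U V \<xi>))"
        using U V \<xi> \<psi> by (simp add: \<beta>_eq)
      also have "\<dots> = restrict (\<beta> U (HQ.pr U \<xi>)) V"
        using U V \<xi> by (simp add: res_\<beta> HQ.pr_res)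
      also have "\<dots> = swap.HQ.pr V (Res H' U V \<xi>')"
        using U V \<xi>' by (simp add: eq swap.HQ.pr_res)
      finally have "agree_on_IJ V (hat' \<psi>) (hat' (Res H' U V \<xi>'))"
        using V U \<psi> \<xi>' by (simp add: swap.Q_class_eq_iff swap_agree)
      then have "agree_on_IJ V (hat \<xi>) (hat' \<xi>')"
        using \<psi>(2) by (auto simp: agree_on_IJ_def swap.hat_ops)
      then show "\<exists>V. opn V \<and> p \<in> V \<and> V \<subseteq> U \<and> agree_on_IJ V (hat \<xi>) (hat' \<xi>')" using V by blast
    next
      fix V f assume V: "opn V" "V \<subseteq> U" "f \<in> I V" "f \<in> J V"
      show "hat \<xi> V f \<in> extensional V \<and> hat' \<xi>' V f \<in> extensional V"
        using K.Q_extensional[OF hat_in_Q[OF \<xi> V(1,2,4)]]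
          swap.K.Q_extensional[OF swap.hat_in_Q[OF \<xi>' V(1,2,3)]] by simp
    qed (use \<xi> \<xi>' hat_restrict swap.hat_restrict in auto)
  next
    assume "agree_on_IJ U (hat \<xi>) (hat' \<xi>')"
    then show "\<beta> U (HQ.pr U \<xi>) = swap.HQ.pr U \<xi>'" by (rule \<beta>_eq[OF U \<xi> \<xi>'])
  qed
  show ?thesis
    unfolding natural_iso_def
    by (rule exI[of _ \<beta>])
      (use iso iff in \<open>simp add: Q_sheaf_eq Q_class_eq swap.Q_sheaf_eq swap.Q_class_eq agree_on_inter_iff\<close>)
qed

end

section \<open>First-order deformations\<close>

lemma dual_ring_simps [simp]:
  "carrier (dual_ring A) = carrier A \<times> carrier A"
  "\<one>\<^bsub>dual_ring A\<^esub> = (\<one>\<^bsub>A\<^esub>, \<zero>\<^bsub>A\<^esub>)"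
  "\<zero>\<^bsub>dual_ring A\<^esub> = (\<zero>\<^bsub>A\<^esub>, \<zero>\<^bsub>A\<^esub>)"
  "(a, b) \<oplus>\<^bsub>dual_ring A\<^esub> (c, d) = (a \<oplus>\<^bsub>A\<^esub> c, b \<oplus>\<^bsub>A\<^esub> d)"
  "(a, b) \<otimes>\<^bsub>dual_ring A\<^esub> (c, d) = (a \<otimes>\<^bsub>A\<^esub> c, a \<otimes>\<^bsub>A\<^esub> d \<oplus>\<^bsub>A\<^esub> b \<otimes>\<^bsub>A\<^esub> c)"
  "(a, b) \<odot>\<^bsub>dual_ring A\<^esub> (c, d) = (a \<otimes>\<^bsub>A\<^esub> c, a \<otimes>\<^bsub>A\<^esub> d \<oplus>\<^bsub>A\<^esub> b \<otimes>\<^bsub>A\<^esub> c)"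
  by (simp_all add: dual_ring_def Let_def)

lemma dual_ring_cring:
  assumes "cring A"
  shows "cring (dual_ring A)"
proof -
  interpret cring A by fact
  show ?thesis
  proof (rule cringI)
    show "abelian_group (dual_ring A)"
    proof (rule abelian_groupI)
      fix x assume "x \<in> carrier (dual_ring A)"
      then show "\<exists>y\<in>carrier (dual_ring A). y \<oplus>\<^bsub>dual_ring A\<^esub> x = \<zero>\<^bsub>dual_ring A\<^esub>"
        by (cases x) (auto intro!: bexI[of _ "(\<ominus>\<^bsub>A\<^esub> fst x, \<ominus>\<^bsub>A\<^esub> snd x)"] simp: l_neg)
    qed (auto simp: a_ac)
    show "Group.comm_monoid (dual_ring A)"
      by (rule comm_monoidI) (auto simp: m_ac a_ac r_distr l_distr)
  qed (auto simp: l_distr a_ac)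
qed

lemma dual_ring_minus:
  assumes "cring A" "a \<in> carrier A" "b \<in> carrier A" "c \<in> carrier A" "d \<in> carrier A"
  shows "(a, b) \<ominus>\<^bsub>dual_ring A\<^esub> (c, d) = (a \<ominus>\<^bsub>A\<^esub> c, b \<ominus>\<^bsub>A\<^esub> d)"
proof -
  interpret cring A by fact
  interpret D: cring "dual_ring A" by (rule dual_ring_cring) fact
  have "\<ominus>\<^bsub>dual_ring A\<^esub> (c, d) = (\<ominus>\<^bsub>A\<^esub> c, \<ominus>\<^bsub>A\<^esub> d)"
    using assms by (intro D.minus_equality) (auto simp: l_neg)
  then show ?thesis by (simp add: a_minus_def)
qed

lemma dual_space_simps [simp]:
  "Top (dual_space S) = Top S"
  "Sec (Str (dual_space S)) U = dual_ring (Sec (Str S) U)"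
  "Res (Str (dual_space S)) U V = map_prod (Res (Str S) U V) (Res (Str S) U V)"
  by (simp_all add: dual_space_def)

lemma (in ring_presheaf) dual_ring_presheaf: "ring_presheaf (dual_space S)"
proof (rule ring_presheaf.intro)
  fix U V assume U: "openin (Top (dual_space S)) U" and V: "openin (Top (dual_space S)) V" "V \<subseteq> U"
  interpret RU: cring "R U" using U by (simp add: cring)
  interpret RV: cring "R V" using V by (simp add: cring)
  have z: "rho U V \<zero>\<^bsub>R U\<^esub> = \<zero>\<^bsub>R V\<^esub>"
    using str_res_hom[of U V] U V RU.ring_axioms RV.ring_axioms by (intro Ring.ring_hom_zero) auto
  show "Res (Str (dual_space S)) U V \<in> Ring.ring_hom (Sec (Str (dual_space S)) U) (Sec (Str (dual_space S)) V)"
    by (rule Ring.ring_hom_memI) (use U V in \<open>auto simp: str_res_mult str_res_add str_res_one z\<close>)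
qed (auto simp: dual_ring_cring cring str_res_id str_res_res)

section \<open>The deformed intersection and its stalks\<close>

context ideal_pair
begin

context
  fixes \<eta>
  assumes \<eta>: "\<eta> \<in> carrier (Sec N X)"
begin

abbreviation D where "D \<equiv> deformation_ideal S J \<eta>"
abbreviation T where "T \<equiv> trivial_deformation I"
abbreviation L where "L \<equiv> ideal_sum (dual_space S) D T"

lemma mem_D: "(f, h) \<in> D U \<longleftrightarrow> f \<in> J U \<and> h \<in> \<O> U \<and> J.pr U h = \<eta> U f"
  by (simp add: deformation_ideal_def)

lemma mem_T: "(f, h) \<in> T U \<longleftrightarrow> f \<in> I U \<and> h \<in> I U"
  by (simp add: trivial_deformation_def)

lemma eta_res: "opn U \<Longrightarrow> opn V \<Longrightarrow> V \<subseteq> U \<Longrightarrow> f \<in> J U \<Longrightarrow> \<eta> V (rho U V f) = restrict (\<eta> U f) V"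
  using morD(4)[OF N_morphism[OF \<eta>], of U V f] openin_sub_top by simp

lemma eta_closed: "opn U \<Longrightarrow> f \<in> J U \<Longrightarrow> \<eta> U f \<in> carrier (Sec J.Q U)"
  using N_closed[OF \<eta>] openin_sub_top by simp

lemma dual_ideal_pair: "ideal_pair (dual_space S) D T"
proof -
  interpret dual: ring_presheaf "dual_space S" by (rule dual_ring_presheaf)
  note m = N_morphism[OF \<eta>]
  have "ideal_presheaf (dual_space S) D"
  proof (rule dual.ideal_presheafI)
    show "submodule_presheaf (dual_space S) (Str (dual_space S)) D"
    proof (intro submodule_presheaf.intro submodule_presheaf_axioms.intro dual.str_presheaf)
      fix U assume U: "dual.opn U"
      then have o: "opn U" "U \<subseteq> X" using openin_sub_top by auto
      interpret RU: cring "R U" by (rule cring[OF o(1)])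
      have "\<eta> U \<zero>\<^bsub>R U\<^esub> = \<zero>\<^bsub>Sec J.Q U\<^esub>"
        using J.sq.morphism_zero[OF J.Q_module m o] by simp
      then show "\<zero>\<^bsub>Sec (Str (dual_space S)) U\<^esub> \<in> D U"
        using o by (simp add: mem_D J.sub_zero J.pr_zero)
      fix x assume x: "x \<in> D U"
      obtain f h where fh: "x = (f, h)" by (cases x)
      have x': "f \<in> J U" "h \<in> \<O> U" "J.pr U h = \<eta> U f" "f \<in> \<O> U"
        using x o by (auto simp: fh mem_D J.sub_carrier)
      show "x \<in> carrier (Sec (Str (dual_space S)) U)" using x' by (simp add: fh)
      show "x \<oplus>\<^bsub>Sec (Str (dual_space S)) U\<^esub> y \<in> D U" if "y \<in> D U" for y
        using that x' o morD(2)[OF m o, of f "fst y"]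
        by (cases y) (auto simp: fh mem_D J.sub_add J.pr_add)
      show "a \<odot>\<^bsub>Sec (Str (dual_space S)) U\<^esub> x \<in> D U" if "a \<in> carrier (Sec (Str (dual_space S)) U)" for a
      proof -
        obtain b c where a: "a = (b, c)" "b \<in> \<O> U" "c \<in> \<O> U" using \<open>a \<in> _\<close> by (cases a) auto
        have cf: "c \<otimes>\<^bsub>R U\<^esub> f \<in> J U" using o a x' by (simp add: J.sub_mult)
        \<comment> \<open>The \<epsilon>-part of (b + \<epsilon> c)(f + \<epsilon> h) is b h + c f,
          and c f lies in J; modulo J there remains b \<eta>(f) = \<eta>(b f).\<close>
        have "J.pr U (b \<otimes>\<^bsub>R U\<^esub> h \<oplus>\<^bsub>R U\<^esub> c \<otimes>\<^bsub>R U\<^esub> f) = J.pr U (b \<otimes>\<^bsub>R U\<^esub> h)"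
        proof (rule J.pr_eq_iff'[THEN iffD2])
          have "b \<otimes>\<^bsub>R U\<^esub> h \<oplus>\<^bsub>R U\<^esub> c \<otimes>\<^bsub>R U\<^esub> f \<ominus>\<^bsub>R U\<^esub> b \<otimes>\<^bsub>R U\<^esub> h = c \<otimes>\<^bsub>R U\<^esub> f"
            using a x' by algebra
          then show "b \<otimes>\<^bsub>R U\<^esub> h \<oplus>\<^bsub>R U\<^esub> c \<otimes>\<^bsub>R U\<^esub> f \<ominus>\<^bsub>R U\<^esub> b \<otimes>\<^bsub>R U\<^esub> h \<in> J U" using cf by simp
        qed (use o a x' in auto)
        also have "\<dots> = \<eta> U (b \<otimes>\<^bsub>R U\<^esub> f)"
          using morD(3)[OF m o, of b f] o a x' by (simp flip: smult_mult add: J.pr_smult)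
        finally show ?thesis
          using o a x' by (simp add: fh mem_D J.sub_mult)
      qed
      show "Res (Str (dual_space S)) U V x \<in> D V" if "dual.opn V" "V \<subseteq> U" for V
        using that o x' by (simp add: fh mem_D J.sub_res eta_res J.pr_res flip: x'(3))
    qed
    fix U s assume U: "dual.opn U" and s: "s \<in> carrier (Sec (Str (dual_space S)) U)"
      and loc: "\<And>p. p \<in> U \<Longrightarrow> \<exists>V. dual.opn V \<and> p \<in> V \<and> V \<subseteq> U \<and> Res (Str (dual_space S)) U V s \<in> D V"
    obtain f h where fh: "s = (f, h)" "f \<in> \<O> U" "h \<in> \<O> U" using s by (cases s) auto
    have loc': "\<exists>V. opn V \<and> p \<in> V \<and> V \<subseteq> U \<and> rho U V f \<in> J V \<and> J.pr V (rho U V h) = \<eta> V (rho U V f)" if "p \<in> U" for p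
      using loc[OF that] by (auto simp: fh mem_D)
    have o: "opn U" using U by simp
    have f: "f \<in> J U"
      by (rule J.ideal_localI[OF o fh(2)]) (use loc' in blast)
    have "J.pr U h = \<eta> U f"
    proof (rule J.Q_eq_localI[of _ U])
      show "\<eta> U f \<in> extensional U" using eta_closed[OF o f] by (rule J.Q_extensional)
      fix p assume "p \<in> U"
      then obtain V where V: "opn V" "p \<in> V" "V \<subseteq> U" "J.pr V (rho U V h) = \<eta> V (rho U V f)"
        using loc' by blast
      then have "restrict (J.pr U h) V = restrict (\<eta> U f) V"
        using o f fh by (simp add: eta_res J.pr_res)
      then show "\<exists>V. p \<in> V \<and> restrict (J.pr U h) V = restrict (\<eta> U f) V" using V(2) by blast
    qed simp
    then show "s \<in> D U" using f fh by (simp add: mem_D)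
  qed
  moreover have "ideal_presheaf (dual_space S) T"
  proof (rule dual.ideal_presheafI)
    show "submodule_presheaf (dual_space S) (Str (dual_space S)) T"
    proof (intro submodule_presheaf.intro submodule_presheaf_axioms.intro dual.str_presheaf)
      fix U assume U: "dual.opn U"
      show "\<zero>\<^bsub>Sec (Str (dual_space S)) U\<^esub> \<in> T U" using U by (simp add: mem_T I.sub_zero)
      fix x assume x: "x \<in> T U"
      then show "x \<in> carrier (Sec (Str (dual_space S)) U)" using U by (cases x) (auto simp: mem_T I.sub_carrier)
      show "x \<oplus>\<^bsub>Sec (Str (dual_space S)) U\<^esub> y \<in> T U" if "y \<in> T U" for y
        using that x U by (cases x; cases y) (auto simp: mem_T I.sub_add)
      show "a \<odot>\<^bsub>Sec (Str (dual_space S)) U\<^esub> x \<in> T U" if "a \<in> carrier (Sec (Str (dual_space S)) U)" for a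
        using that x U by (cases x; cases a) (auto simp: mem_T I.sub_mult I.sub_add)
      show "Res (Str (dual_space S)) U V x \<in> T V" if "dual.opn V" "V \<subseteq> U" for V
        using that x U by (cases x) (auto simp: mem_T I.sub_res)
    qed
    fix U s assume U: "dual.opn U" and s: "s \<in> carrier (Sec (Str (dual_space S)) U)"
      and loc: "\<And>p. p \<in> U \<Longrightarrow> \<exists>V. dual.opn V \<and> p \<in> V \<and> V \<subseteq> U \<and> Res (Str (dual_space S)) U V s \<in> T V"
    obtain f h where fh: "s = (f, h)" "f \<in> \<O> U" "h \<in> \<O> U" using s by (cases s) auto
    have loc': "\<exists>V. opn V \<and> p \<in> V \<and> V \<subseteq> U \<and> rho U V f \<in> I V \<and> rho U V h \<in> I V" if "p \<in> U" for p
      using loc[OF that] by (auto simp: fh mem_T)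
    have o: "opn U" using U by simp
    have "f \<in> I U" by (rule I.ideal_localI[OF o fh(2)]) (use loc' in blast)
    moreover have "h \<in> I U" by (rule I.ideal_localI[OF o fh(3)]) (use loc' in blast)
    ultimately show "s \<in> T U" using fh by (simp add: mem_T)
  qed
  ultimately show ?thesis by (simp add: ideal_pair_def dual.ring_presheaf_axioms)
qed

abbreviation eps where "eps \<equiv> (\<zero>\<^bsub>R X\<^esub>, \<one>\<^bsub>R X\<^esub>)"

abbreviation st where "st \<equiv> quot_stalk (dual_space S) (Str (dual_space S)) L"

text \<open>The left side says that the kernel of \<epsilon> is its image on every stalk, which is
  the flatness criterion proved below. A section of \<open>L\<close> is locally (f + i) + \<epsilon>
  (h + i') with f in J, h representing \<eta>(f), and i, i' in I; its part free of \<epsilon>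
  vanishes exactly when f = - i, and then f lies in I \<inter> J.\<close>

lemma dual_flat_iff:
  "(\<forall>p\<in>X. \<forall>x\<in>carrier (st p). (X, eps) \<odot>\<^bsub>st p\<^esub> x = \<zero>\<^bsub>st p\<^esub> \<longrightarrow>
      (\<exists>y\<in>carrier (st p). x = (X, eps) \<odot>\<^bsub>st p\<^esub> y)) \<longleftrightarrow>
   \<eta> \<in> F_sections S I J X"
proof -
  interpret dp: ideal_pair "dual_space S" D T by (rule dual_ideal_pair)
  have eps_closed: "eps \<in> carrier (dual_ring (R X))" by simp
  have zero_res: "rho X V \<zero>\<^bsub>R X\<^esub> = \<zero>\<^bsub>R V\<^esub>" if "opn V" for V
    using I.res_zero[of X V] that openin_sub_top by simp
  have eps_smult: "(X, eps) \<odot>\<^bsub>st p\<^esub> dp.K.g p V (a, b) = dp.K.g p V (\<zero>\<^bsub>R V\<^esub>, a)"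
    if V: "opn V" "p \<in> V" "a \<in> \<O> V" "b \<in> \<O> V" for V p a b
  proof -
    interpret cring "R V" by (rule cring[OF V(1)])
    have "(X, eps) \<odot>\<^bsub>st p\<^esub> dp.K.g p V (a, b) = dp.K.g p V (map_prod (rho X V) (rho X V) eps \<odot>\<^bsub>dual_ring (R V)\<^esub> (a, b))"
      using dp.K.stalk_smult_same[of X V p eps "(a, b)"] V openin_sub_top by simp
    also have "map_prod (rho X V) (rho X V) eps \<odot>\<^bsub>dual_ring (R V)\<^esub> (a, b) = (\<zero>\<^bsub>R V\<^esub>, a)"
      using V openin_sub_top[OF V(1)] by (simp add: zero_res str_res_one)
    finally show ?thesis .
  qed
  have stalkE: "\<exists>V a b. opn V \<and> p \<in> V \<and> a \<in> \<O> V \<and> b \<in> \<O> V \<and> x = dp.K.g p V (a, b)"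
    if "x \<in> carrier (st p)" for x p
    using that by (rule dp.K.stalk_carrierE) (auto; blast)
  have LE: "\<exists>V f h i i'. opn V \<and> p \<in> V \<and> V \<subseteq> U \<and> f \<in> J V \<and> h \<in> \<O> V \<and> J.pr V h = \<eta> V f \<and>
      i \<in> I V \<and> i' \<in> I V \<and> rho U V a = f \<oplus>\<^bsub>R V\<^esub> i \<and> rho U V b = h \<oplus>\<^bsub>R V\<^esub> i'"
    if ab: "(a, b) \<in> L U" "p \<in> U" for a b U p
  proof -
    obtain V x y where V: "dp.opn V" "p \<in> V" "V \<subseteq> U" "x \<in> D V" "y \<in> T V"
      "Res (Str (dual_space S)) U V (a, b) = x \<oplus>\<^bsub>Sec (Str (dual_space S)) V\<^esub> y"
      using ab by (rule dp.ideal_sumE)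
    obtain f h i i' where "x = (f, h)" "y = (i, i')" by (cases x; cases y)
    then show ?thesis
      using V by (intro exI[of _ V] exI[of _ f] exI[of _ h] exI[of _ i] exI[of _ i']) (auto simp: mem_D mem_T)
  qed
  show ?thesis
  proof
    assume flat: "\<forall>p\<in>X. \<forall>x\<in>carrier (st p). (X, eps) \<odot>\<^bsub>st p\<^esub> x = \<zero>\<^bsub>st p\<^esub> \<longrightarrow>
      (\<exists>y\<in>carrier (st p). x = (X, eps) \<odot>\<^bsub>st p\<^esub> y)"
    have "\<eta> V f \<in> JK.rel V" if V: "opn V" "f \<in> I V" "f \<in> J V" for V f
      unfolding JK.mem_rel_ideal_iff[OF V(1)]
    proof (intro conjI ballI eta_closed V)
      fix p assume p: "p \<in> V"
      obtain W h where W: "opn W" "p \<in> W" "W \<subseteq> V" "h \<in> \<O> W" "restrict (\<eta> V f) W = J.pr W h"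
        using eta_closed[OF V(1,3)] p by (rule J.sec_local)
      interpret RW: cring "R W" by (rule cring[OF W(1)])
      have fW: "rho V W f \<in> I W" "rho V W f \<in> J W" "rho V W f \<in> \<O> W"
        using V W by (auto simp: I.sub_res J.sub_res I.sub_carrier)
      have "(rho V W f, h) \<in> D W" using V W fW by (simp add: mem_D eta_res)
      moreover have "(\<ominus>\<^bsub>R W\<^esub> rho V W f, \<zero>\<^bsub>R W\<^esub>) \<in> T W" using W fW by (simp add: mem_T I.sub_inv I.sub_zero)
      ultimately have "(rho V W f, h) \<oplus>\<^bsub>dual_ring (R W)\<^esub> (\<ominus>\<^bsub>R W\<^esub> rho V W f, \<zero>\<^bsub>R W\<^esub>) \<in> L W"
        using dp.ideal_sumI[of W] W by (simp del: dual_ring_simps)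
      \<comment> \<open>Subtracting (f, 0) from (f, h) leaves \<epsilon> h in \<open>L\<close>, so
        the germ of h is killed by \<epsilon>. Flatness writes h as \<epsilon> c modulo
        \<open>L\<close>, and the part of this relation free of \<epsilon> says that h lies in J +
        I.\<close>
      then have L0: "(\<zero>\<^bsub>R W\<^esub>, h) \<in> L W" using fW W by (simp add: RW.r_neg)
      define x where "x = dp.K.g p W (h, \<zero>\<^bsub>R W\<^esub>)"
      have x: "x \<in> carrier (st p)" using W unfolding x_def by (intro dp.K.germ_in_stalk) auto
      have "Res (Str (dual_space S)) W W (\<zero>\<^bsub>R W\<^esub>, h) = (\<zero>\<^bsub>R W\<^esub>, h)" using W by (simp add: str_res_id)
      then have "dp.K.g p W (\<zero>\<^bsub>R W\<^esub>, h) = \<zero>\<^bsub>st p\<^esub>"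
        using dp.K.germ_zero_iff[of W p "(\<zero>\<^bsub>R W\<^esub>, h)"] W L0 by (metis dual_ring_simps(1) dual_space_simps(1,2) mem_Sigma_iff subset_refl RW.zero_closed)
      then have "(X, eps) \<odot>\<^bsub>st p\<^esub> x = \<zero>\<^bsub>st p\<^esub>"
        using W by (simp add: x_def eps_smult)
      moreover have "p \<in> X" using openin_sub_top[OF V(1)] p by auto
      ultimately obtain y where y: "y \<in> carrier (st p)" "x = (X, eps) \<odot>\<^bsub>st p\<^esub> y"
        using flat x by blast
      obtain N c d where N: "opn N" "p \<in> N" "c \<in> \<O> N" "d \<in> \<O> N" "y = dp.K.g p N (c, d)"
        using stalkE[OF y(1)] by (elim exE conjE)
      interpret RN: cring "R N" by (rule cring[OF N(1)])
      have "dp.K.g p W (h, \<zero>\<^bsub>R W\<^esub>) = dp.K.g p N (\<zero>\<^bsub>R N\<^esub>, c)"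
        using y(2) N by (simp add: x_def eps_smult)
      then have "dp.K.germ_eq p W (h, \<zero>\<^bsub>R W\<^esub>) N (\<zero>\<^bsub>R N\<^esub>, c)"
        using dp.K.germ_iff[of W N p "(h, \<zero>\<^bsub>R W\<^esub>)" "(\<zero>\<^bsub>R N\<^esub>, c)"] W N by simp
      then obtain P where P: "opn P" "p \<in> P" "P \<subseteq> W" "P \<subseteq> N"
        and L1: "(rho W P h, rho W P \<zero>\<^bsub>R W\<^esub>) \<ominus>\<^bsub>dual_ring (R P)\<^esub> (rho N P \<zero>\<^bsub>R N\<^esub>, rho N P c) \<in> L P"
        by (auto simp: dp.K.germ_eq_def)
      interpret RP: cring "R P" by (rule cring[OF P(1)])
      have z: "rho N P \<zero>\<^bsub>R N\<^esub> = \<zero>\<^bsub>R P\<^esub>" "rho W P \<zero>\<^bsub>R W\<^esub> = \<zero>\<^bsub>R P\<^esub>"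
        using I.res_zero[of N P] I.res_zero[of W P] P N W by simp_all
      have "(rho W P h, \<ominus>\<^bsub>R P\<^esub> rho N P c) \<in> L P"
        using L1 P N W by (simp add: z dual_ring_minus RP.cring_axioms) (simp add: a_minus_def)
      from LE[OF this P(2)] obtain P' j h' i i' where P': "opn P'" "p \<in> P'" "P' \<subseteq> P" "j \<in> J P'" "i \<in> I P'"
        "rho P P' (rho W P h) = j \<oplus>\<^bsub>R P'\<^esub> i" and "h' \<in> \<O> P'" "i' \<in> I P'"
        by (elim exE conjE)
      interpret RP': cring "R P'" by (rule cring[OF P'(1)])
      have P'W: "P' \<subseteq> W" using P P' by auto
      have "rho W P' h = i \<oplus>\<^bsub>R P'\<^esub> j"
        using P'(6) W P P' str_res_res[OF W(1) P(1) P'(1,3) P(3) W(4)]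
        by (simp add: I.sub_carrier J.sub_carrier RP'.a_comm)
      then have hK: "rho W P' h \<in> K P'" using P' by (simp add: ideal_sumI)
      have "restrict (\<eta> V f) P' = restrict (restrict (\<eta> V f) W) P'" using P'W by (simp add: Int_absorb1)
      also have "\<dots> = J.pr P' (rho W P' h)" unfolding W(5) using W P' P'W by (intro J.pr_res) auto
      finally show "\<exists>V' s. opn V' \<and> p \<in> V' \<and> V' \<subseteq> V \<and> s \<in> K V' \<and> restrict (\<eta> V f) V' = J.pr V' s"
        using hK P' P'W W by (intro exI[of _ P'] exI[of _ "rho W P' h"]) auto
    qed
    then show "\<eta> \<in> F_sections S I J X" using \<eta> by (auto simp: F_sections_def)
  next
    assume F: "\<eta> \<in> F_sections S I J X"
    show "\<forall>p\<in>X. \<forall>x\<in>carrier (st p). (X, eps) \<odot>\<^bsub>st p\<^esub> x = \<zero>\<^bsub>st p\<^esub> \<longrightarrow>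
      (\<exists>y\<in>carrier (st p). x = (X, eps) \<odot>\<^bsub>st p\<^esub> y)"
    proof (intro ballI impI)
      fix p x assume "p \<in> X" and x: "x \<in> carrier (st p)" and ex: "(X, eps) \<odot>\<^bsub>st p\<^esub> x = \<zero>\<^bsub>st p\<^esub>"
      obtain V a b where V: "opn V" "p \<in> V" "a \<in> \<O> V" "b \<in> \<O> V" "x = dp.K.g p V (a, b)"
        using stalkE[OF x] by (elim exE conjE)
      interpret RV: cring "R V" by (rule cring[OF V(1)])
      have "dp.K.g p V (\<zero>\<^bsub>R V\<^esub>, a) = \<zero>\<^bsub>st p\<^esub>" using ex V by (simp add: eps_smult)
      then obtain W where W: "opn W" "p \<in> W" "W \<subseteq> V" "(rho V W \<zero>\<^bsub>R V\<^esub>, rho V W a) \<in> L W"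
        using dp.K.germ_zero_iff[of V p "(\<zero>\<^bsub>R V\<^esub>, a)"] V by auto
      have zW: "rho V W \<zero>\<^bsub>R V\<^esub> = \<zero>\<^bsub>R W\<^esub>" using I.res_zero[of V W] V W by simp
      obtain P f h i i' where P: "opn P" "p \<in> P" "P \<subseteq> W" "f \<in> J P" "h \<in> \<O> P" "J.pr P h = \<eta> P f"
        "i \<in> I P" "i' \<in> I P" "rho W P \<zero>\<^bsub>R W\<^esub> = f \<oplus>\<^bsub>R P\<^esub> i" "rho W P (rho V W a) = h \<oplus>\<^bsub>R P\<^esub> i'"
        using LE[OF W(4,2)] unfolding zW by (elim exE conjE)
      interpret RP: cring "R P" by (rule cring[OF P(1)])
      have PV: "P \<subseteq> V" using P W by auto
      have c: "f \<in> \<O> P" "i \<in> \<O> P" "i' \<in> \<O> P"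
        using P by (simp_all add: I.sub_carrier J.sub_carrier)
      have "rho W P \<zero>\<^bsub>R W\<^esub> = \<zero>\<^bsub>R P\<^esub>" using I.res_zero[of W P] P W by simp
      then have "f = \<ominus>\<^bsub>R P\<^esub> i" using P(9) c by (metis RP.minus_equality)
      \<comment> \<open>As f + i = 0, the section f lies in I \<inter> J, where the assumption on
        \<eta> puts \<eta>(f) into I_{Z/Y}; so h, and with it a, lies in \<open>K\<close>.\<close>
      then have "f \<in> I P" using P by (simp add: I.sub_inv)
      then have "\<eta> P f \<in> \<eta> P ` (I P \<inter> J P)" using P(4) by blast
      then have "\<eta> P f \<in> JK.rel P" using F P(1) openin_sub_top[OF P(1)] unfolding F_sections_def by blast
      then have "J.pr P h \<in> JK.rel P" by (simp only: P(6))
      then have hK: "h \<in> K P" using JK.pr_rel_iff[OF P(1,5)] by blast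
      have aP: "rho V P a = h \<oplus>\<^bsub>R P\<^esub> i'"
        using P(10) str_res_res[OF V(1) W(1) P(1,3) W(3) V(3)] by simp
      have aK: "rho V P a \<in> K P" unfolding aP using P hK I_sub_K by (intro K.sub_add) auto
      obtain N i2 j2 where N: "opn N" "p \<in> N" "N \<subseteq> P" "i2 \<in> I N" "j2 \<in> J N" "rho P N (rho V P a) = i2 \<oplus>\<^bsub>R N\<^esub> j2"
        using aK P(2) by (rule ideal_sumE)
      obtain M h2 where M: "opn M" "p \<in> M" "M \<subseteq> N" "h2 \<in> \<O> M" "restrict (\<eta> N j2) M = J.pr M h2"
        using eta_closed[OF N(1,5)] N(2) by (rule J.sec_local)
      interpret RM: cring "R M" by (rule cring[OF M(1)])
      have MV: "M \<subseteq> V" "M \<subseteq> P" "N \<subseteq> V" using M N PV by auto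
      define i3 j3 where "i3 = rho N M i2" and "j3 = rho N M j2"
      have ij: "i3 \<in> I M" "j3 \<in> J M" "i3 \<in> \<O> M" "j3 \<in> \<O> M"
        using N M by (auto simp: i3_def j3_def I.sub_res J.sub_res I.sub_carrier J.sub_carrier)
      have "rho V N a = i2 \<oplus>\<^bsub>R N\<^esub> j2"
        using N(6) str_res_res[OF V(1) P(1) N(1,3) PV V(3)] by simp
      then have "rho V M a = rho N M (i2 \<oplus>\<^bsub>R N\<^esub> j2)"
        using str_res_res[OF V(1) N(1) M(1,3) MV(3) V(3)] by simp
      then have aM: "rho V M a = i3 \<oplus>\<^bsub>R M\<^esub> j3"
        using N M by (simp add: i3_def j3_def str_res_add I.sub_carrier J.sub_carrier)
      \<comment> \<open>Writing a = i3 + j3 and lifting \<eta>(j3) to h2 gives a + \<epsilon> h2 in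
        \<open>L\<close>, so a + \<epsilon> b is congruent to \<epsilon> (b - h2).\<close>
      have "(j3, h2) \<in> D M" using N M ij by (simp add: mem_D j3_def eta_res)
      moreover have "(i3, \<zero>\<^bsub>R M\<^esub>) \<in> T M" using M ij by (simp add: mem_T I.sub_zero)
      ultimately have "(j3, h2) \<oplus>\<^bsub>dual_ring (R M)\<^esub> (i3, \<zero>\<^bsub>R M\<^esub>) \<in> L M"
        using dp.ideal_sumI[of M] M by (simp del: dual_ring_simps)
      then have L2: "(rho V M a, h2) \<in> L M" using ij M by (simp add: aM RM.a_comm)
      define b2 where "b2 = rho V M b \<ominus>\<^bsub>R M\<^esub> h2"
      have bM: "rho V M b \<in> \<O> M" "rho V M a \<in> \<O> M" "b2 \<in> \<O> M"
        using V M MV by (auto simp: b2_def)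
      define y where "y = dp.K.g p M (b2, \<zero>\<^bsub>R M\<^esub>)"
      have y: "y \<in> carrier (st p)" unfolding y_def using M bM by (intro dp.K.germ_in_stalk) auto
      have "x = dp.K.g p M (rho V M a, rho V M b)"
        using dp.K.germ_res[of V M p "(a, b)"] V M MV by simp
      also have "\<dots> = dp.K.g p M (\<zero>\<^bsub>R M\<^esub>, b2)"
      proof (rule dp.K.germ_eqI[of _ _ M])
        have "rho V M b \<ominus>\<^bsub>R M\<^esub> b2 = h2"
          unfolding b2_def using bM(1) M(4) by algebra
        then have "(rho V M a, rho V M b) \<ominus>\<^bsub>dual_ring (R M)\<^esub> (\<zero>\<^bsub>R M\<^esub>, b2) = (rho V M a, h2)"
          using bM M by (simp add: dual_ring_minus RM.cring_axioms) (simp add: a_minus_def)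
        then show "Res (Str (dual_space S)) M M (rho V M a, rho V M b) \<ominus>\<^bsub>Sec (Str (dual_space S)) M\<^esub>
            Res (Str (dual_space S)) M M (\<zero>\<^bsub>R M\<^esub>, b2) \<in> L M"
          using L2 bM M by (simp add: str_res_id)
      qed (use M bM in auto)
      also have "\<dots> = (X, eps) \<odot>\<^bsub>st p\<^esub> y"
        unfolding y_def using M bM by (simp add: eps_smult)
      finally show "\<exists>y\<in>carrier (st p). x = (X, eps) \<odot>\<^bsub>st p\<^esub> y" using y by blast
    qed
  qed
qed

end

end

section \<open>Flatness over the dual numbers\<close>

text \<open>Links the tensor construction to free Abelian groups, whose elements have the same type,
  so that \<open>frag_induction\<close> and the universal property become available.\<close>

lemma tensor_map_frag: "tensor_map f t = frag_extend (\<lambda>z. frag_of (f (fst z), snd z)) t"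
proof -
  have "frag_cmul k (frag_of z) = single z k" for k and z :: "'a \<times> 'b"
    by (rule poly_mapping_eqI) (simp add: lookup_single when_def)
  then show ?thesis by (simp add: tensor_map_def frag_extend_def)
qed

lemma tensor_null_minus: "s \<in> tensor_null A N M \<Longrightarrow> - s \<in> tensor_null A N M"
  using tensor_null.diff[OF tensor_null.zero, of s A N M] by simp

lemma tensor_null_add: "s \<in> tensor_null A N M \<Longrightarrow> t \<in> tensor_null A N M \<Longrightarrow> s + t \<in> tensor_null A N M"
  using tensor_null.diff[OF _ tensor_null_minus, of s A N M t] by simp

text \<open>Null elements have admissible support, so an evaluation map that is additive only on
  such elements can be followed through the inductive definition.\<close>

lemma tensor_null_keys:
  assumes "module A N" "module A M" "t \<in> tensor_null A N M"
  shows "keys t \<subseteq> carrier N \<times> carrier M"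
proof -
  interpret N: module A N by fact
  interpret M: module A M by fact
  have d: "keys (a - b) \<subseteq> carrier N \<times> carrier M"
    if "keys a \<subseteq> carrier N \<times> carrier M" "keys b \<subseteq> carrier N \<times> carrier M" for a b :: "_ \<Rightarrow>\<^sub>0 int"
    using keys_diff[of a b] that by blast
  show ?thesis
    using assms(3) by induction (simp_all add: d)
qed

lemma frag_extend_tensor_null:
  assumes "keys t \<subseteq> B" "\<And>z. z \<in> B \<Longrightarrow> \<phi> z - \<psi> z \<in> tensor_null A N M"
  shows "frag_extend \<phi> t - frag_extend \<psi> t \<in> tensor_null A N M"
  using assms(1)
proof (induction rule: frag_induction)
  case (diff a b)
  have "frag_extend \<phi> (a - b) - frag_extend \<psi> (a - b) =
    (frag_extend \<phi> a - frag_extend \<psi> a) - (frag_extend \<phi> b - frag_extend \<psi> b)"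
    by (simp add: frag_extend_diff)
  then show ?case using diff by (simp add: tensor_null.diff)
qed (auto intro: tensor_null.zero assms(2))

lemma tensor_map_null:
  assumes f: "f \<in> linear_maps A N N'" and t: "t \<in> tensor_null A N M"
  shows "tensor_map f t \<in> tensor_null A N' M"
  using t unfolding tensor_map_frag
proof induction
  case (add_left x x' y)
  then have "f x \<in> carrier N'" "f x' \<in> carrier N'" "f (x \<oplus>\<^bsub>N\<^esub> x') = f x \<oplus>\<^bsub>N'\<^esub> f x'"
    using f by (auto simp: linear_maps_def hom_def)
  then show ?case using add_left by (simp add: frag_extend_diff tensor_null.add_left)
next
  case (add_right x y y')
  then have "f x \<in> carrier N'" using f by (auto simp: linear_maps_def hom_def)
  then show ?case using add_right by (simp add: frag_extend_diff tensor_null.add_right)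
next
  case (smult a x y)
  then have "f x \<in> carrier N'" "f (a \<odot>\<^bsub>N\<^esub> x) = a \<odot>\<^bsub>N'\<^esub> f x"
    using f by (auto simp: linear_maps_def hom_def)
  then show ?case using smult by (simp add: frag_extend_diff tensor_null.smult)
qed (auto simp: frag_extend_diff intro: tensor_null.intros)

text \<open>A bilinear map, up to a subgroup \<open>B\<close> of its target, induces a map on the tensor product.\<close>

lemma tensor_eval:
  assumes N: "module A N" and M: "module A M" and G: "abelian_group G"
    and h: "\<And>x y. x \<in> carrier N \<Longrightarrow> y \<in> carrier M \<Longrightarrow> h (x, y) \<in> carrier G"
    and B: "B \<subseteq> carrier G" "\<zero>\<^bsub>G\<^esub> \<in> B" "\<And>x y. x \<in> B \<Longrightarrow> y \<in> B \<Longrightarrow> x \<ominus>\<^bsub>G\<^esub> y \<in> B"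
    and hl: "\<And>x x' y. x \<in> carrier N \<Longrightarrow> x' \<in> carrier N \<Longrightarrow> y \<in> carrier M \<Longrightarrow>
      h (x \<oplus>\<^bsub>N\<^esub> x', y) \<ominus>\<^bsub>G\<^esub> h (x, y) \<ominus>\<^bsub>G\<^esub> h (x', y) \<in> B"
    and hr: "\<And>x y y'. x \<in> carrier N \<Longrightarrow> y \<in> carrier M \<Longrightarrow> y' \<in> carrier M \<Longrightarrow>
      h (x, y \<oplus>\<^bsub>M\<^esub> y') \<ominus>\<^bsub>G\<^esub> h (x, y) \<ominus>\<^bsub>G\<^esub> h (x, y') \<in> B"
    and hs: "\<And>a x y. a \<in> carrier A \<Longrightarrow> x \<in> carrier N \<Longrightarrow> y \<in> carrier M \<Longrightarrow>
      h (a \<odot>\<^bsub>N\<^esub> x, y) \<ominus>\<^bsub>G\<^esub> h (x, a \<odot>\<^bsub>M\<^esub> y) \<in> B"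
  obtains e where "\<And>t. keys t \<subseteq> carrier N \<times> carrier M \<Longrightarrow> e t \<in> carrier G"
    "e 0 = \<zero>\<^bsub>G\<^esub>"
    "\<And>z. z \<in> carrier N \<times> carrier M \<Longrightarrow> e (frag_of z) = h z"
    "\<And>s t. keys s \<subseteq> carrier N \<times> carrier M \<Longrightarrow> keys t \<subseteq> carrier N \<times> carrier M \<Longrightarrow>
      e (s - t) = e s \<ominus>\<^bsub>G\<^esub> e t"
    "\<And>t. t \<in> tensor_null A N M \<Longrightarrow> e t \<in> B"
proof -
  interpret N: module A N by fact
  interpret M: module A M by fact
  interpret G: abelian_group G by fact
  let ?Z = "carrier N \<times> carrier M"
  obtain e where e: "e \<in> hom (free_Abelian_group ?Z) (add_monoid G)" "\<And>z. z \<in> ?Z \<Longrightarrow> e (frag_of z) = h z"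
    using comm_group.free_Abelian_group_universal[OF G.a_comm_group, of h ?Z] h by auto
  have closed: "e t \<in> carrier G" if "keys t \<subseteq> ?Z" for t
    using e(1) that by (auto simp: hom_def)
  have add: "e (s + t) = e s \<oplus>\<^bsub>G\<^esub> e t" if "keys s \<subseteq> ?Z" "keys t \<subseteq> ?Z" for s t
    using e(1) that by (auto simp: hom_def)
  have diff: "e (s - t) = e s \<ominus>\<^bsub>G\<^esub> e t" if "keys s \<subseteq> ?Z" "keys t \<subseteq> ?Z" for s t
  proof -
    have k: "keys (s - t) \<subseteq> ?Z" using keys_diff[of s t] that by blast
    have "e s = e (s - t) \<oplus>\<^bsub>G\<^esub> e t" using add[OF k that(2)] by simp
    then show ?thesis
      using closed[OF k] closed[OF that(2)] by (simp add: a_minus_def G.a_assoc G.r_neg)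
  qed
  have zero: "e 0 = \<zero>\<^bsub>G\<^esub>"
    using diff[of 0 0] closed[of 0] by (simp add: a_minus_def G.r_neg)
  have kd: "keys (frag_of a - frag_of b) \<subseteq> ?Z" if "a \<in> ?Z" "b \<in> ?Z" for a b
    using keys_diff[of "frag_of a" "frag_of b"] that by auto
  have null: "e t \<in> B" if "t \<in> tensor_null A N M" for t
    using that
  proof induction
    case zero
    then show ?case using B \<open>e 0 = \<zero>\<^bsub>G\<^esub>\<close> by simp
  next
    case (diff s t)
    then show ?case
      using \<open>\<And>s t. keys s \<subseteq> ?Z \<Longrightarrow> keys t \<subseteq> ?Z \<Longrightarrow> e (s - t) = e s \<ominus>\<^bsub>G\<^esub> e t\<close>
        tensor_null_keys[OF N M] B(3) by simp
  qed (simp_all add: diff e(2) kd hl hr hs)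
  show thesis by (rule that[of e]) (use closed zero e diff null in auto)
qed

section \<open>Modules over the dual numbers\<close>

abbreviation dualk :: "('k::field \<times> 'k, 'k \<times> 'k) module" where
  "dualk \<equiv> dual_ring field_ring"

lemma field_ring_cring: "cring (field_ring :: 'k::field ring)"
proof (rule cringI)
  show "abelian_group (field_ring :: 'k ring)"
  proof (rule abelian_groupI)
    fix x :: 'k
    show "\<exists>y\<in>carrier field_ring. y \<oplus>\<^bsub>field_ring\<^esub> x = \<zero>\<^bsub>field_ring\<^esub>"
      by (rule bexI[of _ "- x"]) (simp_all add: field_ring_def)
  qed (simp_all add: field_ring_def add.assoc add.commute)
  show "Group.comm_monoid (field_ring :: 'k ring)"
    by (rule comm_monoidI) (simp_all add: field_ring_def mult.assoc mult.commute)
qed (simp add: field_ring_def distrib_right)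

lemma field_ring_simps [simp]:
  "carrier field_ring = UNIV" "\<one>\<^bsub>field_ring\<^esub> = 1" "\<zero>\<^bsub>field_ring\<^esub> = 0"
  "a \<oplus>\<^bsub>field_ring\<^esub> b = a + b" "a \<otimes>\<^bsub>field_ring\<^esub> b = a * b"
  by (simp_all add: field_ring_def)

lemma dual_numbers_simps [simp]:
  "carrier dualk = UNIV"
  "\<one>\<^bsub>dualk\<^esub> = (1, 0)" "\<zero>\<^bsub>dualk\<^esub> = (0, 0)"
  "(a, b) \<oplus>\<^bsub>dualk\<^esub> (c, d) = (a + c, b + d)"
  "(a, b) \<otimes>\<^bsub>dualk\<^esub> (c, d) = (a * c, a * d + b * c)"
  "(a, b) \<odot>\<^bsub>dualk\<^esub> (c, d) = (a * c, a * d + b * c)"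
  by (simp_all add: dual_ring_def field_ring_def Let_def)

lemma (in abelian_group) minus_add_right_cancel:
  assumes "x \<in> carrier G" "y \<in> carrier G"
  shows "y \<ominus> (x \<oplus> y) = \<ominus> x"
  using assms a_comm[of "\<ominus> x" "\<ominus> y"] by (simp add: a_minus_def minus_add r_neg1 r_neg2)

lemma (in abelian_group) add_minus_cancel:
  assumes "x \<in> carrier G" "y \<in> carrier G"
  shows "x \<oplus> y \<ominus> x \<ominus> y = \<zero>"
proof -
  have "x \<oplus> y \<ominus> x \<ominus> y = (x \<oplus> y) \<oplus> \<ominus> (x \<oplus> y)"
    using assms by (simp add: a_minus_def minus_add a_assoc)
  then show ?thesis using assms by (simp add: r_neg)
qed

lemma (in abelian_group) eq_minusI:
  "z = x \<oplus> y \<Longrightarrow> x \<in> carrier G \<Longrightarrow> y \<in> carrier G \<Longrightarrow> x = z \<ominus> y"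
  by (simp add: a_minus_def a_assoc r_neg)

text \<open>By Zorn's lemma there is a k-subspace W maximal among those that contain
  \<open>W0\<close> and avoid v. It is a complement of the line k v, and the functional reads off
  the coefficient of v. The field acts on M through the pairs (c, 0).\<close>

lemma linear_functional:
  fixes M :: "('k::field \<times> 'k, 'm, 'e) module_scheme" (structure)
  assumes M: "module dualk M"
    and W0: "W0 \<subseteq> carrier M" "\<zero> \<in> W0" "\<And>x y. x \<in> W0 \<Longrightarrow> y \<in> W0 \<Longrightarrow> x \<oplus> y \<in> W0"
      "\<And>c x. x \<in> W0 \<Longrightarrow> (c, 0) \<odot> x \<in> W0"
    and v: "v \<in> carrier M" "v \<notin> W0"
  obtains \<alpha> where "\<And>x y. x \<in> carrier M \<Longrightarrow> y \<in> carrier M \<Longrightarrow> \<alpha> (x \<oplus> y) = \<alpha> x + \<alpha> y"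
    "\<And>c x. x \<in> carrier M \<Longrightarrow> \<alpha> ((c, 0) \<odot> x) = c * \<alpha> x"
    "\<And>x. x \<in> W0 \<Longrightarrow> \<alpha> x = 0" "\<alpha> v = 1"
proof -
  interpret module dualk M by fact
  define sub where "sub W \<longleftrightarrow> W \<subseteq> carrier M \<and> \<zero> \<in> W \<and> (\<forall>x\<in>W. \<forall>y\<in>W. x \<oplus> y \<in> W) \<and>
    (\<forall>c. \<forall>x\<in>W. (c, 0) \<odot> x \<in> W)" for W
  let ?C = "{W. sub W \<and> W0 \<subseteq> W \<and> v \<notin> W}"
  have "\<exists>W\<in>?C. \<forall>X\<in>?C. W \<subseteq> X \<longrightarrow> X = W"
  proof (rule subset_Zorn_nonempty)
    have "sub W0" unfolding sub_def by (intro conjI ballI allI W0)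
    then show "?C \<noteq> {}" using v by blast
    fix \<C> assume ne: "\<C> \<noteq> {}" and ch: "subset.chain ?C \<C>"
    then have sub: "\<And>X. X \<in> \<C> \<Longrightarrow> sub X \<and> W0 \<subseteq> X \<and> v \<notin> X"
      and lin: "\<And>X Y. X \<in> \<C> \<Longrightarrow> Y \<in> \<C> \<Longrightarrow> X \<subseteq> Y \<or> Y \<subseteq> X"
      by (auto simp: subset_chain_def)
    have "x \<oplus> y \<in> \<Union>\<C>" if xy: "x \<in> \<Union>\<C>" "y \<in> \<Union>\<C>" for x y
    proof -
      obtain X Y where "X \<in> \<C>" "x \<in> X" "Y \<in> \<C>" "y \<in> Y" using xy by blast
      then obtain Z where "Z \<in> \<C>" "x \<in> Z" "y \<in> Z" using lin[of X Y] by blast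
      then show ?thesis using sub[of Z] by (auto simp: sub_def)
    qed
    moreover have "(c, 0) \<odot> x \<in> \<Union>\<C>" if x: "x \<in> \<Union>\<C>" for c x
    proof -
      obtain Z where "Z \<in> \<C>" "x \<in> Z" using x by blast
      moreover from this have "(c, 0) \<odot> x \<in> Z" using sub[of Z] by (simp add: sub_def)
      ultimately show ?thesis by (intro UnionI)
    qed
    moreover have "\<Union>\<C> \<subseteq> carrier M" "v \<notin> \<Union>\<C>"
      using sub unfolding sub_def by blast+
    moreover obtain Z where "Z \<in> \<C>" using ne by blast
    then have "\<zero> \<in> \<Union>\<C>" "W0 \<subseteq> \<Union>\<C>"
      using sub[of Z] by (auto simp: sub_def)
    ultimately show "\<Union>\<C> \<in> ?C" unfolding sub_def by blast
  qed
  then obtain W where WC: "W \<in> ?C" and maxC: "\<forall>X\<in>?C. W \<subseteq> X \<longrightarrow> X = W"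
    by (rule bexE)
  have W: "sub W" "W0 \<subseteq> W" "v \<notin> W" using WC by simp_all
  have max: "X = W" if "sub X" "W0 \<subseteq> X" "v \<notin> X" "W \<subseteq> X" for X
    using maxC that by simp
  have WM: "x \<in> carrier M" if "x \<in> W" for x using W(1) that by (auto simp: sub_def)
  have Wadd: "x \<oplus> y \<in> W" if "x \<in> W" "y \<in> W" for x y using W(1) that by (auto simp: sub_def)
  have Wsm: "(c, 0) \<odot> x \<in> W" if "x \<in> W" for c x using W(1) that by (auto simp: sub_def)
  have inv_zero [simp]: "\<ominus> \<zero> = \<zero>"
    by (rule M.minus_equality) simp_all
  have one [simp]: "(1, 0) \<odot> x = x" if "x \<in> carrier M" for x using smult_one[OF that] by simp
  have null [simp]: "(0, 0) \<odot> x = \<zero>" if "x \<in> carrier M" for x using smult_l_null[OF that] by simp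
  have sm_add: "(c + d, 0) \<odot> x = (c, 0) \<odot> x \<oplus> (d, 0) \<odot> x" if "x \<in> carrier M" for c d x
    using smult_l_distr[of "(c, 0)" "(d, 0)" x] that by simp
  have sm_mult: "(c, 0) \<odot> ((d, 0) \<odot> x) = (c * d, 0) \<odot> x" if "x \<in> carrier M" for c d x
    using smult_assoc1[of "(c, 0)" "(d, 0)" x] that by simp
  have sm_neg: "\<ominus> ((c, 0) \<odot> x) = (- c, 0) \<odot> x" if "x \<in> carrier M" for c x
    by (rule M.minus_equality) (use that sm_add[OF that, of "- c" c] in auto)
  have ex: "\<exists>c. y \<ominus> (c, 0) \<odot> v \<in> W" if y: "y \<in> carrier M" for y
  proof (cases "y \<in> W")
    case True
    then show ?thesis using v y by (intro exI[of _ 0]) (simp add: a_minus_def)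
  next
    case False
    \<comment> \<open>The space W + k y is strictly larger than W, so by maximality it contains v;
      the relation v = w + c y has c nonzero and can be solved for y.\<close>
    define W' where "W' = {w \<oplus> (c, 0) \<odot> y | w c. w \<in> W}"
    have "sub W'"
      unfolding sub_def
    proof (intro conjI ballI allI)
      show "W' \<subseteq> carrier M" using WM y by (auto simp: W'_def)
      have "\<zero> = \<zero> \<oplus> (0, 0) \<odot> y" using y by simp
      then show "\<zero> \<in> W'" using W(1) by (auto simp: W'_def sub_def)
      show "x \<oplus> z \<in> W'" if xz: "x \<in> W'" "z \<in> W'" for x z
      proof -
        obtain w c w' d where "x = w \<oplus> (c, 0) \<odot> y" "w \<in> W" "z = w' \<oplus> (d, 0) \<odot> y" "w' \<in> W"
          using xz by (auto simp: W'_def)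
        moreover from this have "x \<oplus> z = (w \<oplus> w') \<oplus> (c + d, 0) \<odot> y"
          using y WM by (simp add: sm_add M.a_ac)
        ultimately show ?thesis using Wadd by (auto simp: W'_def)
      qed
      show "(c, 0) \<odot> x \<in> W'" if x: "x \<in> W'" for c x
      proof -
        obtain w d where "x = w \<oplus> (d, 0) \<odot> y" "w \<in> W" using x by (auto simp: W'_def)
        moreover from this have "(c, 0) \<odot> x = (c, 0) \<odot> w \<oplus> (c * d, 0) \<odot> y"
          using y WM by (simp add: smult_r_distr sm_mult)
        ultimately show ?thesis using Wsm by (auto simp: W'_def)
      qed
    qed
    moreover have WW': "W \<subseteq> W'"
    proof
      fix w assume "w \<in> W"
      moreover have "w = w \<oplus> (0, 0) \<odot> y" using \<open>w \<in> W\<close> WM y by simp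
      ultimately show "w \<in> W'" by (auto simp: W'_def)
    qed
    moreover have "y \<in> W'"
    proof -
      have "y = \<zero> \<oplus> (1, 0) \<odot> y" using y by simp
      then show ?thesis using W(1) by (auto simp: W'_def sub_def)
    qed
    ultimately have "v \<in> W'" using max[of W'] False W(2) by blast
    then obtain w c where w: "w \<in> W" "v = w \<oplus> (c, 0) \<odot> y" by (auto simp: W'_def)
    have c: "c \<noteq> 0" using w W(3) WM y by auto
    have "(1 / c, 0) \<odot> v = (1 / c, 0) \<odot> w \<oplus> y"
      using w WM y c by (simp add: smult_r_distr sm_mult)
    then have "y \<ominus> (1 / c, 0) \<odot> v = \<ominus> ((1 / c, 0) \<odot> w)"
      using w(1) WM[OF w(1)] y by (simp add: M.minus_add_right_cancel)
    also have "\<dots> = (- (1 / c), 0) \<odot> w" using w WM by (simp add: sm_neg)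
    finally show ?thesis using Wsm[OF w(1), of "- (1 / c)"] by (intro exI[of _ "1 / c"]) simp
  qed
  \<comment> \<open>Two different coefficients would put a nonzero multiple of v into W.\<close>
  have uniq: "c = d" if y: "y \<in> carrier M" and cd: "y \<ominus> (c, 0) \<odot> v \<in> W" "y \<ominus> (d, 0) \<odot> v \<in> W" for y c d
  proof (rule ccontr)
    assume "c \<noteq> d"
    have "(d - c, 0) \<odot> v = (y \<ominus> (c, 0) \<odot> v) \<oplus> (-1, 0) \<odot> (y \<ominus> (d, 0) \<odot> v)"
    proof -
      have "(-1, 0) \<odot> (y \<ominus> (d, 0) \<odot> v) = \<ominus> y \<oplus> (d, 0) \<odot> v"
        using y v sm_neg[OF y, of 1] by (simp add: a_minus_def smult_r_distr sm_neg sm_mult)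
      moreover have "(d - c, 0) \<odot> v = (d, 0) \<odot> v \<oplus> (- c, 0) \<odot> v"
        using sm_add[OF v(1), of d "- c"] by simp
      ultimately show ?thesis
        using y v by (simp add: a_minus_def sm_neg M.a_ac M.r_neg2 M.r_neg1)
    qed
    then have "(d - c, 0) \<odot> v \<in> W" using Wadd[OF cd(1) Wsm[OF cd(2), of "-1"]] by simp
    then have "(1 / (d - c), 0) \<odot> ((d - c, 0) \<odot> v) \<in> W" by (rule Wsm)
    then show False using \<open>c \<noteq> d\<close> v W(3) by (simp add: sm_mult)
  qed
  define \<alpha> where "\<alpha> y = (THE c. y \<ominus> (c, 0) \<odot> v \<in> W)" for y
  have \<alpha>: "\<alpha> y = c" if "y \<in> carrier M" "y \<ominus> (c, 0) \<odot> v \<in> W" for y c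
    unfolding \<alpha>_def using that uniq by blast
  have \<alpha>W: "y \<ominus> (\<alpha> y, 0) \<odot> v \<in> W" if "y \<in> carrier M" for y
    using ex[OF that] \<alpha>[OF that] by auto
  show thesis
  proof (rule that[of \<alpha>])
    fix x y assume xy: "x \<in> carrier M" "y \<in> carrier M"
    have "(x \<oplus> y) \<ominus> (\<alpha> x + \<alpha> y, 0) \<odot> v = (x \<ominus> (\<alpha> x, 0) \<odot> v) \<oplus> (y \<ominus> (\<alpha> y, 0) \<odot> v)"
      using xy v by (simp add: sm_add M.add_minus_add)
    then show "\<alpha> (x \<oplus> y) = \<alpha> x + \<alpha> y"
      using xy Wadd[OF \<alpha>W \<alpha>W] by (intro \<alpha>) auto
  next
    fix c x assume x: "x \<in> carrier M"
    have "(c, 0) \<odot> x \<ominus> (c * \<alpha> x, 0) \<odot> v = (c, 0) \<odot> (x \<ominus> (\<alpha> x, 0) \<odot> v)"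
      using x v by (simp add: a_minus_def smult_r_distr sm_mult sm_neg)
    then show "\<alpha> ((c, 0) \<odot> x) = c * \<alpha> x"
      using x Wsm[OF \<alpha>W] by (intro \<alpha>) auto
  next
    fix x assume "x \<in> W0"
    then show "\<alpha> x = 0" using W(2) WM v by (intro \<alpha>) (auto simp: a_minus_def)
  next
    show "\<alpha> v = 1" using v W(1) by (intro \<alpha>) (auto simp: a_minus_def M.r_neg sub_def)
  qed
qed

abbreviation eps :: "'k::field \<times> 'k" where "eps \<equiv> (0, 1)"

text \<open>The ring k[\<epsilon>] is self-injective: a k-linear \<alpha> becomes the
  k[\<epsilon>]-linear map x |-> \<alpha>(\<epsilon> x) + \<epsilon> \<alpha>(x). Choosing \<alpha>
  with \<alpha>(m) = 0 and \<alpha>(\<epsilon> m) = 1 makes its value at m equal to 1.\<close>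

lemma dual_functional:
  fixes M :: "('k::field \<times> 'k, 'm, 'e) module_scheme" (structure)
  assumes M: "module dualk M"
    and ker_eps: "\<And>x. x \<in> carrier M \<Longrightarrow> eps \<odot> x = \<zero> \<Longrightarrow> \<exists>y\<in>carrier M. x = eps \<odot> y"
    and m: "m \<in> carrier M" "\<not> (\<exists>y\<in>carrier M. m = eps \<odot> y)"
  obtains \<Lambda> where "\<And>x y. x \<in> carrier M \<Longrightarrow> y \<in> carrier M \<Longrightarrow> \<Lambda> (x \<oplus> y) = \<Lambda> x \<oplus>\<^bsub>dualk\<^esub> \<Lambda> y"
    "\<And>a x. x \<in> carrier M \<Longrightarrow> \<Lambda> (a \<odot> x) = a \<otimes>\<^bsub>dualk\<^esub> \<Lambda> x" "\<Lambda> m = (1, 0)"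
proof -
  interpret module dualk M by fact
  have mult: "a \<odot> (b \<odot> x) = (a \<otimes>\<^bsub>dualk\<^esub> b) \<odot> x" if "x \<in> carrier M" for a b x
    using smult_assoc1[of a b x] that by simp
  have null: "(0, 0) \<odot> x = \<zero>" if "x \<in> carrier M" for x using smult_l_null[OF that] by simp
  have r_null: "a \<odot> \<zero> = \<zero>" for a using smult_r_null[of a] by simp
  have closed: "a \<odot> x \<in> carrier M" if "x \<in> carrier M" for a x using that by simp
  let ?W = "range (\<lambda>c. (c, 0) \<odot> m)"
  \<comment> \<open>If \<epsilon> m = c m, then c \<epsilon> m = \<epsilon>^2 m = 0, so \<epsilon> m
    = 0 whether or not c vanishes; then \<open>ker_eps\<close> makes m a multiple of
    \<epsilon>.\<close>
  have nin: "eps \<odot> m \<notin> ?W"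
  proof
    assume "eps \<odot> m \<in> ?W"
    then obtain c where c: "eps \<odot> m = (c, 0) \<odot> m" by auto
    have "(0, c) \<odot> m = eps \<odot> (eps \<odot> m)" using m by (simp add: c mult)
    also have "\<dots> = \<zero>" using m by (simp add: mult null)
    finally have z: "(0, c) \<odot> m = \<zero>" .
    have "eps \<odot> m = \<zero>"
    proof (cases "c = 0")
      case True
      then show ?thesis using c m by (simp add: null)
    next
      case False
      have "eps \<odot> m = (1 / c, 0) \<odot> ((0, c) \<odot> m)" using m False by (simp add: mult)
      then show ?thesis by (simp add: z r_null)
    qed
    then show False using ker_eps m by blast
  qed
  obtain \<alpha> where \<alpha>: "\<And>x y. x \<in> carrier M \<Longrightarrow> y \<in> carrier M \<Longrightarrow> \<alpha> (x \<oplus> y) = \<alpha> x + \<alpha> y"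
    "\<And>c x. x \<in> carrier M \<Longrightarrow> \<alpha> ((c, 0) \<odot> x) = c * \<alpha> x"
    "\<And>x. x \<in> ?W \<Longrightarrow> \<alpha> x = 0" "\<alpha> (eps \<odot> m) = 1"
  proof (rule linear_functional[OF M, of ?W "eps \<odot> m"])
    show "?W \<subseteq> carrier M" using m by auto
    show "\<zero> \<in> ?W" using null[OF m(1)] by (metis rangeI)
    show "x \<oplus> y \<in> ?W" if "x \<in> ?W" "y \<in> ?W" for x y
    proof -
      obtain c d where "x = (c, 0) \<odot> m" "y = (d, 0) \<odot> m" using \<open>x \<in> ?W\<close> \<open>y \<in> ?W\<close> by auto
      then have "x \<oplus> y = (c + d, 0) \<odot> m" using smult_l_distr[of "(c, 0)" "(d, 0)" m] m by simp
      then show ?thesis by simp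
    qed
    show "(c, 0) \<odot> x \<in> ?W" if "x \<in> ?W" for c x
      using that m by (auto simp: mult)
  qed (use m nin in auto)
  define \<Lambda> where "\<Lambda> x = (\<alpha> (eps \<odot> x), \<alpha> x)" for x
  have \<alpha>0: "\<alpha> \<zero> = 0" using \<alpha>(2)[of "\<zero>" 0] by (simp add: r_null)
  show thesis
  proof (rule that[of \<Lambda>])
    show "\<Lambda> (x \<oplus> y) = \<Lambda> x \<oplus>\<^bsub>dualk\<^esub> \<Lambda> y" if "x \<in> carrier M" "y \<in> carrier M" for x y
      using that by (simp add: \<Lambda>_def smult_r_distr \<alpha>)
    fix a :: "'k \<times> 'k" and x assume x: "x \<in> carrier M"
    obtain a1 a2 where a: "a = (a1, a2)" by (cases a)
    have "a \<odot> x = (a1, 0) \<odot> x \<oplus> (0, a2) \<odot> x"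
      using smult_l_distr[of "(a1, 0)" "(0, a2)" x] x by (simp add: a)
    also have "(0, a2) \<odot> x = (a2, 0) \<odot> (eps \<odot> x)"
      using x by (simp add: mult)
    finally have 1: "\<alpha> (a \<odot> x) = a1 * \<alpha> x + a2 * \<alpha> (eps \<odot> x)"
      using x \<alpha>(2)[of "eps \<odot> x" a2] by (simp add: \<alpha>)
    have "eps \<odot> (a \<odot> x) = (a1, 0) \<odot> (eps \<odot> x)"
      using x by (simp add: a mult)
    then have 2: "\<alpha> (eps \<odot> (a \<odot> x)) = a1 * \<alpha> (eps \<odot> x)"
      using \<alpha>(2)[of "eps \<odot> x" a1] x by simp
    show "\<Lambda> (a \<odot> x) = a \<otimes>\<^bsub>dualk\<^esub> \<Lambda> x"
      using 1 2 by (simp add: \<Lambda>_def a)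
  next
    have "(1, 0) \<odot> m = m" using smult_one[OF m(1)] by simp
    then have "m \<in> ?W" by (metis rangeI)
    then show "\<Lambda> m = (1, 0)" using \<alpha>(3)[of m] \<alpha>(4) by (simp add: \<Lambda>_def)
  qed
qed

text \<open>If \<open>m \<notin> \<epsilon>M\<close>, a functional \<open>\<Lambda>\<close> with \<open>\<Lambda>(m) = 1\<close> splits off the free summand \<open>k[\<epsilon>]m\<close>, so one can induct on
  the number of elements of \<open>M\<close> that occur in a tensor.\<close>

lemma dual_tensor_injective:
  fixes M :: "('k::field \<times> 'k, 'm, 'e) module_scheme" (structure)
    and N :: "('k \<times> 'k, 'n, 'f) module_scheme" and N' :: "('k \<times> 'k, 'n', 'g) module_scheme"
  assumes M: "module dualk M" and N: "module dualk N" and N': "module dualk N'"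
    and ker_eps: "\<And>x. x \<in> carrier M \<Longrightarrow> eps \<odot> x = \<zero> \<Longrightarrow> \<exists>y\<in>carrier M. x = eps \<odot> y"
    and f: "f \<in> linear_maps dualk N N'" and inj: "inj_on f (carrier N)"
    and t: "keys t \<subseteq> carrier N \<times> carrier M" and ft: "tensor_map f t \<in> tensor_null dualk N' M"
  shows "t \<in> tensor_null dualk N M"
  using t ft
proof (induction "card (snd ` keys t - {\<zero>})" arbitrary: t rule: less_induct)
  case less
  interpret M: module dualk M by fact
  interpret N: module dualk N by fact
  interpret N': module dualk N' by fact
  let ?T = "tensor_null dualk N M"
  have single_zero_right: "frag_of (x, \<zero>) \<in> ?T" if "x \<in> carrier N" for x
    using tensor_null_minus[OF tensor_null.add_right[OF that M.M.zero_closed M.M.zero_closed, where A=dualk]] by simp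
  have single_zero_left: "frag_of (\<zero>\<^bsub>N\<^esub>, y) \<in> ?T" if "y \<in> carrier M" for y
    using tensor_null_minus[OF tensor_null.add_left[OF N.M.zero_closed N.M.zero_closed that, where A=dualk]] by simp
  show ?case
  proof (cases "snd ` keys t \<subseteq> {\<zero>}")
    case True
    then have "keys t \<subseteq> carrier N \<times> {\<zero>}" using less.prems(1) by fastforce
    then show ?thesis
      by (induction rule: frag_induction) (auto intro: tensor_null.intros single_zero_right)
  next
    case False
    then obtain m where m: "m \<in> snd ` keys t" "m \<noteq> \<zero>" by blast
    then have mM: "m \<in> carrier M" using less.prems(1) by auto
    \<comment> \<open>If \<epsilon> divides m, pass to m' with m = \<epsilon> m'. It is not
      divisible again, since \<epsilon>^2 = 0 and m is nonzero; so \<kappa> can be taken to be 1 or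
      \<epsilon>.\<close>
    obtain m' \<kappa> where m': "m' \<in> carrier M" "\<not> (\<exists>y\<in>carrier M. m' = eps \<odot> y)" "m = \<kappa> \<odot> m'"
    proof (cases "\<exists>y\<in>carrier M. m = eps \<odot> y")
      case True
      then obtain m' where m': "m' \<in> carrier M" "m = eps \<odot> m'" by blast
      have "m' \<noteq> eps \<odot> y" if "y \<in> carrier M" for y
        using m' m(2) that M.smult_assoc1[of eps eps y] M.smult_l_null[of y] by auto
      then show ?thesis using that m' by blast
    next
      case False
      then show ?thesis using that[of m "(1, 0)"] mM M.smult_one[OF mM] by simp
    qed
    obtain \<Lambda> where \<Lambda>: "\<And>x y. x \<in> carrier M \<Longrightarrow> y \<in> carrier M \<Longrightarrow> \<Lambda> (x \<oplus> y) = \<Lambda> x \<oplus>\<^bsub>dualk\<^esub> \<Lambda> y"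
      "\<And>a x. x \<in> carrier M \<Longrightarrow> \<Lambda> (a \<odot> x) = a \<otimes>\<^bsub>dualk\<^esub> \<Lambda> x" "\<Lambda> m' = (1, 0)"
      using dual_functional[OF M ker_eps m'(1,2)] by metis
    \<comment> \<open>The projection along the summand spanned by m'; it is the complement of y |->
      \<Lambda>(y) m'.\<close>
    define q where "q y = y \<ominus> \<Lambda> y \<odot> m'" for y
    have q_closed: "q y \<in> carrier M" if "y \<in> carrier M" for y using that m' by (simp add: q_def)
    have "\<Lambda> m = \<kappa>" using \<Lambda>(2)[OF m'(1), of \<kappa>] \<Lambda>(3) m'(3) by (cases \<kappa>) simp
    then have qm: "q m = \<zero>" using m' by (simp add: q_def a_minus_def M.r_neg)
    have q0: "q \<zero> = \<zero>"
    proof -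
      have "\<Lambda> \<zero> = (0, 0)" using \<Lambda>(2)[of "\<zero>" "(0, 0)"] M.smult_r_null[of "(0, 0)"] by (cases "\<Lambda> \<zero>") simp
      then have "\<Lambda> \<zero> \<odot> m' = \<zero>" using M.smult_l_null[OF m'(1)] by simp
      then show ?thesis by (simp add: q_def a_minus_def M.r_neg)
    qed
    let ?P = "frag_extend (\<lambda>z. frag_of (fst z, q (snd z)))"
    let ?L = "frag_extend (\<lambda>z. frag_of (\<Lambda> (snd z) \<odot>\<^bsub>N\<^esub> fst z, m'))"
    \<comment> \<open>Each x \<otimes> y is x \<otimes> q y plus (\<Lambda>(y) x) \<otimes> m', the
      scalar being moved across the tensor sign.\<close>
    have split: "s - (?P s + ?L s) \<in> ?T" if "keys s \<subseteq> carrier N \<times> carrier M" for s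
    proof -
      have "frag_extend frag_of s - frag_extend (\<lambda>z. frag_of (fst z, q (snd z)) + frag_of (\<Lambda> (snd z) \<odot>\<^bsub>N\<^esub> fst z, m')) s \<in> ?T"
        using that
      proof (rule frag_extend_tensor_null)
        fix z assume "z \<in> carrier N \<times> carrier M"
        then obtain x y where z: "z = (x, y)" "x \<in> carrier N" "y \<in> carrier M" by auto
        have y: "q y \<oplus> \<Lambda> y \<odot> m' = y" using z m' by (simp add: q_def a_minus_def M.a_assoc M.l_neg)
        have 1: "frag_of (x, y) - frag_of (x, q y) - frag_of (x, \<Lambda> y \<odot> m') \<in> ?T"
          using tensor_null.add_right[OF z(2) q_closed[OF z(3)], of "\<Lambda> y \<odot> m'" dualk] m' y by simp
        have 2: "frag_of (\<Lambda> y \<odot>\<^bsub>N\<^esub> x, m') - frag_of (x, \<Lambda> y \<odot> m') \<in> ?T"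
          using tensor_null.smult[of "\<Lambda> y" dualk x N m' M] z m' by simp
        have "frag_of z - (frag_of (fst z, q (snd z)) + frag_of (\<Lambda> (snd z) \<odot>\<^bsub>N\<^esub> fst z, m')) =
          (frag_of (x, y) - frag_of (x, q y) - frag_of (x, \<Lambda> y \<odot> m')) - (frag_of (\<Lambda> y \<odot>\<^bsub>N\<^esub> x, m') - frag_of (x, \<Lambda> y \<odot> m'))"
          by (simp add: z)
        then show "frag_of z - (frag_of (fst z, q (snd z)) + frag_of (\<Lambda> (snd z) \<odot>\<^bsub>N\<^esub> fst z, m')) \<in> ?T"
          using 1 2 by (simp only: tensor_null.diff)
      qed
      moreover have "frag_extend (\<lambda>z. frag_of (fst z, q (snd z)) + frag_of (\<Lambda> (snd z) \<odot>\<^bsub>N\<^esub> fst z, m')) s = ?P s + ?L s"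
        by (simp add: frag_extend_def frag_cmul_distrib2 sum.distrib)
      ultimately show ?thesis by (simp flip: frag_expansion)
    qed
    have aa: "(\<Lambda> y \<oplus>\<^bsub>dualk\<^esub> \<Lambda> y') \<odot>\<^bsub>N'\<^esub> x = \<Lambda> y \<odot>\<^bsub>N'\<^esub> x \<oplus>\<^bsub>N'\<^esub> \<Lambda> y' \<odot>\<^bsub>N'\<^esub> x" if "x \<in> carrier N'" for x y y'
      using N'.smult_l_distr[of "\<Lambda> y" "\<Lambda> y'" x] that by simp
    have cm: "a \<odot>\<^bsub>N'\<^esub> (b \<odot>\<^bsub>N'\<^esub> x) = (b \<otimes>\<^bsub>dualk\<^esub> a) \<odot>\<^bsub>N'\<^esub> x" if "x \<in> carrier N'" for x a b
      using N'.smult_assoc1[of a b x] that by (cases a; cases b) (simp add: algebra_simps)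
    \<comment> \<open>The map x \<otimes> y |-> \<Lambda>(y) x into N' isolates the m'-component of
      \<open>tensor_map f t\<close>. This component is zero, and injectivity of f makes the
      m'-component of t zero as well.\<close>
    let ?h = "\<lambda>z. \<Lambda> (snd z) \<odot>\<^bsub>N'\<^esub> fst z"
    obtain e' where e': "\<And>t. keys t \<subseteq> carrier N' \<times> carrier M \<Longrightarrow> e' t \<in> carrier N'" "e' 0 = \<zero>\<^bsub>N'\<^esub>"
      "\<And>z. z \<in> carrier N' \<times> carrier M \<Longrightarrow> e' (frag_of z) = ?h z"
      "\<And>s t. keys s \<subseteq> carrier N' \<times> carrier M \<Longrightarrow> keys t \<subseteq> carrier N' \<times> carrier M \<Longrightarrow>
        e' (s - t) = e' s \<ominus>\<^bsub>N'\<^esub> e' t"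
      "\<And>t. t \<in> tensor_null dualk N' M \<Longrightarrow> e' t \<in> {\<zero>\<^bsub>N'\<^esub>}"
    proof (rule tensor_eval[OF N' M N'.abelian_group_axioms, of ?h "{\<zero>\<^bsub>N'\<^esub>}"])
      show "?h (x \<oplus>\<^bsub>N'\<^esub> x', y) \<ominus>\<^bsub>N'\<^esub> ?h (x, y) \<ominus>\<^bsub>N'\<^esub> ?h (x', y) \<in> {\<zero>\<^bsub>N'\<^esub>}"
        if "x \<in> carrier N'" "x' \<in> carrier N'" "y \<in> carrier M" for x x' y
        using that by (simp add: N'.smult_r_distr a_minus_def N'.M.a_ac N'.M.r_neg N'.M.r_neg1 N'.M.r_neg2)
      show "?h (x, y \<oplus> y') \<ominus>\<^bsub>N'\<^esub> ?h (x, y) \<ominus>\<^bsub>N'\<^esub> ?h (x, y') \<in> {\<zero>\<^bsub>N'\<^esub>}"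
        if "x \<in> carrier N'" "y \<in> carrier M" "y' \<in> carrier M" for x y y'
        using that by (simp add: \<Lambda> aa a_minus_def N'.M.a_ac N'.M.r_neg N'.M.r_neg1 N'.M.r_neg2)
      show "?h (a \<odot>\<^bsub>N'\<^esub> x, y) \<ominus>\<^bsub>N'\<^esub> ?h (x, a \<odot> y) \<in> {\<zero>\<^bsub>N'\<^esub>}"
        if "x \<in> carrier N'" "y \<in> carrier M" for a x y
        using that by (simp add: \<Lambda> cm a_minus_def N'.M.r_neg)
    qed (auto simp: a_minus_def N'.M.r_neg)
    have f_closed: "f x \<in> carrier N'" if "x \<in> carrier N" for x using f that by (auto simp: linear_maps_def hom_def)
    have f_add: "f (x \<oplus>\<^bsub>N\<^esub> y) = f x \<oplus>\<^bsub>N'\<^esub> f y" if "x \<in> carrier N" "y \<in> carrier N" for x y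
      using f that by (auto simp: linear_maps_def hom_def)
    have f_smult: "f (a \<odot>\<^bsub>N\<^esub> x) = a \<odot>\<^bsub>N'\<^esub> f x" if "x \<in> carrier N" for a x
      using f that by (cases a) (simp add: linear_maps_def)
    have f_zero: "f \<zero>\<^bsub>N\<^esub> = \<zero>\<^bsub>N'\<^esub>"
      using f_smult[of "\<zero>\<^bsub>N\<^esub>" "(0, 0)"] N.smult_r_null[of "(0, 0)"] N'.smult_l_null[OF f_closed[of "\<zero>\<^bsub>N\<^esub>"]] by simp
    have tm_keys: "keys (tensor_map f s) \<subseteq> carrier N' \<times> carrier M" if "keys s \<subseteq> carrier N \<times> carrier M" for s
    proof -
      have "keys (tensor_map f s) \<subseteq> (\<lambda>z. (f (fst z), snd z)) ` keys s"
        using keys_frag_extend[of "\<lambda>z. frag_of (f (fst z), snd z)" s] by (simp add: tensor_map_frag UNION_singleton_eq_range)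
      also have "\<dots> \<subseteq> (\<lambda>z. (f (fst z), snd z)) ` (carrier N \<times> carrier M)"
        using that by (rule image_mono)
      also have "\<dots> \<subseteq> carrier N' \<times> carrier M" using f_closed by auto
      finally show ?thesis .
    qed
    \<comment> \<open>The m'-component collects into a single n \<otimes> m', and n is tied to the
      evaluation by its image under f.\<close>
    have L: "\<exists>n\<in>carrier N. ?L s - frag_of (n, m') \<in> ?T \<and> f n = e' (tensor_map f s)"
      if "keys s \<subseteq> carrier N \<times> carrier M" for s
    proof -
      have "keys s \<subseteq> carrier N \<times> carrier M \<and> (\<exists>n\<in>carrier N. ?L s - frag_of (n, m') \<in> ?T \<and> f n = e' (tensor_map f s))"
        using that
      proof (induction rule: frag_induction)
        case zero
        have "0 - frag_of (\<zero>\<^bsub>N\<^esub>, m') \<in> ?T" using single_zero_left[OF m'(1)] by (intro tensor_null.diff tensor_null.zero)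
        then show ?case by (auto intro!: bexI[of _ "\<zero>\<^bsub>N\<^esub>"] simp: f_zero e'(2) tensor_map_frag)
      next
        case (one z)
        have "f (\<Lambda> (snd z) \<odot>\<^bsub>N\<^esub> fst z) = e' (tensor_map f (frag_of z))"
          using one f_closed by (auto simp: tensor_map_frag e'(3) f_smult)
        then show ?case using one
          by (auto intro!: bexI[of _ "\<Lambda> (snd z) \<odot>\<^bsub>N\<^esub> fst z"] tensor_null.zero)
      next
        case (diff a b)
        then obtain n n' where n: "n \<in> carrier N" "?L a - frag_of (n, m') \<in> ?T" "f n = e' (tensor_map f a)"
          and n': "n' \<in> carrier N" "?L b - frag_of (n', m') \<in> ?T" "f n' = e' (tensor_map f b)"
          and k: "keys a \<subseteq> carrier N \<times> carrier M" "keys b \<subseteq> carrier N \<times> carrier M"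
          by blast
        have nn: "n = (n \<ominus>\<^bsub>N\<^esub> n') \<oplus>\<^bsub>N\<^esub> n'" using n n' by (simp add: a_minus_def N.M.a_assoc N.M.l_neg)
        have "frag_of (n, m') - frag_of (n \<ominus>\<^bsub>N\<^esub> n', m') - frag_of (n', m') \<in> ?T"
          using tensor_null.add_left[of "n \<ominus>\<^bsub>N\<^esub> n'" N n' m' M dualk] n n' m' nn by simp
        then have "(?L a - frag_of (n, m')) - (?L b - frag_of (n', m')) +
            (frag_of (n, m') - frag_of (n \<ominus>\<^bsub>N\<^esub> n', m') - frag_of (n', m')) \<in> ?T"
          by (rule tensor_null_add[OF tensor_null.diff[OF n(2) n'(2)]])
        then have "?L (a - b) - frag_of (n \<ominus>\<^bsub>N\<^esub> n', m') \<in> ?T"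
          by (simp add: frag_extend_diff algebra_simps)
        moreover have "f (n \<ominus>\<^bsub>N\<^esub> n') = e' (tensor_map f (a - b))"
        proof -
          have "f n = f (n \<ominus>\<^bsub>N\<^esub> n') \<oplus>\<^bsub>N'\<^esub> f n'" using nn n n' f_add[of "n \<ominus>\<^bsub>N\<^esub> n'" n'] by simp
          then have "f (n \<ominus>\<^bsub>N\<^esub> n') = f n \<ominus>\<^bsub>N'\<^esub> f n'"
            by (rule N'.M.eq_minusI) (use n(1) n'(1) f_closed in auto)
          also have "\<dots> = e' (tensor_map f a - tensor_map f b)"
            using n n' k tm_keys by (simp add: e'(4))
          finally show ?thesis by (simp add: tensor_map_frag frag_extend_diff)
        qed
        moreover have "keys (a - b) \<subseteq> carrier N \<times> carrier M" using keys_diff[of a b] k by blast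
        ultimately show ?case using n n' by (intro conjI bexI[of _ "n \<ominus>\<^bsub>N\<^esub> n'"]) auto
      qed
      then show ?thesis by blast
    qed
    obtain n where n: "n \<in> carrier N" "?L t - frag_of (n, m') \<in> ?T" "f n = e' (tensor_map f t)"
      using L[OF less.prems(1)] by blast
    have "f n = f \<zero>\<^bsub>N\<^esub>" using n(3) e'(5)[OF less.prems(2)] by (simp add: f_zero)
    then have "n = \<zero>\<^bsub>N\<^esub>" using inj n(1) by (auto dest: inj_onD)
    then have "?L t \<in> ?T"
      using tensor_null_add[OF n(2)] single_zero_left[OF m'(1)] by fastforce
    then have tP: "t - ?P t \<in> ?T"
      using tensor_null_add[OF split[OF less.prems(1)], of "?L t"] by simp
    have Pkeys: "keys (?P t) \<subseteq> (\<lambda>z. (fst z, q (snd z))) ` keys t"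
      using keys_frag_extend[of "\<lambda>z. frag_of (fst z, q (snd z))" t] by auto
    have "?P t \<in> ?T"
    \<comment> \<open>Both m and 0 go to 0 under q, so the nonzero second factors of
      \<open>?P t\<close> are images of those of t other than m: their number drops.\<close>
    proof (rule less.hyps)
      let ?Y = "snd ` keys t - {\<zero>}"
      have fin: "finite ?Y" by simp
      have "snd ` keys (?P t) - {\<zero>} \<subseteq> q ` (?Y - {m})"
        using Pkeys qm q0 by fastforce
      then have "card (snd ` keys (?P t) - {\<zero>}) \<le> card (?Y - {m})"
        using fin by (meson card_image_le card_mono finite_Diff finite_imageI le_trans)
      also have "\<dots> < card ?Y" using m fin by (intro psubset_card_mono) auto
      finally show "card (snd ` keys (?P t) - {\<zero>}) < card ?Y" .
      show "keys (?P t) \<subseteq> carrier N \<times> carrier M"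
      proof -
        have "(\<lambda>z. (fst z, q (snd z))) ` keys t \<subseteq> (\<lambda>z. (fst z, q (snd z))) ` (carrier N \<times> carrier M)"
          using less.prems(1) by (rule image_mono)
        also have "\<dots> \<subseteq> carrier N \<times> carrier M"
          by (rule image_subsetI) (simp add: mem_Times_iff q_closed)
        finally show ?thesis using Pkeys by blast
      qed
      have "tensor_map f t - tensor_map f (?P t) \<in> tensor_null dualk N' M"
        using tensor_map_null[OF f tP] by (simp add: tensor_map_frag frag_extend_diff)
      from tensor_null.diff[OF less.prems(2) this] show "tensor_map f (?P t) \<in> tensor_null dualk N' M"
        by simp
    qed
    from tensor_null_add[OF tP this] show ?thesis by simp
  qed
qed

text \<open>Submodules of \<open>k[\<epsilon>]\<close>, copied to the type over which \<open>flat_module\<close> quantifies.\<close>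

definition coset_copy :: "('k::field \<times> 'k) set \<Rightarrow> ('k \<times> 'k, (nat \<Rightarrow> 'k \<times> 'k) set) module" where
  "coset_copy C = (let e = (\<lambda>z. {\<lambda>_. z}); d = inv_into UNIV e in
     \<lparr>carrier = e ` C, monoid.mult = undefined, monoid.one = undefined, ring.zero = e (0, 0),
      ring.add = (\<lambda>x y. e (d x \<oplus>\<^bsub>dualk\<^esub> d y)), module.smult = (\<lambda>a x. e (a \<otimes>\<^bsub>dualk\<^esub> d x))\<rparr>)"

abbreviation copy :: "'a \<Rightarrow> (nat \<Rightarrow> 'a) set" where "copy z \<equiv> {\<lambda>_. z}"

lemma inv_copy [simp]: "inv_into UNIV copy (copy z) = z"
proof (rule inv_f_f)
  show "inj (copy :: 'a \<Rightarrow> _)" by (rule injI) (auto dest: fun_cong)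
qed

lemma coset_copy_simps [simp]:
  "carrier (coset_copy C) = copy ` C" "\<zero>\<^bsub>coset_copy C\<^esub> = copy (0, 0)"
  "copy x \<oplus>\<^bsub>coset_copy C\<^esub> copy y = copy (x \<oplus>\<^bsub>dualk\<^esub> y)"
  "a \<odot>\<^bsub>coset_copy C\<^esub> copy y = copy (a \<otimes>\<^bsub>dualk\<^esub> y)"
  by (simp_all add: coset_copy_def Let_def)

lemma coset_copy_module:
  fixes C :: "('k::field \<times> 'k) set"
  assumes "(0, 0) \<in> C" "\<And>x y. x \<in> C \<Longrightarrow> y \<in> C \<Longrightarrow> x \<oplus>\<^bsub>dualk\<^esub> y \<in> C"
    "\<And>a x. x \<in> C \<Longrightarrow> a \<otimes>\<^bsub>dualk\<^esub> x \<in> C"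
  shows "module dualk (coset_copy C)"
proof (rule module_from_smult)
  show "cring dualk" by (rule dual_ring_cring[OF field_ring_cring])
  fix x y z assume x: "x \<in> carrier (coset_copy C)" and y: "y \<in> carrier (coset_copy C)" and z: "z \<in> carrier (coset_copy C)"
  show "x \<oplus>\<^bsub>coset_copy C\<^esub> y \<in> carrier (coset_copy C)" using x y assms by auto
  show "x \<oplus>\<^bsub>coset_copy C\<^esub> y \<oplus>\<^bsub>coset_copy C\<^esub> z = x \<oplus>\<^bsub>coset_copy C\<^esub> (y \<oplus>\<^bsub>coset_copy C\<^esub> z)"
    using x y z by (auto simp: add.assoc)
  show "x \<oplus>\<^bsub>coset_copy C\<^esub> y = y \<oplus>\<^bsub>coset_copy C\<^esub> x"
    using x y by (auto simp: add.commute)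
  show "a \<odot>\<^bsub>coset_copy C\<^esub> x \<in> carrier (coset_copy C)" for a
    using x assms(3) by (cases a) auto
qed (use assms in \<open>auto simp: algebra_simps\<close>)

text \<open>That flatness implies the condition is seen on the single inclusion of the ideal
  (\<epsilon>) in k[\<epsilon>]: if \<epsilon> x = 0, then \<epsilon> \<otimes> x becomes 1
  \<otimes> \<epsilon> x = 0 over k[\<epsilon>], hence is 0 already over (\<epsilon>). The other
  direction is \<open>dual_tensor_injective\<close>.\<close>

lemma flat_dual_numbers_iff:
  fixes M :: "('k::field \<times> 'k, 'm, 'e) module_scheme" (structure)
  assumes M: "module dualk M"
  shows "flat_module dualk M \<longleftrightarrow>
    (\<forall>x\<in>carrier M. eps \<odot> x = \<zero> \<longrightarrow> (\<exists>y\<in>carrier M. x = eps \<odot> y))"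
proof
  assume ker: "\<forall>x\<in>carrier M. eps \<odot> x = \<zero> \<longrightarrow> (\<exists>y\<in>carrier M. x = eps \<odot> y)"
  show "flat_module dualk M"
    unfolding flat_module_def
  proof (intro conjI M allI impI, elim conjE)
    fix N N' :: "('k \<times> 'k, (nat \<Rightarrow> 'k \<times> 'k) set) module" and f t
    assume *: "module dualk N" "module dualk N'" "f \<in> linear_maps dualk N N'" "inj_on f (carrier N)"
      "keys t \<subseteq> carrier N \<times> carrier M" "tensor_map f t \<in> tensor_null dualk N' M"
    show "t \<in> tensor_null dualk N M"
      by (rule dual_tensor_injective[OF M *(1,2) _ *(3-6)]) (use ker in auto)
  qed
next
  assume flat: "flat_module dualk M"
  interpret M: module dualk M by (rule M)
  let ?N = "coset_copy (range (Pair 0)) :: ('k \<times> 'k, (nat \<Rightarrow> 'k \<times> 'k) set) module"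
  let ?N' = "coset_copy UNIV :: ('k \<times> 'k, (nat \<Rightarrow> 'k \<times> 'k) set) module"
  have N: "module dualk ?N" by (rule coset_copy_module) auto
  have N': "module dualk ?N'" by (rule coset_copy_module) auto
  have lin: "(\<lambda>x. x) \<in> linear_maps dualk ?N ?N'" by (auto simp: linear_maps_def hom_def)
  show "\<forall>x\<in>carrier M. eps \<odot> x = \<zero> \<longrightarrow> (\<exists>y\<in>carrier M. x = eps \<odot> y)"
  proof (intro ballI impI)
    fix x assume x: "x \<in> carrier M" and ex: "eps \<odot> x = \<zero>"
    let ?t = "frag_of (copy eps, x)"
    have "frag_of (eps \<odot>\<^bsub>?N'\<^esub> copy (1, 0), x) - frag_of (copy (1, 0), eps \<odot> x) \<in> tensor_null dualk ?N' M"
      using x by (intro tensor_null.smult) auto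
    moreover have "frag_of (copy (1, 0), \<zero>) \<in> tensor_null dualk ?N' M"
      using tensor_null_minus[OF tensor_null.add_right[of "copy (1, 0)" ?N' "\<zero>" M "\<zero>" dualk]] by simp
    ultimately have "?t \<in> tensor_null dualk ?N' M"
      using tensor_null_add[of "frag_of (copy eps, x) - frag_of (copy (1, 0), \<zero>)" dualk ?N' M "frag_of (copy (1, 0), \<zero>)"]
      by (simp add: ex)
    then have "tensor_map (\<lambda>x. x) ?t \<in> tensor_null dualk ?N' M"
      by (simp add: tensor_map_frag)
    moreover have "keys ?t \<subseteq> carrier ?N \<times> carrier M" using x by auto
    ultimately have t: "?t \<in> tensor_null dualk ?N M"
      using flat[unfolded flat_module_def, THEN conjunct2, THEN spec, THEN spec, THEN spec, THEN mp, of ?N ?N' "\<lambda>x. x"] N N' lin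
      by simp
    \<comment> \<open>Identifies (\<epsilon>) \<otimes> M with M / \<epsilon> M, where \<epsilon> c
      \<otimes> y goes to the class of c y. The map is balanced only modulo \<open>?B\<close>,
      because the \<epsilon>-part of a scalar acts as zero on (\<epsilon>) but not on M.\<close>
    let ?B = "{eps \<odot> y | y. y \<in> carrier M}"
    let ?h = "\<lambda>z. (snd (inv_into UNIV copy (fst z)), 0) \<odot> snd z"
    have sm_add: "(c + d, 0) \<odot> y = (c, 0) \<odot> y \<oplus> (d, 0) \<odot> y" if "y \<in> carrier M" for c d y
      using M.smult_l_distr[of "(c, 0)" "(d, 0)" y] that by simp
    have mult: "a \<odot> (b \<odot> y) = (a \<otimes>\<^bsub>dualk\<^esub> b) \<odot> y" if "y \<in> carrier M" for a b y
      using M.smult_assoc1[of a b y] that by simp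
    have B0: "\<zero> \<in> ?B" using M.smult_r_null[of eps] by force
    have cancel: "u \<oplus> v \<ominus> u \<ominus> v = \<zero>" if "u \<in> carrier M" "v \<in> carrier M" for u v
      using that by (rule M.M.add_minus_cancel)
    obtain e where "\<And>z. z \<in> carrier ?N \<times> carrier M \<Longrightarrow> e (frag_of z) = ?h z"
      "\<And>t. t \<in> tensor_null dualk ?N M \<Longrightarrow> e t \<in> ?B"
    proof (rule tensor_eval[OF N M M.abelian_group_axioms, of ?h ?B])
      show "u \<ominus> v \<in> ?B" if "u \<in> ?B" "v \<in> ?B" for u v
      proof -
        obtain y y' where "u = eps \<odot> y" "y \<in> carrier M" "v = eps \<odot> y'" "y' \<in> carrier M"
          using \<open>u \<in> ?B\<close> \<open>v \<in> ?B\<close> by blast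
        then have "u \<ominus> v = eps \<odot> (y \<ominus> y')"
          by (simp add: a_minus_def M.smult_r_distr M.smult_r_minus)
        then show ?thesis using \<open>y \<in> carrier M\<close> \<open>y' \<in> carrier M\<close> by auto
      qed
      show "?h (u \<oplus>\<^bsub>?N\<^esub> u', y) \<ominus> ?h (u, y) \<ominus> ?h (u', y) \<in> ?B"
        if "u \<in> carrier ?N" "u' \<in> carrier ?N" "y \<in> carrier M" for u u' y
      proof -
        have "?h (u \<oplus>\<^bsub>?N\<^esub> u', y) = ?h (u, y) \<oplus> ?h (u', y)" using that by (auto simp: sm_add)
        then show ?thesis using B0 cancel that(3) by simp
      qed
      show "?h (u, y \<oplus> y') \<ominus> ?h (u, y) \<ominus> ?h (u, y') \<in> ?B"
        if "y \<in> carrier M" "y' \<in> carrier M" for u y y'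
      proof -
        have "?h (u, y \<oplus> y') = ?h (u, y) \<oplus> ?h (u, y')" using that by (simp add: M.smult_r_distr)
        then show ?thesis using B0 cancel that by simp
      qed
      show "?h (a \<odot>\<^bsub>?N\<^esub> u, y) \<ominus> ?h (u, a \<odot> y) \<in> ?B"
        if u: "u \<in> carrier ?N" and y: "y \<in> carrier M" for a u y
      proof -
        obtain c where c: "u = copy (0, c)" using u by auto
        obtain a1 a2 where a: "a = (a1, a2)" by (cases a)
        have "(c * a1, c * a2) \<odot> y = (c * a1, 0) \<odot> y \<oplus> (0, c * a2) \<odot> y"
          using M.smult_l_distr[of "(c * a1, 0)" "(0, c * a2)" y] y by simp
        then have "?h (a \<odot>\<^bsub>?N\<^esub> u, y) \<ominus> ?h (u, a \<odot> y) = \<ominus> ((0, c * a2) \<odot> y)"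
          using y by (simp add: a c mult a_minus_def M.M.minus_add M.M.r_neg1 M.M.r_neg2 mult.commute)
        also have "\<dots> = eps \<odot> ((- (c * a2), 0) \<odot> y)"
        proof (rule M.M.minus_equality)
          have "(0, - (c * a2)) \<odot> y \<oplus> (0, c * a2) \<odot> y = \<zero>"
            using M.smult_l_distr[of "(0, - (c * a2))" "(0, c * a2)" y] M.smult_l_null[OF y] y by simp
          then show "eps \<odot> ((- (c * a2), 0) \<odot> y) \<oplus> (0, c * a2) \<odot> y = \<zero>"
            using y by (simp add: mult)
        qed (use y in auto)
        finally show ?thesis using y by auto
      qed
    qed (use B0 in auto)
    then have "?h (copy eps, x) \<in> ?B" using t x by force
    moreover have "?h (copy eps, x) = x" using M.smult_one[OF x] by simp
    ultimately show "\<exists>y\<in>carrier M. x = eps \<odot> y" by auto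
  qed
qed

section \<open>Polynomials and forms\<close>

definition poly_var :: "nat \<Rightarrow> 'k::field mpoly" where
  "poly_var i = single (single i 1) 1"

text \<open>The support may shrink in a sum; vanishing of \<phi> at 0 allows all three sums to run
  over the union of both supports.\<close>

lemma sum_keys_add:
  fixes \<phi> :: "'a \<Rightarrow> 'b::comm_monoid_add \<Rightarrow> 'c::comm_monoid_add"
  assumes 0: "\<And>m. \<phi> m 0 = 0" and add: "\<And>m c d. \<phi> m (c + d) = \<phi> m c + \<phi> m d"
  shows "(\<Sum>m\<in>keys (a + b). \<phi> m (lookup (a + b) m)) =
    (\<Sum>m\<in>keys a. \<phi> m (lookup a m)) + (\<Sum>m\<in>keys b. \<phi> m (lookup b m))"
proof -
  let ?K = "keys a \<union> keys b"
  have sup: "(\<Sum>m\<in>keys c. \<phi> m (lookup c m)) = (\<Sum>m\<in>?K. \<phi> m (lookup c m))"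
    if "keys c \<subseteq> ?K" for c
    by (rule sum.mono_neutral_left) (use that in \<open>auto simp: 0 in_keys_iff\<close>)
  show ?thesis
    unfolding sup[OF keys_add] sup[OF Un_upper1] sup[OF Un_upper2]
    by (simp add: lookup_add add sum.distrib)
qed

lemma poly_mapping_add_induct [case_names zero add]:
  fixes a :: "'a \<Rightarrow>\<^sub>0 'b::comm_monoid_add"
  assumes "P 0" "\<And>a m c. P a \<Longrightarrow> P (single m c + a)"
  shows "P a"
proof (induction a rule: update_induct)
  case (update f m c)
  have "Poly_Mapping.update m c f = single m c + f"
    by (rule poly_mapping_eqI) (use update in \<open>auto simp: lookup_update lookup_add lookup_single when_def in_keys_iff\<close>)
  then show ?case using assms(2)[OF update(3)] by simp
qed (rule assms)

lemma sum_singles: "(\<Sum>m\<in>keys a. single m (lookup a m)) = a"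
  by (rule poly_mapping_eqI) (simp add: lookup_sum lookup_single when_def in_keys_iff)

lemma monomial_degree_eq_sum:
  assumes "finite A" "keys m \<subseteq> A"
  shows "monomial_degree m = (\<Sum>i\<in>A. lookup m i)"
  unfolding monomial_degree_def
  by (rule sum.mono_neutral_left) (use assms in \<open>auto simp: in_keys_iff\<close>)

lemma monomial_degree_add: "monomial_degree (m + m') = monomial_degree m + monomial_degree m'"
  by (subst (1 2 3) monomial_degree_eq_sum[where A="keys m \<union> keys m'"])
    (use keys_add[of m m'] in \<open>auto simp: lookup_add sum.distrib\<close>)

lemma monomial_degree_single [simp]: "monomial_degree (single i k) = k"
  by (simp add: monomial_degree_def)

lemma monomial_minus_single:
  "lookup m i \<noteq> 0 \<Longrightarrow> m = single i 1 + (m - single i (1::nat))"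
  by (rule poly_mapping_eqI) (auto simp: lookup_add lookup_minus lookup_single when_def)

lemma monomial_induct [consumes 1, case_names zero add]:
  fixes m :: "nat \<Rightarrow>\<^sub>0 nat"
  assumes "keys m \<subseteq> A" "P 0"
    "\<And>m i. i \<in> A \<Longrightarrow> keys m \<subseteq> A \<Longrightarrow> P m \<Longrightarrow> P (single i 1 + m)"
  shows "P m"
  using assms(1)
proof (induction "monomial_degree m" arbitrary: m rule: less_induct)
  case less
  show ?case
  proof (cases "m = 0")
    case False
    then obtain i where i: "i \<in> keys m" using keys_eq_empty by blast
    let ?m = "m - single i 1"
    have m: "m = single i 1 + ?m" using i by (intro monomial_minus_single) (simp add: in_keys_iff)
    have "keys ?m \<subseteq> A"
      using less.prems by (auto simp: in_keys_iff lookup_minus)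
    moreover have "monomial_degree ?m < monomial_degree m"
      by (subst (2) m) (simp add: monomial_degree_add)
    ultimately have "P (single i 1 + ?m)"
      using i less by (intro assms(3)) auto
    then show ?thesis using m by simp
  qed (simp add: assms)
qed

lemma const_poly_simps:
  "const_poly 0 = 0" "const_poly 1 = 1" "const_poly (c + d) = const_poly c + const_poly d"
  "const_poly (c * d) = const_poly c * const_poly d"
  by (simp_all add: const_poly_def single_add mult_single)

lemma poly_ring_simps [simp]:
  "monoid.mult (poly_ring n) = (*)" "monoid.one (poly_ring n) = 1" "ring.zero (poly_ring n) = 0"
  "ring.add (poly_ring n) = (+)"
  by (simp_all add: poly_ring_def)

abbreviation "polys n \<equiv> carrier (poly_ring n)"

lemma mem_poly_ring: "f \<in> polys n \<longleftrightarrow> (\<forall>m\<in>keys f. keys m \<subseteq> {..<n})"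
  by (simp add: poly_ring_def)

lemma poly_ring_closed [simp]:
  fixes a b :: "'k::field mpoly" and c :: 'k
  shows "0 \<in> polys n" "1 \<in> polys n" "const_poly c \<in> polys n"
    and poly_ring_add: "a \<in> polys n \<Longrightarrow> b \<in> polys n \<Longrightarrow> a + b \<in> polys n"
    and poly_ring_mult: "a \<in> polys n \<Longrightarrow> b \<in> polys n \<Longrightarrow> a * b \<in> polys n"
    and poly_ring_uminus: "a \<in> polys n \<Longrightarrow> - a \<in> polys n"
    and poly_var_closed: "i < n \<Longrightarrow> poly_var i \<in> polys n"
proof -
  show "0 \<in> polys n" "1 \<in> polys n" "const_poly c \<in> polys n"
    by (auto simp: mem_poly_ring const_poly_def)
  show "a + b \<in> polys n" if "a \<in> polys n" "b \<in> polys n"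
    using that keys_add[of a b] by (auto simp: mem_poly_ring)
  show "a * b \<in> polys n" if ab: "a \<in> polys n" "b \<in> polys n"
    unfolding mem_poly_ring
  proof
    fix m assume "m \<in> keys (a * b)"
    then obtain k l where "m = k + l" "k \<in> keys a" "l \<in> keys b"
      using keys_mult[of a b] by blast
    then show "keys m \<subseteq> {..<n}"
      using ab keys_add[of k l] unfolding mem_poly_ring by blast
  qed
  show "- a \<in> polys n" if "a \<in> polys n"
    using that by (auto simp: mem_poly_ring in_keys_iff)
  show "poly_var i \<in> polys n" if "i < n"
    using that by (auto simp: mem_poly_ring poly_var_def)
qed

lemma poly_ring_sum [simp]: "(\<And>i. i \<in> A \<Longrightarrow> f i \<in> polys n) \<Longrightarrow> sum f A \<in> polys n"
  by (induction A rule: infinite_finite_induct) auto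

lemma poly_ring_prod [simp]: "(\<And>i. i \<in> A \<Longrightarrow> f i \<in> polys n) \<Longrightarrow> prod f A \<in> polys n"
  by (induction A rule: infinite_finite_induct) auto

lemma poly_ring_cring: "cring (poly_ring n :: 'k::field mpoly ring)"
proof (rule cringI)
  show "abelian_group (poly_ring n :: 'k mpoly ring)"
  proof (rule abelian_groupI)
    fix x :: "'k mpoly" assume "x \<in> polys n"
    then show "\<exists>y\<in>polys n. y \<oplus>\<^bsub>poly_ring n\<^esub> x = \<zero>\<^bsub>poly_ring n\<^esub>"
      by (intro bexI[of _ "- x"]) auto
  qed (auto simp: algebra_simps)
  show "Group.comm_monoid (poly_ring n :: 'k mpoly ring)"
    by (rule comm_monoidI) (auto simp: algebra_simps)
qed (auto simp: algebra_simps)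

lemma single_monomial_eq:
  "single (single i 1 + m) c = poly_var i * single m c"
  by (simp add: poly_var_def mult_single)

lemma poly_ring_induct [consumes 1, case_names const var add mult]:
  assumes a: "a \<in> polys n"
    and const: "\<And>c. P (const_poly c)" and var: "\<And>i. i < n \<Longrightarrow> P (poly_var i)"
    and add: "\<And>a b. a \<in> polys n \<Longrightarrow> b \<in> polys n \<Longrightarrow> P a \<Longrightarrow> P b \<Longrightarrow> P (a + b)"
    and mult: "\<And>a b. a \<in> polys n \<Longrightarrow> b \<in> polys n \<Longrightarrow> P a \<Longrightarrow> P b \<Longrightarrow> P (a * b)"
  shows "P a"
proof -
  have single: "single m c \<in> polys n \<and> P (single m c)"
    if "keys m \<subseteq> {..<n}" for m c
    using that
  proof (induction rule: monomial_induct)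
    case zero
    then show ?case using const[of c] poly_ring_closed(3)[of c n] by (simp add: const_poly_def)
  next
    case (add m i)
    then show ?case unfolding single_monomial_eq using var[of i] by (auto intro: mult)
  qed
  have "finite A \<Longrightarrow> A \<subseteq> keys a \<Longrightarrow> (\<Sum>m\<in>A. single m (lookup a m)) \<in> polys n \<and>
      P (\<Sum>m\<in>A. single m (lookup a m))" for A
  proof (induction A rule: finite_induct)
    case empty
    then show ?case using const[of 0] by (simp add: const_poly_simps)
  next
    case (insert m A)
    then have "keys m \<subseteq> {..<n}" using a by (auto simp: mem_poly_ring)
    then show ?case using insert single[of m "lookup a m"] by (auto intro: add)
  qed
  then show ?thesis
    using sum_singles[of a] by (metis finite_keys subset_refl)
qed

text \<open>Evaluation in an arbitrary commutative ring, with coefficients mapped by \<iota>. It is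
  used for values in the fraction field (\<open>feval\<close>), for substituting polynomials (with
  \<open>const_poly\<close> as \<iota>), and for the graded map \<open>dehomogenize\<close>.\<close>

definition peval :: "('k::field \<Rightarrow> 'b::comm_ring_1) \<Rightarrow> (nat \<Rightarrow> 'b) \<Rightarrow> 'k mpoly \<Rightarrow> 'b" where
  "peval \<iota> u a = (\<Sum>m\<in>keys a. \<iota> (lookup a m) *
     (\<Prod>i\<in>keys m. u i ^ lookup m i))"

definition field_embedding :: "('k::field \<Rightarrow> 'b::comm_ring_1) \<Rightarrow> bool" where
  "field_embedding \<iota> \<longleftrightarrow> \<iota> 0 = 0 \<and> \<iota> 1 = 1 \<and> (\<forall>c d. \<iota> (c + d) = \<iota> c + \<iota> d) \<and> (\<forall>c d. \<iota> (c * d) = \<iota> c * \<iota> d)"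

lemma monomial_eval_add:
  fixes u :: "nat \<Rightarrow> 'b::comm_ring_1"
  shows "(\<Prod>i\<in>keys (m + m'). u i ^ lookup (m + m') i) =
    (\<Prod>i\<in>keys m. u i ^ lookup m i) * (\<Prod>i\<in>keys m'. u i ^ lookup m' i)"
proof -
  let ?K = "keys m \<union> keys m'"
  have sup: "(\<Prod>i\<in>keys k. u i ^ lookup k i) = (\<Prod>i\<in>?K. u i ^ lookup k i)"
    if "keys k \<subseteq> ?K" for k :: "nat \<Rightarrow>\<^sub>0 nat"
    by (rule prod.mono_neutral_left) (use that in \<open>auto simp: in_keys_iff\<close>)
  show ?thesis
    unfolding sup[OF keys_add] sup[OF Un_upper1] sup[OF Un_upper2]
    by (simp add: lookup_add power_add prod.distrib)
qed

context
  fixes \<iota> :: "'k::field \<Rightarrow> 'b::comm_ring_1"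
  assumes \<iota>: "field_embedding \<iota>"
begin

lemma eval_simps: "\<iota> 0 = 0" "\<iota> 1 = 1" "\<iota> (c + d) = \<iota> c + \<iota> d" "\<iota> (c * d) = \<iota> c * \<iota> d"
  using \<iota> by (auto simp: field_embedding_def)

lemma peval_zero [simp]: "peval \<iota> u 0 = 0"
  by (simp add: peval_def)

lemma peval_add: "peval \<iota> u (a + b) = peval \<iota> u a + peval \<iota> u b"
  unfolding peval_def by (rule sum_keys_add) (simp_all add: eval_simps algebra_simps)

lemma peval_single: "peval \<iota> u (single m c) = \<iota> c * (\<Prod>i\<in>keys m. u i ^ lookup m i)"
  by (cases "c = 0") (simp_all add: peval_def eval_simps)

lemma peval_mult: "peval \<iota> u (a * b) = peval \<iota> u a * peval \<iota> u b"
proof (induction a rule: poly_mapping_add_induct)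
  case (add a m c)
  have "peval \<iota> u (single m c * b) = peval \<iota> u (single m c) * peval \<iota> u b"
  proof (induction b rule: poly_mapping_add_induct)
    case (add b m' c')
    then show ?case
      by (simp add: distrib_left peval_add mult_single peval_single monomial_eval_add eval_simps mult_ac)
  qed simp
  then show ?case using add by (simp add: distrib_right peval_add)
qed simp

lemma peval_const [simp]: "peval \<iota> u (const_poly c) = \<iota> c"
  by (simp add: const_poly_def peval_single)

lemma peval_var [simp]: "peval \<iota> u (poly_var i) = u i"
  by (simp add: poly_var_def peval_single eval_simps)

lemma peval_one [simp]: "peval \<iota> u 1 = 1"
  using peval_const[of u 1] by (simp add: const_poly_simps eval_simps)

lemma peval_uminus: "peval \<iota> u (- a) = - peval \<iota> u a"
  using peval_add[of u a "- a"] by (simp add: eq_neg_iff_add_eq_0 add.commute)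

lemma peval_sum: "peval \<iota> u (sum f A) = (\<Sum>i\<in>A. peval \<iota> u (f i))"
  by (induction A rule: infinite_finite_induct) (auto simp: peval_add)

end

lemma field_embedding_const_poly: "field_embedding (const_poly :: 'k::field \<Rightarrow> _)"
  by (simp add: field_embedding_def const_poly_simps)

lemma peval_compose:
  assumes \<iota>: "field_embedding \<iota>" and a: "a \<in> polys n"
  shows "peval \<iota> u (peval const_poly P a) = peval \<iota> (\<lambda>j. peval \<iota> u (P j)) a"
  using a
  by (induction rule: poly_ring_induct)
    (simp_all add: peval_add peval_mult \<iota> field_embedding_const_poly)

lemma peval_det:
  assumes "field_embedding \<iota>"
  shows "peval \<iota> u (det (mat n n A)) = det (mat n n (\<lambda>k. peval \<iota> u (A k)))"
proof -
  interpret comm_ring_hom "peval \<iota> u"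
    by unfold_locales (simp_all add: assms peval_add peval_mult)
  show ?thesis
    by (subst hom_det[symmetric]) (rule arg_cong[where f=det], rule eq_matI, auto)
qed

section \<open>Partial derivatives\<close>

lemma partial_deriv_zero [simp]: "partial_deriv i 0 = 0"
  by (simp add: partial_deriv_def)

lemma partial_deriv_add: "partial_deriv i (a + b) = partial_deriv i a + partial_deriv i b"
  unfolding partial_deriv_def by (rule sum_keys_add) (simp_all add: single_add distrib_left)

lemma partial_deriv_single:
  "partial_deriv i (single m c) =
    single (m - single i 1) (of_nat (lookup m i) * c)"
  by (cases "c = 0") (simp_all add: partial_deriv_def)

lemma add_minus_single:
  "0 < lookup m i \<Longrightarrow> k + (m - single i 1) = k + m - single i (1::nat)"
  by (rule poly_mapping_eqI) (auto simp: lookup_add lookup_minus lookup_single when_def)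

text \<open>Exponents are natural numbers and \<open>m - single i 1\<close> truncates; where
  truncation would matter, the coefficient carries the factor \<open>of_nat 0\<close>.\<close>

lemma partial_deriv_mult_single:
  fixes c c' :: "'k::field"
  shows "partial_deriv i (single m c * single m' c') =
    single m c * partial_deriv i (single m' c') +
    partial_deriv i (single m c) * single m' c'"
proof -
  let ?e = "single i (1::nat)"
  have 1: "single (m + (m' - ?e)) (c * (of_nat (lookup m' i) * c')) =
      single (m + m' - ?e) (of_nat (lookup m' i) * (c * c'))"
    by (cases "lookup m' i") (simp, subst add_minus_single, simp_all add: mult_ac)
  have 2: "single ((m - ?e) + m') (of_nat (lookup m i) * c * c') =
      single (m + m' - ?e) (of_nat (lookup m i) * (c * c'))"
    by (cases "lookup m i")
      (simp, subst add.commute, subst add_minus_single, simp_all add: mult_ac add.commute)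
  show ?thesis
    unfolding mult_single partial_deriv_single 1 2
    by (simp add: lookup_add single_add[symmetric] distrib_right add.commute)
qed

lemma partial_deriv_mult: "partial_deriv i (a * b) = a * partial_deriv i b + partial_deriv i a * b"
proof (induction a rule: poly_mapping_add_induct)
  case (add a m c)
  have "partial_deriv i (single m c * b) =
      single m c * partial_deriv i b + partial_deriv i (single m c) * b"
  proof (induction b rule: poly_mapping_add_induct)
    case (add b m' c')
    then show ?case
      by (simp add: distrib_left partial_deriv_add partial_deriv_mult_single)
  qed simp
  then show ?case using add by (simp add: distrib_right partial_deriv_add)
qed simp

lemma partial_deriv_const [simp]: "partial_deriv i (const_poly c) = 0"
  by (simp add: const_poly_def partial_deriv_single)

lemma partial_deriv_var: "partial_deriv i (poly_var j) = (if i = j then 1 else 0)"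
  by (auto simp: poly_var_def partial_deriv_single lookup_single)

section \<open>Forms and homogeneous parts\<close>

lemma formsD:
  assumes "a \<in> forms r d"
  shows forms_carrier: "a \<in> polys (Suc r)"
    and forms_degree: "m \<in> keys a \<Longrightarrow> monomial_degree m = d"
    and forms_keys: "m \<in> keys a \<Longrightarrow> keys m \<subseteq> {..<Suc r}"
  using assms by (auto simp: forms_def mem_poly_ring)

lemma forms_zero [simp]: "0 \<in> forms r d"
  by (simp add: forms_def)

lemma forms_add: "a \<in> forms r d \<Longrightarrow> b \<in> forms r d \<Longrightarrow> a + b \<in> forms r d"
  using keys_add[of a b] by (auto simp: forms_def)

lemma forms_uminus: "a \<in> forms r d \<Longrightarrow> - a \<in> forms r d"
  by (auto simp: forms_def in_keys_iff)

lemma forms_sum: "(\<And>i. i \<in> A \<Longrightarrow> f i \<in> forms r d) \<Longrightarrow> sum f A \<in> forms r d"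
  by (induction A rule: infinite_finite_induct) (auto simp: forms_add)

lemma single_in_forms: "keys m \<subseteq> {..<Suc r} \<Longrightarrow> monomial_degree m = d \<Longrightarrow> single m c \<in> forms r d"
  by (auto simp: forms_def mem_poly_ring)

lemma const_poly_in_forms [simp]: "const_poly c \<in> forms r 0"
  unfolding const_poly_def by (rule single_in_forms) (simp_all add: monomial_degree_def)

lemma one_in_forms [simp]: "1 \<in> forms r 0"
  using const_poly_in_forms[of 1] by (simp add: const_poly_simps)

lemma poly_var_in_forms: "i \<le> r \<Longrightarrow> poly_var i \<in> forms r 1"
  unfolding poly_var_def by (rule single_in_forms) auto

lemma forms_power: "a \<in> forms r d \<Longrightarrow> a ^ n \<in> forms r (n * d)"
  by (induction n) (auto intro: forms_mult)

text \<open>For d = 0 the truncated degree is harmless: the derivative is 0, which is a form of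
  every degree.\<close>

lemma partial_deriv_in_forms:
  assumes a: "a \<in> forms r d" shows "partial_deriv i a \<in> forms r (d - 1)"
  unfolding partial_deriv_def
proof (rule forms_sum)
  fix m assume m: "m \<in> keys a"
  show "single (m - single i 1)
      (of_nat (lookup m i) * lookup a m) \<in> forms r (d - 1)"
  proof (cases "lookup m i = 0")
    case False
    have "d = Suc (monomial_degree (m - single i 1))"
      unfolding forms_degree[OF a m, symmetric]
      by (subst monomial_minus_single[OF False]) (simp only: monomial_degree_add monomial_degree_single)
    moreover have "keys (m - single i 1) \<subseteq> keys m"
      by (auto simp: in_keys_iff lookup_minus)
    then have "keys (m - single i 1) \<subseteq> {..<Suc r}"
      using forms_keys[OF a m] by (rule subset_trans)
    ultimately show ?thesis by (intro single_in_forms) simp_all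
  qed simp
qed

lemma partial_deriv_form0: assumes a: "a \<in> forms r 0" shows "partial_deriv i a = 0"
  unfolding partial_deriv_def
proof (rule sum.neutral, rule ballI)
  fix m assume "m \<in> keys a"
  then have "monomial_degree m = 0" by (rule forms_degree[OF a])
  then have "lookup m i = 0"
    unfolding monomial_degree_def by (cases "i \<in> keys m") (auto simp: in_keys_iff)
  then show "single (m - single i 1)
      (of_nat (lookup m i) * lookup a m) = 0" by simp
qed

lemma partial_deriv_closed: "a \<in> polys n \<Longrightarrow> partial_deriv i a \<in> polys n"
  by (induction rule: poly_ring_induct)
    (auto simp: partial_deriv_add partial_deriv_mult partial_deriv_var poly_ring_add poly_ring_mult)

lemma peval_homogeneous:
  assumes a: "a \<in> forms r d"
  shows "peval \<iota> (\<lambda>j. l * u j) a = l ^ d * peval \<iota> u a"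
  unfolding peval_def sum_distrib_left
proof (rule sum.cong[OF refl])
  fix m assume "m \<in> keys a"
  have "(\<Prod>i\<in>keys m. (l * u i) ^ lookup m i) =
      l ^ d * (\<Prod>i\<in>keys m. u i ^ lookup m i)"
    unfolding forms_degree[OF a \<open>m \<in> _\<close>, symmetric] monomial_degree_def
    by (simp add: power_mult_distrib prod.distrib power_sum)
  then show "\<iota> (lookup a m) * (\<Prod>i\<in>keys m. (l * u i) ^ lookup m i) =
      l ^ d * (\<iota> (lookup a m) * (\<Prod>i\<in>keys m. u i ^ lookup m i))"
    by (simp add: mult_ac)
qed

definition homogeneous_part :: "nat \<Rightarrow> 'k::field mpoly \<Rightarrow> 'k mpoly" where
  "homogeneous_part d a = (\<Sum>m | m \<in> keys a \<and> monomial_degree m = d.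
     single m (lookup a m))"

lemma homogeneous_part_in_forms:
  "a \<in> polys (Suc r) \<Longrightarrow> homogeneous_part d a \<in> forms r d"
  unfolding homogeneous_part_def
  by (rule forms_sum) (auto simp: mem_poly_ring intro!: single_in_forms)

lemma sum_homogeneous_parts:
  "(\<Sum>d\<in>monomial_degree ` keys a. homogeneous_part d a) = a"
  unfolding homogeneous_part_def
  using sum.image_gen[of "keys a" "\<lambda>m. single m (lookup a m)" monomial_degree]
  by (simp add: sum_singles conj_commute)

text \<open>The model is the ring \<open>R\<close> of regular functions on an open set, inside the
  fraction field, with \<open>M\<close> the sections of I_Y and \<open>Q\<close> the square of
  \<open>M\<close>. Subsets of one ambient ring permit ordinary arithmetic, sums and
  determinants.\<close>

locale nested_ideals =
  fixes \<iota> :: "'k::field \<Rightarrow> 'b::comm_ring_1" and R M Q :: "'b set"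
  assumes emb: "field_embedding \<iota>"
    and R: "\<And>c. \<iota> c \<in> R" "\<And>x y. x \<in> R \<Longrightarrow> y \<in> R \<Longrightarrow> x + y \<in> R" "\<And>x y. x \<in> R \<Longrightarrow> y \<in> R \<Longrightarrow> x * y \<in> R"
    and M: "M \<subseteq> R" "0 \<in> M" "\<And>x y. x \<in> M \<Longrightarrow> y \<in> M \<Longrightarrow> x + y \<in> M" "\<And>x y. x \<in> R \<Longrightarrow> y \<in> M \<Longrightarrow> x * y \<in> M"
    and Q: "Q \<subseteq> M" "0 \<in> Q" "\<And>x y. x \<in> Q \<Longrightarrow> y \<in> Q \<Longrightarrow> x + y \<in> Q" "\<And>x y. x \<in> R \<Longrightarrow> y \<in> Q \<Longrightarrow> x * y \<in> Q"
    and square: "\<And>x y. x \<in> M \<Longrightarrow> y \<in> M \<Longrightarrow> x * y \<in> Q"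
begin

lemma emb_minus_one: "\<iota> (- 1) = - 1"
  using eval_simps(1)[OF emb] eval_simps(2)[OF emb] eval_simps(3)[OF emb, of 1 "- 1"]
  by (simp add: eq_neg_iff_add_eq_0 add.commute)

lemma one_R: "1 \<in> R"
  using R(1)[of 1] by (simp add: eval_simps[OF emb])

lemma uminus_closed: "x \<in> R \<Longrightarrow> - x \<in> R" "x \<in> M \<Longrightarrow> - x \<in> M" "x \<in> Q \<Longrightarrow> - x \<in> Q"
  using R(3)[OF R(1)[of "- 1"]] M(4)[OF R(1)[of "- 1"]] Q(4)[OF R(1)[of "- 1"]]
  by (auto simp: emb_minus_one)

lemma diff_closed: "x \<in> R \<Longrightarrow> y \<in> R \<Longrightarrow> x - y \<in> R" "x \<in> M \<Longrightarrow> y \<in> M \<Longrightarrow> x - y \<in> M"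
  "x \<in> Q \<Longrightarrow> y \<in> Q \<Longrightarrow> x - y \<in> Q"
  using R(2) M(3) Q(3) uminus_closed by (metis diff_conv_add_uminus)+

lemma sum_M: "(\<And>i. i \<in> A \<Longrightarrow> f i \<in> M) \<Longrightarrow> sum f A \<in> M"
  by (induction A rule: infinite_finite_induct) (auto simp: M)

lemma sum_R: "(\<And>i. i \<in> A \<Longrightarrow> f i \<in> R) \<Longrightarrow> sum f A \<in> R"
  using M(1,2) by (induction A rule: infinite_finite_induct) (auto simp: R)

lemma prod_R: "(\<And>i. i \<in> A \<Longrightarrow> f i \<in> R) \<Longrightarrow> prod f A \<in> R"
  by (induction A rule: infinite_finite_induct) (auto simp: R one_R)

text \<open>The matrices have entries in the ambient ring; the Leibniz formula uses only signs,
  products and sums, and so does not leave \<open>R\<close>.\<close>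

lemma det_R:
  assumes A: "A \<in> carrier_mat n n" "\<And>i j. i < n \<Longrightarrow> j < n \<Longrightarrow> A $$ (i, j) \<in> R"
  shows "det A \<in> R"
proof -
  have "(\<Prod>i = 0..<n. A $$ (i, p i)) \<in> R" if "p permutes {0..<n}" for p
    by (rule prod_R) (use A permutes_in_image[OF that] in auto)
  then have "signof p * (\<Prod>i = 0..<n. A $$ (i, p i)) \<in> R" if "p permutes {0..<n}" for p
    using that uminus_closed(1) by (auto simp: sign_def)
  then show ?thesis
    unfolding det_def'[OF A(1)] by (intro sum_R) auto
qed

lemma cofactor_R:
  assumes A: "A \<in> carrier_mat n n" "\<And>i j. i < n \<Longrightarrow> j < n \<Longrightarrow> A $$ (i, j) \<in> R" and "i < n" "j < n"
  shows "cofactor A i j \<in> R"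
proof -
  have "det (mat_delete A i j) \<in> R"
    by (rule det_R[of _ "n - 1"]) (use A in \<open>auto simp: mat_delete_def\<close>)
  moreover have "(- 1) ^ k \<in> R" for k
    by (induction k) (use R(3) one_R uminus_closed(1) in auto)
  ultimately show ?thesis unfolding cofactor_def by (intro R(3))
qed

lemma eval_R:
  assumes "a \<in> polys n" "\<And>i. i < n \<Longrightarrow> u i \<in> R"
  shows "peval \<iota> u a \<in> R"
  using assms(1)
  by (induction rule: poly_ring_induct) (auto simp: peval_add peval_mult emb assms(2) R)

text \<open>The product case of \<open>taylor\<close>: x, y stand for the values at the shifted
  point, a, b for those at u, and d, e for the linear terms. On the right every summand contains a
  remainder, except d e, a product of two elements of \<open>M\<close>.\<close>

lemma taylor_identity:
  "x * y - a * b - (a * e + b * d) = x * (y - b - e) + (d * e + b * (x - a - d) + e * (x - a - (d :: 'b)))"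
  by (simp add: algebra_simps)

text \<open>All terms of order at least two in e are multiples of products of two elements of
  \<open>M\<close>, hence lie in \<open>Q\<close>; the induction over a carries this through
  products by \<open>taylor_identity\<close>.\<close>

lemma taylor:
  assumes a: "a \<in> polys n" and u: "\<And>i. i < n \<Longrightarrow> u i \<in> R" and e: "\<And>i. i < n \<Longrightarrow> e i \<in> M"
  shows "peval \<iota> (\<lambda>i. u i + e i) a - peval \<iota> u a - (\<Sum>i<n. e i * peval \<iota> u (partial_deriv i a)) \<in> Q"
  using a
proof (induction rule: poly_ring_induct)
  case (const c)
  then show ?case by (simp add: emb Q)
next
  case (var j)
  have "(\<Sum>i<n. e i * peval \<iota> u (partial_deriv i (poly_var j))) = (\<Sum>i<n. if i = j then e j else 0)"
    by (rule sum.cong) (auto simp: partial_deriv_var emb)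
  then show ?case using var by (simp add: emb Q)
next
  case (add a b)
  then show ?case
    using Q(3)[OF add(3,4)]
    by (simp add: peval_add[OF emb] partial_deriv_add distrib_left sum.distrib algebra_simps)
next
  case (mult a b)
  let ?d = "\<lambda>a. \<Sum>i<n. e i * peval \<iota> u (partial_deriv i a)"
  let ?r = "\<lambda>a. peval \<iota> (\<lambda>i. u i + e i) a - peval \<iota> u a - ?d a"
  have R': "peval \<iota> u c \<in> R" if "c \<in> polys n" for c
    by (rule eval_R[OF that u])
  have dM: "?d c \<in> M" if "c \<in> polys n" for c
    by (rule sum_M, subst mult.commute) (auto intro!: M(4) e R' partial_deriv_closed that)
  have d: "?d (a * b) = peval \<iota> u a * ?d b + peval \<iota> u b * ?d a"
    by (simp add: partial_deriv_mult peval_add peval_mult emb distrib_left sum.distrib sum_distrib_left mult_ac)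
  have "?r (a * b) = peval \<iota> (\<lambda>i. u i + e i) a * ?r b + (?d a * ?d b + peval \<iota> u b * ?r a + ?d b * ?r a)"
    unfolding d peval_mult[OF emb] by (rule taylor_identity)
  moreover have "peval \<iota> (\<lambda>i. u i + e i) a \<in> R"
    by (rule eval_R[OF mult(1)], rule R(2), erule u, rule subsetD[OF M(1)], erule e)
  moreover have "?d b * ?r a \<in> Q" "?d a * ?d b \<in> Q"
    using dM mult M(1) by (auto intro: Q(4) square)
  ultimately show ?case
    using R'[OF mult(1)] R'[OF mult(2)] mult(3,4) dM[OF mult(2)] M(1)
    by (simp only:) (rule Q(3)[OF Q(4) Q(3)[OF Q(3)[OF _ Q(4)] Q(4)]]; blast)
qed

text \<open>One Newton step, e = - h f(u) adj(A) with A the Jacobian minor at u. Since adj(A) A =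
  det(A), the linear term of Taylor's formula is - h det(A) f(u), which cancels f(u) up to (1 - h
  det(A)) f(u), a product of two elements of \<open>M\<close>.\<close>

lemma newton:
  assumes f: "\<And>j. j < c \<Longrightarrow> f j \<in> polys n" and "c \<le> n"
    and u: "\<And>i. i < n \<Longrightarrow> u i \<in> R" and fu: "\<And>j. j < c \<Longrightarrow> peval \<iota> u (f j) \<in> M"
    and h: "h \<in> R" "h * peval \<iota> u (det (mat c c (\<lambda>(i, j). partial_deriv i (f j)))) - 1 \<in> M"
  obtains e where "\<And>i. e i \<in> M" "\<And>j. j < c \<Longrightarrow> peval \<iota> (\<lambda>i. u i + e i) (f j) \<in> Q"
proof -
  define A where "A = mat c c (\<lambda>(i, j). peval \<iota> u (partial_deriv i (f j)))"
  have A: "A \<in> carrier_mat c c" by (simp add: A_def)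
  have A_R: "A $$ (i, j) \<in> R" if "i < c" "j < c" for i j
    using that unfolding A_def by (auto intro!: eval_R[where n=n] partial_deriv_closed f u)
  have det: "peval \<iota> u (det (mat c c (\<lambda>(i, j). partial_deriv i (f j)))) = det A"
    unfolding peval_det[OF emb] A_def by (simp add: case_prod_unfold)
  \<comment> \<open>Only the first c coordinates move; they are the ones with respect to which the
    minor is taken.\<close>
  define e where "e i = (if i < c then - h * (\<Sum>k<c. adj_mat A $$ (k, i) * peval \<iota> u (f k)) else 0)" for i
  have adj: "adj_mat A $$ (k, i) \<in> R" if "i < c" "k < c" for i k
    using that A cofactor_R[OF A A_R, of i k] by (simp add: adj_mat_def)
  have e: "e i \<in> M" for i
    unfolding e_def using h(1) adj fu
    by (simp add: M(2)) (intro impI uminus_closed(2) M(4) sum_M; simp)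
  have "peval \<iota> (\<lambda>i. u i + e i) (f j) \<in> Q" if j: "j < c" for j
  proof -
    have "(\<Sum>i<n. e i * peval \<iota> u (partial_deriv i (f j))) = (\<Sum>i<c. e i * A $$ (i, j))"
      by (rule sum.mono_neutral_cong_right) (use \<open>c \<le> n\<close> j in \<open>auto simp: e_def A_def\<close>)
    also have "\<dots> = - h * (\<Sum>i<c. \<Sum>k<c. peval \<iota> u (f k) * (adj_mat A $$ (k, i) * A $$ (i, j)))"
      by (simp add: e_def sum_distrib_left sum_distrib_right sum_negf mult_ac)
    also have "(\<Sum>i<c. \<Sum>k<c. peval \<iota> u (f k) * (adj_mat A $$ (k, i) * A $$ (i, j))) =
        (\<Sum>k<c. peval \<iota> u (f k) * (adj_mat A * A) $$ (k, j))"
      unfolding sum.swap[of _ "{..<c}" "{..<c}"] sum_distrib_left[symmetric]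
      using A adj_mat(1)[OF A] j
      by (intro sum.cong refl) (auto simp: scalar_prod_def atLeast0LessThan intro!: sum.cong)
    also have "\<dots> = (\<Sum>k<c. if k = j then peval \<iota> u (f k) * det A else 0)"
      unfolding adj_mat(3)[OF A] using j by (intro sum.cong) auto
    finally have "(\<Sum>i<n. e i * peval \<iota> u (partial_deriv i (f j))) = - h * (peval \<iota> u (f j) * det A)"
      using j by simp
    then have "peval \<iota> (\<lambda>i. u i + e i) (f j) - peval \<iota> u (f j) + h * (peval \<iota> u (f j) * det A) \<in> Q"
      using taylor[of "f j" n u e, OF f[OF j] u e] by simp
    moreover have "(h * det A - 1) * peval \<iota> u (f j) \<in> Q"
      using h(2) fu[OF j] unfolding det by (intro square)
    ultimately have "(peval \<iota> (\<lambda>i. u i + e i) (f j) - peval \<iota> u (f j) + h * (peval \<iota> u (f j) * det A))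
        - (h * det A - 1) * peval \<iota> u (f j) \<in> Q"
      by (rule diff_closed(3))
    then show ?thesis by (simp add: algebra_simps)
  qed
  then show thesis by (rule that[OF e])
qed

end

section \<open>Projective space\<close>

text \<open>Projective space is integral, so its local rings and its rings of sections live in one
  fraction field: \<open>local_values\<close> and \<open>regular_values\<close> are these subrings,
  and \<open>vsec U x\<close> is the section with constant value x.\<close>

definition local_values :: "nat \<Rightarrow> 'k::field mpoly set \<Rightarrow> 'k mpoly fract set" where
  "local_values r q = {Fract a b | a b d. a \<in> forms r d \<and> b \<in> forms r d \<and> b \<notin> q}"

definition regular_values :: "nat \<Rightarrow> 'k::field mpoly set set \<Rightarrow> 'k mpoly fract set" where
  "regular_values r U = {x. \<forall>q\<in>U. x \<in> local_values r q}"

definition vsec :: "'k::field mpoly set set \<Rightarrow> 'k mpoly fract \<Rightarrow> 'k mpoly set \<Rightarrow> 'k mpoly fract" where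
  "vsec U x = (\<lambda>p\<in>U. x)"

lemma openin_proj: "openin (proj_top r) U \<longleftrightarrow> (\<exists>A\<subseteq>(\<Union>d. forms r d). U = {p \<in> proj_points r. \<not> A \<subseteq> p})"
  unfolding proj_top_def by (subst topology_inverse'[OF istopology_proj]) (rule refl)

lemma openin_basic: "a \<in> forms r d \<Longrightarrow> openin (proj_top r) (basic_open r a)"
  unfolding openin_proj basic_open_def by (rule exI[of _ "{a}"]) auto

lemma open_points: "openin (proj_top r) U \<Longrightarrow> q \<in> U \<Longrightarrow> q \<in> proj_points r"
  by (auto simp: openin_proj)

lemma point_facts:
  fixes q :: "'k::field mpoly set"
  assumes q: "q \<in> proj_points r"
  shows point_subset: "q \<subseteq> polys (Suc r)"
    and point_zero: "0 \<in> q"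
    and point_add: "\<And>a b. a \<in> q \<Longrightarrow> b \<in> q \<Longrightarrow> a + b \<in> q"
    and point_mult: "\<And>a b. a \<in> polys (Suc r) \<Longrightarrow> b \<in> q \<Longrightarrow> a * b \<in> q"
    and point_prime: "\<And>a b. a \<in> polys (Suc r) \<Longrightarrow> b \<in> polys (Suc r) \<Longrightarrow>
      a * b \<in> q \<longleftrightarrow> a \<in> q \<or> b \<in> q"
    and point_one: "1 \<notin> q"
proof -
  interpret q: primeideal q "poly_ring (Suc r)" using q by (simp add: proj_points_def)
  show sub: "q \<subseteq> polys (Suc r)" using q.a_subset by simp
  show "0 \<in> q" using additive_subgroup.zero_closed[OF q.additive_subgroup_axioms] by simp
  show "a + b \<in> q" if "a \<in> q" "b \<in> q" for a b using additive_subgroup.a_closed[OF q.additive_subgroup_axioms that] by simp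
  show m: "a * b \<in> q" if "a \<in> polys (Suc r)" "b \<in> q" for a b using q.I_l_closed[OF that(2,1)] by simp
  show "a * b \<in> q \<longleftrightarrow> a \<in> q \<or> b \<in> q" if "a \<in> polys (Suc r)" "b \<in> polys (Suc r)" for a b
    using q.I_prime[OF that] m[OF that(1), of b] m[OF that(2), of a] by (auto simp: mult.commute)
  show "1 \<notin> q"
  proof
    assume "1 \<in> q"
    then have "a \<in> q" if "a \<in> polys (Suc r)" for a using m[OF that, of 1] by simp
    then show False using q.I_notcarr sub by auto
  qed
qed

lemma sum_in_point:
  assumes q: "q \<in> proj_points r" shows "(\<And>i. i \<in> A \<Longrightarrow> f i \<in> q) \<Longrightarrow> sum f A \<in> q"
  by (induction A rule: infinite_finite_induct) (auto simp: point_zero[OF q] intro!: point_add[OF q])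

text \<open>Otherwise every monomial of positive degree lies in q, and hence the whole irrelevant
  ideal does.\<close>

lemma ex_coordinate_notin:
  assumes q: "q \<in> proj_points r"
  obtains i where "i \<le> r" "poly_var i \<notin> q"
proof -
  have "\<exists>i\<le>r. poly_var i \<notin> q"
  proof (rule ccontr)
    assume "\<not> ?thesis"
    then have vars: "poly_var i \<in> q" if "i \<le> r" for i using that by auto
    have "f \<in> q" if f: "f \<in> polys (Suc r)" "lookup f 0 = 0" for f
    proof -
      have "single m (lookup f m) \<in> q" if m: "m \<in> keys f" for m
      proof -
        have "m \<noteq> 0" using m f(2) by (auto simp: in_keys_iff)
        then obtain i where i: "i \<in> keys m" using keys_eq_empty by blast
        have keys: "keys m \<subseteq> {..<Suc r}" using f(1) m by (simp add: mem_poly_ring)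
        have "m = single i 1 + (m - single i 1)"
          using i by (intro monomial_minus_single) (simp add: in_keys_iff)
        then have s: "single m (lookup f m) =
            single (m - single i 1) (lookup f m) * poly_var i"
          using single_monomial_eq[of i "m - single i 1" "lookup f m"] by (simp add: mult.commute)
        have "keys (m - single i 1) \<subseteq> keys m"
          by (auto simp: in_keys_iff lookup_minus)
        then have "single (m - single i 1) (lookup f m) \<in> polys (Suc r)"
          using keys by (auto simp: mem_poly_ring)
        then show ?thesis unfolding s using vars i keys by (intro point_mult[OF q]) auto
      qed
      then have "(\<Sum>m\<in>keys f. single m (lookup f m)) \<in> q"
        by (intro sum_in_point[OF q])
      then show ?thesis by (simp add: sum_singles)
    qed
    then show False using q by (auto simp: proj_points_def)
  qed
  then show thesis using that by auto
qed

lemma point_neq_zero: "q \<in> proj_points r \<Longrightarrow> a \<notin> q \<Longrightarrow> a \<noteq> 0"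
  using point_zero by auto

lemma forms_notin_mult:
  "q \<in> proj_points r \<Longrightarrow> a \<in> forms r d \<Longrightarrow> b \<in> forms r e \<Longrightarrow> a \<notin> q \<Longrightarrow> b \<notin> q \<Longrightarrow> a * b \<notin> q"
  by (simp add: point_prime forms_carrier)

lemma forms_notin_power:
  "q \<in> proj_points r \<Longrightarrow> a \<in> forms r d \<Longrightarrow> a \<notin> q \<Longrightarrow> a ^ n \<notin> q"
proof (induction n)
  case (Suc n)
  then show ?case using forms_notin_mult[OF Suc.prems(1,2) forms_power[OF Suc.prems(2)], of n] by simp
qed (simp add: point_one)

context
  fixes q :: "'k::field mpoly set" and r
  assumes q: "q \<in> proj_points r"
begin

lemma local_valuesI: "a \<in> forms r d \<Longrightarrow> b \<in> forms r d \<Longrightarrow> b \<notin> q \<Longrightarrow> Fract a b \<in> local_values r q"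
  by (auto simp: local_values_def)

lemma local_valuesE:
  assumes "x \<in> local_values r q"
  obtains a b d where "x = Fract a b" "a \<in> forms r d" "b \<in> forms r d" "b \<notin> q" "b \<noteq> 0"
  using assms point_neq_zero[OF q] by (auto simp: local_values_def)

lemma local_values_const: "Fract (const_poly c) 1 \<in> local_values r q"
  by (rule local_valuesI[of _ 0]) (auto simp: point_one[OF q])

lemma local_values_zero: "0 \<in> local_values r q"
  using local_values_const[of 0] by (simp add: const_poly_simps fract_collapse)

lemma local_values_one: "1 \<in> local_values r q"
  using local_values_const[of 1] by (simp add: const_poly_simps fract_collapse)

lemma local_values_add:
  assumes "x \<in> local_values r q" "y \<in> local_values r q" shows "x + y \<in> local_values r q"
proof -
  obtain a b d where x: "x = Fract a b" "a \<in> forms r d" "b \<in> forms r d" "b \<notin> q" "b \<noteq> 0"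
    by (rule local_valuesE[OF assms(1)])
  obtain a' b' d' where y: "y = Fract a' b'" "a' \<in> forms r d'" "b' \<in> forms r d'" "b' \<notin> q" "b' \<noteq> 0"
    by (rule local_valuesE[OF assms(2)])
  have "x + y = Fract (a * b' + a' * b) (b * b')" using x y by simp
  moreover have "a' * b \<in> forms r (d + d')" using forms_mult[OF y(2) x(3)] by (simp add: add.commute)
  ultimately show ?thesis
    using x y by (simp only:) (rule local_valuesI[of _ "d + d'"]; simp add: forms_add forms_mult forms_notin_mult[OF q])
qed

lemma local_values_mult:
  assumes "x \<in> local_values r q" "y \<in> local_values r q" shows "x * y \<in> local_values r q"
proof -
  obtain a b d where x: "x = Fract a b" "a \<in> forms r d" "b \<in> forms r d" "b \<notin> q" "b \<noteq> 0"
    by (rule local_valuesE[OF assms(1)])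
  obtain a' b' d' where y: "y = Fract a' b'" "a' \<in> forms r d'" "b' \<in> forms r d'" "b' \<notin> q" "b' \<noteq> 0"
    by (rule local_valuesE[OF assms(2)])
  have "x * y = Fract (a * a') (b * b')" using x y by simp
  then show ?thesis
    using x y by (simp only:) (rule local_valuesI[of _ "d + d'"]; simp add: forms_mult forms_notin_mult[OF q])
qed

lemma local_values_uminus:
  assumes "x \<in> local_values r q" shows "- x \<in> local_values r q"
  using assms by (elim local_valuesE) (auto intro!: local_valuesI forms_uminus)

end

lemma regular_values_closed:
  assumes U: "openin (proj_top r) U"
  shows regular_const: "Fract (const_poly c) 1 \<in> regular_values r U"
    and regular_zero: "0 \<in> regular_values r U"
    and regular_one: "1 \<in> regular_values r U"
    and regular_add: "x \<in> regular_values r U \<Longrightarrow> y \<in> regular_values r U \<Longrightarrow> x + y \<in> regular_values r U"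
    and regular_mult: "x \<in> regular_values r U \<Longrightarrow> y \<in> regular_values r U \<Longrightarrow> x * y \<in> regular_values r U"
    and regular_uminus: "x \<in> regular_values r U \<Longrightarrow> - x \<in> regular_values r U"
  using open_points[OF U]
  by (auto simp: regular_values_def local_values_const local_values_zero local_values_one local_values_add
      local_values_mult local_values_uminus)

lemma regular_mono: "V \<subseteq> U \<Longrightarrow> x \<in> regular_values r U \<Longrightarrow> x \<in> regular_values r V"
  by (auto simp: regular_values_def)

lemma single_neq_zero: "c \<noteq> 0 \<Longrightarrow> single m c \<noteq> 0"
  using lookup_single_eq[of m c] by (metis lookup_zero)

text \<open>The generic point of projective space. It lies in every nonempty open set, which lets a
  section be recovered from a single value.\<close>

lemma zero_point: "{0} \<in> (proj_points r :: 'k::field mpoly set set)"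
proof -
  let ?R = "poly_ring (Suc r) :: 'k mpoly ring"
  interpret R: cring ?R by (rule poly_ring_cring)
  have id: "ideal {0} ?R" using R.zeroideal by simp
  have "poly_var 0 \<in> {f \<in> carrier ?R. lookup f 0 = 0}"
    using poly_var_closed[of 0 "Suc r"] single_neq_zero[of "1::nat" "0::nat"]
    by (simp add: poly_var_def lookup_single when_def)
  moreover have nz: "poly_var 0 \<noteq> (0 :: 'k mpoly)" unfolding poly_var_def by (rule single_neq_zero) simp
  ultimately have "\<not> {f \<in> carrier ?R. lookup f 0 = 0} \<subseteq> {0}" by blast
  moreover have "primeideal {0} ?R"
  proof (rule primeidealI[OF id poly_ring_cring])
    show "carrier ?R \<noteq> {0}"
    proof
      assume "carrier ?R = {0}"
      then have "(1 :: 'k mpoly) \<in> {0}" using poly_ring_closed(2) by (rule subst)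
      then show False by simp
    qed
  qed simp
  moreover have "{0} = Idl\<^bsub>?R\<^esub> ({0} \<inter> (\<Union>d. forms r d))"
    using R.genideal_minimal[OF id, of "{0} \<inter> (\<Union>d. forms r d)"] R.genideal_self[of "{0} \<inter> (\<Union>d. forms r d)"] by auto
  ultimately show ?thesis by (simp add: proj_points_def)
qed

lemma zero_point_mem: "openin (proj_top r) U \<Longrightarrow> q \<in> U \<Longrightarrow> {0} \<in> U"
  using zero_point[of r] point_zero[of q r] by (auto simp: openin_proj)

lemma vsec_simps [simp]:
  "q \<in> U \<Longrightarrow> vsec U x q = x" "V \<subseteq> U \<Longrightarrow> restrict (vsec U x) V = vsec V x"
  "vsec U x \<in> extensional U"
  by (auto simp: vsec_def Int_absorb1)

lemma carrier_proj_sheaf: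
  assumes U: "openin (proj_top r) U"
  shows "carrier (Sec (proj_sheaf r) U) = vsec U ` regular_values r U" (is "?L = ?R")
proof (intro equalityI subsetI)
  fix s assume "s \<in> ?L"
  then have ext: "s \<in> extensional U" and loc: "\<And>q. q \<in> U \<Longrightarrow> \<exists>V d a b. openin (proj_top r) V \<and> q \<in> V \<and> V \<subseteq> U \<and>
      a \<in> forms r d \<and> b \<in> forms r d \<and> (\<forall>p\<in>V. b \<notin> p \<and> s p = Fract a b)"
    by (auto simp: proj_sheaf_def)
  \<comment> \<open>Near q the section is one fraction, and this neighbourhood contains {0}; so the
    value at q equals that at the generic point.\<close>
  have s: "s q = s {0} \<and> s {0} \<in> local_values r q" if q: "q \<in> U" for q
  proof -
    obtain V d a b where V: "openin (proj_top r) V" "q \<in> V" "a \<in> forms r d" "b \<in> forms r d"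
      "\<forall>p\<in>V. b \<notin> p \<and> s p = Fract a b"
      using loc[OF q] by (elim exE conjE)
    then show ?thesis using zero_point_mem[OF V(1,2)] by (auto intro: local_valuesI[OF open_points[OF U q]])
  qed
  then have "s = vsec U (s {0})"
    using ext by (auto simp: vsec_def intro!: extensionalityI)
  then show "s \<in> ?R" using s by (auto simp: regular_values_def)
next
  fix s assume "s \<in> ?R"
  then obtain x where s: "s = vsec U x" and x: "x \<in> regular_values r U" by auto
  have "\<exists>V d a b. openin (proj_top r) V \<and> q \<in> V \<and> V \<subseteq> U \<and>
      a \<in> forms r d \<and> b \<in> forms r d \<and> (\<forall>p\<in>V. b \<notin> p \<and> s p = Fract a b)" if q: "q \<in> U" for q
  proof -
    obtain a b d where ab: "x = Fract a b" "a \<in> forms r d" "b \<in> forms r d" "b \<notin> q" "b \<noteq> 0"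
      using local_valuesE[OF open_points[OF U q], of x] x q by (auto simp: regular_values_def)
    show ?thesis
      by (rule exI[of _ "U \<inter> basic_open r b"], rule exI[of _ d], rule exI[of _ a], rule exI[of _ b])
        (use U q ab openin_basic[OF ab(3)] open_points[OF U q] in \<open>auto simp: basic_open_def s\<close>)
  qed
  then show "s \<in> ?L" by (simp add: proj_sheaf_def s)
qed

lemma proj_sheaf_simps [simp]:
  "vsec U x \<otimes>\<^bsub>Sec (proj_sheaf r) U\<^esub> vsec U y = vsec U (x * y)"
  "vsec U x \<odot>\<^bsub>Sec (proj_sheaf r) U\<^esub> vsec U y = vsec U (x * y)"
  "vsec U x \<oplus>\<^bsub>Sec (proj_sheaf r) U\<^esub> vsec U y = vsec U (x + y)"
  "\<one>\<^bsub>Sec (proj_sheaf r) U\<^esub> = vsec U 1" "\<zero>\<^bsub>Sec (proj_sheaf r) U\<^esub> = vsec U 0"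
  "V \<subseteq> U \<Longrightarrow> Res (proj_sheaf r) U V (vsec U x) = vsec V x"
  by (auto simp: proj_sheaf_def vsec_def Int_absorb1)

lemma proj_space_simps [simp]: "Top (proj_space r) = proj_top r" "Str (proj_space r) = proj_sheaf r"
  by (simp_all add: proj_space_def)

lemma topspace_proj [simp]: "topspace (proj_top r) = proj_points r"
proof
  have "openin (proj_top r) (proj_points r)"
  proof -
    have "basic_open r 1 = proj_points r" by (auto simp: basic_open_def point_one)
    then show ?thesis using openin_basic[OF one_in_forms] by metis
  qed
  then show "proj_points r \<subseteq> topspace (proj_top r)" by (rule openin_subset)
  show "topspace (proj_top r) \<subseteq> proj_points r"
    using open_points[OF openin_topspace] by auto
qed

lemma proj_ring_presheaf: "ring_presheaf (proj_space r)"
proof (rule ring_presheaf.intro; simp)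
  fix U V assume U: "openin (proj_top r) U"
  note C = carrier_proj_sheaf[OF U]
  show "cring (Sec (proj_sheaf r) U)"
  proof (rule cringI)
    show "abelian_group (Sec (proj_sheaf r) U)"
    proof (rule abelian_groupI)
      show "\<exists>y\<in>carrier (Sec (proj_sheaf r) U). y \<oplus>\<^bsub>Sec (proj_sheaf r) U\<^esub> x = \<zero>\<^bsub>Sec (proj_sheaf r) U\<^esub>"
        if "x \<in> carrier (Sec (proj_sheaf r) U)" for x
        using that unfolding C by (auto intro!: bexI[of _ "- _"] regular_uminus[OF U])
    qed (auto simp: C regular_add[OF U] regular_zero[OF U] add_ac)
    show "Group.comm_monoid (Sec (proj_sheaf r) U)"
      by (rule comm_monoidI) (auto simp: C regular_mult[OF U] regular_one[OF U] mult_ac)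
  qed (auto simp: C distrib_right)
  show "a \<odot>\<^bsub>Sec (proj_sheaf r) U\<^esub> b = a \<otimes>\<^bsub>Sec (proj_sheaf r) U\<^esub> b"
    if "a \<in> carrier (Sec (proj_sheaf r) U)" "b \<in> carrier (Sec (proj_sheaf r) U)" for a b
    using that by (auto simp: C)
  show "Res (proj_sheaf r) U U a = a" if "a \<in> carrier (Sec (proj_sheaf r) U)" for a
    using that by (auto simp: C)
  assume V: "openin (proj_top r) V" "V \<subseteq> U"
  show "Res (proj_sheaf r) U V \<in> Ring.ring_hom (Sec (proj_sheaf r) U) (Sec (proj_sheaf r) V)"
    by (rule Ring.ring_hom_memI) (use V in \<open>auto simp: C carrier_proj_sheaf[OF V(1)] regular_mono\<close>)
next
  fix U V W a
  assume "openin (proj_top r) U" "openin (proj_top r) V" "openin (proj_top r) W" "W \<subseteq> V" "V \<subseteq> U"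
    "a \<in> carrier (Sec (proj_sheaf r) U)"
  then show "Res (proj_sheaf r) V W (Res (proj_sheaf r) U V a) = Res (proj_sheaf r) U W a"
    by (auto simp: carrier_proj_sheaf)
qed

lemma to_fract_power: "to_fract (a ^ n) = to_fract a ^ n"
  by (induction n) simp_all

lemma local_values_to_fract:
  "q \<in> proj_points r \<Longrightarrow> a \<in> forms r d \<Longrightarrow> b \<in> forms r d \<Longrightarrow> b \<notin> q \<Longrightarrow> to_fract a / to_fract b \<in> local_values r q"
  by (simp add: local_valuesI flip: Fract_conv_to_fract)

lemma local_valuesE':
  assumes "x \<in> local_values r q" "q \<in> proj_points r"
  obtains a b d where "x = to_fract a / to_fract b" "a \<in> forms r d" "b \<in> forms r d" "b \<notin> q" "to_fract b \<noteq> 0"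
  by (rule local_valuesE[OF assms(2,1)]) (simp add: Fract_conv_to_fract that)

lemma local_values_nbhd:
  assumes x: "x \<in> local_values r q" and q: "q \<in> proj_points r"
  obtains V where "openin (proj_top r) V" "q \<in> V" "x \<in> regular_values r V"
proof -
  obtain a b d where ab: "x = Fract a b" "a \<in> forms r d" "b \<in> forms r d" "b \<notin> q"
    using local_valuesE[OF q x] by metis
  show thesis
    by (rule that[OF openin_basic[OF ab(3)]])
      (use ab q in \<open>auto simp: basic_open_def regular_values_def local_values_def\<close>)
qed

lemma regular_local: "x \<in> regular_values r U \<Longrightarrow> q \<in> U \<Longrightarrow> x \<in> local_values r q"
  by (simp add: regular_values_def)

abbreviation "fr \<equiv> to_fract"

abbreviation fract_const :: "'k::field \<Rightarrow> 'k mpoly fract" where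
  "fract_const c \<equiv> fr (const_poly c)"

abbreviation "feval \<equiv> peval fract_const"

lemma fract_const_embedding: "field_embedding (fract_const :: 'k::field \<Rightarrow> _)"
  by (simp add: field_embedding_def const_poly_simps)

lemma regular_fract_const: "openin (proj_top r) U \<Longrightarrow> fract_const c \<in> regular_values r U"
  using regular_const by (simp add: to_fract_def)

lemma peval_to_fract:
  "a \<in> polys n \<Longrightarrow> feval (\<lambda>j. fr (poly_var j)) a = fr a"
  by (induction rule: poly_ring_induct)
    (simp_all add: peval_add peval_mult fract_const_embedding)

lemma sum_in_ideal:
  assumes "ideal I (poly_ring n)" "\<And>i. i \<in> A \<Longrightarrow> f i \<in> I"
  shows "sum f A \<in> I"
proof -
  interpret ideal I "poly_ring n" by fact
  have "0 \<in> I" "\<And>x y. x \<in> I \<Longrightarrow> y \<in> I \<Longrightarrow> x + y \<in> I"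
    using additive_subgroup.zero_closed[OF additive_subgroup_axioms] additive_subgroup.a_closed[OF additive_subgroup_axioms] by auto
  then show ?thesis using assms(2) by (induction A rule: infinite_finite_induct) auto
qed

text \<open>The graded homomorphism with \<open>x\<^sub>j \<mapsto> (x\<^sub>j / x\<^sub>i) t\<close>; its coefficients are the
  dehomogenizations of the homogeneous parts.\<close>

definition dehomogenize :: "nat \<Rightarrow> 'k::field mpoly \<Rightarrow> 'k mpoly fract poly" where
  "dehomogenize i = peval (\<lambda>c. [:fract_const c:]) (\<lambda>j. monom (fr (poly_var j) / fr (poly_var i)) 1)"

lemma dehomogenize_embedding: "field_embedding (\<lambda>c :: 'k::field. [:fract_const c:])"
  by (simp add: field_embedding_def const_poly_simps one_poly_eq_simps)

lemma dehomogenize_simps: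
  "dehomogenize i 0 = 0" "dehomogenize i 1 = 1" "dehomogenize i (a + b) = dehomogenize i a + dehomogenize i b"
  "dehomogenize i (a * b) = dehomogenize i a * dehomogenize i b"
  "dehomogenize i (sum f A) = (\<Sum>j\<in>A. dehomogenize i (f j))"
  unfolding dehomogenize_def
  by (simp_all add: peval_add peval_mult peval_sum dehomogenize_embedding)

text \<open>Homogeneity pulls the d-th powers of the polynomial variable and of 1 / x_i out of the
  value; what remains is the value of a at the coordinates, which is a itself.\<close>

lemma dehomogenize_form:
  fixes a :: "'k::field mpoly"
  assumes a: "a \<in> forms r d"
  shows "dehomogenize i a = monom (fr a / fr (poly_var i) ^ d) d"
proof -
  let ?x = "\<lambda>j. fr (poly_var j) :: 'k mpoly fract"
  have const: "peval (\<lambda>c. [:fract_const c:]) (\<lambda>j. [:y j:]) b = [:feval y b:]"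
    if "b \<in> polys n" for b :: "'k mpoly" and n y
    using that
    by (induction rule: poly_ring_induct)
      (simp_all add: peval_add peval_mult dehomogenize_embedding fract_const_embedding)
  have "dehomogenize i a = peval (\<lambda>c. [:fract_const c:]) (\<lambda>j. monom 1 1 * [:inverse (?x i) * ?x j:]) a"
    unfolding dehomogenize_def by (simp add: monom_altdef field_simps)
  also have "\<dots> = monom 1 1 ^ d * [:inverse (?x i) ^ d * fr a:]"
    using peval_homogeneous[OF a, of fract_const "inverse (?x i)" ?x] peval_to_fract[OF forms_carrier[OF a]]
    by (simp only: peval_homogeneous[OF a] const[OF forms_carrier[OF a]])
  finally show ?thesis by (simp add: monom_power smult_monom field_simps)
qed

lemma coeff_dehomogenize:
  assumes a: "a \<in> polys (Suc r)"
  shows "coeff (dehomogenize i a) d = fr (homogeneous_part d a) / fr (poly_var i) ^ d"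
proof -
  let ?D = "monomial_degree ` keys a"
  have "coeff (dehomogenize i a) d = coeff (dehomogenize i (\<Sum>d\<in>?D. homogeneous_part d a)) d"
    by (simp add: sum_homogeneous_parts)
  also have "\<dots> = (\<Sum>e\<in>?D. if e = d then fr (homogeneous_part e a) / fr (poly_var i) ^ e else 0)"
    by (simp add: dehomogenize_simps coeff_sum dehomogenize_form[OF homogeneous_part_in_forms[OF a]])
  also have "\<dots> = (if d \<in> ?D then fr (homogeneous_part d a) / fr (poly_var i) ^ d else 0)"
    by (simp add: sum.delta)
  also have "\<dots> = fr (homogeneous_part d a) / fr (poly_var i) ^ d"
  proof (cases "d \<in> ?D")
    case False
    then have "{m. m \<in> keys a \<and> monomial_degree m = d} = {}" by auto
    then have "homogeneous_part d a = 0" unfolding homogeneous_part_def by (simp only: sum.empty)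
    then show ?thesis using False by simp
  qed simp
  finally show ?thesis .
qed

text \<open>As in Gauss's lemma: take the least i and j with the coefficients of P and Q outside G;
  modulo G the coefficient of P Q at i + j is the product of these two.\<close>

lemma coeffs_prime:
  fixes P Q :: "'b::comm_ring_1 poly"
  assumes G: "G \<subseteq> R" "0 \<in> G" "\<And>x y. x \<in> G \<Longrightarrow> y \<in> G \<Longrightarrow> x + y \<in> G" "\<And>x y. x \<in> R \<Longrightarrow> y \<in> G \<Longrightarrow> x * y \<in> G"
      "\<And>x. x \<in> G \<Longrightarrow> - x \<in> G"
    and prime: "\<And>x y. x \<in> R \<Longrightarrow> y \<in> R \<Longrightarrow> x * y \<in> G \<Longrightarrow> x \<in> G \<or> y \<in> G"
    and PQ: "\<And>n. coeff P n \<in> R" "\<And>n. coeff Q n \<in> R" "\<And>n. coeff (P * Q) n \<in> G"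
  shows "(\<forall>n. coeff P n \<in> G) \<or> (\<forall>n. coeff Q n \<in> G)"
proof (rule ccontr)
  assume "\<not> ?thesis"
  then have ex: "\<exists>n. coeff P n \<notin> G" "\<exists>n. coeff Q n \<notin> G" by auto
  define i j where "i = (LEAST n. coeff P n \<notin> G)" and "j = (LEAST n. coeff Q n \<notin> G)"
  have i: "coeff P i \<notin> G" "\<And>k. k < i \<Longrightarrow> coeff P k \<in> G"
    unfolding i_def using LeastI_ex[OF ex(1)] not_less_Least by auto
  have j: "coeff Q j \<notin> G" "\<And>k. k < j \<Longrightarrow> coeff Q k \<in> G"
    unfolding j_def using LeastI_ex[OF ex(2)] not_less_Least by auto
  let ?s = "\<Sum>k\<in>{..i + j} - {i}. coeff P k * coeff Q (i + j - k)"
  have sum_G: "(\<And>x. x \<in> A \<Longrightarrow> f x \<in> G) \<Longrightarrow> sum f A \<in> G" for f :: "nat \<Rightarrow> 'b" and A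
    by (induction A rule: infinite_finite_induct) (auto simp: G)
  have "?s \<in> G"
  proof (rule sum_G)
    fix k assume k: "k \<in> {..i + j} - {i}"
    show "coeff P k * coeff Q (i + j - k) \<in> G"
    proof (cases "k < i")
      case True
      then show ?thesis using G(4)[OF PQ(2) i(2)] by (simp add: mult.commute)
    next
      case False
      then have "i + j - k < j" using k by auto
      then show ?thesis by (rule G(4)[OF PQ(1) j(2)])
    qed
  qed
  moreover have "coeff (P * Q) (i + j) = coeff P i * coeff Q j + ?s"
    unfolding coeff_mult by (subst sum.remove[of _ i]) auto
  ultimately have "coeff P i * coeff Q j \<in> G"
    using G(3)[OF PQ(3)[of "i + j"] G(5), of ?s] by simp
  then show False using prime[OF PQ(1,2)] i(1) j(1) by blast
qed

lemma sum_in_additive: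
  assumes "0 \<in> G" "\<And>x y. x \<in> G \<Longrightarrow> y \<in> G \<Longrightarrow> x + y \<in> G" "\<And>i. i \<in> A \<Longrightarrow> f i \<in> G"
  shows "sum f A \<in> G"
  using assms(3) by (induction A rule: infinite_finite_induct) (auto intro: assms(1,2))

text \<open>This and \<open>germ_values\<close> are J (U) and the stalk J_q as subsets of the
  fraction field.\<close>

definition ideal_values where
  "ideal_values r J U = {x \<in> regular_values r U. vsec U x \<in> J U}"

definition germ_values where
  "germ_values r J q = {x. \<exists>V. openin (proj_top r) V \<and> q \<in> V \<and> x \<in> ideal_values r J V}"

declare proj_space_simps(2) [simp del]

lemmas proj_space_ops [simp] = proj_sheaf_simps[folded proj_space_simps(2)]

section \<open>Ideal sheaves on projective space, read in the fraction field\<close>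

locale projective_ideal = ideal_presheaf "proj_space r" J
  for r :: nat and J :: "'k::field subscheme"
begin

abbreviation "supp \<equiv> support (proj_space r) J"
abbreviation "rv \<equiv> regular_values r"
abbreviation "lv \<equiv> local_values r"

lemma R_carrier: "opn U \<Longrightarrow> \<O> U = vsec U ` rv U"
  by (simp add: carrier_proj_sheaf proj_space_simps(2))

abbreviation "jv \<equiv> ideal_values r J"
abbreviation "jg \<equiv> germ_values r J"

lemma J_eq: "opn U \<Longrightarrow> J U = vsec U ` jv U"
  using R_carrier[of U] sub_carrier[of U] by (auto simp: ideal_values_def)

lemma jv_facts:
  assumes U: "opn U"
  shows jv_regular: "x \<in> jv U \<Longrightarrow> x \<in> rv U"
    and jv_zero: "0 \<in> jv U"
    and jv_add: "x \<in> jv U \<Longrightarrow> y \<in> jv U \<Longrightarrow> x + y \<in> jv U"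
    and jv_mult: "x \<in> rv U \<Longrightarrow> y \<in> jv U \<Longrightarrow> x * y \<in> jv U"
  using sub_zero[OF U] sub_add[OF U, of "vsec U x" "vsec U y"]
    sub_mult[OF U, of "vsec U x" "vsec U y"] U R_carrier[OF U]
  by (auto simp: ideal_values_def regular_zero regular_add regular_mult)

lemma jv_mono:
  assumes "opn U" "opn V" "V \<subseteq> U" "x \<in> jv U" shows "x \<in> jv V"
  using sub_res[OF assms(1,2,3), of "vsec U x"] assms regular_mono[of V U x]
  by (auto simp: ideal_values_def)

lemma jv_uminus: "opn U \<Longrightarrow> x \<in> jv U \<Longrightarrow> - x \<in> jv U"
  using jv_mult[of U "- 1" x] regular_uminus[OF _ regular_one, of r U] by simp

lemma jgI: "opn U \<Longrightarrow> q \<in> U \<Longrightarrow> x \<in> jv U \<Longrightarrow> x \<in> jg q"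
  by (auto simp: germ_values_def)

lemma jgE:
  assumes "x \<in> jg q" "opn U" "q \<in> U"
  obtains V where "opn V" "q \<in> V" "V \<subseteq> U" "x \<in> jv V"
proof -
  obtain V where V: "opn V" "q \<in> V" "x \<in> jv V" using assms(1) by (auto simp: germ_values_def)
  show thesis
    by (rule that[of "U \<inter> V"]) (use assms V jv_mono[OF V(1) _ _ V(3), of "U \<inter> V"] in auto)
qed

lemma jv_local:
  assumes U: "opn U" and x: "x \<in> rv U" "\<And>q. q \<in> U \<Longrightarrow> x \<in> jg q"
  shows "x \<in> jv U"
proof -
  have "vsec U x \<in> J U"
  proof (rule ideal_localI[OF U])
    show "vsec U x \<in> \<O> U" using R_carrier[OF U] x(1) by simp
    fix q assume q: "q \<in> U"
    obtain V where V: "opn V" "q \<in> V" "V \<subseteq> U" "x \<in> jv V" by (rule jgE[OF x(2)[OF q] U q])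
    then show "\<exists>V. opn V \<and> q \<in> V \<and> V \<subseteq> U \<and> rho U V (vsec U x) \<in> J V"
      by (intro exI[of _ V]) (simp add: ideal_values_def)
  qed
  then show ?thesis using x(1) by (simp add: ideal_values_def)
qed

lemma jg_facts:
  assumes q: "q \<in> proj_points r"
  shows jg_local_values: "x \<in> jg q \<Longrightarrow> x \<in> lv q"
    and jg_zero: "0 \<in> jg q"
    and jg_add: "x \<in> jg q \<Longrightarrow> y \<in> jg q \<Longrightarrow> x + y \<in> jg q"
    and jg_mult: "x \<in> lv q \<Longrightarrow> y \<in> jg q \<Longrightarrow> x * y \<in> jg q"
proof -
  have X: "opn (proj_points r)" using openin_topspace[of "proj_top r :: 'k mpoly set topology"] by simp
  show "0 \<in> jg q" using jgI[OF X q jv_zero[OF X]] .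
  show "x \<in> lv q" if x: "x \<in> jg q"
  proof -
    obtain V where V: "opn V" "q \<in> V" "V \<subseteq> proj_points r" "x \<in> jv V" by (rule jgE[OF x X q])
    show ?thesis by (rule regular_local[OF jv_regular[OF V(1,4)] V(2)])
  qed
  show "x + y \<in> jg q" if x: "x \<in> jg q" and y: "y \<in> jg q"
  proof -
    obtain V where V: "opn V" "q \<in> V" "V \<subseteq> proj_points r" "x \<in> jv V" by (rule jgE[OF x X q])
    obtain W where W: "opn W" "q \<in> W" "W \<subseteq> V" "y \<in> jv W" by (rule jgE[OF y V(1,2)])
    show ?thesis by (rule jgI[OF W(1,2) jv_add[OF W(1) jv_mono[OF V(1) W(1,3) V(4)] W(4)]])
  qed
  show "x * y \<in> jg q" if x: "x \<in> lv q" and y: "y \<in> jg q"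
  proof -
    obtain V where V: "openin (proj_top r) V" "q \<in> V" "x \<in> rv V"
      by (rule local_values_nbhd[OF x q])
    obtain W where W: "opn W" "q \<in> W" "W \<subseteq> V" "y \<in> jv W" by (rule jgE[OF y, of V]) (use V in auto)
    show ?thesis by (rule jgI[OF W(1,2) jv_mult[OF W(1) regular_mono[OF W(3) V(3)] W(4)]])
  qed
qed

lemma jg_uminus: "q \<in> proj_points r \<Longrightarrow> x \<in> jg q \<Longrightarrow> - x \<in> jg q"
  using jg_mult[of q "- 1" x] local_values_uminus[OF _ local_values_one, of q r] by simp

lemma support_iff: "q \<in> supp \<longleftrightarrow> q \<in> proj_points r \<and> 1 \<notin> jg q"
  by (auto simp: support_def germ_values_def ideal_values_def regular_one)

lemma pr_value_zero_iff:
  "opn U \<Longrightarrow> x \<in> rv U \<Longrightarrow> pr U (vsec U x) = \<zero>\<^bsub>Sec Q U\<^esub> \<longleftrightarrow> x \<in> jv U"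
  using pr_zero_iff'[of U "vsec U x"] R_carrier[of U] by (auto simp: ideal_values_def)

end

section \<open>Integral subschemes and their generic point\<close>

context projective_ideal
begin

lemma value_carrier [simp]: "opn U \<Longrightarrow> x \<in> rv U \<Longrightarrow> vsec U x \<in> \<O> U"
  by (simp add: R_carrier)

lemma pr_value_res:
  assumes "opn U" "opn V" "V \<subseteq> U" "x \<in> rv U"
  shows "restrict (pr U (vsec U x)) V = pr V (vsec V x)"
  using pr_res[OF assms(1-3) value_carrier[OF assms(1,4)]] assms by simp

lemma pr_value_eq_iff:
  assumes U: "opn U" and x: "x \<in> rv U" "y \<in> rv U"
  shows "pr U (vsec U x) = pr U (vsec U y) \<longleftrightarrow> x - y \<in> jv U"
proof -
  interpret RU: cring "R U" by (rule cring[OF U])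
  have y: "- y \<in> rv U" using U x by (simp add: regular_uminus)
  have "\<ominus>\<^bsub>R U\<^esub> vsec U y = vsec U (- y)"
    using U x y RU.minus_equality[of "vsec U (- y)" "vsec U y"] by simp
  then have "vsec U x \<ominus>\<^bsub>R U\<^esub> vsec U y = vsec U (x - y)"
    by (simp add: a_minus_def)
  moreover have "x - y \<in> rv U" using regular_add[of r U x "- y"] U x y by simp
  ultimately show ?thesis using U x by (simp add: pr_eq_iff' ideal_values_def)
qed

text \<open>Irreducibility of Y: if W and W' both meet Y but not each other inside Y, then 0 on W
  and 1 on W' glue to an idempotent among the sections of O_Y over their union. That ring is a
  domain, so the idempotent is 0 or 1, and accordingly 1 lies in J near q' or near q.\<close>

lemma support_connected:
  assumes int: "integral_subscheme (proj_space r) J"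
    and W: "opn W" "opn W'" "q \<in> W" "q' \<in> W'" "q \<in> supp" "q' \<in> supp"
    and disj: "\<And>p. p \<in> W \<inter> W' \<Longrightarrow> 1 \<in> jg p"
  shows False
proof -
  let ?U = "W \<union> W'"
  have U: "opn ?U" using W by auto
  have I: "opn (W \<inter> W')" using W by auto
  have reg: "0 \<in> rv V" "1 \<in> rv V" if "opn V" for V
    using that by (auto simp: regular_zero regular_one)
  interpret domain "Sec Q ?U"
    using int U W(3,5) unfolding integral_subscheme_def by blast
  define \<mu> where "\<mu> = (\<lambda>p\<in>?U. if p \<in> W then pr W (vsec W 0) p else pr W' (vsec W' 1) p)"
  have "1 \<in> jv (W \<inter> W')" by (rule jv_local[OF I reg(2)[OF I] disj])
  then have "pr (W \<inter> W') (vsec (W \<inter> W') 1) = pr (W \<inter> W') (vsec (W \<inter> W') 0)"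
    using I reg[OF I] by (simp add: pr_value_eq_iff)
  then have eq: "pr W' (vsec W' 1) p = pr W (vsec W 0) p" if "p \<in> W \<inter> W'" for p
    using that W(1,2) I reg by (metis Int_lower1 Int_lower2 pr_value_res restrict_apply')
  have \<mu>W: "restrict \<mu> W = pr W (vsec W 0)"
    by (rule extensionalityI[of _ W]) (auto simp: \<mu>_def)
  have \<mu>W': "restrict \<mu> W' = pr W' (vsec W' 1)"
    by (rule extensionalityI[of _ W']) (auto simp: \<mu>_def eq)
  have \<mu>: "\<mu> \<in> carrier (Sec Q ?U)"
  proof (rule Q_glueI)
    show "\<mu> \<in> extensional ?U" by (simp add: \<mu>_def)
    fix p assume "p \<in> ?U"
    then have "p \<in> W \<or> p \<in> W'" by simp
    then show "\<exists>V. opn V \<and> p \<in> V \<and> V \<subseteq> ?U \<and> restrict \<mu> V \<in> carrier (Sec Q V)"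
    proof
      assume "p \<in> W"
      then show ?thesis using W(1) reg \<mu>W by (intro exI[of _ W]) simp
    next
      assume "p \<in> W'"
      then show ?thesis using W(2) reg \<mu>W' by (intro exI[of _ W']) simp
    qed
  qed
  have "\<mu> \<otimes>\<^bsub>Sec Q ?U\<^esub> \<mu> = \<mu>"
  proof (rule Q_eq_localI[of _ ?U])
    have sq: "restrict (\<mu> \<otimes>\<^bsub>Sec Q ?U\<^esub> \<mu>) V = restrict \<mu> V"
      if "opn V" "V \<subseteq> ?U" "restrict \<mu> V = pr V (vsec V c)" "c \<in> rv V" "c * c = c" for V c
    proof -
      have "restrict (\<mu> \<otimes>\<^bsub>Sec Q ?U\<^esub> \<mu>) V = pr V (vsec V (c * c))"
        using that(1-4) by (simp add: restrict_mult flip: pr_mult)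
      then show ?thesis using that(3,5) by simp
    qed
    fix p assume "p \<in> ?U"
    then have "p \<in> W \<or> p \<in> W'" by simp
    then show "\<exists>V. p \<in> V \<and> restrict (\<mu> \<otimes>\<^bsub>Sec Q ?U\<^esub> \<mu>) V = restrict \<mu> V"
      using sq[OF W(1) _ \<mu>W reg(1)[OF W(1)]] sq[OF W(2) _ \<mu>W' reg(2)[OF W(2)]] by (metis Un_upper1 Un_upper2 mult_1 mult_zero_left)
  qed (use \<mu> Q_extensional m_closed in auto)
  then have "\<mu> = \<zero>\<^bsub>Sec Q ?U\<^esub> \<or> \<mu> = \<one>\<^bsub>Sec Q ?U\<^esub>"
    using m_lcancel[OF _ \<mu> \<mu> one_closed] \<mu> by auto
  then have "\<mu> = pr ?U (vsec ?U 0) \<or> \<mu> = pr ?U (vsec ?U 1)"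
    using pr_zero[OF U] pr_one[OF U] by simp
  then have "pr W' (vsec W' 1) = pr W' (vsec W' 0) \<or> pr W (vsec W 0) = pr W (vsec W 1)"
    using \<mu>W \<mu>W' pr_value_res[OF U W(1) Un_upper1 reg(2)[OF U]] pr_value_res[OF U W(2) Un_upper2 reg(1)[OF U]] by auto
  then have "1 \<in> jv W' \<or> - 1 \<in> jv W" using W(1,2) reg by (simp add: pr_value_eq_iff)
  then have "1 \<in> jg q' \<or> 1 \<in> jg q"
    using jgI[OF W(2,4)] jgI[OF W(1,3)] jv_uminus[OF W(1), of "- 1"] by auto
  then show False using W(5,6) by (simp add: support_iff)
qed

text \<open>A product in J_q already lies in J over a neighbourhood of q, where the ring of sections
  of O_Y is a domain.\<close>

lemma jg_prime:
  assumes int: "integral_subscheme (proj_space r) J" and q: "q \<in> supp"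
    and x: "x \<in> lv q" and y: "y \<in> lv q" and xy: "x * y \<in> jg q"
  shows "x \<in> jg q \<or> y \<in> jg q"
proof -
  have q': "q \<in> proj_points r" using q by (simp add: support_iff)
  obtain V where V: "openin (proj_top r) V" "q \<in> V" "x \<in> rv V" by (rule local_values_nbhd[OF x q'])
  obtain V' where V': "openin (proj_top r) V'" "q \<in> V'" "y \<in> rv V'" by (rule local_values_nbhd[OF y q'])
  obtain W where W: "opn W" "q \<in> W" "W \<subseteq> V \<inter> V'" "x * y \<in> jv W"
    by (rule jgE[OF xy, of "V \<inter> V'"]) (use V V' in auto)
  have xy': "x \<in> rv W" "y \<in> rv W" "x * y \<in> rv W"
    using W V V' regular_mono[of W V x r] regular_mono[of W V' y r] by (auto simp: regular_mult)
  interpret domain "Sec Q W"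
    using int W q unfolding integral_subscheme_def by blast
  have "pr W (vsec W x) \<otimes>\<^bsub>Sec Q W\<^esub> pr W (vsec W y) = \<zero>\<^bsub>Sec Q W\<^esub>"
    using W xy' by (simp add: pr_value_zero_iff flip: pr_mult)
  then have "x \<in> jv W \<or> y \<in> jv W"
    using integral W xy' by (simp flip: pr_value_zero_iff)
  then show ?thesis using jgI[OF W(1,2)] by blast
qed

text \<open>\<open>\<eta>\<close> is the point of \<open>Spec O\<^bsub>P,q\<^esub>\<close> corresponding to \<open>J\<^sub>q\<close>, the generic point of \<open>Y\<close>.\<close>

lemma generic_point:
  assumes int: "integral_subscheme (proj_space r) J" and gen: "locally_generated (proj_space r) J"
    and q: "q \<in> supp"
  obtains \<eta> where "\<eta> \<in> supp" "\<And>U. opn U \<Longrightarrow> q \<in> U \<Longrightarrow> \<eta> \<in> U"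
    "\<And>a b d. a \<in> forms r d \<Longrightarrow> b \<in> forms r d \<Longrightarrow> b \<notin> q \<Longrightarrow> a \<in> \<eta> \<longleftrightarrow> fr a / fr b \<in> jg q"
proof -
  let ?R = "poly_ring (Suc r) :: 'k mpoly ring"
  have q': "q \<in> proj_points r" and one: "1 \<notin> jg q" using q by (simp_all add: support_iff)
  obtain i where i: "i \<le> r" "poly_var i \<notin> q" by (rule ex_coordinate_notin[OF q'])
  define t :: "'k mpoly fract" where "t = fr (poly_var i)"
  have t: "t \<noteq> 0" using i(2) point_zero[OF q'] by (auto simp: t_def)
  have xi: "poly_var i ^ d \<in> forms r d" for d
    using forms_power[OF poly_var_in_forms[OF i(1)], of d] by simp
  have xi_notin: "poly_var i ^ d \<notin> q" for d
    by (rule forms_notin_power[OF q' poly_var_in_forms[OF i(1)] i(2)])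
  have local: "fr a / t ^ d \<in> lv q" if "a \<in> forms r d" for a d
    using local_values_to_fract[OF q' that xi xi_notin] by (simp add: t_def to_fract_power)
  \<comment> \<open>All homogeneous parts of a, divided by powers of x_i, must lie in J_q: this is
    the preimage of the polynomials with coefficients in J_q under a graded map, hence a homogeneous
    ideal, and prime by \<open>coeffs_prime\<close>.\<close>
  define \<eta> where "\<eta> = {a \<in> carrier ?R. \<forall>d. coeff (dehomogenize i a) d \<in> jg q}"
  have coeff_local: "coeff (dehomogenize i a) d \<in> lv q" if "a \<in> carrier ?R" for a d
    unfolding coeff_dehomogenize[OF that] using local[OF homogeneous_part_in_forms[OF that]] by (simp add: t_def)
  have form: "a \<in> \<eta> \<longleftrightarrow> fr a / t ^ d \<in> jg q" if "a \<in> forms r d" for a d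
    using forms_carrier[OF that] jg_zero[OF q']
    by (auto simp: \<eta>_def dehomogenize_form[OF that] t_def)
  \<comment> \<open>The condition does not depend on the denominator: a form b of degree d outside q
    differs from x_i^d by a unit of the local ring at q.\<close>
  have cong: "fr a / t ^ d \<in> jg q \<longleftrightarrow> fr a / fr b \<in> jg q"
    if ab: "a \<in> forms r d" "b \<in> forms r d" "b \<notin> q" for a b d
  proof -
    have b: "fr b \<noteq> 0" using point_neq_zero[OF q' ab(3)] by simp
    have "fr b / t ^ d \<in> lv q" by (rule local[OF ab(2)])
    moreover have "t ^ d / fr b \<in> lv q"
      using local_values_to_fract[OF q' xi ab(2,3)] by (simp add: t_def to_fract_power)
    moreover have "fr a / t ^ d = (fr b / t ^ d) * (fr a / fr b)"
      "fr a / fr b = (t ^ d / fr b) * (fr a / t ^ d)"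
      using b t by (simp_all add: field_simps)
    ultimately show ?thesis using jg_mult[OF q'] by metis
  qed
  interpret cR: cring ?R by (rule poly_ring_cring)
  have ideal: "ideal \<eta> ?R"
  proof (rule idealI[OF cR.ring_axioms])
    show "subgroup \<eta> (add_monoid ?R)"
    proof (rule cR.add.subgroupI)
      show "\<eta> \<subseteq> carrier ?R" by (auto simp: \<eta>_def)
      have "0 \<in> \<eta>" by (simp add: \<eta>_def dehomogenize_simps jg_zero[OF q'])
      then show "\<eta> \<noteq> {}" by auto
      show "\<ominus>\<^bsub>?R\<^esub> a \<in> \<eta>" if a: "a \<in> \<eta>" for a
      proof -
        have "\<ominus>\<^bsub>?R\<^esub> a = - a"
          by (rule cR.minus_equality) (use a in \<open>auto simp: \<eta>_def poly_ring_uminus\<close>)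
        moreover have "dehomogenize i (- a) = - dehomogenize i a"
          using dehomogenize_simps(3)[of i a "- a"] by (simp add: dehomogenize_simps eq_neg_iff_add_eq_0 add.commute)
        ultimately show ?thesis using a jg_uminus[OF q'] by (auto simp: \<eta>_def poly_ring_uminus)
      qed
      show "a \<oplus>\<^bsub>?R\<^esub> b \<in> \<eta>" if "a \<in> \<eta>" "b \<in> \<eta>" for a b
        using that by (simp add: \<eta>_def dehomogenize_simps poly_ring_add jg_add[OF q'])
    qed
    have mult: "x * a \<in> \<eta>" if "a \<in> \<eta>" "x \<in> carrier ?R" for a x
    proof -
      have "(\<Sum>k\<le>d. coeff (dehomogenize i x) k * coeff (dehomogenize i a) (d - k)) \<in> jg q" for d
        by (rule sum_in_additive[of "jg q"]) (use that in \<open>auto simp: \<eta>_def jg_zero[OF q'] intro!: jg_add[OF q'] jg_mult[OF q'] coeff_local\<close>)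
      then show ?thesis using that by (simp add: \<eta>_def dehomogenize_simps coeff_mult poly_ring_mult)
    qed
    then show "x \<otimes>\<^bsub>?R\<^esub> a \<in> \<eta>" "a \<otimes>\<^bsub>?R\<^esub> x \<in> \<eta>" if "a \<in> \<eta>" "x \<in> carrier ?R" for a x
      using that by (simp_all add: mult.commute[of a x])
  qed
  have not1: "1 \<notin> \<eta>" using form[OF one_in_forms] one by simp
  have prime: "primeideal \<eta> ?R"
  proof (rule primeidealI[OF ideal poly_ring_cring])
    show "carrier ?R \<noteq> \<eta>" using not1 by (metis poly_ring_closed(2))
    fix a b assume ab: "a \<in> carrier ?R" "b \<in> carrier ?R" "a \<otimes>\<^bsub>?R\<^esub> b \<in> \<eta>"
    have "(\<forall>n. coeff (dehomogenize i a) n \<in> jg q) \<or> (\<forall>n. coeff (dehomogenize i b) n \<in> jg q)"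
    proof (rule coeffs_prime[of "jg q" "lv q"])
      show "coeff (dehomogenize i a * dehomogenize i b) n \<in> jg q" for n
        using ab(3) by (simp add: \<eta>_def dehomogenize_simps)
    qed (use ab in \<open>auto simp: jg_zero[OF q'] coeff_local intro: jg_local_values[OF q'] jg_add[OF q'] jg_mult[OF q'] jg_uminus[OF q'] dest: jg_prime[OF int q]\<close>)
    then show "a \<in> \<eta> \<or> b \<in> \<eta>" using ab by (auto simp: \<eta>_def)
  qed
  have hom: "\<eta> = Idl\<^bsub>?R\<^esub> (\<eta> \<inter> (\<Union>d. forms r d))"
  proof
    let ?A = "\<eta> \<inter> (\<Union>d. forms r d)"
    have A: "?A \<subseteq> carrier ?R" by (auto simp: \<eta>_def)
    show "Idl\<^bsub>?R\<^esub> ?A \<subseteq> \<eta>" by (rule cR.genideal_minimal[OF ideal]) auto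
    show "\<eta> \<subseteq> Idl\<^bsub>?R\<^esub> ?A"
    proof
      fix a assume a: "a \<in> \<eta>"
      then have aR: "a \<in> carrier ?R" by (simp add: \<eta>_def)
      have "homogeneous_part d a \<in> \<eta>" for d
        using a form[OF homogeneous_part_in_forms[OF aR, of d]] by (simp add: \<eta>_def coeff_dehomogenize[OF aR] t_def)
      then have "homogeneous_part d a \<in> Idl\<^bsub>?R\<^esub> ?A" for d
        using homogeneous_part_in_forms[OF aR, of d] cR.genideal_self[OF A] by blast
      then have "(\<Sum>d\<in>monomial_degree ` keys a. homogeneous_part d a) \<in> Idl\<^bsub>?R\<^esub> ?A"
        by (intro sum_in_ideal[OF cR.genideal_ideal[OF A]])
      then show "a \<in> Idl\<^bsub>?R\<^esub> ?A" by (simp add: sum_homogeneous_parts)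
    qed
  qed
  have "poly_var i \<notin> \<eta>" using form[OF poly_var_in_forms[OF i(1)]] one t by (simp add: t_def)
  moreover have "poly_var i \<in> {f \<in> carrier ?R. lookup f 0 = 0}"
    using poly_var_closed[of i "Suc r"] i(1) single_neq_zero[of "1::nat" i]
    by (simp add: poly_var_def lookup_single when_def)
  ultimately have "\<not> {f \<in> carrier ?R. lookup f 0 = 0} \<subseteq> \<eta>" by blast
  then have \<eta>: "\<eta> \<in> proj_points r" using prime hom by (simp add: proj_points_def)
  have form': "a \<in> \<eta> \<longleftrightarrow> fr a / fr b \<in> jg q" if "a \<in> forms r d" "b \<in> forms r d" "b \<notin> q" for a b d
    using form[OF that(1)] cong[OF that] by simp
  \<comment> \<open>With b = a in \<open>form'\<close> the quotient is 1, which is not in J_q. Hence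
    every neighbourhood of q contains \<eta>.\<close>
  have notin: "a \<notin> \<eta>" if "a \<in> forms r d" "a \<notin> q" for a d
    using form'[OF that(1,1,2)] one point_neq_zero[OF q' that(2)] by simp
  have nbhd: "\<eta> \<in> U" if U: "opn U" "q \<in> U" for U
  proof -
    obtain A where A: "A \<subseteq> (\<Union>d. forms r d)" "U = {p \<in> proj_points r. \<not> A \<subseteq> p}"
      using U(1) by (auto simp: openin_proj)
    obtain a where a: "a \<in> A" "a \<notin> q" using U(2) A(2) by auto
    obtain d where "a \<in> forms r d" using A(1) a(1) by auto
    then show ?thesis using notin[of a d] a A(2) \<eta> by auto
  qed
  have "\<eta> \<in> supp"
    unfolding support_iff
  proof
    show "1 \<notin> jg \<eta>"
    proof
      assume 1: "1 \<in> jg \<eta>"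
      \<comment> \<open>\<open>M\<close> is J_q extended to the localization of O_q at J_q. If 1
        were in J at \<eta>, local generation would express it near \<eta> by sections of J on a
        neighbourhood of q; these lie in \<open>M\<close>, which is stable under the local ring at
        \<eta> but does not contain 1.\<close>
      define M where "M = {z / w | z w. z \<in> jg q \<and> w \<in> lv q \<and> w \<notin> jg q}"
      obtain U where U: "opn U" "q \<in> U" and gen: "\<And>V s p. opn V \<Longrightarrow> V \<subseteq> U \<Longrightarrow> s \<in> J V \<Longrightarrow> p \<in> V \<Longrightarrow>
          \<exists>W. opn W \<and> p \<in> W \<and> W \<subseteq> V \<and> rho V W s \<in> Idl\<^bsub>R W\<^esub> (rho U W ` J U)"
        using gen q' unfolding locally_generated_def by auto
      obtain V where V: "opn V" "\<eta> \<in> V" "V \<subseteq> U" "1 \<in> jv V" by (rule jgE[OF 1 U(1) nbhd[OF U]])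
      obtain W where W: "opn W" "\<eta> \<in> W" "W \<subseteq> V" "rho V W (vsec V 1) \<in> Idl\<^bsub>R W\<^esub> (rho U W ` J U)"
        using gen[OF V(1,3) _ V(2), of "vsec V 1"] V(4) by (auto simp: ideal_values_def)
      interpret RW: cring "R W" by (rule cring[OF W(1)])
      have nz: "w \<noteq> 0" if "w \<notin> jg q" for w using that jg_zero[OF q'] by auto
      have prime': "w * w' \<in> lv q \<and> w * w' \<notin> jg q"
        if "w \<in> lv q" "w \<notin> jg q" "w' \<in> lv q" "w' \<notin> jg q" for w w'
        using that jg_prime[OF int q that(1,3)] local_values_mult[OF q'] by auto
      have jgM: "x \<in> M" if "x \<in> jg q" for x
        unfolding M_def using that one local_values_one[OF q'] by (intro CollectI exI[of _ x] exI[of _ 1]) simp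
      have Madd: "x + y \<in> M" if xy: "x \<in> M" "y \<in> M" for x y
      proof -
        obtain z w where x: "x = z / w" "z \<in> jg q" "w \<in> lv q" "w \<notin> jg q" using xy(1) by (auto simp: M_def)
        obtain z' w' where y: "y = z' / w'" "z' \<in> jg q" "w' \<in> lv q" "w' \<notin> jg q" using xy(2) by (auto simp: M_def)
        have "x + y = (w' * z + w * z') / (w * w')" using nz[OF x(4)] nz[OF y(4)] x(1) y(1) by (simp add: field_simps)
        moreover have "w' * z + w * z' \<in> jg q" by (intro jg_add[OF q'] jg_mult[OF q'] x y)
        ultimately show ?thesis unfolding M_def using prime'[OF x(3,4) y(3,4)] by blast
      qed
      have Mmult: "x * y \<in> M" if xy: "x \<in> lv \<eta>" "y \<in> M" for x y
      proof -
        obtain a b d where x: "x = fr a / fr b" "a \<in> forms r d" "b \<in> forms r d" "b \<notin> \<eta>"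
          by (rule local_valuesE'[OF xy(1) \<eta>])
        obtain z w where y: "y = z / w" "z \<in> jg q" "w \<in> lv q" "w \<notin> jg q" using xy(2) by (auto simp: M_def)
        have "x * y = (fr a / t ^ d * z) / (fr b / t ^ d * w)" using t x(1) y(1) by simp
        moreover have "fr a / t ^ d * z \<in> jg q" by (rule jg_mult[OF q' local[OF x(2)] y(2)])
        moreover have "fr b / t ^ d \<notin> jg q" using form[OF x(3)] x(4) by simp
        ultimately show ?thesis unfolding M_def using prime'[OF local[OF x(3)] _ y(3,4)] by blast
      qed
      let ?M = "vsec W ` (M \<inter> rv W)"
      have "ideal ?M (R W)"
      proof (rule idealI[OF RW.ring_axioms])
        show "subgroup ?M (add_monoid (R W))"
        proof (rule RW.add.subgroupI)
          show "?M \<subseteq> \<O> W" using W(1) by auto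
          show "?M \<noteq> {}" using jgM[OF jg_zero[OF q']] W(1) by (auto simp: regular_zero)
          show "\<ominus>\<^bsub>R W\<^esub> s \<in> ?M" if s: "s \<in> ?M" for s
          proof -
            obtain x where x: "s = vsec W x" "x \<in> M" "x \<in> rv W" using s by auto
            have m: "- x \<in> rv W" using W(1) x by (simp add: regular_uminus)
            have "\<ominus>\<^bsub>R W\<^esub> s = vsec W (- x)"
              by (rule RW.minus_equality) (use x m W(1) in auto)
            moreover have "- x \<in> M"
              using Mmult[OF local_values_uminus[OF \<eta> local_values_one[OF \<eta>]] x(2)] by simp
            ultimately show ?thesis using m by auto
          qed
          show "s \<oplus>\<^bsub>R W\<^esub> s' \<in> ?M" if "s \<in> ?M" "s' \<in> ?M" for s s'
            using that Madd W(1) by (auto simp: regular_add intro!: imageI)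
        qed
        show cs: "c \<otimes>\<^bsub>R W\<^esub> s \<in> ?M" if "s \<in> ?M" "c \<in> \<O> W" for s c
          using that Mmult W(1,2) by (auto simp: R_carrier regular_mult regular_local intro!: imageI)
        show "s \<otimes>\<^bsub>R W\<^esub> c \<in> ?M" if "s \<in> ?M" "c \<in> \<O> W" for s c
        proof -
          have "s \<in> \<O> W" using that(1) W(1) by auto
          then show ?thesis using cs[OF that] that(2) by (simp only: RW.m_comm[of s c])
        qed
      qed
      moreover have "rho U W ` J U \<subseteq> ?M"
      proof
        fix s assume "s \<in> rho U W ` J U"
        then obtain x where x: "x \<in> jv U" "s = rho U W (vsec U x)" by (auto simp: J_eq[OF U(1)])
        have WU: "W \<subseteq> U" using W V by auto
        have xreg: "x \<in> rv U" by (rule jv_regular[OF U(1) x(1)])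
        have "x \<in> M" by (rule jgM[OF jgI[OF U x(1)]])
        then show "s \<in> ?M" using x(2) WU regular_mono[OF WU xreg] by auto
      qed
      ultimately have "Idl\<^bsub>R W\<^esub> (rho U W ` J U) \<subseteq> ?M" by (rule RW.genideal_minimal)
      then have "vsec W 1 \<in> ?M" using W(3,4) by auto
      then have "1 \<in> M" using W(2) by (auto dest!: fun_cong[of _ _ \<eta>])
      then obtain z w where "1 = z / w" "z \<in> jg q" "w \<notin> jg q" by (auto simp: M_def)
      then show False using nz[of w] by simp
    qed
  qed (rule \<eta>)
  then show thesis using nbhd form' by (rule that)
qed

text \<open>Otherwise x = a / b is a unit at the generic point of Y as seen from q', and hence on
  D_+(a b). Near q it lies in J, so the two open sets do not meet on Y, against
  irreducibility.\<close>

lemma jg_transfer: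
  assumes int: "integral_subscheme (proj_space r) J" and gen: "locally_generated (proj_space r) J"
    and q: "q \<in> supp" "q' \<in> supp"
    and x: "x \<in> jg q" "x \<in> lv q'"
  shows "x \<in> jg q'"
proof (rule ccontr)
  assume nx: "x \<notin> jg q'"
  have p: "q \<in> proj_points r" "q' \<in> proj_points r" using q by (simp_all add: support_iff)
  obtain \<eta> where \<eta>: "\<eta> \<in> supp" "\<And>U. opn U \<Longrightarrow> q' \<in> U \<Longrightarrow> \<eta> \<in> U"
    "\<And>a b d. a \<in> forms r d \<Longrightarrow> b \<in> forms r d \<Longrightarrow> b \<notin> q' \<Longrightarrow> a \<in> \<eta> \<longleftrightarrow> fr a / fr b \<in> jg q'"
    using generic_point[OF int gen q(2)] by metis
  obtain a b d where ab: "x = fr a / fr b" "a \<in> forms r d" "b \<in> forms r d" "b \<notin> q'"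
    by (rule local_valuesE'[OF x(2) p(2)])
  have a: "a \<notin> \<eta>" using \<eta>(3)[OF ab(2-4)] nx ab(1) by simp
  have b: "b \<notin> \<eta>" using \<eta>(2)[of "basic_open r b"] ab(3,4) p(2) by (simp add: openin_basic) (simp add: basic_open_def)
  obtain W where W: "openin (proj_top r) W" "q \<in> W" "x \<in> jv W" using x(1) by (auto simp: germ_values_def)
  let ?W' = "basic_open r (a * b)"
  have W': "openin (proj_top r) ?W'" by (rule openin_basic[OF forms_mult[OF ab(2,3)]])
  have "\<eta> \<in> proj_points r" using \<eta>(1) by (simp add: support_iff)
  then have "\<eta> \<in> ?W'" using forms_notin_mult[OF _ ab(2,3) a b] by (simp add: basic_open_def)
  moreover have "1 \<in> jg p" if pW: "p \<in> W \<inter> ?W'" for p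
  proof -
    have pp: "p \<in> proj_points r" "a * b \<notin> p" using pW by (auto simp: basic_open_def)
    have ap: "a \<notin> p" "b \<notin> p"
      using pp ab(2,3) by (auto simp: point_prime[OF pp(1)] forms_carrier)
    have nz: "fr a \<noteq> 0" "fr b \<noteq> 0" using point_neq_zero[OF pp(1)] ap by auto
    have "x \<in> jg p" using jgI[of W p x] W pW by simp
    moreover have "fr b / fr a \<in> lv p"
      by (rule local_values_to_fract[OF pp(1) ab(3,2) ap(1)])
    ultimately have "fr b / fr a * x \<in> jg p" by (intro jg_mult[OF pp(1)])
    then show ?thesis using nz by (simp add: ab(1))
  qed
  ultimately show False
    using support_connected[OF int, of W ?W' q \<eta>] W W' q(1) \<eta>(1) by simp
qed

end

section \<open>Smooth subvarieties\<close>

text \<open>The quotient rule in the form (a' - x b') / b; \<open>fract_deriv_eq\<close> shows that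
  the chosen representation of x does not matter.\<close>

definition fract_deriv :: "nat \<Rightarrow> 'k::field mpoly fract \<Rightarrow> 'k mpoly fract" where
  "fract_deriv i x = (let (a, b) = (SOME (a, b). b \<noteq> 0 \<and> x = fr a / fr b)
     in (fr (partial_deriv i a) - x * fr (partial_deriv i b)) / fr b)"

lemma fract_cases':
  obtains a b where "x = fr a / fr b" "b \<noteq> 0" "fr b \<noteq> 0"
  by (cases x rule: Fract_cases) (auto simp: Fract_conv_to_fract)

text \<open>Two representations a / b and a' / b' of x satisfy a b' = a' b. Differentiating this
  identity and substituting a = x b and a' = x b' gives equality of both quotients.\<close>

lemma fract_deriv_eq:
  assumes "b \<noteq> 0" "x = fr a / fr b"
  shows "fract_deriv i x = (fr (partial_deriv i a) - x * fr (partial_deriv i b)) / fr b"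
proof -
  obtain a' b' where s: "(SOME (a, b). b \<noteq> 0 \<and> x = fr a / fr b) = (a', b')" by fastforce
  have "case (SOME (a, b). b \<noteq> 0 \<and> x = fr a / fr b) of (a, b) \<Rightarrow> b \<noteq> 0 \<and> x = fr a / fr b"
    by (rule someI[of _ "(a, b)"]) (use assms in simp)
  then have b': "b' \<noteq> 0" "x = fr a' / fr b'" by (simp_all add: s)
  have nz: "fr b \<noteq> 0" "fr b' \<noteq> 0" using assms(1) b'(1) by auto
  have ax: "fr a = x * fr b" "fr a' = x * fr b'"
    using nz by (simp add: assms(2)) (use nz in \<open>simp add: b'(2)\<close>)
  have "fr (a * b') = fr (a' * b)" by (simp add: ax mult_ac)
  then have "a * b' = a' * b" unfolding to_fract_eq_iff .
  then have "fr (partial_deriv i (a * b')) = fr (partial_deriv i (a' * b))" by simp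
  then have "x * fr b * fr (partial_deriv i b') + fr (partial_deriv i a) * fr b' =
      x * fr b' * fr (partial_deriv i b) + fr (partial_deriv i a') * fr b"
    by (simp add: partial_deriv_mult ax)
  then have "(fr (partial_deriv i a') - x * fr (partial_deriv i b')) * fr b =
      (fr (partial_deriv i a) - x * fr (partial_deriv i b)) * fr b'"
    by (simp add: algebra_simps)
  then show ?thesis using nz by (simp add: fract_deriv_def s field_simps)
qed

lemma fract_deriv_add: "fract_deriv i (x + y) = fract_deriv i x + fract_deriv i y"
proof -
  obtain a b where x: "x = fr a / fr b" "b \<noteq> 0" "fr b \<noteq> 0" by (rule fract_cases')
  obtain c d where y: "y = fr c / fr d" "d \<noteq> 0" "fr d \<noteq> 0" by (rule fract_cases')
  have "x + y = fr (a * d + c * b) / fr (b * d)" using x y by (simp add: field_simps)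
  from fract_deriv_eq[OF _ this] show ?thesis
    unfolding fract_deriv_eq[OF x(2,1)] fract_deriv_eq[OF y(2,1)]
    using x y by (simp add: partial_deriv_add partial_deriv_mult) (simp add: field_simps)
qed

lemma fract_deriv_mult: "fract_deriv i (x * y) = x * fract_deriv i y + y * fract_deriv i x"
proof -
  obtain a b where x: "x = fr a / fr b" "b \<noteq> 0" "fr b \<noteq> 0" by (rule fract_cases')
  obtain c d where y: "y = fr c / fr d" "d \<noteq> 0" "fr d \<noteq> 0" by (rule fract_cases')
  have "x * y = fr (a * c) / fr (b * d)" using x y by simp
  from fract_deriv_eq[OF _ this] show ?thesis
    unfolding fract_deriv_eq[OF x(2,1)] fract_deriv_eq[OF y(2,1)]
    using x y by (simp add: partial_deriv_mult) (simp add: field_simps)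
qed

text \<open>Sections of the presheaf square of J over U, not of its sheafification; membership is
  therefore always asserted over an explicit open set.\<close>

definition square_values where
  "square_values r J U = {x \<in> regular_values r U. vsec U x \<in> square (Str (proj_space r)) J U}"

section \<open>Lifting a smooth chart from Y to projective space\<close>

context projective_ideal
begin

abbreviation "jsq \<equiv> square_values r J"

lemma jsq_facts:
  assumes U: "opn U"
  shows jsq_jv: "x \<in> jsq U \<Longrightarrow> x \<in> jv U"
    and jsq_zero: "0 \<in> jsq U"
    and jsq_add: "x \<in> jsq U \<Longrightarrow> y \<in> jsq U \<Longrightarrow> x + y \<in> jsq U"
    and jsq_mult: "x \<in> rv U \<Longrightarrow> y \<in> jsq U \<Longrightarrow> x * y \<in> jsq U"
    and jv_mult_jv: "x \<in> jv U \<Longrightarrow> y \<in> jv U \<Longrightarrow> x * y \<in> jsq U"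
  using sq.sub_carrier[OF U, of "vsec U x"] sq.sub_zero[OF U]
    sq.sub_add[OF U, of "vsec U x" "vsec U y"]
    sq.sub_smult[OF U, of "vsec U x" "vsec U y"] U R_carrier[OF U]
    ideal_prod.prod[of "vsec U x" "J U" "vsec U y" "J U" "R U"]
  by (auto simp: square_values_def ideal_values_def regular_zero regular_add regular_mult square_def)

lemma jsq_mono:
  assumes "opn U" "opn V" "V \<subseteq> U" "x \<in> jsq U" shows "x \<in> jsq V"
  using sq.sub_res[OF assms(1,2,3), of "vsec U x"] assms regular_mono[of V U x]
  by (auto simp: square_values_def)

lemma nested: "opn U \<Longrightarrow> nested_ideals fract_const (rv U) (jv U) (jsq U)"
  by (rule nested_ideals.intro)
    (auto simp: fract_const_embedding regular_fract_const regular_add regular_mult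
      jv_regular jv_zero jv_add jv_mult jsq_jv jsq_zero jsq_add jsq_mult jv_mult_jv)

lemma regular_iff: "opn U \<Longrightarrow> s \<in> \<O> U \<longleftrightarrow> (\<exists>x\<in>rv U. s = vsec U x)"
  by (auto simp: R_carrier)

text \<open>Each further section shrinks the neighbourhood once more and the earlier lifts are
  restricted to it, which is why finiteness matters.\<close>

lemma finite_lifts:
  fixes n :: nat
  assumes U: "opn U" "p \<in> U" and \<sigma>: "\<And>i. i < n \<Longrightarrow> \<sigma> i \<in> carrier (Sec Q U)"
  obtains V u where "opn V" "p \<in> V" "V \<subseteq> U" "\<And>i. i < n \<Longrightarrow> u i \<in> rv V"
    "\<And>i. i < n \<Longrightarrow> restrict (\<sigma> i) V = pr V (vsec V (u i))"
proof -
  have "\<exists>V u. opn V \<and> p \<in> V \<and> V \<subseteq> U \<and> (\<forall>i<n. u i \<in> rv V \<and> restrict (\<sigma> i) V = pr V (vsec V (u i)))"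
    using \<sigma>
  proof (induction n)
    case 0
    then show ?case using U by (intro exI[of _ U]) auto
  next
    case (Suc n)
    have "\<exists>V u. opn V \<and> p \<in> V \<and> V \<subseteq> U \<and> (\<forall>i<n. u i \<in> rv V \<and> restrict (\<sigma> i) V = pr V (vsec V (u i)))"
      by (rule Suc.IH) (use Suc.prems in simp)
    then obtain V u where V: "opn V" "p \<in> V" "V \<subseteq> U"
      "\<forall>i<n. u i \<in> rv V \<and> restrict (\<sigma> i) V = pr V (vsec V (u i))"
      by (elim exE conjE)
    obtain W s where W: "opn W" "p \<in> W" "W \<subseteq> U" "s \<in> \<O> W" "restrict (\<sigma> n) W = pr W s"
      using sec_local[OF Suc.prems[OF lessI] U(2)] by metis
    obtain x where x: "s = vsec W x" "x \<in> rv W" using W(1,4) by (auto simp: regular_iff)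
    have o: "opn (V \<inter> W)" using V W by simp
    have "u' i \<in> rv (V \<inter> W) \<and> restrict (\<sigma> i) (V \<inter> W) = pr (V \<inter> W) (vsec (V \<inter> W) (u' i))"
      if i: "i < Suc n" and u': "u' = u(n := x)" for i u'
    proof (cases "i = n")
      case True
      have "restrict (restrict (\<sigma> n) W) (V \<inter> W) = pr (V \<inter> W) (vsec (V \<inter> W) x)"
        unfolding W(5) x(1) by (rule pr_value_res[OF W(1) o _ x(2)]) simp
      then show ?thesis using True u' regular_mono[OF _ x(2), of "V \<inter> W"] by (simp add: Int_absorb1 Int_commute Int_left_commute)
    next
      case False
      then have i': "i < n" using i by simp
      have "restrict (restrict (\<sigma> i) V) (V \<inter> W) = pr (V \<inter> W) (vsec (V \<inter> W) (u i))"
        unfolding V(4)[rule_format, OF i', THEN conjunct2]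
        by (rule pr_value_res[OF V(1) o _ V(4)[rule_format, OF i', THEN conjunct1]]) simp
      then show ?thesis using False u' regular_mono[OF _ V(4)[rule_format, OF i', THEN conjunct1], of "V \<inter> W"]
        by (simp add: Int_absorb1 Int_commute Int_left_commute)
    qed
    then show ?case using o V W by (intro exI[of _ "V \<inter> W"] exI[of _ "u(n := x)"]) auto
  qed
  then obtain V u where V: "opn V" "p \<in> V" "V \<subseteq> U"
    "\<forall>i<n. u i \<in> rv V \<and> restrict (\<sigma> i) V = pr V (vsec V (u i))"
    by (elim exE conjE)
  show thesis by (rule that[OF V(1-3)]) (simp_all only: V(4)[rule_format])
qed

lemma struct_ring: "opn U \<Longrightarrow> integral_subscheme (proj_space r) J \<Longrightarrow> p \<in> U \<Longrightarrow> p \<in> supp \<Longrightarrow> cring (Sec Q U)"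
  unfolding integral_subscheme_def by (metis IntI domain.axioms(1) empty_iff)

lemma pr_const: "opn U \<Longrightarrow> pr U (const_section U c) = pr U (vsec U (fract_const c))"
  by (simp add: const_section_def vsec_def to_fract_def)

lemma restrict_Q_add: "V \<subseteq> U \<Longrightarrow> restrict (\<sigma> \<oplus>\<^bsub>Sec Q U\<^esub> \<tau>) V = restrict \<sigma> V \<oplus>\<^bsub>Sec Q V\<^esub> restrict \<tau> V"
  by (auto simp: Q_add restrict_def fun_eq_iff)

lemma pr_value_hom:
  assumes "opn U" "x \<in> rv U" "y \<in> rv U"
  shows "pr U (vsec U (x + y)) = pr U (vsec U x) \<oplus>\<^bsub>Sec Q U\<^esub> pr U (vsec U y)"
    and "pr U (vsec U (x * y)) = pr U (vsec U x) \<otimes>\<^bsub>Sec Q U\<^esub> pr U (vsec U y)"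
  using assms pr_add[of U "vsec U x" "vsec U y"] pr_mult[of U "vsec U x" "vsec U y"]
  by simp_all

text \<open>Both sides respect sums and products in a, so agreement on constants and variables
  suffices.\<close>

lemma chart_eval:
  assumes \<phi>: "\<phi> \<in> Ring.ring_hom (poly_ring n) (Sec Q D)" "\<And>c. \<phi> (const_poly c) = pr D (vsec D (fract_const c))"
    and D: "opn D" "opn V" "V \<subseteq> D"
    and u: "\<And>i. i < n \<Longrightarrow> u i \<in> rv V"
      "\<And>i. i < n \<Longrightarrow> restrict (\<phi> (poly_var i)) V = pr V (vsec V (u i))"
    and a: "a \<in> polys n"
  shows "restrict (\<phi> a) V = pr V (vsec V (feval u a))"
proof -
  interpret N: nested_ideals fract_const "rv V" "jv V" "jsq V" by (rule nested[OF D(2)])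
  have e: "feval u b \<in> rv V" if "b \<in> polys n" for b
    by (rule N.eval_R[OF that u(1)])
  show ?thesis
    using a
  proof (induction rule: poly_ring_induct)
    case (const c)
    then show ?case
      using pr_value_res[OF D, of "fract_const c"] regular_fract_const[of r D c] D(1)
      by (simp add: \<phi>(2) fract_const_embedding)
  next
    case (var i)
    then show ?case using u(2) by (simp add: fract_const_embedding)
  next
    case (add a b)
    then show ?case
      using Ring.ring_hom_add[OF \<phi>(1) add(1,2)] restrict_Q_add[OF D(3)] pr_value_hom(1)[OF D(2) e[OF add(1)] e[OF add(2)]]
      by (simp only: peval_add[OF fract_const_embedding] poly_ring_simps)
  next
    case (mult a b)
    then show ?case
      using Ring.ring_hom_mult[OF \<phi>(1) mult(1,2)] restrict_mult[OF D(3)] pr_value_hom(2)[OF D(2) e[OF mult(1)] e[OF mult(2)]]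
      by (simp only: peval_mult[OF fract_const_embedding] poly_ring_simps)
  qed
qed

text \<open>Newton's method: the point of the chart lifts to \<open>P\<close> modulo the square of \<open>J\<close>.\<close>

lemma smooth_chart:
  assumes int: "integral_subscheme (proj_space r) J" and smooth: "smooth_subscheme r J"
    and p: "p \<in> supp"
  obtains e g n \<phi> V u where "0 < e" "g \<in> forms r e" "g \<notin> p" "opn V" "p \<in> V" "V \<subseteq> basic_open r g"
    "\<phi> \<in> Ring.ring_hom (poly_ring n) (Sec Q (basic_open r g))"
    "\<forall>c. \<phi> (const_poly c) = pr (basic_open r g) (vsec (basic_open r g) (fract_const c))"
    "\<phi> ` polys n = carrier (Sec Q (basic_open r g))"
    "\<forall>i<n. u i \<in> rv V"
    "\<forall>a\<in>polys n. restrict (\<phi> a) V = pr V (vsec V (feval u a))"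
    "\<forall>a\<in>polys n. \<phi> a = \<zero>\<^bsub>Sec Q (basic_open r g)\<^esub> \<longrightarrow> feval u a \<in> jsq V"
proof -
  have pp: "p \<in> proj_points r" using p by (simp add: support_iff)
  obtain e g where g: "0 < e" "g \<in> forms r e" "g \<notin> p" and std: "standard_smooth
      (\<lambda>c. pr (basic_open r g) (const_section (basic_open r g) c)) (Sec Q (basic_open r g))"
    using smooth[unfolded smooth_subscheme_def, rule_format, OF p] by (auto simp: proj_space_simps(2))
  define D where "D = basic_open r g"
  have D: "opn D" "p \<in> D" using openin_basic[OF g(2)] g(3) pp by (auto simp: D_def basic_open_def)
  obtain n c f \<phi> where n: "c \<le> n" "f ` {..<c} \<subseteq> polys n"
    and \<phi>: "\<phi> \<in> Ring.ring_hom (poly_ring n) (Sec Q D)" "\<And>a. \<phi> (const_poly a) = pr D (const_section D a)"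
      "\<phi> ` polys n = carrier (Sec Q D)"
      "a_kernel (poly_ring n) (Sec Q D) \<phi> = Idl\<^bsub>poly_ring n\<^esub> (f ` {..<c})"
      "\<phi> (det (mat c c (\<lambda>(i, j). partial_deriv i (f j)))) \<in> Units (Sec Q D)"
    using std unfolding standard_smooth_def D_def[symmetric] by (elim exE conjE) simp
  have \<phi>c: "\<phi> (const_poly a) = pr D (vsec D (fract_const a))" for a
    using \<phi>(2) pr_const[OF D(1)] by simp
  have f: "f j \<in> polys n" if "j < c" for j using n(2) that by auto
  interpret A: cring "Sec Q D" by (rule struct_ring[OF D(1) int D(2) p])
  interpret P: cring "poly_ring n :: 'k mpoly ring" by (rule poly_ring_cring)
  have \<phi>_closed: "\<phi> a \<in> carrier (Sec Q D)" if "a \<in> polys n" for a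
    using \<phi>(3) that by auto
  define \<Delta> where "\<Delta> = det (mat c c (\<lambda>(i, j). partial_deriv i (f j)))"
  have \<Delta>: "\<Delta> \<in> polys n"
  proof -
    have [simp]: "signof \<pi> * a \<in> polys n" if "a \<in> polys n" for \<pi> and a :: "'k mpoly"
      using that by (auto simp: sign_def poly_ring_uminus)
    have "(\<Prod>i = 0..<c. mat c c (\<lambda>(i, j). partial_deriv i (f j)) $$ (i, \<pi> i)) \<in> polys n"
      if "\<pi> permutes {0..<c}" for \<pi>
      by (rule poly_ring_prod) (use permutes_in_image[OF that] in \<open>auto intro!: partial_deriv_closed f\<close>)
    then show ?thesis
      unfolding \<Delta>_def by (subst det_def'[of _ c]) (auto intro!: poly_ring_sum)
  qed
  \<comment> \<open>Surjectivity of \<phi> provides a polynomial h whose image inverts the Jacobian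
    minor on Y; evaluated at a lift on P, it inverts the minor modulo J, as Newton's step
    requires.\<close>
  obtain x where x: "x \<in> \<phi> ` polys n" "x \<otimes>\<^bsub>Sec Q D\<^esub> \<phi> \<Delta> = \<one>\<^bsub>Sec Q D\<^esub>"
    using \<phi>(5) unfolding \<Delta>_def[symmetric] Units_def \<phi>(3) by auto
  then obtain h where h: "h \<in> polys n" "\<phi> h \<otimes>\<^bsub>Sec Q D\<^esub> \<phi> \<Delta> = \<one>\<^bsub>Sec Q D\<^esub>"
    by (elim imageE) simp
  obtain V u where V: "opn V" "p \<in> V" "V \<subseteq> D" and u: "\<And>i. i < n \<Longrightarrow> u i \<in> rv V"
    "\<And>i. i < n \<Longrightarrow> restrict (\<phi> (poly_var i)) V = pr V (vsec V (u i))"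
    by (rule finite_lifts[OF D, of n "\<lambda>i. \<phi> (poly_var i)"]) (auto intro: \<phi>_closed poly_var_closed)
  interpret N: nested_ideals fract_const "rv V" "jv V" "jsq V" by (rule nested[OF V(1)])
  have ev: "restrict (\<phi> a) V = pr V (vsec V (feval u a))" if "a \<in> polys n" for a
    by (rule chart_eval[OF \<phi>(1) \<phi>c D(1) V(1,3) _ _ that]) (simp_all add: u)
  have evR: "feval u a \<in> rv V" if "a \<in> polys n" for a
    by (rule N.eval_R[OF that u(1)])
  have zero: "feval u a \<in> jv V" if a: "a \<in> polys n" "\<phi> a = \<zero>\<^bsub>Sec Q D\<^esub>" for a
  proof -
    have "pr V (vsec V (feval u a)) = restrict \<zero>\<^bsub>Sec Q D\<^esub> V"
      using ev[OF a(1)] a(2) by simp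
    also have "\<dots> = \<zero>\<^bsub>Sec Q V\<^esub>" using V(3) by (auto simp: Q_zero fun_eq_iff)
    finally show ?thesis using pr_value_zero_iff[OF V(1) evR[OF a(1)]] by simp
  qed
  have f0: "\<phi> (f j) = \<zero>\<^bsub>Sec Q D\<^esub>" if "j < c" for j
  proof -
    have "f j \<in> a_kernel (poly_ring n) (Sec Q D) \<phi>"
      unfolding \<phi>(4) using that P.genideal_self[OF n(2)] by auto
    then show ?thesis by (simp add: a_kernel_def')
  qed
  have "\<phi> (h * \<Delta> + const_poly (- 1)) = \<zero>\<^bsub>Sec Q D\<^esub>"
  proof -
    have "\<phi> (const_poly (- 1)) \<oplus>\<^bsub>Sec Q D\<^esub> \<one>\<^bsub>Sec Q D\<^esub> = \<phi> (const_poly (- 1) + 1)"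
      using Ring.ring_hom_add[OF \<phi>(1), of "const_poly (- 1)" 1] Ring.ring_hom_one[OF \<phi>(1)] by simp
    also have "const_poly (- 1) + 1 = (0 :: 'k mpoly)"
      using const_poly_simps(3)[of "- 1 :: 'k" 1] by (simp add: const_poly_simps)
    also have "\<phi> 0 = \<zero>\<^bsub>Sec Q D\<^esub>"
      using Ring.ring_hom_zero[OF \<phi>(1)] P.ring_axioms A.ring_axioms by simp
    finally have "\<one>\<^bsub>Sec Q D\<^esub> \<oplus>\<^bsub>Sec Q D\<^esub> \<phi> (const_poly (- 1)) = \<zero>\<^bsub>Sec Q D\<^esub>"
      using \<phi>_closed[of "const_poly (- 1)"] by (simp add: A.a_comm)
    then show ?thesis
      using Ring.ring_hom_add[OF \<phi>(1), of "h * \<Delta>" "const_poly (- 1)"] Ring.ring_hom_mult[OF \<phi>(1) h(1) \<Delta>] h \<Delta>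
      by (simp add: poly_ring_mult)
  qed
  from zero[OF _ this] have det: "feval u h * feval u \<Delta> - 1 \<in> jv V"
    using h(1) \<Delta> N.emb_minus_one
    by (simp add: poly_ring_add poly_ring_mult peval_add peval_mult fract_const_embedding)
  obtain d where d: "\<And>i. d i \<in> jv V" "\<And>j. j < c \<Longrightarrow> feval (\<lambda>i. u i + d i) (f j) \<in> jsq V"
  proof (rule N.newton[of c f n u "feval u h"])
    show "feval u (f j) \<in> jv V" if "j < c" for j
      by (rule zero[OF f[OF that] f0[OF that]])
    show "feval u h * feval u (det (mat c c (\<lambda>(i, j). partial_deriv i (f j)))) - 1 \<in> jv V"
      by (rule det[unfolded \<Delta>_def])
    fix d
    assume a1: "\<And>i. d i \<in> jv V" and a2: "\<And>j. j < c \<Longrightarrow> feval (\<lambda>i. u i + d i) (f j) \<in> jsq V"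
    show thesis by (rule that[of d], rule a1, erule a2)
  next
    show "f j \<in> polys n" if "j < c" for j by (rule f[OF that])
    show "u i \<in> rv V" if "i < n" for i by (rule u(1)[OF that])
  qed (rule n(1), rule evR[OF h(1)])
  \<comment> \<open>The corrected lift. The correction lies in J, so u' still reduces to the chart
    on Y, while the relations f_j now hold modulo J^2.\<close>
  define u' where "u' = (\<lambda>i. u i + d i)"
  have u'R: "u' i \<in> rv V" if "i < n" for i
    using u(1)[OF that] N.M(1) d(1)[of i] V(1) by (auto simp: u'_def regular_add)
  have u'pr: "restrict (\<phi> (poly_var i)) V = pr V (vsec V (u' i))" if "i < n" for i
    using pr_value_eq_iff[OF V(1) u(1)[OF that] u'R[OF that]] jv_uminus[OF V(1) d(1)[of i]] u(2)[OF that]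
    by (simp add: u'_def)
  have kernel: "feval u' a \<in> jsq V" if a: "a \<in> polys n" "\<phi> a = \<zero>\<^bsub>Sec Q D\<^esub>" for a
  proof -
    \<comment> \<open>The polynomials that vanish at u' modulo J^2 form an ideal, and it contains
      the generators f_j of the kernel of \<phi>.\<close>
    let ?I = "{a \<in> polys n. feval u' a \<in> jsq V}"
    have "ideal ?I (poly_ring n)"
    proof (rule idealI[OF P.ring_axioms])
      have neg: "\<ominus>\<^bsub>poly_ring n\<^esub> b = - b" if "b \<in> polys n" for b :: "'k mpoly"
        using that by (intro P.minus_equality) (auto simp: poly_ring_uminus)
      show "subgroup ?I (add_monoid (poly_ring n))"
        by (rule P.add.subgroupI)
          (auto simp: neg poly_ring_uminus poly_ring_add peval_add peval_uminus fract_const_embedding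
            N.uminus_closed N.Q intro!: exI[of _ 0])
      have m: "x * b \<in> ?I" if "b \<in> ?I" "x \<in> polys n" for b x
        using that N.Q(4)[OF N.eval_R[OF that(2) u'R]]
        by (simp add: poly_ring_mult peval_mult fract_const_embedding)
      show "x \<otimes>\<^bsub>poly_ring n\<^esub> b \<in> ?I" "b \<otimes>\<^bsub>poly_ring n\<^esub> x \<in> ?I" if "b \<in> ?I" "x \<in> polys n" for b x
        using m[OF that] by (simp_all add: mult.commute)
    qed
    moreover have "f ` {..<c} \<subseteq> ?I" using f d(2) by (auto simp: u'_def)
    ultimately have "a_kernel (poly_ring n) (Sec Q D) \<phi> \<subseteq> ?I"
      unfolding \<phi>(4) by (rule P.genideal_minimal)
    moreover have "a \<in> a_kernel (poly_ring n) (Sec Q D) \<phi>" using a by (simp add: a_kernel_def')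
    ultimately show ?thesis by auto
  qed
  have ev': "restrict (\<phi> a) V = pr V (vsec V (feval u' a))" if "a \<in> polys n" for a
    by (rule chart_eval[OF \<phi>(1) \<phi>c D(1) V(1,3) _ _ that]) (simp_all add: u'R u'pr)
  show thesis
    by (rule that[OF g V(1,2) _ \<phi>(1)[unfolded D_def] _ \<phi>(3)[unfolded D_def], of u'])
      (use V(3) u'R ev' kernel \<phi>c in \<open>simp_all add: D_def\<close>)
qed

end

context projective_ideal
begin

lemma opn_nbhd:
  assumes "x \<in> lv q" "opn U" "q \<in> U"
  obtains W where "opn W" "q \<in> W" "W \<subseteq> U" "x \<in> rv W"
proof -
  have q: "q \<in> proj_points r" using open_points[of r U q] assms by simp
  obtain V where V: "openin (proj_top r) V" "q \<in> V" "x \<in> rv V"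
    by (rule local_values_nbhd[OF assms(1) q])
  show thesis
    by (rule that[of "U \<inter> V"]) (use assms V regular_mono[OF _ V(3), of "U \<inter> V"] in auto)
qed

text \<open>Generators \<open>E\<^sub>j\<close> of \<open>J / J\<^sup>2\<close> together with derivations that split \<open>J / J\<^sup>2 \<rightarrow> \<Omega>\<^sub>P|\<^sub>Y\<close>: a form \<open>a\<close>
  of degree \<open>d\<close> with \<open>\<mu>\<^sup>d a \<in> J\<close> is evaluated at \<open>\<mu> x\<^sub>j = P\<^sub>j + E\<^sub>j\<close>, where \<open>a (P)\<close> lies in \<open>J\<^sup>2\<close>, and
  Taylor's formula applies.\<close>

lemma chart_derivations:
  assumes int: "integral_subscheme (proj_space r) J" and gen: "locally_generated (proj_space r) J"
    and smooth: "smooth_subscheme r J" and p: "p \<in> supp"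
  obtains V E l where "opn V" "p \<in> V" "\<forall>j<Suc r. E j \<in> jv V"
    "\<forall>j. \<forall>q\<in>V. \<forall>x\<in>lv q. l * fract_deriv j x \<in> lv q"
    "\<forall>q\<in>V. \<forall>x\<in>jg q. \<exists>W. opn W \<and> q \<in> W \<and> W \<subseteq> V \<and> x \<in> jv W \<and>
      x - (\<Sum>j<Suc r. E j * (l * fract_deriv j x)) \<in> jsq W"
proof -
  have pp: "p \<in> proj_points r" using p by (simp add: support_iff)
  obtain e g n \<phi> V0 u where g: "0 < e" "g \<in> forms r e" "g \<notin> p" and V0: "opn V0" "p \<in> V0" "V0 \<subseteq> basic_open r g"
    and \<phi>: "\<phi> \<in> Ring.ring_hom (poly_ring n) (Sec Q (basic_open r g))"
      "\<forall>c. \<phi> (const_poly c) = pr (basic_open r g) (vsec (basic_open r g) (fract_const c))"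
      "\<phi> ` polys n = carrier (Sec Q (basic_open r g))"
    and u0: "\<forall>i<n. u i \<in> rv V0"
    and ev: "\<forall>a\<in>polys n. restrict (\<phi> a) V0 = pr V0 (vsec V0 (feval u a))"
    and ker: "\<forall>a\<in>polys n. \<phi> a = \<zero>\<^bsub>Sec Q (basic_open r g)\<^esub> \<longrightarrow> feval u a \<in> jsq V0"
    by (rule smooth_chart[OF int smooth p])
  have u: "u i \<in> rv V0" if "i < n" for i using u0 that by simp
  define D where "D = basic_open r g"
  have D: "opn D" using openin_basic[OF g(2)] by (simp add: D_def)
  have gD: "q \<in> proj_points r \<and> g \<notin> q" if "q \<in> D" for q using that by (simp add: D_def basic_open_def)
  obtain i where i: "i \<le> r" "poly_var i \<notin> p" by (rule ex_coordinate_notin[OF pp])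
  have xi: "poly_var i ^ m \<in> forms r m" for m
    using forms_power[OF poly_var_in_forms[OF i(1)], of m] by simp
  define t :: "'k mpoly fract" where "t = fr (poly_var i)"
  define \<gamma> where "\<gamma> = fr g"
  have nz: "t \<noteq> 0" "\<gamma> \<noteq> 0" using point_neq_zero[OF pp i(2)] point_neq_zero[OF pp g(3)] by (simp_all add: t_def \<gamma>_def)
  \<comment> \<open>A factor of degree -1, with e > 0 the degree of g and t the coordinate x_i: it
    makes the homogeneous coordinates into regular functions y_j = \<mu> x_j on D_+(g).\<close>
  define \<mu> where "\<mu> = t ^ (e - 1) / \<gamma>"
  have \<mu>: "\<mu> \<noteq> 0" using nz by (simp add: \<mu>_def)
  define y :: "nat \<Rightarrow> 'k mpoly fract" where "y = (\<lambda>j. \<mu> * fr (poly_var j))"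
  have yD: "y j \<in> rv D" if "j < Suc r" for j
    unfolding regular_values_def
  proof (intro CollectI ballI)
    fix q assume "q \<in> D"
    then have q: "q \<in> proj_points r" "g \<notin> q" using gD by auto
    have "poly_var i ^ (e - 1) * poly_var j \<in> forms r e"
      using forms_mult[OF xi[of "e - 1"] poly_var_in_forms[of j r]] that g(1) by simp
    from local_values_to_fract[OF q(1) this g(2) q(2)] show "y j \<in> lv q"
      by (simp add: y_def \<mu>_def t_def \<gamma>_def to_fract_power)
  qed
  interpret ND: nested_ideals fract_const "rv D" "jv D" "jsq D" by (rule nested[OF D])
  \<comment> \<open>On Y each y_j is a polynomial P_j in the chart coordinates; on P the two differ
    by a section E_j of J, defined next.\<close>
  have "\<exists>P\<in>polys n. \<phi> P = pr D (vsec D (y j))" if "j < Suc r" for j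
  proof -
    have "pr D (vsec D (y j)) \<in> \<phi> ` polys n"
      unfolding \<phi>(3)[folded D_def] using D yD[OF that] by simp
    then obtain P where "P \<in> polys n" "pr D (vsec D (y j)) = \<phi> P" by (elim imageE)
    then show ?thesis by (intro bexI[of _ P]) simp_all
  qed
  then obtain P where P: "\<And>j. j < Suc r \<Longrightarrow> P j \<in> polys n"
    "\<And>j. j < Suc r \<Longrightarrow> \<phi> (P j) = pr D (vsec D (y j))" by metis
  define E where "E = (\<lambda>j. y j - feval u (P j))"
  interpret N0: nested_ideals fract_const "rv V0" "jv V0" "jsq V0" by (rule nested[OF V0(1)])
  have uP: "feval u (P j) \<in> rv V0" if "j < Suc r" for j
    by (rule N0.eval_R[OF P(1)[OF that] u])
  have yV0: "y j \<in> rv V0" if "j < Suc r" for j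
    using regular_mono[OF V0(3)[folded D_def] yD[OF that]] .
  have E: "E j \<in> jv V0" if "j < Suc r" for j
  proof -
    have "pr V0 (vsec V0 (y j)) = pr V0 (vsec V0 (feval u (P j)))"
      using ev[rule_format, OF P(1)[OF that]] P(2)[OF that] pr_value_res[OF D V0(1) V0(3)[folded D_def] yD[OF that]] by simp
    then show ?thesis using pr_value_eq_iff[OF V0(1) yV0[OF that] uP[OF that]] by (simp add: E_def)
  qed
  \<comment> \<open>Substituting the P_j into a and applying \<phi> amounts to evaluating a at the
    functions y_j on Y.\<close>
  have comp: "peval const_poly P a \<in> polys n \<and>
      \<phi> (peval const_poly P a) = pr D (vsec D (feval y a))"
    if "a \<in> polys (Suc r)" for a
    using that
  proof (induction rule: poly_ring_induct)
    case (const c)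
    then show ?case using \<phi>(2)[folded D_def] by (simp add: field_embedding_const_poly fract_const_embedding)
  next
    case (var j)
    then show ?case using P by (simp add: field_embedding_const_poly fract_const_embedding)
  next
    case (add a b)
    then show ?case
      using Ring.ring_hom_add[OF \<phi>(1), folded D_def, of "peval const_poly P a" "peval const_poly P b"]
        pr_value_hom(1)[OF D ND.eval_R[OF add(1) yD] ND.eval_R[OF add(2) yD]]
      by (simp add: peval_add field_embedding_const_poly fract_const_embedding poly_ring_add)
  next
    case (mult a b)
    then show ?case
      using Ring.ring_hom_mult[OF \<phi>(1), folded D_def, of "peval const_poly P a" "peval const_poly P b"]
        pr_value_hom(2)[OF D ND.eval_R[OF mult(1) yD] ND.eval_R[OF mult(2) yD]]
      by (simp add: peval_mult field_embedding_const_poly fract_const_embedding poly_ring_mult)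
  qed
  have hom: "feval y a = \<mu> ^ d * fr a" if "a \<in> forms r d" for a d
    unfolding y_def peval_homogeneous[OF that] peval_to_fract[OF forms_carrier[OF that]] by simp
  \<comment> \<open>A derivative of a has degree d - 1, so one more factor \<mu> brings it to the
    power d; for d = 0 both sides vanish.\<close>
  have hom': "\<mu> * feval y (partial_deriv j a) = \<mu> ^ d * fr (partial_deriv j a)"
    if "a \<in> forms r d" for a d j
  proof (cases d)
    case 0
    then show ?thesis using partial_deriv_form0[of a r j] that by (simp add: fract_const_embedding)
  next
    case (Suc d')
    then show ?thesis using hom[OF partial_deriv_in_forms[OF that, of j]] by simp
  qed
  define V where "V = V0 \<inter> basic_open r (poly_var i)"
  have V: "opn V" "p \<in> V" "V \<subseteq> V0"
    using V0 openin_basic[OF poly_var_in_forms[OF i(1)]] i(2) pp by (auto simp: V_def basic_open_def)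
  have VD: "V \<subseteq> D" using V(3) V0(3) by (simp add: D_def)
  have Vq: "q \<in> proj_points r" "g \<notin> q" "poly_var i \<notin> q" if "q \<in> V" for q
    using gD[of q] VD that by (auto simp: V_def basic_open_def)
  interpret N: nested_ideals fract_const "rv V" "jv V" "jsq V" by (rule nested[OF V(1)])
  have yV: "y j \<in> rv V" if "j < Suc r" for j using regular_mono[OF VD yD[OF that]] .
  have EV: "E j \<in> jv V" if "j < Suc r" for j using jv_mono[OF V0(1) V(1,3) E[OF that]] .
  \<comment> \<open>Differentiation lowers the degree by one. The factor l = 1 / \<mu> of degree 1
    restores degree 0, so that l \<partial>_j preserves regularity where g and x_i do not vanish
    (\<open>local\<close>).\<close>
  define l where "l = inverse \<mu>"
  have evR: "feval y (partial_deriv j a) \<in> rv V" if "a \<in> forms r d" for a d j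
    by (rule N.eval_R[OF partial_deriv_closed[OF forms_carrier[OF that]] yV])
  \<comment> \<open>With the powers of \<mu> cleared, this is the quotient of g^d by x_i^(d (e - 1))
    b, both forms of degree d e.\<close>
  have w: "1 / (\<mu> ^ d * fr b) \<in> lv q" if q: "q \<in> V" and b: "b \<in> forms r d" "b \<notin> q" for b d q
  proof -
    have 1: "g ^ d \<in> forms r (d * e)" by (rule forms_power[OF g(2)])
    have "(poly_var i ^ (e - 1)) ^ d * b \<in> forms r (d * (e - 1) + d)"
      by (rule forms_mult[OF forms_power[OF xi] b(1)])
    then have 2: "(poly_var i ^ (e - 1)) ^ d * b \<in> forms r (d * e)"
      using g(1) by (cases e) (simp_all add: add.commute)
    have 3: "(poly_var i ^ (e - 1)) ^ d * b \<notin> q"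
      by (rule forms_notin_mult[OF Vq(1)[OF q] forms_power[OF xi] b(1)
            forms_notin_power[OF Vq(1)[OF q] xi forms_notin_power[OF Vq(1)[OF q] poly_var_in_forms[OF i(1)] Vq(3)[OF q]]] b(2)])
    have "fr (g ^ d) / fr ((poly_var i ^ (e - 1)) ^ d * b) = 1 / (\<mu> ^ d * fr b)"
      by (simp add: to_fract_power t_def \<gamma>_def \<mu>_def power_divide)
    then show ?thesis using local_values_to_fract[OF Vq(1)[OF q] 1 2 3] by simp
  qed
  have deriv: "l * fract_deriv j x = 1 / (\<mu> ^ d * fr b) *
      (feval y (partial_deriv j a) - x * feval y (partial_deriv j b))"
    if ab: "x = fr a / fr b" "fr b \<noteq> 0" "a \<in> forms r d" "b \<in> forms r d" for x a b d j
  proof -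
    have "l * fract_deriv j x * (\<mu> * \<mu> ^ d * fr b) = \<mu> ^ d * (fr (partial_deriv j a) - x * fr (partial_deriv j b))"
      unfolding fract_deriv_eq[OF _ ab(1), of j, simplified, OF ab(2)[simplified]] l_def using \<mu> ab(2) by simp
    also have "\<dots> = \<mu> * (feval y (partial_deriv j a) - x * feval y (partial_deriv j b))"
      using hom'[OF ab(3), of j] hom'[OF ab(4), of j] by (simp add: algebra_simps)
    finally have "\<mu> * (l * fract_deriv j x * (\<mu> ^ d * fr b)) =
        \<mu> * (feval y (partial_deriv j a) - x * feval y (partial_deriv j b))"
      by (simp add: mult_ac)
    then have "l * fract_deriv j x * (\<mu> ^ d * fr b) =
        feval y (partial_deriv j a) - x * feval y (partial_deriv j b)"
      using \<mu> by simp
    moreover have nzb: "\<mu> ^ d * fr b \<noteq> 0" using \<mu> ab(2) by simp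
    ultimately have "l * fract_deriv j x =
        (feval y (partial_deriv j a) - x * feval y (partial_deriv j b)) / (\<mu> ^ d * fr b)"
      by (simp only: nonzero_eq_divide_eq[OF nzb])
    then show ?thesis by (simp only: times_divide_eq_left mult_1)
  qed
  have local: "l * fract_deriv j x \<in> lv q" if q: "q \<in> V" and x: "x \<in> lv q" for j q x
  proof -
    note qp = Vq(1)[OF q]
    obtain a b d where ab: "x = fr a / fr b" "a \<in> forms r d" "b \<in> forms r d" "b \<notin> q" "fr b \<noteq> 0"
      by (rule local_valuesE'[OF x qp])
    have "feval y (partial_deriv j a) + - (x * feval y (partial_deriv j b)) \<in> lv q"
      using regular_local[OF evR[OF ab(2)] q] regular_local[OF evR[OF ab(3)] q] x
      by (intro local_values_add[OF qp] local_values_uminus[OF qp] local_values_mult[OF qp])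
    then show ?thesis
      unfolding deriv[OF ab(1,5,2,3)] using w[OF q ab(3,4)] by (intro local_values_mult[OF qp]) simp_all
  qed
  have main: "\<exists>W. opn W \<and> q \<in> W \<and> W \<subseteq> V \<and> x \<in> jv W \<and> x - (\<Sum>j<Suc r. E j * (l * fract_deriv j x)) \<in> jsq W"
    if q: "q \<in> V" and x: "x \<in> jg q" for q x
  proof -
    note qp = Vq(1)[OF q]
    obtain W0 where W0: "opn W0" "q \<in> W0" "W0 \<subseteq> V" "x \<in> jv W0" by (rule jgE[OF x V(1) q])
    show ?thesis
    proof (cases "q \<in> supp")
      case False
      \<comment> \<open>Off Y the ideal is everything near q, so J and its square coincide there and
        membership in J is enough.\<close>
      then have "1 \<in> jg q" using qp by (simp add: support_iff)
      then obtain W where W: "opn W" "q \<in> W" "W \<subseteq> W0" "1 \<in> jv W" by (rule jgE[OF _ W0(1,2)])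
      have xW: "x \<in> jv W" by (rule jv_mono[OF W0(1) W(1,3) W0(4)])
      have "l * fract_deriv j x \<in> rv W" for j
        unfolding regular_values_def using local W W0 regular_local[OF jv_regular[OF W(1) xW]] by blast
      then have "E j * (l * fract_deriv j x) \<in> jv W" if "j < Suc r" for j
        using jv_mult[OF W(1), of "l * fract_deriv j x" "E j"] jv_mono[OF V(1) W(1) _ EV[OF that]] W W0
        by (simp add: mult.commute)
      then have "(\<Sum>j<Suc r. E j * (l * fract_deriv j x)) \<in> jv W"
        by (intro sum_in_additive[of "jv W"]) (use W(1) in \<open>auto simp: jv_zero jv_add\<close>)
      then have "x - (\<Sum>j<Suc r. E j * (l * fract_deriv j x)) \<in> jv W"
        using jv_add[OF W(1) xW jv_uminus[OF W(1)]] by simp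
      then have "1 * (x - (\<Sum>j<Suc r. E j * (l * fract_deriv j x))) \<in> jsq W"
        by (rule jv_mult_jv[OF W(1,4)])
      then show ?thesis using W W0 xW by (intro exI[of _ W]) auto
    next
      case True
      obtain a b d where ab: "x = fr a / fr b" "a \<in> forms r d" "b \<in> forms r d" "b \<notin> q" "fr b \<noteq> 0"
        by (rule local_valuesE'[OF jg_local_values[OF qp x] qp])
      let ?ev = "feval y"
      have evD: "?ev a \<in> rv D" by (rule ND.eval_R[OF forms_carrier[OF ab(2)] yD])
      have evD': "?ev b \<in> rv D" by (rule ND.eval_R[OF forms_carrier[OF ab(3)] yD])
      have qD: "q \<in> D" using q VD by auto
      have "?ev a = ?ev b * x" unfolding hom[OF ab(2)] hom[OF ab(3)] ab(1) using ab(5) by simp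
      then have aq: "?ev a \<in> jg q" using jg_mult[OF qp regular_local[OF evD' qD] x] by simp
      \<comment> \<open>\<phi> detects only relations that hold on the whole of Y \<inter> D_+(g),
        while a(y) = b(y) x is known to lie in J only near q. By \<open>jg_transfer\<close> it lies
        in J at every point of \<open>D\<close>.\<close>
      have "?ev a \<in> jv D"
      proof (rule jv_local[OF D evD])
        fix q' assume q': "q' \<in> D"
        show "?ev a \<in> jg q'"
        proof (cases "q' \<in> supp")
          case True
          then show ?thesis using jg_transfer[OF int gen \<open>q \<in> support _ _\<close> _ aq regular_local[OF evD q']] by simp
        next
          case False
          then have "1 \<in> jg q'" using gD[OF q'] by (simp add: support_iff)
          then have "?ev a * 1 \<in> jg q'" using gD[OF q'] regular_local[OF evD q'] by (intro jg_mult) auto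
          then show ?thesis by simp
        qed
      qed
      then have "\<phi> (peval const_poly P a) = \<zero>\<^bsub>Sec Q D\<^esub>"
        using comp[OF forms_carrier[OF ab(2)]] pr_value_zero_iff[OF D evD] by simp
      then have "feval u (peval const_poly P a) \<in> jsq V0"
        using ker[folded D_def] comp[OF forms_carrier[OF ab(2)]] by simp
      \<comment> \<open>Since y_j - E_j is P_j evaluated at the lifted chart, this value is a(P), a
        polynomial in the kernel of \<phi> evaluated there.\<close>
      then have aPV: "feval (\<lambda>j. y j + - E j) a \<in> jsq V"
        using jsq_mono[OF V0(1) V(1,3)]
        unfolding peval_compose[OF fract_const_embedding forms_carrier[OF ab(2)]] by (simp add: E_def)
      \<comment> \<open>Taylor's formula at y with increments - E_j. As the value at the shifted
        point is in J^2, it expresses a(y) modulo J^2 through the E_j.\<close>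
      have "feval (\<lambda>j. y j + - E j) a - ?ev a - (\<Sum>j<Suc r. - E j * ?ev (partial_deriv j a)) \<in> jsq V"
        by (rule N.taylor[OF forms_carrier[OF ab(2)] yV]) (auto intro: N.uminus_closed EV)
      then have "feval (\<lambda>j. y j + - E j) a -
          (feval (\<lambda>j. y j + - E j) a - ?ev a - (\<Sum>j<Suc r. - E j * ?ev (partial_deriv j a))) \<in> jsq V"
        by (rule N.diff_closed(3)[OF aPV])
      then have T: "?ev a - (\<Sum>j<Suc r. E j * ?ev (partial_deriv j a)) \<in> jsq V"
        by (simp add: sum_negf algebra_simps del: sum.lessThan_Suc)
      define w' where "w' = 1 / (\<mu> ^ d * fr b)"
      obtain W where W: "opn W" "q \<in> W" "W \<subseteq> W0" "w' \<in> rv W"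
        using opn_nbhd[OF w[OF q ab(3,4)] W0(1,2)] unfolding w'_def by metis
      have WV: "W \<subseteq> V" using W W0 by auto
      have xW: "x \<in> jv W" by (rule jv_mono[OF W0(1) W(1,3) W0(4)])
      have EW: "E j \<in> jv W" if "j < Suc r" for j by (rule jv_mono[OF V(1) W(1) WV EV[OF that]])
      have evW: "?ev (partial_deriv j b) \<in> rv W" for j by (rule regular_mono[OF WV evR[OF ab(3)]])
      have "w' * (?ev a - (\<Sum>j<Suc r. E j * ?ev (partial_deriv j a))) \<in> jsq W"
        by (rule jsq_mult[OF W(1,4) jsq_mono[OF V(1) W(1) WV T]])
      moreover have "(\<Sum>j<Suc r. E j * ?ev (partial_deriv j b)) \<in> jv W"
        using jv_mult[OF W(1) evW EW]
        by (intro sum_in_additive[of "jv W"]) (use W(1) in \<open>auto simp: jv_zero jv_add mult.commute\<close>)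
      then have "(w' * x) * (\<Sum>j<Suc r. E j * ?ev (partial_deriv j b)) \<in> jsq W"
        by (rule jv_mult_jv[OF W(1) jv_mult[OF W(1,4) xW]])
      ultimately have "w' * (?ev a - (\<Sum>j<Suc r. E j * ?ev (partial_deriv j a))) +
          (w' * x) * (\<Sum>j<Suc r. E j * ?ev (partial_deriv j b)) \<in> jsq W"
        by (rule jsq_add[OF W(1)])
      moreover have "x = w' * ?ev a" unfolding w'_def hom[OF ab(2)] ab(1) using \<mu> ab(5) by simp
      \<comment> \<open>By the quotient rule (\<open>deriv\<close>) the derivatives of b enter with
        the factor x; as x and the E_j all lie in J, that term is in J^2.\<close>
      moreover have "(\<Sum>j<Suc r. E j * (l * fract_deriv j x)) =
          w' * (\<Sum>j<Suc r. E j * ?ev (partial_deriv j a)) - (w' * x) * (\<Sum>j<Suc r. E j * ?ev (partial_deriv j b))"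
        unfolding deriv[OF ab(1,5,2,3)] w'_def[symmetric]
        by (simp only: sum_distrib_left sum_subtractf[symmetric]) (rule sum.cong[OF refl], simp add: algebra_simps)
      ultimately have "x - (\<Sum>j<Suc r. E j * (l * fract_deriv j x)) \<in> jsq W"
        by (simp only:) (simp add: algebra_simps)
      then show ?thesis using W WV xW by (intro exI[of _ W]) auto
    qed
  qed
  show thesis
    by (rule that[OF V(1,2), of E l]) (use EV local main in auto)
qed

end

lemma (in ideal_presheaf) sections_trivial:
  assumes U: "opn U" "\<one>\<^bsub>R U\<^esub> \<in> I U" and \<sigma>: "\<sigma> \<in> carrier (Sec Q U)"
  shows "\<sigma> = \<zero>\<^bsub>Sec Q U\<^esub>"
proof -
  interpret QM: module_presheaf S Q by (rule Q_module)
  interpret module "R U" "Sec Q U" by (rule QM.module[OF U(1)])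
  have "\<sigma> = \<one>\<^bsub>R U\<^esub> \<odot>\<^bsub>Sec Q U\<^esub> \<sigma>" using \<sigma> by simp
  also have "\<dots> = \<zero>\<^bsub>Sec Q U\<^esub>" by (rule ideal_smult_zero[OF U \<sigma>])
  finally show ?thesis .
qed

section \<open>From homomorphisms to derivations\<close>

context projective_ideal
begin

text \<open>The vector field with coefficients G_j along the derivations l \<partial>_j; it acts
  point by point because sections are functions with values in the fraction field.\<close>

definition value_derivation where
  "value_derivation l G W f = (\<lambda>q\<in>W. \<Sum>j<Suc r. G j * (l * fract_deriv j (f q)))"

lemma value_derivation_section:
  "value_derivation l G W (vsec W x) = vsec W (\<Sum>j<Suc r. G j * (l * fract_deriv j x))"
  by (auto simp: value_derivation_def vsec_def fun_eq_iff)

lemma value_derivation_on: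
  assumes V: "opn V"
    and l: "\<And>j q x. q \<in> V \<Longrightarrow> x \<in> lv q \<Longrightarrow> l * fract_deriv j x \<in> lv q"
    and G: "\<And>j. j < Suc r \<Longrightarrow> G j \<in> rv V"
  shows "derivation_on V (value_derivation l G)"
proof -
  let ?D = "\<lambda>x. \<Sum>j<Suc r. G j * (l * fract_deriv j x)"
  have closed: "?D x \<in> rv W" if W: "opn W" "W \<subseteq> V" "x \<in> rv W" for W x
  proof -
    have "l * fract_deriv j x \<in> rv W" for j
      unfolding regular_values_def using l[OF subsetD[OF W(2)] regular_local[OF W(3)]] by simp
    then have "G j * (l * fract_deriv j x) \<in> rv W" if "j < Suc r" for j
      using regular_mult[of r W "G j" "l * fract_deriv j x"] regular_mono[OF W(2) G[OF that]] W(1) by simp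
    then show ?thesis
      by (intro sum_in_additive[of "rv W"]) (use W(1) in \<open>auto simp: regular_zero regular_add\<close>)
  qed
  have add: "?D (x + y) = ?D x + ?D y" for x y
    by (simp add: fract_deriv_add distrib_left sum.distrib del: sum.lessThan_Suc)
  have mult: "?D (x * y) = x * ?D y + y * ?D x" for x y
    by (simp add: fract_deriv_mult distrib_left sum.distrib sum_distrib_left mult_ac del: sum.lessThan_Suc)
  show ?thesis
    unfolding derivation_on_def
  proof (intro conjI allI impI ballI; elim conjE)
    fix W f assume W: "opn W" "W \<subseteq> V" and f: "f \<in> \<O> W"
    obtain x where x: "f = vsec W x" "x \<in> rv W" using f W(1) by (auto simp: regular_iff)
    show "value_derivation l G W f \<in> \<O> W"
      unfolding x(1) value_derivation_section using closed[OF W x(2)] W(1) by simp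
    fix g assume g: "g \<in> \<O> W"
    obtain y where y: "g = vsec W y" using g W(1) by (auto simp: regular_iff)
    show "value_derivation l G W (f \<oplus>\<^bsub>R W\<^esub> g) = value_derivation l G W f \<oplus>\<^bsub>R W\<^esub> value_derivation l G W g"
      unfolding x(1) y proj_space_ops value_derivation_section add ..
    show "value_derivation l G W (f \<otimes>\<^bsub>R W\<^esub> g) =
        f \<otimes>\<^bsub>R W\<^esub> value_derivation l G W g \<oplus>\<^bsub>R W\<^esub> g \<otimes>\<^bsub>R W\<^esub> value_derivation l G W f"
      unfolding x(1) y proj_space_ops value_derivation_section mult ..
  next
    fix W W' f assume W: "opn W" "opn W'" "W' \<subseteq> W" and f: "f \<in> \<O> W"
    obtain x where x: "f = vsec W x" using f W(1) by (auto simp: regular_iff)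
    show "value_derivation l G W' (rho W W' f) = rho W W' (value_derivation l G W f)"
      unfolding x value_derivation_section using W(3) by (simp add: value_derivation_section del: sum.lessThan_Suc)
  qed
qed

text \<open>Near points of Y, \<open>chart_derivations\<close> gives x = \<Sum> E_j l \<partial>_j x
  modulo J^2 for x in J. As h is linear and kills J^2, h x = \<Sum> (l \<partial>_j x) h E_j;
  lifting each h E_j to a regular function G_j turns the right side into a derivation.\<close>

lemma smooth_homs_from_derivations:
  assumes int: "integral_subscheme (proj_space r) J" and gen: "locally_generated (proj_space r) J"
    and smooth: "smooth_subscheme r J"
  shows "homs_from_derivations J"
  unfolding homs_from_derivations_def
proof (intro allI impI; elim conjE)
  fix K U h p
  assume JK: "ideal_inclusion (proj_space r) J K" and U: "opn U" "p \<in> U"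
    and h: "morphism_on (proj_space r) U (subpresheaf (Str (proj_space r)) J) (struct_sheaf (proj_space r) K) h"
  interpret JK: ideal_inclusion "proj_space r" J K by (rule JK)
  interpret K: projective_ideal r K by (rule projective_ideal.intro[OF JK.K.ideal_presheaf_axioms])
  interpret KQ: module_presheaf "proj_space r" JK.K.Q by (rule JK.K.Q_module)
  have p: "p \<in> proj_points r" using open_points[of r U p] U by simp
  show "\<exists>V E. opn V \<and> p \<in> V \<and> V \<subseteq> U \<and> derivation_on V E \<and>
      (\<forall>W f. opn W \<and> W \<subseteq> V \<and> f \<in> J W \<longrightarrow> h W f = JK.K.pr W (E W f))"
  proof (cases "p \<in> supp")
    case False
    \<comment> \<open>Off Y the target O_P / K is zero near p, because K contains J, so the zero
      derivation represents h.\<close>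
    then have "1 \<in> jg p" using p by (simp add: support_iff)
    then obtain V where V: "opn V" "p \<in> V" "V \<subseteq> U" "1 \<in> jv V" by (rule jgE[OF _ U])
    have "derivation_on V (\<lambda>W f. \<zero>\<^bsub>R W\<^esub>)"
    proof -
      have "(\<lambda>W f. \<zero>\<^bsub>R W\<^esub>) = value_derivation 0 (\<lambda>_. 0)"
        by (auto simp: value_derivation_def vsec_def fun_eq_iff)
      then show ?thesis
        using V(1) open_points[of r V]
        by (simp only:) (rule value_derivation_on; simp add: regular_zero local_values_zero)
    qed
    moreover have "h W f = JK.K.pr W \<zero>\<^bsub>R W\<^esub>" if W: "opn W" "W \<subseteq> V" and f: "f \<in> J W" for W f
    proof -
      have WU: "W \<subseteq> U" using W V by auto
      have "1 \<in> jv W" by (rule jv_mono[OF V(1) W V(4)])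
      then have "\<one>\<^bsub>R W\<^esub> \<in> K W" using JK.incl[of W "vsec W 1"] W(1) by (simp add: ideal_values_def)
      moreover have "h W f \<in> carrier (Sec JK.K.Q W)" using morD(1)[OF h W(1) WU] f by simp
      ultimately have "h W f = \<zero>\<^bsub>Sec JK.K.Q W\<^esub>" by (rule JK.K.sections_trivial[OF W(1)])
      then show ?thesis using JK.K.pr_zero[OF W(1)] by simp
    qed
    ultimately show ?thesis using V by (intro exI[of _ V] exI[of _ "\<lambda>W f. \<zero>\<^bsub>R W\<^esub>"]) auto
  next
    case True
    obtain V0 E l where V0: "opn V0" "p \<in> V0" and E0: "\<forall>j<Suc r. E j \<in> jv V0"
      and l0: "\<forall>j. \<forall>q\<in>V0. \<forall>x\<in>lv q. l * fract_deriv j x \<in> lv q"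
      and split: "\<forall>q\<in>V0. \<forall>x\<in>jg q. \<exists>W. opn W \<and> q \<in> W \<and> W \<subseteq> V0 \<and> x \<in> jv W \<and>
        x - (\<Sum>j<Suc r. E j * (l * fract_deriv j x)) \<in> jsq W"
      by (rule chart_derivations[OF int gen smooth True])
    have E: "E j \<in> jv V0" if "j < Suc r" for j using E0 that by simp
    have l: "l * fract_deriv j x \<in> lv q" if "q \<in> V0" "x \<in> lv q" for j q x
      using l0 that by simp
    let ?U = "V0 \<inter> U"
    have U': "opn ?U" "p \<in> ?U" "?U \<subseteq> V0" "?U \<subseteq> U" using U V0 by auto
    have EJ: "vsec W (E j) \<in> J W" if "opn W" "W \<subseteq> V0" "j < Suc r" for W j
      using jv_mono[OF V0(1) that(1,2) E[OF that(3)]] by (simp add: ideal_values_def)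
    obtain V G where V: "opn V" "p \<in> V" "V \<subseteq> ?U" and G: "\<And>j. j < Suc r \<Longrightarrow> G j \<in> rv V"
      "\<And>j. j < Suc r \<Longrightarrow> restrict (h ?U (vsec ?U (E j))) V = JK.K.pr V (vsec V (G j))"
    proof (rule K.finite_lifts[OF U'(1,2), of "Suc r" "\<lambda>j. h ?U (vsec ?U (E j))"])
      show "h ?U (vsec ?U (E j)) \<in> carrier (Sec JK.K.Q ?U)" if "j < Suc r" for j
        using morD(1)[OF h U'(1,4)] EJ[OF U'(1,3) that] by simp
      fix V u
      assume a: "opn V" "p \<in> V" "V \<subseteq> ?U" and b: "\<And>j. j < Suc r \<Longrightarrow> u j \<in> rv V"
        "\<And>j. j < Suc r \<Longrightarrow> restrict (h ?U (vsec ?U (E j))) V = JK.K.pr V (vsec V (u j))"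
      show thesis by (rule that[OF a]) (rule b, assumption)+
    qed
    have VU: "V \<subseteq> U" "V \<subseteq> V0" using V(3) by auto
    have hE: "h W (vsec W (E j)) = JK.K.pr W (vsec W (G j))"
      if W: "opn W" "W \<subseteq> V" and j: "j < Suc r" for W j
    proof -
      have WU: "W \<subseteq> ?U" using W(2) V(3) by (rule subset_trans)
      have "h W (vsec W (E j)) = restrict (h ?U (vsec ?U (E j))) W"
        using morD(4)[OF h U'(1) W(1) WU U'(4), of "vsec ?U (E j)"] EJ[OF U'(1,3) j]
        by (simp only: subpresheaf_simps proj_space_ops(6)[OF WU] JK.K.Q_res)
      also have "\<dots> = restrict (restrict (h ?U (vsec ?U (E j))) V) W"
        using W(2) by (simp add: Int_absorb1)
      also have "\<dots> = JK.K.pr W (vsec W (G j))"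
        unfolding G(2)[OF j] by (rule K.pr_value_res[OF V(1) W G(1)[OF j]])
      finally show ?thesis .
    qed
    have hsq: "h W (vsec W z) = \<zero>\<^bsub>Sec JK.K.Q W\<^esub>" if "opn W" "W \<subseteq> U" "z \<in> jsq W" for W z
      by (rule JK.vanish_on_square[OF h that(1,2)]) (use that(3) in \<open>simp add: square_values_def\<close>)
    \<comment> \<open>Linearity of h on combinations of the E_j, by induction on the number of
      terms; membership in J and regularity are carried along because each step applies linearity to
      the previous sum.\<close>
    have sum: "(\<Sum>j<m. E j * c j) \<in> jv W \<and> (\<Sum>j<m. G j * c j) \<in> rv W \<and>
        h W (vsec W (\<Sum>j<m. E j * c j)) = JK.K.pr W (vsec W (\<Sum>j<m. G j * c j))"
      if W: "opn W" "W \<subseteq> V" and c: "\<And>j. j < Suc r \<Longrightarrow> c j \<in> rv W" and m: "m \<le> Suc r" for W c m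
      using m
    proof (induction m)
      case 0
      have "W \<subseteq> U" using W(2) VU by auto
      then show ?case
        using hsq[OF W(1) _ jsq_zero[OF W(1)]] JK.K.pr_zero[OF W(1)] W(1) by (simp add: jv_zero regular_zero)
    next
      case (Suc m)
      have WU: "W \<subseteq> U" "W \<subseteq> V0" using W(2) VU by auto
      have m: "m < Suc r" using Suc.prems by simp
      note IH = Suc.IH[OF Suc_leD[OF Suc.prems]]
      have cR: "vsec W (c m) \<in> \<O> W" using c[OF m] W(1) by simp
      have Em: "E m \<in> jv W" by (rule jv_mono[OF V0(1) W(1) WU(2) E[OF m]])
      have Gm: "G m \<in> rv W" by (rule regular_mono[OF W(2) G(1)[OF m]])
      have cE: "c m * E m \<in> jv W" by (rule jv_mult[OF W(1) c[OF m] Em])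
      have "h W (vsec W (c m * E m)) = vsec W (c m) \<odot>\<^bsub>Sec JK.K.Q W\<^esub> h W (vsec W (E m))"
        using morD(3)[OF h W(1) WU(1) cR, of "vsec W (E m)"] EJ[OF W(1) WU(2) m] by simp
      also have "\<dots> = JK.K.pr W (vsec W (c m) \<odot>\<^bsub>R W\<^esub> vsec W (G m))"
        unfolding hE[OF W m] using W(1) cR Gm by (intro JK.K.pr_smult[symmetric]) simp_all
      finally have step: "h W (vsec W (c m * E m)) = JK.K.pr W (vsec W (c m * G m))" by simp
      have "h W (vsec W ((\<Sum>j<m. E j * c j) + c m * E m)) =
          h W (vsec W (\<Sum>j<m. E j * c j)) \<oplus>\<^bsub>Sec JK.K.Q W\<^esub> h W (vsec W (c m * E m))"
        using morD(2)[OF h W(1) WU(1), of "vsec W (\<Sum>j<m. E j * c j)" "vsec W (c m * E m)"] IH cE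
        by (simp add: ideal_values_def)
      also have "\<dots> = JK.K.pr W (vsec W (\<Sum>j<m. G j * c j) \<oplus>\<^bsub>R W\<^esub> vsec W (c m * G m))"
        unfolding step IH[THEN conjunct2, THEN conjunct2]
        using W(1) IH c[OF m] Gm by (intro JK.K.pr_add[symmetric]) (simp_all add: regular_mult)
      finally show ?case
        using IH cE W(1) c[OF m] Gm by (simp add: jv_add regular_add regular_mult mult.commute)
    qed
    have der: "derivation_on V (value_derivation l G)"
      by (rule value_derivation_on[OF V(1) l[OF subsetD[OF VU(2)]] G(1)])
    moreover have "h W f = JK.K.pr W (value_derivation l G W f)" if W: "opn W" "W \<subseteq> V" and f: "f \<in> J W" for W f
    proof -
      have WU: "W \<subseteq> U" "W \<subseteq> V0" using W(2) VU by auto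
      obtain x where x: "f = vsec W x" "x \<in> jv W" using f J_eq[OF W(1)] by auto
      have xW: "x \<in> rv W" by (rule jv_regular[OF W(1) x(2)])
      let ?D = "\<Sum>j<Suc r. G j * (l * fract_deriv j x)"
      have DW: "vsec W ?D \<in> \<O> W"
        unfolding value_derivation_section[symmetric]
        by (rule der[unfolded derivation_on_def, THEN conjunct1, THEN spec, THEN mp, OF conjI[OF W],
              THEN conjunct1, THEN bspec, OF value_carrier[OF W(1) xW]])
      \<comment> \<open>The expansion of x modulo J^2 is available only near each point, so the
        equality is tested locally.\<close>
      have "h W (vsec W x) = JK.K.pr W (vsec W ?D)"
      proof (rule JK.K.Q_eq_localI)
        show "h W (vsec W x) \<in> extensional W"
          using morD(1)[OF h W(1) WU(1)] f x(1) by (auto intro: JK.K.Q_extensional)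
        fix q assume q: "q \<in> W"
        obtain W0 where W0: "opn W0" "q \<in> W0" "W0 \<subseteq> V0" "x \<in> jv W0" "x - (\<Sum>j<Suc r. E j * (l * fract_deriv j x)) \<in> jsq W0"
          using split[rule_format, OF subsetD[OF WU(2) q] jgI[OF W(1) q x(2)]] by (elim exE conjE)
        define N where "N = W0 \<inter> W"
        have N: "opn N" "q \<in> N" "N \<subseteq> W0" "N \<subseteq> W" "N \<subseteq> V" "N \<subseteq> U" "N \<subseteq> V0"
          using W0(1-3) W q WU by (auto simp: N_def)
        define z where "z = x - (\<Sum>j<Suc r. E j * (l * fract_deriv j x))"
        have z: "z \<in> jsq N" unfolding z_def by (rule jsq_mono[OF W0(1) N(1,3) W0(5)])
        have c: "l * fract_deriv j x \<in> rv N" for j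
          unfolding regular_values_def using l[OF subsetD[OF N(7)] regular_local[OF regular_mono[OF N(4) xW]]] by simp
        note s = sum[OF N(1,5) c order_refl]
        have "h N (vsec N x) = h N (vsec N (\<Sum>j<Suc r. E j * (l * fract_deriv j x)) \<oplus>\<^bsub>R N\<^esub> vsec N z)"
          by (simp add: z_def del: sum.lessThan_Suc)
        also have "\<dots> = h N (vsec N (\<Sum>j<Suc r. E j * (l * fract_deriv j x))) \<oplus>\<^bsub>Sec JK.K.Q N\<^esub> h N (vsec N z)"
          using morD(2)[OF h N(1,6), of "vsec N (\<Sum>j<Suc r. E j * (l * fract_deriv j x))" "vsec N z"]
            s jsq_jv[OF N(1) z] by (simp add: ideal_values_def del: sum.lessThan_Suc)
        also have "\<dots> = JK.K.pr N (vsec N ?D) \<oplus>\<^bsub>Sec JK.K.Q N\<^esub> \<zero>\<^bsub>Sec JK.K.Q N\<^esub>"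
          unfolding hsq[OF N(1,6) z] s[THEN conjunct2, THEN conjunct2] ..
        also have "\<dots> = JK.K.pr N (vsec N ?D)"
        proof -
          interpret abelian_group "Sec JK.K.Q N" by (rule KQ.abelian[OF N(1)])
          show ?thesis using s N(1) by (intro r_zero) (simp del: sum.lessThan_Suc)
        qed
        finally have "h N (vsec N x) = JK.K.pr N (vsec N ?D)" .
        moreover have "restrict (h W (vsec W x)) N = h N (vsec N x)"
          using morD(4)[OF h W(1) N(1,4) WU(1), of "vsec W x"] f x(1) N(4) by simp
        moreover have "restrict (JK.K.pr W (vsec W ?D)) N = JK.K.pr N (vsec N ?D)"
          using JK.K.pr_res[OF W(1) N(1,4) DW] N(4) by (simp del: sum.lessThan_Suc)
        ultimately show "\<exists>N. q \<in> N \<and> restrict (h W (vsec W x)) N = restrict (JK.K.pr W (vsec W ?D)) N"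
          using N(2) by (intro exI[of _ N]) simp
      qed simp
      then show ?thesis unfolding x(1) value_derivation_section .
    qed
    ultimately show ?thesis
      using V VU by (intro exI[of _ V] exI[of _ "value_derivation l G"]) auto
  qed
qed

end

section \<open>Stalks as modules over the dual numbers, and the theorem\<close>

lemma (in submodule_presheaf) stalk_module:
  assumes A: "cring A" and c: "c \<in> Ring.ring_hom A (R X)" and p: "p \<in> X"
  shows "module A \<lparr>carrier = carrier (stalk p), monoid.mult = monoid.mult (stalk p), monoid.one = monoid.one (stalk p),
    ring.zero = ring.zero (stalk p), ring.add = ring.add (stalk p), module.smult = (\<lambda>a x. (X, c a) \<odot>\<^bsub>stalk p\<^esub> x)\<rparr>"
proof -
  interpret A: cring A by fact
  have X: "opn X" by simp
  interpret RX: cring "R X" by (rule cring[OF X])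
  note cl = Ring.ring_hom_closed[OF c] and z = stalk_zero_closed[OF p]
  note hom = Ring.ring_hom_add[OF c] Ring.ring_hom_mult[OF c] Ring.ring_hom_one[OF c]
    Ring.ring_hom_zero[OF c A.ring_axioms RX.ring_axioms]
  show ?thesis
    by (rule module_from_smult[OF A])
      (simp_all add: hom cl stalk_l_distr[OF X p _ _ _ z] stalk_r_distr[OF X p _ RX.zero_closed]
        stalk_assoc1[OF X p _ _ _ z] stalk_one[OF X p RX.zero_closed RX.zero_closed _ z]
        stalk_zero_smult[OF X p RX.zero_closed RX.zero_closed _ z] stalk_smult_closed[OF X p] stalk_add_closed stalk_assoc
        z stalk_zero_add, rule stalk_comm)
qed

lemma dual_const_hom:
  "map_prod (const_section (proj_points r)) (const_section (proj_points r)) \<in>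
    Ring.ring_hom (dualk :: ('k::field \<times> 'k, 'k \<times> 'k) module)
      (dual_ring (Sec (Str (proj_space r)) (proj_points r)))" (is "?c \<in> Ring.ring_hom _ ?D")
proof (rule Ring.ring_hom_memI)
  have X: "openin (proj_top r) (proj_points r :: 'k mpoly set set)"
    using openin_topspace[of "proj_top r :: 'k mpoly set topology"] by simp
  have cs: "const_section (proj_points r) c = vsec (proj_points r) (fract_const c)" for c :: 'k
    by (simp add: const_section_def vsec_def to_fract_def)
  have carrier: "vsec (proj_points r) (fract_const c) \<in> carrier (Sec (Str (proj_space r)) (proj_points r))" for c :: 'k
    using regular_fract_const[OF X, of c] by (simp add: proj_space_simps(2) carrier_proj_sheaf[OF X])
  fix x y :: "'k \<times> 'k"
  obtain a b where x: "x = (a, b)" by (cases x)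
  obtain a' b' where y: "y = (a', b')" by (cases y)
  show "?c x \<in> carrier ?D"
    by (simp add: x cs carrier)
  show "?c (x \<otimes>\<^bsub>dualk\<^esub> y) = ?c x \<otimes>\<^bsub>?D\<^esub> ?c y"
    by (simp add: x y cs const_poly_simps field_ring_simps)
  show "?c (x \<oplus>\<^bsub>dualk\<^esub> y) = ?c x \<oplus>\<^bsub>?D\<^esub> ?c y"
    by (simp add: x y cs const_poly_simps field_ring_simps)
  show "?c \<one>\<^bsub>dualk :: ('k \<times> 'k, 'k \<times> 'k) module\<^esub> = \<one>\<^bsub>?D\<^esub>"
    by (simp add: cs const_poly_simps field_ring_simps)
qed

text \<open>On each stalk k[\<epsilon>] acts through global constants, and the constant \<epsilon>
  is the section (0, 1); the flatness criterion for k[\<epsilon>]-modules thus becomes the left side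
  of \<open>dual_flat_iff\<close>.\<close>

lemma induces_flat_deformation_iff:
  fixes I J :: "'k::field subscheme"
  assumes pair: "ideal_pair (proj_space r) I J"
    and \<eta>: "\<eta> \<in> global (proj_space r) (normal_sheaf (proj_space r) J)"
  shows "induces_flat_deformation r I J \<eta> \<longleftrightarrow> \<eta> \<in> F_sections (proj_space r) I J (proj_points r)"
proof -
  interpret ideal_pair "proj_space r" I J by (rule pair)
  let ?S = "dual_space (proj_space r) :: ('k mpoly set, _) ringed_space"
  let ?L = "ideal_sum ?S (deformation_ideal (proj_space r) J \<eta>) (trivial_deformation I)"
  let ?st = "quot_stalk ?S (Str ?S) ?L"
  let ?c = "map_prod (const_section (proj_points r)) (const_section (proj_points r)) :: 'k \<times> 'k \<Rightarrow> _"
  let ?M = "\<lambda>p. \<lparr>carrier = carrier (?st p), monoid.mult = monoid.mult (?st p), monoid.one = monoid.one (?st p),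
    ring.zero = ring.zero (?st p), ring.add = ring.add (?st p), module.smult = (\<lambda>c x. (proj_points r, ?c c) \<odot>\<^bsub>?st p\<^esub> x)\<rparr>"
  interpret dp: ideal_pair ?S "deformation_ideal (proj_space r) J \<eta>" "trivial_deformation I"
    by (rule dual_ideal_pair[OF \<eta>])
  have one: "?c (0, 1) = (\<zero>\<^bsub>Sec (Str (proj_space r)) (proj_points r)\<^esub>, \<one>\<^bsub>Sec (Str (proj_space r)) (proj_points r)\<^esub>)"
    by (simp add: const_section_def vsec_def to_fract_def const_poly_simps fract_collapse)
  have "flat_module dualk (?M p) \<longleftrightarrow>
      (\<forall>x\<in>carrier (?st p). (proj_points r, ?c (0, 1)) \<odot>\<^bsub>?st p\<^esub> x = \<zero>\<^bsub>?st p\<^esub> \<longrightarrow>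
        (\<exists>y\<in>carrier (?st p). x = (proj_points r, ?c (0, 1)) \<odot>\<^bsub>?st p\<^esub> y))" if "p \<in> proj_points r" for p
  proof -
    have "module dualk (?M p)"
      using dp.K.stalk_module[OF dual_ring_cring[OF field_ring_cring], of ?c p] that dual_const_hom[of r] by simp
    from flat_dual_numbers_iff[OF this] show ?thesis by simp
  qed
  then have "induces_flat_deformation r I J \<eta> \<longleftrightarrow>
      (\<forall>p\<in>proj_points r. \<forall>x\<in>carrier (?st p). (proj_points r, ?c (0, 1)) \<odot>\<^bsub>?st p\<^esub> x = \<zero>\<^bsub>?st p\<^esub> \<longrightarrow>
        (\<exists>y\<in>carrier (?st p). x = (proj_points r, ?c (0, 1)) \<odot>\<^bsub>?st p\<^esub> y))"
    unfolding induces_flat_deformation_def flat_over_dual_def Let_def by (intro ball_cong refl)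
  also have "\<dots> \<longleftrightarrow> \<eta> \<in> F_sections (proj_space r) I J (proj_points r)"
    using dual_flat_iff[OF \<eta>] unfolding one by simp
  finally show ?thesis .
qed

theorem theorem7p1:
  fixes r :: nat
    and X Y :: "'k::{alg_closed_field, field_char_0} subscheme"
  assumes "smooth_subvariety r X" and "smooth_subvariety r Y"
  shows "(\<forall>\<eta> \<in> global (proj_space r) (normal_sheaf (proj_space r) Y).
            induces_flat_deformation r X Y \<eta> \<longleftrightarrow>
            \<eta> \<in> global (proj_space r) (F_sheaf (proj_space r) X Y)) \<and>
         short_exact (proj_space r)
            (F_sheaf (proj_space r) X Y) (normal_sheaf (proj_space r) Y)
            (Q_sheaf (proj_space r) X Y) (\<lambda>U \<eta>. \<eta>) (normal_to_Q (proj_space r) X Y) \<and>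
         (\<exists>\<beta>. natural_iso (proj_space r) X Y \<beta>)"
proof -
  have ideal: "ideal_presheaf (proj_space r) Z" if "smooth_subvariety r Z" for Z :: "'k subscheme"
    using that by (simp add: smooth_subvariety_def closed_subscheme_def ideal_presheaf_def ideal_presheaf_axioms_def proj_ring_presheaf)
  have homs: "ring_presheaf.homs_from_derivations (proj_space r) Z" if Z: "smooth_subvariety r Z" for Z :: "'k subscheme"
    by (rule projective_ideal.smooth_homs_from_derivations[OF projective_ideal.intro[OF ideal[OF Z]]])
      (use Z in \<open>simp_all add: smooth_subvariety_def closed_subscheme_def\<close>)
  have pair: "ideal_pair (proj_space r) X Y"
    using assms by (simp add: ideal_pair_def ideal proj_ring_presheaf)
  have "induces_flat_deformation r X Y \<eta> \<longleftrightarrow> \<eta> \<in> global (proj_space r) (F_sheaf (proj_space r) X Y)"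
    if "\<eta> \<in> global (proj_space r) (normal_sheaf (proj_space r) Y)" for \<eta>
    using induces_flat_deformation_iff[OF pair that] by (simp add: F_sheaf_def)
  then show ?thesis
    using ideal_pair.short_exact_normal[OF pair homs[OF assms(2)]]
      ideal_pair.Q_symmetric[OF pair homs[OF assms(1)] homs[OF assms(2)]] by blast
qed

end
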